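(* Assume that $F\in O_N$ satisfies $Fe_0=\frac{1}{\sqrt N}\xi$, where $\xi$ is the all-one vector. Then we have inclusions $$B_N\subset B_F^\circ\subset B_N^+,$$ with the intermediate quantum group $B_F^\circ$ being not easy, obtained by taking the image of the inclusions $O_{N-1}\subset O_{N-1}^*\subset O_{N-1}^+$ via the isomorphism $O_{N-1}^+\simeq B_N^+$ induced by $F$.
   Context: Indices run over $0,1,\ldots,N-1$ for the $N\times N$ quantum groups, and over $1,\ldots,N-1$ for the $(N-1)\times(N-1)$ ones. $C(O_N^+)$ is the universal $C^*$-algebra generated by the entries of an $N\times N$ matrix $u=(u_{ij})$ which is orthogonal, $u=\bar u$, $u^t=u^{-1}$, with its standard compact quantum group structure. $O_N^*\subset O_N^+$ is obtained by imposing the half-commutation relations $abc=cba$ for all $a,b,c\in\{u_{ij}\}$, and $O_N\subset O_N^+$ by imposing commutativity. $B_N\subset O_N$ is the orthogonal bistochastic group (orthogonal matrices having sum $1$ on each row and column), and $B_N^+\subset O_N^+$ is obtained by imposing $u\xi=\xi$. Isomorphism induced by $F$: when $F\in O_N$ satisfies $Fe_0=\frac{1}{\sqrt N}\xi$, one has $F^*uF=diag(1,w)$ for the fundamental matrix $u$ of $B_N^+$, and $w_{ij}\mapsto(F^*uF)_{ij}$ $(i,j=1,\ldots,N-1)$ defines an isomorphism $C(O_{N-1}^+)\to C(B_N^+)$, i.e. $B_N^+\simeq O_{N-1}^+$. Easiness: a quantum group $S_N\subset G\subset U_N^+$ (with $S_N$ embedded as permutation matrices) is easy when $Hom(u^{\otimes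 k},u^{\otimes l})=span(T_\pi|\pi\in D(k,l))$ for all $k,l$ (words in $\circ,\bullet$, with $u^\circ=u,u^\bullet=\bar u$), for some category of partitions $D$ (a family of sets $D(k,l)$ of partitions of an upper row of points colored by $k$ and a lower row of points colored by $l$, stable under horizontal and vertical concatenation and upside-down turning with switching of the colors, containing the identity and duality pairings). Here $T_\pi(e_{i_1}\otimes\ldots\otimes e_{i_k})=\sum_{j}\delta_\pi(i;j)e_{j_1}\otimes\ldots\otimes e_{j_l}$, with $\delta_\pi(i;j)=1$ if each block of $\pi$ contains equal indices and $0$ otherwise.
   Formalization: Non-easiness is claimed only for N ≥ 4: for N ≤ 3 one has O_{N-1}^* = O_{N-1}^+ (half-commutation is automatic), so B_F° = B_N^+, which is easy; the inclusions are for all N ≥ 1. *)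

theory Defs
  imports
    "HOL-Analysis.Analysis"
    "HOL-Algebra.Module"
    "HOL-Algebra.Subrings"
    "HOL-Library.Poly_Mapping"
    "HOL-Library.Disjoint_Sets"
begin

section \<open>Unital C*-algebras\<close>

record 'a cstar = "(complex, 'a) module" +
  adj :: "'a \<Rightarrow> 'a"
  nrm :: "'a \<Rightarrow> real"

locale cstar_algebra = ring A for A :: "'a cstar" (structure) +
  assumes smult_closed: "x \<in> carrier A \<Longrightarrow> c \<odot> x \<in> carrier A"
    and smult_add_left: "x \<in> carrier A \<Longrightarrow> (c + d) \<odot> x = c \<odot> x \<oplus> d \<odot> x"
    and smult_add_right:
      "\<lbrakk>x \<in> carrier A; y \<in> carrier A\<rbrakk> \<Longrightarrow> c \<odot> (x \<oplus> y) = c \<odot> x \<oplus> c \<odot> y"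
    and smult_smult: "x \<in> carrier A \<Longrightarrow> (c * d) \<odot> x = c \<odot> (d \<odot> x)"
    and smult_one: "x \<in> carrier A \<Longrightarrow> 1 \<odot> x = x"
    and smult_mult_left:
      "\<lbrakk>x \<in> carrier A; y \<in> carrier A\<rbrakk> \<Longrightarrow> (c \<odot> x) \<otimes> y = c \<odot> (x \<otimes> y)"
    and smult_mult_right:
      "\<lbrakk>x \<in> carrier A; y \<in> carrier A\<rbrakk> \<Longrightarrow> x \<otimes> (c \<odot> y) = c \<odot> (x \<otimes> y)"
    and adj_closed: "x \<in> carrier A \<Longrightarrow> adj A x \<in> carrier A"
    and adj_adj: "x \<in> carrier A \<Longrightarrow> adj A (adj A x) = x"
    and adj_add:
      "\<lbrakk>x \<in> carrier A; y \<in> carrier A\<rbrakk> \<Longrightarrow> adj A (x \<oplus> y) = adj A x \<oplus> adj A y"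
    and adj_smult: "x \<in> carrier A \<Longrightarrow> adj A (c \<odot> x) = cnj c \<odot> adj A x"
    and adj_mult:
      "\<lbrakk>x \<in> carrier A; y \<in> carrier A\<rbrakk> \<Longrightarrow> adj A (x \<otimes> y) = adj A y \<otimes> adj A x"
    and nrm_eq_zero: "x \<in> carrier A \<Longrightarrow> nrm A x = 0 \<longleftrightarrow> x = \<zero>"
    and nrm_triangle:
      "\<lbrakk>x \<in> carrier A; y \<in> carrier A\<rbrakk> \<Longrightarrow> nrm A (x \<oplus> y) \<le> nrm A x + nrm A y"
    and nrm_smult: "x \<in> carrier A \<Longrightarrow> nrm A (c \<odot> x) = cmod c * nrm A x"
    and nrm_mult:
      "\<lbrakk>x \<in> carrier A; y \<in> carrier A\<rbrakk> \<Longrightarrow> nrm A (x \<otimes> y) \<le> nrm A x * nrm A y"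
    and cstar_identity: "x \<in> carrier A \<Longrightarrow> nrm A (adj A x \<otimes> x) = (nrm A x)\<^sup>2"
    and complete:
      "\<lbrakk>\<And>n. X n \<in> carrier A;
        \<forall>e>0. \<exists>M. \<forall>m\<ge>M. \<forall>n\<ge>M. nrm A (X m \<ominus> X n) < e\<rbrakk>
       \<Longrightarrow> \<exists>x\<in>carrier A. (\<lambda>n. nrm A (X n \<ominus> x)) \<longlonglongrightarrow> 0"

definition cstar_hom :: "'a cstar \<Rightarrow> 'b cstar \<Rightarrow> ('a \<Rightarrow> 'b) set" where
  "cstar_hom A B = {f \<in> ring_hom A B.
     (\<forall>c. \<forall>x\<in>carrier A. f (c \<odot>\<^bsub>A\<^esub> x) = c \<odot>\<^bsub>B\<^esub> f x) \<and>
     (\<forall>x\<in>carrier A. f (adj A x) = adj B (f x))}"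

definition cstar_iso :: "'a cstar \<Rightarrow> 'b cstar \<Rightarrow> ('a \<Rightarrow> 'b) set" where
  "cstar_iso A B = {f \<in> cstar_hom A B. bij_betw f (carrier A) (carrier B)}"

definition closed_star_subalgebra :: "'a set \<Rightarrow> 'a cstar \<Rightarrow> bool" where
  "closed_star_subalgebra B A \<longleftrightarrow> subring B A \<and>
     (\<forall>c. \<forall>x\<in>B. c \<odot>\<^bsub>A\<^esub> x \<in> B) \<and> (\<forall>x\<in>B. adj A x \<in> B) \<and>
     (\<forall>X x. (\<forall>n::nat. X n \<in> B) \<longrightarrow> x \<in> carrier A \<longrightarrow>
        (\<lambda>n. nrm A (X n \<ominus>\<^bsub>A\<^esub> x)) \<longlonglongrightarrow> 0 \<longrightarrow> x \<in> B)"

definition cstar_generated :: "'a cstar \<Rightarrow> 'a set \<Rightarrow> 'a set" where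
  "cstar_generated A S = \<Inter>{B. closed_star_subalgebra B A \<and> S \<subseteq> B}"

definition complex_cstar :: "complex cstar" where
  "complex_cstar = \<lparr>carrier = UNIV, monoid.mult = (*), one = 1, ring.zero = 0, add = (+),
     smult = (*), adj = cnj, nrm = cmod\<rparr>"

definition opposite :: "'a cstar \<Rightarrow> 'a cstar" where
  "opposite A = A\<lparr>monoid.mult := (\<lambda>x y. y \<otimes>\<^bsub>A\<^esub> x)\<rparr>"


section \<open>Universal C*-algebras\<close>

text \<open>The free unital *-algebra on a type of generators is the algebra of the free monoid on the
  letters \<open>(g, False)\<close>, standing for the generator \<open>g\<close>, and \<open>(g, True)\<close>, standing for its
  adjoint.  Words get their own type so that concatenation can serve as the addition that the
  convolution product of \<^type>\<open>poly_mapping\<close> is built from.\<close>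

datatype 'g monom = Monom (letters: "('g \<times> bool) list")

instantiation monom :: (type) monoid_add
begin

definition zero_monom :: "'a monom" where "zero_monom = Monom []"

definition plus_monom :: "'a monom \<Rightarrow> 'a monom \<Rightarrow> 'a monom" where
  "plus_monom v w = Monom (letters v @ letters w)"

instance
  by standard (simp_all add: zero_monom_def plus_monom_def)

end

type_synonym 'g free_star = "'g monom \<Rightarrow>\<^sub>0 complex"

definition fgen :: "'g \<Rightarrow> 'g free_star" where
  "fgen g = Poly_Mapping.single (Monom [(g, False)]) 1"

definition fscale :: "complex \<Rightarrow> 'g free_star \<Rightarrow> 'g free_star" where
  "fscale c p = Poly_Mapping.single 0 c * p"

definition monom_adj :: "'g monom \<Rightarrow> 'g monom" where
  "monom_adj w = Monom (rev (map (\<lambda>(g, b). (g, \<not> b)) (letters w)))"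

definition fadj :: "'g free_star \<Rightarrow> 'g free_star" where
  "fadj p = (\<Sum>w\<in>Poly_Mapping.keys p.
     Poly_Mapping.single (monom_adj w) (cnj (Poly_Mapping.lookup p w)))"

definition cstar_seminorm :: "('g free_star \<Rightarrow> real) \<Rightarrow> bool" where
  "cstar_seminorm \<nu> \<longleftrightarrow>
     (\<forall>p q. \<nu> (p + q) \<le> \<nu> p + \<nu> q) \<and>
     (\<forall>c p. \<nu> (fscale c p) = cmod c * \<nu> p) \<and>
     (\<forall>p q. \<nu> (p * q) \<le> \<nu> p * \<nu> q) \<and>
     (\<forall>p. \<nu> (fadj p * p) = (\<nu> p)\<^sup>2)"

text \<open>The largest C*-seminorm vanishing on the relators \<open>R\<close>.  It is only meaningful when the
  relations bound the generators, as all those used below do.\<close>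

definition universal_seminorm :: "'g free_star set \<Rightarrow> 'g free_star \<Rightarrow> real" where
  "universal_seminorm R p = (SUP \<nu>\<in>{\<nu>. cstar_seminorm \<nu> \<and> (\<forall>r\<in>R. \<nu> r = 0)}. \<nu> p)"

text \<open>Hausdorff completion of the free *-algebra with respect to a seminorm: Cauchy sequences
  modulo null sequences.\<close>

definition cauchy_seqs :: "('g free_star \<Rightarrow> real) \<Rightarrow> (nat \<Rightarrow> 'g free_star) set" where
  "cauchy_seqs \<nu> = {X. \<forall>e>0. \<exists>M. \<forall>m\<ge>M. \<forall>n\<ge>M. \<nu> (X m - X n) < e}"

definition null_rel ::
    "('g free_star \<Rightarrow> real) \<Rightarrow> ((nat \<Rightarrow> 'g free_star) \<times> (nat \<Rightarrow> 'g free_star)) set" where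
  "null_rel \<nu> = {(X, Y). X \<in> cauchy_seqs \<nu> \<and> Y \<in> cauchy_seqs \<nu> \<and>
     (\<lambda>n. \<nu> (X n - Y n)) \<longlonglongrightarrow> 0}"

definition seq_class ::
    "('g free_star \<Rightarrow> real) \<Rightarrow> (nat \<Rightarrow> 'g free_star) \<Rightarrow> (nat \<Rightarrow> 'g free_star) set" where
  "seq_class \<nu> X = null_rel \<nu> `` {X}"

definition completion :: "('g free_star \<Rightarrow> real) \<Rightarrow> (nat \<Rightarrow> 'g free_star) set cstar" where
  "completion \<nu> =
     \<lparr>carrier = cauchy_seqs \<nu> // null_rel \<nu>,
      monoid.mult = (\<lambda>a b. \<Union>X\<in>a. \<Union>Y\<in>b. seq_class \<nu> (\<lambda>n. X n * Y n)),
      one = seq_class \<nu> (\<lambda>n. 1),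
      ring.zero = seq_class \<nu> (\<lambda>n. 0),
      add = (\<lambda>a b. \<Union>X\<in>a. \<Union>Y\<in>b. seq_class \<nu> (\<lambda>n. X n + Y n)),
      smult = (\<lambda>c a. \<Union>X\<in>a. seq_class \<nu> (\<lambda>n. fscale c (X n))),
      adj = (\<lambda>a. \<Union>X\<in>a. seq_class \<nu> (\<lambda>n. fadj (X n))),
      nrm = (\<lambda>a. lim (\<lambda>n. \<nu> ((SOME X. X \<in> a) n)))\<rparr>"

text \<open>The universal C*-algebra on the generators in \<open>S\<close> with relators \<open>R\<close>; the generators of the
  ambient type lying outside \<open>S\<close> are set to \<open>0\<close>.\<close>

definition relators :: "'g set \<Rightarrow> 'g free_star set \<Rightarrow> 'g free_star set" where
  "relators S R = R \<union> fgen ` (- S)"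

definition universal_cstar ::
    "'g set \<Rightarrow> 'g free_star set \<Rightarrow> (nat \<Rightarrow> 'g free_star) set cstar" where
  "universal_cstar S R = completion (universal_seminorm (relators S R))"

definition ugen :: "'g set \<Rightarrow> 'g free_star set \<Rightarrow> 'g \<Rightarrow> (nat \<Rightarrow> 'g free_star) set" where
  "ugen S R g = seq_class (universal_seminorm (relators S R)) (\<lambda>n. fgen g)"


section \<open>Tensor products\<close>

text \<open>The maximal C*-tensor product, i.e. the universal C*-algebra generated by commuting copies of
  the two factors.  Every other C*-tensor product is a quotient of it, so a comultiplication with
  values here induces one for each of them, including the minimal one.\<close>

definition copy_rel :: "'a cstar \<Rightarrow> ('a \<Rightarrow> 'g) \<Rightarrow> 'g free_star set" where
  "copy_rel A \<iota> =
     {fgen (\<iota> (x \<oplus>\<^bsub>A\<^esub> y)) - (fgen (\<iota> x) + fgen (\<iota> y)) | x y. x \<in> carrier A \<and> y \<in> carrier A} \<union>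
     {fgen (\<iota> (x \<otimes>\<^bsub>A\<^esub> y)) - fgen (\<iota> x) * fgen (\<iota> y) | x y. x \<in> carrier A \<and> y \<in> carrier A} \<union>
     {fgen (\<iota> (c \<odot>\<^bsub>A\<^esub> x)) - fscale c (fgen (\<iota> x)) | c x. x \<in> carrier A} \<union>
     {fgen (\<iota> (adj A x)) - fadj (fgen (\<iota> x)) | x. x \<in> carrier A} \<union>
     {fgen (\<iota> \<one>\<^bsub>A\<^esub>) - 1}"

definition tensor_rel :: "'a cstar \<Rightarrow> 'b cstar \<Rightarrow> ('a + 'b) free_star set" where
  "tensor_rel A B = copy_rel A Inl \<union> copy_rel B Inr \<union>
     {fgen (Inl x) * fgen (Inr y) - fgen (Inr y) * fgen (Inl x) | x y.
        x \<in> carrier A \<and> y \<in> carrier B}"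

definition tensor_cstar ::
    "'a cstar \<Rightarrow> 'b cstar \<Rightarrow> (nat \<Rightarrow> ('a + 'b) free_star) set cstar" where
  "tensor_cstar A B = universal_cstar (carrier A <+> carrier B) (tensor_rel A B)"

definition tens ::
    "'a cstar \<Rightarrow> 'b cstar \<Rightarrow> 'a \<Rightarrow> 'b \<Rightarrow> (nat \<Rightarrow> ('a + 'b) free_star) set" where
  "tens A B x y =
     ugen (carrier A <+> carrier B) (tensor_rel A B) (Inl x) \<otimes>\<^bsub>tensor_cstar A B\<^esub>
     ugen (carrier A <+> carrier B) (tensor_rel A B) (Inr y)"


section \<open>Compact quantum groups\<close>

text \<open>A compact matrix quantum group is given by its function algebra and its fundamental matrix;
  the index set is part of the data.\<close>

record 'a qgroup =
  alg :: "'a cstar"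
  ind :: "nat set"
  fund :: "nat \<Rightarrow> nat \<Rightarrow> 'a"

definition unitary_over :: "'a cstar \<Rightarrow> nat set \<Rightarrow> (nat \<Rightarrow> nat \<Rightarrow> 'a) \<Rightarrow> bool" where
  "unitary_over A I u \<longleftrightarrow> (\<forall>i\<in>I. \<forall>j\<in>I.
     (\<Oplus>\<^bsub>A\<^esub>k\<in>I. u i k \<otimes>\<^bsub>A\<^esub> adj A (u j k)) = (if i = j then \<one>\<^bsub>A\<^esub> else \<zero>\<^bsub>A\<^esub>) \<and>
     (\<Oplus>\<^bsub>A\<^esub>k\<in>I. adj A (u k i) \<otimes>\<^bsub>A\<^esub> u k j) = (if i = j then \<one>\<^bsub>A\<^esub> else \<zero>\<^bsub>A\<^esub>))"

definition compact_quantum_group :: "'a qgroup \<Rightarrow> bool" where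
  "compact_quantum_group G \<longleftrightarrow>
     (let A = alg G; I = ind G; u = fund G in
        cstar_algebra A \<and> finite I \<and>
        (\<forall>i\<in>I. \<forall>j\<in>I. u i j \<in> carrier A) \<and>
        unitary_over A I u \<and>
        cstar_generated A {u i j | i j. i \<in> I \<and> j \<in> I} = carrier A \<and>
        (\<exists>\<Delta>\<in>cstar_hom A (tensor_cstar A A). \<forall>i\<in>I. \<forall>j\<in>I.
           \<Delta> (u i j) = (\<Oplus>\<^bsub>tensor_cstar A A\<^esub>k\<in>I. tens A A (u i k) (u k j))) \<and>
        (\<exists>\<epsilon>\<in>cstar_hom A complex_cstar. \<forall>i\<in>I. \<forall>j\<in>I. \<epsilon> (u i j) = of_bool (i = j)) \<and>
        (\<exists>S\<in>cstar_hom A (opposite A). \<forall>i\<in>I. \<forall>j\<in>I. S (u i j) = adj A (u j i)))"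

text \<open>\<open>H \<subset> G\<close> is witnessed by the quotient map of function algebras sending the fundamental matrix
  of \<open>G\<close> to that of \<open>H\<close>; when this map is bijective, \<open>H = G\<close> as quantum groups.\<close>

definition restriction_map :: "'a qgroup \<Rightarrow> 'b qgroup \<Rightarrow> ('b \<Rightarrow> 'a) \<Rightarrow> bool" where
  "restriction_map H G f \<longleftrightarrow> ind H = ind G \<and> f \<in> cstar_hom (alg G) (alg H) \<and>
     f ` carrier (alg G) = carrier (alg H) \<and>
     (\<forall>i\<in>ind G. \<forall>j\<in>ind G. f (fund G i j) = fund H i j)"

definition qsubgroup :: "'a qgroup \<Rightarrow> 'b qgroup \<Rightarrow> bool" where
  "qsubgroup H G \<longleftrightarrow> (\<exists>f. restriction_map H G f)"

definition qequal :: "'a qgroup \<Rightarrow> 'b qgroup \<Rightarrow> bool" where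
  "qequal H G \<longleftrightarrow> (\<exists>f. restriction_map H G f \<and> f \<in> cstar_iso (alg G) (alg H))"

text \<open>The image in \<open>G\<close> of a quantum subgroup \<open>H \<subset> K\<close>, via an isomorphism \<open>\<Phi>\<close> from the function
  algebra of \<open>K\<close> to that of \<open>G\<close>.  The function algebra does not change, and the fundamental matrix
  is the restriction to \<open>H\<close> of the one of \<open>G\<close>, transported to \<open>K\<close>.\<close>

definition image_subgroup ::
    "'a qgroup \<Rightarrow> 'b qgroup \<Rightarrow> ('a \<Rightarrow> 'b) \<Rightarrow> 'c qgroup \<Rightarrow> 'c qgroup" where
  "image_subgroup K G \<Phi> H =
     \<lparr>alg = alg H, ind = ind G,
      fund = (\<lambda>i j. (SOME f. restriction_map H K f)
                      (inv_into (carrier (alg K)) \<Phi> (fund G i j)))\<rparr>"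


section \<open>The quantum groups involved\<close>

definition universal_qgroup ::
    "nat set \<Rightarrow> (nat \<times> nat) free_star set \<Rightarrow> (nat \<Rightarrow> (nat \<times> nat) free_star) set qgroup" where
  "universal_qgroup I R = \<lparr>alg = universal_cstar (I \<times> I) R, ind = I,
     fund = (\<lambda>i j. ugen (I \<times> I) R (i, j))\<rparr>"

definition unitary_rel :: "nat set \<Rightarrow> (nat \<times> nat) free_star set" where
  "unitary_rel I =
     {(\<Sum>k\<in>I. fgen (i, k) * fadj (fgen (j, k))) - of_bool (i = j) | i j. i \<in> I \<and> j \<in> I} \<union>
     {(\<Sum>k\<in>I. fadj (fgen (k, i)) * fgen (k, j)) - of_bool (i = j) | i j. i \<in> I \<and> j \<in> I} \<union>
     {(\<Sum>k\<in>I. fadj (fgen (i, k)) * fgen (j, k)) - of_bool (i = j) | i j. i \<in> I \<and> j \<in> I} \<union>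
     {(\<Sum>k\<in>I. fgen (k, i) * fadj (fgen (k, j))) - of_bool (i = j) | i j. i \<in> I \<and> j \<in> I}"

definition orthogonal_rel :: "nat set \<Rightarrow> (nat \<times> nat) free_star set" where
  "orthogonal_rel I =
     {fgen (i, j) - fadj (fgen (i, j)) | i j. i \<in> I \<and> j \<in> I} \<union>
     {(\<Sum>k\<in>I. fgen (i, k) * fgen (j, k)) - of_bool (i = j) | i j. i \<in> I \<and> j \<in> I} \<union>
     {(\<Sum>k\<in>I. fgen (k, i) * fgen (k, j)) - of_bool (i = j) | i j. i \<in> I \<and> j \<in> I}"

definition half_commutation_rel :: "nat set \<Rightarrow> (nat \<times> nat) free_star set" where
  "half_commutation_rel I =
     {fgen a * fgen b * fgen c - fgen c * fgen b * fgen a | a b c.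
        a \<in> I \<times> I \<and> b \<in> I \<times> I \<and> c \<in> I \<times> I}"

definition commutation_rel :: "nat set \<Rightarrow> (nat \<times> nat) free_star set" where
  "commutation_rel I =
     {fgen a * fgen b - fgen b * fgen a | a b. a \<in> I \<times> I \<and> b \<in> I \<times> I}"

definition bistochastic_rel :: "nat set \<Rightarrow> (nat \<times> nat) free_star set" where
  "bistochastic_rel I = {(\<Sum>j\<in>I. fgen (i, j)) - 1 | i. i \<in> I}"

definition "U_plus I = universal_qgroup I (unitary_rel I)"
definition "O_plus I = universal_qgroup I (orthogonal_rel I)"
definition "O_star I = universal_qgroup I (orthogonal_rel I \<union> half_commutation_rel I)"
definition "O_comm I = universal_qgroup I (orthogonal_rel I \<union> commutation_rel I)"
definition "B_plus I = universal_qgroup I (orthogonal_rel I \<union> bistochastic_rel I)"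

text \<open>Classical groups: real matrices indexed by \<open>I\<close>, extended by \<open>0\<close> outside \<open>I\<close>.\<close>

definition orthogonal_matrices :: "nat set \<Rightarrow> (nat \<Rightarrow> nat \<Rightarrow> real) set" where
  "orthogonal_matrices I = {g.
     (\<forall>i j. i \<notin> I \<or> j \<notin> I \<longrightarrow> g i j = 0) \<and>
     (\<forall>i\<in>I. \<forall>j\<in>I. (\<Sum>k\<in>I. g i k * g j k) = of_bool (i = j)) \<and>
     (\<forall>i\<in>I. \<forall>j\<in>I. (\<Sum>k\<in>I. g k i * g k j) = of_bool (i = j))}"

definition bistochastic_matrices :: "nat set \<Rightarrow> (nat \<Rightarrow> nat \<Rightarrow> real) set" where
  "bistochastic_matrices I = {g \<in> orthogonal_matrices I.
     (\<forall>i\<in>I. (\<Sum>j\<in>I. g i j) = 1) \<and> (\<forall>j\<in>I. (\<Sum>i\<in>I. g i j) = 1)}"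

definition permutation_matrices :: "nat set \<Rightarrow> (nat \<Rightarrow> nat \<Rightarrow> real) set" where
  "permutation_matrices I =
     {(\<lambda>i j. of_bool (i \<in> I \<and> j \<in> I \<and> i = \<sigma> j)) | \<sigma>. \<sigma> permutes I}"

text \<open>\<open>C(\<Gamma>)\<close> for a compact matrix group \<open>\<Gamma>\<close>, with the coordinate functions as fundamental matrix.
  The product topology on \<^typ>\<open>nat \<Rightarrow> nat \<Rightarrow> real\<close> restricts to the usual one on \<open>\<Gamma>\<close>; functions
  are normalized to vanish outside \<open>\<Gamma>\<close>.\<close>

definition classical_qgroup ::
    "nat set \<Rightarrow> (nat \<Rightarrow> nat \<Rightarrow> real) set \<Rightarrow> ((nat \<Rightarrow> nat \<Rightarrow> real) \<Rightarrow> complex) qgroup" where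
  "classical_qgroup I \<Gamma> =
     \<lparr>alg =
        \<lparr>carrier = {f. continuous_on \<Gamma> f \<and> (\<forall>g. g \<notin> \<Gamma> \<longrightarrow> f g = 0)},
         monoid.mult = (\<lambda>f h g. f g * h g),
         one = (\<lambda>g. of_bool (g \<in> \<Gamma>)),
         ring.zero = (\<lambda>g. 0),
         add = (\<lambda>f h g. f g + h g),
         smult = (\<lambda>c f g. c * f g),
         adj = (\<lambda>f g. cnj (f g)),
         nrm = (\<lambda>f. SUP g\<in>\<Gamma>. cmod (f g))\<rparr>,
      ind = I,
      fund = (\<lambda>i j g. if g \<in> \<Gamma> then complex_of_real (g i j) else 0)\<rparr>"

definition "B_class I = classical_qgroup I (bistochastic_matrices I)"
definition "S_class I = classical_qgroup I (permutation_matrices I)"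

definition mat_vec :: "nat set \<Rightarrow> (nat \<Rightarrow> nat \<Rightarrow> real) \<Rightarrow> (nat \<Rightarrow> real) \<Rightarrow> nat \<Rightarrow> real" where
  "mat_vec I M v i = (\<Sum>j\<in>I. M i j * v j)"

text \<open>\<open>(F\<^sup>* u F)\<^sub>i\<^sub>j\<close> for a real matrix \<open>F\<close>.\<close>

definition conj_entry :: "(nat \<Rightarrow> nat \<Rightarrow> real) \<Rightarrow> 'a qgroup \<Rightarrow> nat \<Rightarrow> nat \<Rightarrow> 'a" where
  "conj_entry F G i j = (\<Oplus>\<^bsub>alg G\<^esub>k\<in>ind G. \<Oplus>\<^bsub>alg G\<^esub>l\<in>ind G.
     complex_of_real (F k i * F l j) \<odot>\<^bsub>alg G\<^esub> fund G k l)"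

definition is_induced_iso ::
    "nat \<Rightarrow> (nat \<Rightarrow> nat \<Rightarrow> real) \<Rightarrow>
     ((nat \<Rightarrow> (nat \<times> nat) free_star) set \<Rightarrow> (nat \<Rightarrow> (nat \<times> nat) free_star) set) \<Rightarrow> bool" where
  "is_induced_iso N F \<Phi> \<longleftrightarrow>
     \<Phi> \<in> cstar_iso (alg (O_plus {1..<N})) (alg (B_plus {0..<N})) \<and>
     (\<forall>i\<in>{1..<N}. \<forall>j\<in>{1..<N}.
        \<Phi> (fund (O_plus {1..<N}) i j) = conj_entry F (B_plus {0..<N}) i j)"

definition induced_iso ::
    "nat \<Rightarrow> (nat \<Rightarrow> nat \<Rightarrow> real) \<Rightarrow>
     (nat \<Rightarrow> (nat \<times> nat) free_star) set \<Rightarrow> (nat \<Rightarrow> (nat \<times> nat) free_star) set" where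
  "induced_iso N F = (SOME \<Phi>. is_induced_iso N F \<Phi>)"

text \<open>The image in \<open>B\<^sub>N\<^sup>+\<close> of a quantum subgroup of \<open>O\<^sub>N\<^sub>-\<^sub>1\<^sup>+\<close>.\<close>

definition F_image :: "nat \<Rightarrow> (nat \<Rightarrow> nat \<Rightarrow> real) \<Rightarrow> 'c qgroup \<Rightarrow> 'c qgroup" where
  "F_image N F H = image_subgroup (O_plus {1..<N}) (B_plus {0..<N}) (induced_iso N F) H"

definition B_circ ::
    "nat \<Rightarrow> (nat \<Rightarrow> nat \<Rightarrow> real) \<Rightarrow> (nat \<Rightarrow> (nat \<times> nat) free_star) set qgroup" where
  "B_circ N F = F_image N F (O_star {1..<N})"


section \<open>Categories of partitions and easiness\<close>

datatype colour = White | Black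

fun switch :: "colour \<Rightarrow> colour" where
  "switch White = Black"
| "switch Black = White"

text \<open>A partition of \<open>m\<close> upper and \<open>n\<close> lower points: the upper points are \<open>Inl 0, Inl 1, \<dots>\<close>, the
  lower ones \<open>Inr 0, Inr 1, \<dots>\<close>, both numbered from left to right.\<close>

type_synonym points_partition = "(nat + nat) set set"

definition points :: "nat \<Rightarrow> nat \<Rightarrow> (nat + nat) set" where
  "points m n = {..<m} <+> {..<n}"

definition hconcat ::
    "nat \<Rightarrow> nat \<Rightarrow> points_partition \<Rightarrow> points_partition \<Rightarrow> points_partition" where
  "hconcat m n \<pi> \<sigma> = \<pi> \<union> (\<lambda>b. map_sum (\<lambda>i. i + m) (\<lambda>j. j + n) ` b) ` \<sigma>"

text \<open>Vertical concatenation of \<open>\<pi>\<close> (on top, with \<open>m\<close> upper points) and \<open>\<sigma>\<close> (below, with \<open>n\<close> lower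
  points).  The points of the three rows are \<open>Inl i\<close>, \<open>Inr (Inl j)\<close>, \<open>Inr (Inr k)\<close>; components
  not reaching the outer rows are discarded.\<close>

definition vlink :: "points_partition \<Rightarrow> points_partition \<Rightarrow> ((nat + nat + nat) \<times> (nat + nat + nat)) set"
  where
  "vlink \<pi> \<sigma> =
     (\<Union>b\<in>\<pi>. (map_sum id Inl ` b) \<times> (map_sum id Inl ` b)) \<union> (\<Union>b\<in>\<sigma>. (Inr ` b) \<times> (Inr ` b))"

definition vconcat ::
    "nat \<Rightarrow> nat \<Rightarrow> points_partition \<Rightarrow> points_partition \<Rightarrow> points_partition" where
  "vconcat m n \<pi> \<sigma> = points m n //
     {(p, q). p \<in> points m n \<and> q \<in> points m n \<and>
        (map_sum id Inr p, map_sum id Inr q) \<in> (vlink \<pi> \<sigma>)\<^sup>+}"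

definition upside_down :: "points_partition \<Rightarrow> points_partition" where
  "upside_down \<pi> = (\<lambda>b. case_sum Inr Inl ` b) ` \<pi>"

definition category_of_partitions :: "(colour list \<Rightarrow> colour list \<Rightarrow> points_partition set) \<Rightarrow> bool"
  where
  "category_of_partitions D \<longleftrightarrow>
     (\<forall>k l. \<forall>\<pi>\<in>D k l. partition_on (points (length k) (length l)) \<pi>) \<and>
     (\<forall>k l k' l'. \<forall>\<pi>\<in>D k l. \<forall>\<sigma>\<in>D k' l'.
        hconcat (length k) (length l) \<pi> \<sigma> \<in> D (k @ k') (l @ l')) \<and>
     (\<forall>k l m. \<forall>\<pi>\<in>D k l. \<forall>\<sigma>\<in>D l m. vconcat (length k) (length m) \<pi> \<sigma> \<in> D k m) \<and>
     (\<forall>k l. \<forall>\<pi>\<in>D k l. upside_down \<pi> \<in> D (map switch l) (map switch k)) \<and>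
     (\<forall>k. {{Inl i, Inr i} | i. i < length k} \<in> D k k) \<and>
     {{Inr 0, Inr 1}} \<in> D [] [White, Black] \<and>
     {{Inr 0, Inr 1}} \<in> D [] [Black, White]"

text \<open>A linear map \<open>T\<close> from the \<open>k\<close>-th to the \<open>l\<close>-th tensor power of the space with basis indexed
  by \<open>I\<close> is the family of its matrix entries \<open>T j i\<close>, for multi-indices \<open>i\<close> of length \<open>k\<close> and \<open>j\<close>
  of length \<open>l\<close>, extended by \<open>0\<close>.\<close>

type_synonym tensor_map = "nat list \<Rightarrow> nat list \<Rightarrow> complex"

definition multi_indices :: "nat set \<Rightarrow> nat \<Rightarrow> nat list set" where
  "multi_indices I n = {i. length i = n \<and> set i \<subseteq> I}"

definition partition_map :: "nat set \<Rightarrow> nat \<Rightarrow> nat \<Rightarrow> points_partition \<Rightarrow> tensor_map" where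
  "partition_map I m n \<pi> j i = of_bool (i \<in> multi_indices I m \<and> j \<in> multi_indices I n \<and>
     (\<forall>b\<in>\<pi>. \<forall>p\<in>b. \<forall>q\<in>b. case_sum (\<lambda>r. i ! r) (\<lambda>r. j ! r) p = case_sum (\<lambda>r. i ! r) (\<lambda>r. j ! r) q))"

definition coloured_fund :: "'a qgroup \<Rightarrow> colour \<Rightarrow> nat \<Rightarrow> nat \<Rightarrow> 'a" where
  "coloured_fund G c i j = (case c of White \<Rightarrow> fund G i j | Black \<Rightarrow> adj (alg G) (fund G i j))"

text \<open>The entry at row \<open>i\<close> and column \<open>j\<close> of the tensor power of the fundamental matrix along a
  coloured word.\<close>

fun tensor_power :: "'a qgroup \<Rightarrow> colour list \<Rightarrow> nat list \<Rightarrow> nat list \<Rightarrow> 'a" where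
  "tensor_power G (c # k) (i # is) (j # js) =
     coloured_fund G c i j \<otimes>\<^bsub>alg G\<^esub> tensor_power G k is js"
| "tensor_power G _ _ _ = \<one>\<^bsub>alg G\<^esub>"

definition Hom :: "'a qgroup \<Rightarrow> colour list \<Rightarrow> colour list \<Rightarrow> tensor_map set" where
  "Hom G k l = {T.
     (\<forall>j i. j \<notin> multi_indices (ind G) (length l) \<or> i \<notin> multi_indices (ind G) (length k) \<longrightarrow>
        T j i = 0) \<and>
     (\<forall>j\<in>multi_indices (ind G) (length l). \<forall>i\<in>multi_indices (ind G) (length k).
        (\<Oplus>\<^bsub>alg G\<^esub>r\<in>multi_indices (ind G) (length k). T j r \<odot>\<^bsub>alg G\<^esub> tensor_power G k r i) =
        (\<Oplus>\<^bsub>alg G\<^esub>r\<in>multi_indices (ind G) (length l). T r i \<odot>\<^bsub>alg G\<^esub> tensor_power G l j r))}"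

definition tensor_span :: "tensor_map set \<Rightarrow> tensor_map set" where
  "tensor_span B = {(\<lambda>j i. \<Sum>T\<in>X. c T * T j i) | X c. finite X \<and> X \<subseteq> B}"

definition easy :: "'a qgroup \<Rightarrow> bool" where
  "easy G \<longleftrightarrow>
     qsubgroup (S_class (ind G)) G \<and> qsubgroup G (U_plus (ind G)) \<and>
     (\<exists>D. category_of_partitions D \<and>
        (\<forall>k l. Hom G k l =
           tensor_span (partition_map (ind G) (length k) (length l) ` D k l)))"

end

theory Submission
  imports Defs
begin

text \<open>Conjugation by \<open>F\<close> identifies orthogonal matrices over a C*-algebra with row sums \<open>1\<close> with the
  matrices \<open>diag(1, w)\<close>, \<open>w\<close> orthogonal of size \<open>N - 1\<close> (\<open>unrot_bistochastic\<close>).  By the universal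
  properties this gives the isomorphism \<open>C(O\<^sub>N\<^sub>-\<^sub>1\<^sup>+) \<rightarrow> C(B\<^sub>N\<^sup>+)\<close>, and it shows that the image of a quantum
  subgroup of \<open>O\<^sub>N\<^sub>-\<^sub>1\<^sup>+\<close> with fundamental matrix \<open>w\<close> has fundamental matrix \<open>F diag(1, w) F\<^sup>t\<close>
  (\<open>F_image_simps\<close>).  The inclusions come from adding relations; that the maps between the function
  algebras are onto rests on the theorem that a *-homomorphism with dense range is surjective
  (\<open>cstar_hom_surjective\<close>).

  The universal C*-algebras are completions of free *-algebras for a largest C*-seminorm.  They are
  controlled by characters of commutative C*-seminorms (\<open>exists_character\<close>): minimal seminorms exist
  by Zorn's lemma, are multiplicative by a localisation argument, and are then absolute values of
  characters by Ostrowski's form of the Gelfand--Mazur theorem.  This yields functional calculus for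
  self-adjoint elements, contractivity of *-homomorphisms, the bounds making the universal
  algebras and the tensor product exist, and the identification of the commutative version of
  \<open>O\<^sub>N\<^sub>-\<^sub>1\<^sup>+\<close> with the functions on \<open>B\<^sub>N\<close> (\<open>O_comm_B_class\<close>).  The comultiplication, counit and antipode
  of \<open>B\<^sub>F\<^sup>\<circ>\<close> are those of \<open>O\<^sub>N\<^sub>-\<^sub>1\<^sup>*\<close>, since conjugation by \<open>F\<close> is compatible with products and transposes
  of matrices.

  Suppose that \<open>B\<^sub>F\<^sup>\<circ>\<close> is easy and \<open>N \<ge> 4\<close>.  Half-commutation of \<open>w\<close> says that the flip of the outer
  legs of the third tensor power, cut down to the complement of \<open>\<xi>\<close>, is a morphism; so it is a
  combination of maps \<open>T\<^sub>\<pi>\<close> that are morphisms.  Contracting with columns \<open>1, 2, 3\<close> of \<open>F\<close>, one such \<open>\<pi>\<close>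
  has a nonzero contraction, whence no singletons, as these columns are orthogonal to \<open>\<xi>\<close>.  Invariance
  under a reflection in \<open>B\<^sub>N\<close> excludes blocks of three or more points, so \<open>\<pi>\<close> is the flip pairing
  (\<open>partition_blocks\<close>).  Hence the entries of \<open>u\<close> half-commute, and summing the middle entry over a row
  they commute; but \<open>O\<^sub>N\<^sub>-\<^sub>1\<^sup>*\<close> has a noncommutative representation by antidiagonal two by two matrices.\<close>

section \<open>The free unital *-algebra\<close>

abbreviation fconst :: "complex \<Rightarrow> 'g free_star" where
  "fconst c \<equiv> Poly_Mapping.single 0 c"

lemma fscale_eq: "fscale c p = fconst c * p"
  by (simp add: fscale_def)

lemma free_star_sum_single:
  fixes p :: "'g free_star"
  shows "p = (\<Sum>w\<in>Poly_Mapping.keys p. Poly_Mapping.single w (Poly_Mapping.lookup p w))"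
proof (rule poly_mapping_eqI)
  fix v
  show "Poly_Mapping.lookup p v =
    Poly_Mapping.lookup (\<Sum>w\<in>Poly_Mapping.keys p. Poly_Mapping.single w (Poly_Mapping.lookup p w)) v"
    by (simp add: lookup_sum lookup_single when_def in_keys_iff sum.delta)
qed

lemma free_star_induct_single [case_names single add]:
  fixes p :: "'g free_star"
  assumes "\<And>w c. P (Poly_Mapping.single w c)" and "\<And>p q. P p \<Longrightarrow> P q \<Longrightarrow> P (p + q)"
  shows "P p"
proof -
  have "P 0" using assms(1)[of 0 0] by simp
  have "P (\<Sum>w\<in>S. Poly_Mapping.single w (f w))" if "finite S" for S and f :: "'g monom \<Rightarrow> complex"
    using that by (induction S rule: finite_induct) (auto simp: \<open>P 0\<close> intro: assms)
  then show ?thesis using free_star_sum_single[of p] by (metis finite_keys)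
qed

lemma lookup_fadj: "Poly_Mapping.lookup (fadj p) w = cnj (Poly_Mapping.lookup p (monom_adj w))"
proof -
  have inv: "monom_adj (monom_adj v) = v" for v :: "'g monom"
    by (cases v) (simp add: monom_adj_def rev_map case_prod_beta o_def)
  have "Poly_Mapping.lookup (fadj p) w =
      (\<Sum>v\<in>Poly_Mapping.keys p. if v = monom_adj w then cnj (Poly_Mapping.lookup p v) else 0)"
    unfolding fadj_def lookup_sum lookup_single when_def
    by (rule sum.cong) (use inv in \<open>metis+\<close>)
  then show ?thesis by (simp add: in_keys_iff)
qed

lemma monom_adj_adj [simp]: "monom_adj (monom_adj v) = v"
  by (cases v) (simp add: monom_adj_def rev_map case_prod_beta o_def)

lemma monom_adj_plus: "monom_adj (v + w) = monom_adj w + monom_adj v"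
  by (simp add: monom_adj_def plus_monom_def)

lemma monom_adj_zero [simp]: "monom_adj 0 = 0"
  by (simp add: monom_adj_def zero_monom_def)

lemma fadj_add: "fadj (p + q) = fadj p + fadj q"
  by (rule poly_mapping_eqI) (simp add: lookup_fadj lookup_add)

lemma fadj_fadj [simp]: "fadj (fadj p) = p"
  by (rule poly_mapping_eqI) (simp add: lookup_fadj)

lemma fadj_single: "fadj (Poly_Mapping.single w c) = Poly_Mapping.single (monom_adj w) (cnj c)"
  by (rule poly_mapping_eqI) (auto simp: lookup_fadj lookup_single when_def)

lemma fadj_mult: "fadj (p * q) = fadj q * fadj p"
proof (induction p rule: free_star_induct_single)
  case (single w c)
  show ?case
    by (induction q rule: free_star_induct_single)
      (simp_all add: mult_single fadj_single monom_adj_plus distrib_left distrib_right fadj_add mult.commute)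
qed (simp add: fadj_add distrib_left distrib_right)

lemma fadj_fconst [simp]: "fadj (fconst c) = fconst (cnj c)"
  by (simp add: fadj_single)

lemma fadj_0 [simp]: "fadj 0 = 0" and fadj_1 [simp]: "fadj 1 = 1"
  using fadj_fconst[of 0] fadj_fconst[of 1] by simp_all

lemma fadj_uminus: "fadj (- p) = - fadj p"
  by (rule poly_mapping_eqI) (simp add: lookup_fadj)

lemma fadj_diff: "fadj (p - q) = fadj p - fadj q"
  by (metis fadj_add fadj_uminus uminus_add_conv_diff add.commute)

lemma fadj_power: "fadj (p ^ n) = fadj p ^ n"
  by (induction n) (simp_all add: fadj_mult power_commutes)

lemma fconst_commute: "fconst c * p = p * fconst c"
  by (induction p rule: free_star_induct_single)
    (simp_all add: mult_single distrib_left distrib_right mult.commute)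

lemma fconst_mult: "fconst c * fconst d = fconst (c * d)"
  by (simp add: mult_single)

lemma fscale_0_right [simp]: "fscale c 0 = 0"
  by (simp add: fscale_def)

lemma fadj_fscale: "fadj (fscale c p) = fscale (cnj c) (fadj p)"
  by (simp add: fscale_def fadj_mult fconst_commute)

lemma free_star_induct [case_names const gen adj add mult]:
  fixes p :: "'g free_star"
  assumes "\<And>c. P (fconst c)" "\<And>g. P (fgen g)" "\<And>g. P (fadj (fgen g))"
    "\<And>p q. P p \<Longrightarrow> P q \<Longrightarrow> P (p + q)" "\<And>p q. P p \<Longrightarrow> P q \<Longrightarrow> P (p * q)"
  shows "P p"
proof (induction p rule: free_star_induct_single)
  case (single w c)
  have "P (Poly_Mapping.single (Monom l) c)" for l
  proof (induction l)
    case Nil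
    show ?case using assms(1)[of c] by (simp add: zero_monom_def)
  next
    case (Cons a l)
    obtain g b where a: "a = (g, b)" by force
    have "Poly_Mapping.single (Monom (a # l)) c =
        Poly_Mapping.single (Monom [(g, b)]) 1 * Poly_Mapping.single (Monom l) c"
      by (simp add: mult_single plus_monom_def a)
    moreover have "Poly_Mapping.single (Monom [(g, b)]) 1 = (if b then fadj (fgen g) else fgen g)"
      by (simp add: fgen_def fadj_single monom_adj_def)
    ultimately show ?case using Cons assms(2,3,5) by auto
  qed
  then show ?case by (metis monom.exhaust)
qed (rule assms(4))

section \<open>C*-seminorms\<close>

context
  fixes \<nu> :: "'g free_star \<Rightarrow> real"
  assumes \<nu>: "cstar_seminorm \<nu>"
begin

lemma cs_triangle: "\<nu> (p + q) \<le> \<nu> p + \<nu> q"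
  and cs_scale: "\<nu> (fconst c * p) = cmod c * \<nu> p"
  and cs_mult: "\<nu> (p * q) \<le> \<nu> p * \<nu> q"
  and cs_star: "\<nu> (fadj p * p) = (\<nu> p)\<^sup>2"
  using \<nu> unfolding cstar_seminorm_def fscale_def by blast+

lemma cs_zero: "\<nu> 0 = 0"
  using cs_scale[of 0 0] by simp

lemma cs_uminus: "\<nu> (- p) = \<nu> p"
proof -
  have "- p = fconst (-1) * p" by (simp add: single_uminus)
  then show ?thesis by (simp only: cs_scale) simp
qed

lemma cs_nonneg: "0 \<le> \<nu> p"
  using cs_triangle[of p "- p"] by (simp add: cs_uminus cs_zero)

lemma cs_diff_commute: "\<nu> (p - q) = \<nu> (q - p)"
  using cs_uminus[of "p - q"] by simp

lemma cs_triangle_diff: "\<nu> (p - q) \<le> \<nu> p + \<nu> q"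
  using cs_triangle[of p "- q"] by (simp add: cs_uminus)

lemma cs_triangle3: "\<nu> (p - r) \<le> \<nu> (p - q) + \<nu> (q - r)"
  using cs_triangle[of "p - q" "q - r"] by simp

lemma cs_abs_diff: "\<bar>\<nu> p - \<nu> q\<bar> \<le> \<nu> (p - q)"
  using cs_triangle[of "p - q" q] cs_triangle[of "q - p" p] cs_diff_commute[of p q] by simp

lemma cs_eqI: "\<nu> (p - q) = 0 \<Longrightarrow> \<nu> p = \<nu> q"
  using cs_abs_diff[of p q] by simp

lemma cs_adj: "\<nu> (fadj p) = \<nu> p"
proof -
  have le: "\<nu> q \<le> \<nu> (fadj q)" for q
  proof (cases "\<nu> q = 0")
    case False
    have "\<nu> q * \<nu> q \<le> \<nu> (fadj q) * \<nu> q"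
      using cs_star[of q] cs_mult[of "fadj q" q] by (simp add: power2_eq_square)
    then show ?thesis using False cs_nonneg[of q] by (simp add: mult_le_cancel_right)
  qed (simp add: cs_nonneg)
  show ?thesis using le[of p] le[of "fadj p"] by simp
qed

lemma cs_one: "\<nu> 1 = 0 \<or> \<nu> 1 = 1"
  using cs_star[of 1] by (simp add: power2_eq_square)

lemma cs_const: "\<nu> (fconst c) = cmod c * \<nu> 1"
  using cs_scale[of c 1] by simp

lemma cs_mult_diff: "\<nu> (p * q - p' * q') \<le> \<nu> (p - p') * \<nu> q + \<nu> p' * \<nu> (q - q')"
proof -
  have "p * q - p' * q' = (p - p') * q + p' * (q - q')" by (simp add: algebra_simps)
  then show ?thesis
    using cs_triangle[of "(p - p') * q" "p' * (q - q')"] cs_mult[of "p - p'" q]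
      cs_mult[of p' "q - q'"] by simp
qed

lemma cs_null_mult: "\<nu> p = 0 \<Longrightarrow> \<nu> (a * p * b) = 0"
  using cs_mult[of "a * p" b] cs_mult[of a p] cs_nonneg[of "a * p * b"] cs_nonneg[of "a * p"]
  by simp

lemma cs_power_le: "\<nu> 1 \<le> 1 \<Longrightarrow> \<nu> (p ^ n) \<le> \<nu> p ^ n"
proof (induction n)
  case (Suc n)
  then show ?case using cs_mult[of p "p ^ n"] cs_nonneg[of p]
    by simp (meson mult_left_mono order_trans)
qed simp

end

section \<open>Elementary facts on C*-algebras\<close>

context cstar_algebra
begin

lemma smult_zero_left: "x \<in> carrier A \<Longrightarrow> 0 \<odot> x = \<zero>"
  using smult_add_left[of x 0 0] smult_closed[of x 0]
  by (metis add.l_cancel_one' add_0)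

lemma smult_zero_right: "c \<odot> \<zero> = \<zero>"
  using smult_add_right[of \<zero> \<zero> c] smult_closed[of \<zero> c] by (metis add.l_cancel_one' zero_closed l_zero)

lemma smult_minus_one: "x \<in> carrier A \<Longrightarrow> (-1) \<odot> x = \<ominus> x"
  using smult_add_left[of x 1 "-1"] smult_closed[of x "-1"]
  by (simp add: smult_one smult_zero_left) (metis add.inv_unique' minus_equality a_comm)

lemma smult_uminus: "x \<in> carrier A \<Longrightarrow> c \<odot> (\<ominus> x) = \<ominus> (c \<odot> x)"
  by (metis smult_minus_one smult_closed smult_smult mult.commute)

lemma smult_diff_right:
  "x \<in> carrier A \<Longrightarrow> y \<in> carrier A \<Longrightarrow> c \<odot> (x \<ominus> y) = c \<odot> x \<ominus> c \<odot> y"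
  by (simp add: a_minus_def smult_add_right smult_uminus)

lemma adj_zero: "adj A \<zero> = \<zero>"
  using adj_smult[of \<zero> 0] by (simp add: smult_zero_left adj_closed)

lemma adj_one: "adj A \<one> = \<one>"
proof -
  have "adj A \<one> = adj A \<one> \<otimes> \<one>" by (simp add: adj_closed)
  also have "\<dots> = adj A (adj A \<one> \<otimes> \<one>)" by (simp only: adj_mult adj_closed one_closed adj_adj)
  also have "\<dots> = \<one>" by (simp add: adj_closed adj_adj)
  finally show ?thesis .
qed

lemma adj_uminus: "x \<in> carrier A \<Longrightarrow> adj A (\<ominus> x) = \<ominus> adj A x"
  using adj_smult[of x "-1"] by (simp add: smult_minus_one adj_closed)

lemma adj_minus: "x \<in> carrier A \<Longrightarrow> y \<in> carrier A \<Longrightarrow> adj A (x \<ominus> y) = adj A x \<ominus> adj A y"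
  by (simp add: a_minus_def adj_add adj_uminus adj_closed)

lemma nrm_zero: "nrm A \<zero> = 0"
  by (simp add: nrm_eq_zero)

lemma nrm_uminus: "x \<in> carrier A \<Longrightarrow> nrm A (\<ominus> x) = nrm A x"
  using nrm_smult[of x "-1"] by (simp add: smult_minus_one)

lemma nrm_nonneg: "x \<in> carrier A \<Longrightarrow> 0 \<le> nrm A x"
  using nrm_triangle[of x "\<ominus> x"] by (simp add: nrm_uminus nrm_zero r_neg)

lemma minus_add_minus:
  "\<lbrakk>x \<in> carrier A; y \<in> carrier A; z \<in> carrier A\<rbrakk> \<Longrightarrow> (x \<ominus> y) \<oplus> (y \<ominus> z) = x \<ominus> z"
  by (simp add: a_minus_def a_assoc) (simp add: a_assoc[symmetric] l_neg)

lemma nrm_triangle3: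
  "\<lbrakk>x \<in> carrier A; y \<in> carrier A; z \<in> carrier A\<rbrakk> \<Longrightarrow> nrm A (x \<ominus> z) \<le> nrm A (x \<ominus> y) + nrm A (y \<ominus> z)"
  using nrm_triangle[of "x \<ominus> y" "y \<ominus> z"] by (simp add: minus_add_minus)

lemma nrm_minus_commute:
  "x \<in> carrier A \<Longrightarrow> y \<in> carrier A \<Longrightarrow> nrm A (x \<ominus> y) = nrm A (y \<ominus> x)"
  by (metis minus_closed nrm_uminus minus_minus a_minus_def minus_add a_comm a_inv_closed)

lemma nrm_abs_diff:
  assumes "x \<in> carrier A" "y \<in> carrier A"
  shows "\<bar>nrm A x - nrm A y\<bar> \<le> nrm A (x \<ominus> y)"
  using nrm_triangle3[of x y \<zero>] nrm_triangle3[of y x \<zero>] nrm_minus_commute[of x y] assms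
  by (simp add: a_minus_def)

lemma nrm_minus_eq_zero:
  "x \<in> carrier A \<Longrightarrow> y \<in> carrier A \<Longrightarrow> nrm A (x \<ominus> y) = 0 \<longleftrightarrow> x = y"
  by (simp add: nrm_eq_zero)

lemma nrm_adj: "x \<in> carrier A \<Longrightarrow> nrm A (adj A x) = nrm A x"
proof -
  have le: "nrm A y \<le> nrm A (adj A y)" if "y \<in> carrier A" for y
  proof (cases "nrm A y = 0")
    case False
    have "nrm A y * nrm A y \<le> nrm A (adj A y) * nrm A y"
      using cstar_identity[OF that] nrm_mult[of "adj A y" y] that adj_closed[OF that]
      by (simp add: power2_eq_square)
    then show ?thesis using False nrm_nonneg[OF that] by (simp add: mult_le_cancel_right)
  qed (simp add: nrm_nonneg that adj_closed)
  assume "x \<in> carrier A"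
  then show ?thesis using le[of x] le[of "adj A x"] adj_closed by (simp add: adj_adj)
qed

lemma lim_unique:
  assumes "\<And>n. X n \<in> carrier A" "x \<in> carrier A" "y \<in> carrier A"
    and "(\<lambda>n::nat. nrm A (X n \<ominus> x)) \<longlonglongrightarrow> 0" "(\<lambda>n. nrm A (X n \<ominus> y)) \<longlonglongrightarrow> 0"
  shows "x = y"
proof -
  have "nrm A (x \<ominus> y) \<le> nrm A (X n \<ominus> x) + nrm A (X n \<ominus> y)" for n
    using nrm_triangle3[of x "X n" y] nrm_minus_commute[of x "X n"] assms(1-3) by simp
  moreover have "(\<lambda>n. nrm A (X n \<ominus> x) + nrm A (X n \<ominus> y)) \<longlonglongrightarrow> 0"
    using tendsto_add[OF assms(4,5)] by simp
  ultimately have "nrm A (x \<ominus> y) \<le> 0" by (meson LIMSEQ_le_const)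
  then show ?thesis using nrm_minus_eq_zero[of x y] nrm_nonneg[of "x \<ominus> y"] assms by simp
qed

lemma lim_nrm:
  assumes "\<And>n. X n \<in> carrier A" "x \<in> carrier A" "(\<lambda>n::nat. nrm A (X n \<ominus> x)) \<longlonglongrightarrow> 0"
  shows "(\<lambda>n. nrm A (X n)) \<longlonglongrightarrow> nrm A x"
proof -
  have "(\<lambda>n. nrm A (X n) - nrm A x) \<longlonglongrightarrow> 0"
    by (rule Lim_null_comparison[OF _ assms(3)]) (simp add: nrm_abs_diff assms)
  then show ?thesis using LIM_zero_iff by blast
qed

lemma lim_add:
  assumes "\<And>n. X n \<in> carrier A" "\<And>n. Y n \<in> carrier A" "x \<in> carrier A" "y \<in> carrier A"
    "(\<lambda>n::nat. nrm A (X n \<ominus> x)) \<longlonglongrightarrow> 0" "(\<lambda>n. nrm A (Y n \<ominus> y)) \<longlonglongrightarrow> 0"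
  shows "(\<lambda>n. nrm A ((X n \<oplus> Y n) \<ominus> (x \<oplus> y))) \<longlonglongrightarrow> 0"
proof (rule Lim_null_comparison)
  have "(X n \<oplus> Y n) \<ominus> (x \<oplus> y) = (X n \<ominus> x) \<oplus> (Y n \<ominus> y)" for n
    using assms(1-4) by (simp add: a_minus_def minus_add a_ac)
  then show "\<forall>\<^sub>F n in sequentially. norm (nrm A ((X n \<oplus> Y n) \<ominus> (x \<oplus> y))) \<le> nrm A (X n \<ominus> x) + nrm A (Y n \<ominus> y)"
    using nrm_triangle[of "X _ \<ominus> x" "Y _ \<ominus> y"] assms(1-4) by (simp add: nrm_nonneg)
  show "(\<lambda>n. nrm A (X n \<ominus> x) + nrm A (Y n \<ominus> y)) \<longlonglongrightarrow> 0"
    using tendsto_add[OF assms(5,6)] by simp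
qed

lemma lim_mult:
  assumes "\<And>n. X n \<in> carrier A" "\<And>n. Y n \<in> carrier A" "x \<in> carrier A" "y \<in> carrier A"
    "(\<lambda>n::nat. nrm A (X n \<ominus> x)) \<longlonglongrightarrow> 0" "(\<lambda>n. nrm A (Y n \<ominus> y)) \<longlonglongrightarrow> 0"
  shows "(\<lambda>n. nrm A ((X n \<otimes> Y n) \<ominus> (x \<otimes> y))) \<longlonglongrightarrow> 0"
proof (rule Lim_null_comparison)
  have "(X n \<otimes> Y n) \<ominus> (x \<otimes> y) = (X n \<ominus> x) \<otimes> Y n \<oplus> x \<otimes> (Y n \<ominus> y)" for n
    using assms(1-4) by (simp add: a_minus_def l_distr r_distr l_minus r_minus a_assoc)
      (simp add: a_assoc[symmetric] l_neg)
  then have "nrm A ((X n \<otimes> Y n) \<ominus> (x \<otimes> y)) \<le> nrm A (X n \<ominus> x) * nrm A (Y n) + nrm A x * nrm A (Y n \<ominus> y)" for n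
    using nrm_triangle[of "(X n \<ominus> x) \<otimes> Y n" "x \<otimes> (Y n \<ominus> y)"] nrm_mult[of "X n \<ominus> x" "Y n"]
      nrm_mult[of x "Y n \<ominus> y"] assms(1-4) by simp
  then show "\<forall>\<^sub>F n in sequentially. norm (nrm A ((X n \<otimes> Y n) \<ominus> (x \<otimes> y)))
     \<le> nrm A (X n \<ominus> x) * nrm A (Y n) + nrm A x * nrm A (Y n \<ominus> y)"
    using assms(1-4) by (simp add: nrm_nonneg)
  have "(\<lambda>n. nrm A (Y n)) \<longlonglongrightarrow> nrm A y" using lim_nrm assms by blast
  from tendsto_add[OF tendsto_mult[OF assms(5) this] tendsto_mult[OF tendsto_const assms(6), of "nrm A x"]]
  show "(\<lambda>n. nrm A (X n \<ominus> x) * nrm A (Y n) + nrm A x * nrm A (Y n \<ominus> y)) \<longlonglongrightarrow> 0"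
    by simp
qed

lemma lim_adj:
  assumes "\<And>n. X n \<in> carrier A" "x \<in> carrier A" "(\<lambda>n::nat. nrm A (X n \<ominus> x)) \<longlonglongrightarrow> 0"
  shows "(\<lambda>n. nrm A (adj A (X n) \<ominus> adj A x)) \<longlonglongrightarrow> 0"
  using assms(3) by (simp add: adj_minus[symmetric] assms(1,2) nrm_adj)

lemma lim_smult:
  assumes "\<And>n. X n \<in> carrier A" "x \<in> carrier A" "(\<lambda>n::nat. nrm A (X n \<ominus> x)) \<longlonglongrightarrow> 0"
  shows "(\<lambda>n. nrm A (c \<odot> X n \<ominus> c \<odot> x)) \<longlonglongrightarrow> 0"
  using tendsto_mult_right_zero[OF assms(3), of "cmod c"]
  by (simp add: smult_diff_right[symmetric] assms(1,2) nrm_smult)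

lemma smult_finsum:
  assumes "\<And>i. i \<in> I \<Longrightarrow> x i \<in> carrier A"
  shows "c \<odot> (\<Oplus>i\<in>I. x i) = (\<Oplus>i\<in>I. c \<odot> x i)"
  using assms
proof (induction I rule: infinite_finite_induct)
  case (insert i I)
  then show ?case by (simp add: finsum_insert Pi_iff smult_add_right smult_closed)
qed (simp_all add: smult_zero_right finsum_infinite)

lemma adj_finsum:
  assumes "\<And>i. i \<in> I \<Longrightarrow> x i \<in> carrier A"
  shows "adj A (\<Oplus>i\<in>I. x i) = (\<Oplus>i\<in>I. adj A (x i))"
  using assms
proof (induction I rule: infinite_finite_induct)
  case (insert i I)
  then show ?case by (simp add: finsum_insert Pi_iff adj_add adj_closed)
qed (simp_all add: adj_zero finsum_infinite)

end

section \<open>Evaluation of the free *-algebra\<close>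

text \<open>Unital *-homomorphisms from the free *-algebra.\<close>

definition free_hom :: "'a cstar \<Rightarrow> ('g free_star \<Rightarrow> 'a) \<Rightarrow> bool" where
  "free_hom A e \<longleftrightarrow> (\<forall>p. e p \<in> carrier A) \<and>
     (\<forall>p q. e (p + q) = e p \<oplus>\<^bsub>A\<^esub> e q) \<and> (\<forall>p q. e (p * q) = e p \<otimes>\<^bsub>A\<^esub> e q) \<and>
     (\<forall>c. e (fconst c) = c \<odot>\<^bsub>A\<^esub> \<one>\<^bsub>A\<^esub>) \<and> (\<forall>p. e (fadj p) = adj A (e p))"

lemma free_hom_eqI:
  assumes "free_hom A e" "free_hom A e'" "\<And>g. e (fgen g) = e' (fgen g)"
  shows "e p = e' p"
  using assms by (induction p rule: free_star_induct) (auto simp: free_hom_def)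

context cstar_algebra
begin

context
  fixes e :: "'g free_star \<Rightarrow> 'a"
  assumes e: "free_hom A e"
begin

lemma fh_closed: "e p \<in> carrier A"
  and fh_add: "e (p + q) = e p \<oplus> e q"
  and fh_mult: "e (p * q) = e p \<otimes> e q"
  and fh_const: "e (fconst c) = c \<odot> \<one>"
  and fh_adj: "e (fadj p) = adj A (e p)"
  using e by (auto simp: free_hom_def)

lemma fh_one: "e 1 = \<one>"
  using fh_const[of 1] by (simp add: smult_one)

lemma fh_zero: "e 0 = \<zero>"
  using fh_const[of 0] by (simp add: smult_zero_left)

lemma fh_scale: "e (fscale c p) = c \<odot> e p"
  by (simp add: fscale_eq fh_mult fh_const smult_mult_left fh_closed)

lemma fh_uminus: "e (- p) = \<ominus> e p"
  using fh_add[of p "- p"] by (simp add: fh_zero) (metis fh_closed minus_equality a_comm)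

lemma fh_minus: "e (p - q) = e p \<ominus> e q"
  using fh_add[of p "- q"] by (simp add: fh_uminus a_minus_def)

lemma fh_sum: "e (\<Sum>i\<in>I. f i) = (\<Oplus>i\<in>I. e (f i))"
  by (induction I rule: infinite_finite_induct)
    (simp_all add: fh_zero fh_add finsum_insert finsum_infinite fh_closed)

lemma fh_of_bool: "e (of_bool b) = (if b then \<one> else \<zero>)"
  by (simp add: fh_one fh_zero)

lemma cstar_seminorm_free_hom: "cstar_seminorm (\<lambda>p. nrm A (e p))"
  unfolding cstar_seminorm_def
  by (simp add: fh_add nrm_triangle fh_scale nrm_smult fh_mult nrm_mult fh_adj cstar_identity fh_closed)

end

end

text \<open>The value of a word at the elements \<open>h g\<close>; flagged letters are sent to adjoints.\<close>

definition word_val :: "'a cstar \<Rightarrow> ('g \<Rightarrow> 'a) \<Rightarrow> 'g monom \<Rightarrow> 'a" where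
  "word_val A h w = foldr (\<lambda>(g, b) x. (if b then adj A (h g) else h g) \<otimes>\<^bsub>A\<^esub> x) (letters w) \<one>\<^bsub>A\<^esub>"

text \<open>The value of a noncommutative *-polynomial at a family of elements.\<close>

definition eval :: "'a cstar \<Rightarrow> ('g \<Rightarrow> 'a) \<Rightarrow> 'g free_star \<Rightarrow> 'a" where
  "eval A h p = (\<Oplus>\<^bsub>A\<^esub>w\<in>Poly_Mapping.keys p. Poly_Mapping.lookup p w \<odot>\<^bsub>A\<^esub> word_val A h w)"

context cstar_algebra
begin

context
  fixes h :: "'g \<Rightarrow> 'a"
  assumes h: "\<And>g. h g \<in> carrier A"
begin

lemma word_val_closed: "word_val A h w \<in> carrier A"
proof -
  have "foldr (\<lambda>(g, b) x. (if b then adj A (h g) else h g) \<otimes>\<^bsub>A\<^esub> x) l \<one> \<in> carrier A" for l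
    by (induction l) (auto simp: h adj_closed)
  then show ?thesis by (simp add: word_val_def)
qed

lemma word_val_plus: "word_val A h (v + w) = word_val A h v \<otimes> word_val A h w"
proof -
  have "word_val A h (Monom (l @ letters w)) = word_val A h (Monom l) \<otimes> word_val A h w" for l
  proof (induction l)
    case Nil
    then show ?case using word_val_closed[of w] by (simp add: word_val_def)
  next
    case (Cons a l)
    then show ?case using word_val_closed[of w] word_val_closed[of "Monom l"]
      by (cases a) (auto simp: word_val_def h adj_closed m_assoc)
  qed
  from this[of "letters v"] show ?thesis by (simp add: plus_monom_def)
qed

lemma word_val_zero: "word_val A h 0 = \<one>"
  by (simp add: word_val_def zero_monom_def)

lemma word_val_letter: "word_val A h (Monom [(g, b)]) = (if b then adj A (h g) else h g)"
  by (simp add: word_val_def h adj_closed)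

lemma word_val_adj: "word_val A h (monom_adj w) = adj A (word_val A h w)"
proof -
  have "word_val A h (monom_adj (Monom l)) = adj A (word_val A h (Monom l))" for l
  proof (induction l)
    case Nil
    then show ?case by (simp add: word_val_zero adj_one flip: zero_monom_def)
  next
    case (Cons a l)
    obtain g b where a: "a = (g, b)" by force
    have 1: "Monom (a # l) = Monom [(g, b)] + Monom l" by (simp add: plus_monom_def a)
    have 2: "monom_adj (Monom [(g, b)]) = Monom [(g, \<not> b)]" by (simp add: monom_adj_def)
    show ?case unfolding 1 monom_adj_plus 2 word_val_plus Cons
      using word_val_closed h by (simp add: word_val_letter adj_mult adj_closed adj_adj)
  qed
  then show ?thesis by (metis monom.exhaust)
qed

lemma eval_superset:
  assumes "finite S" "Poly_Mapping.keys p \<subseteq> S"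
  shows "eval A h p = (\<Oplus>w\<in>S. Poly_Mapping.lookup p w \<odot> word_val A h w)"
  unfolding eval_def
  by (rule add.finprod_mono_neutral_cong_left[OF assms])
    (auto simp: in_keys_iff smult_zero_left word_val_closed smult_closed)

lemma eval_single: "eval A h (Poly_Mapping.single w c) = c \<odot> word_val A h w"
  by (subst eval_superset[of "{w}"])
    (simp_all add: word_val_closed smult_closed finsum_insert)

lemma eval_closed: "eval A h p \<in> carrier A"
  unfolding eval_def by (intro finsum_closed) (auto simp: word_val_closed smult_closed)

lemma eval_add: "eval A h (p + q) = eval A h p \<oplus> eval A h q"
proof -
  let ?S = "Poly_Mapping.keys p \<union> Poly_Mapping.keys q"
  show ?thesis
    using keys_add[of p q]
    by (simp add: eval_superset[of ?S] lookup_add smult_add_left word_val_closed finsum_addf smult_closed)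
qed

lemma eval_mult: "eval A h (p * q) = eval A h p \<otimes> eval A h q"
proof (induction p rule: free_star_induct_single)
  case (single w c)
  show ?case
    by (induction q rule: free_star_induct_single)
      (simp_all add: mult_single eval_single word_val_plus eval_closed r_distr eval_add distrib_left
        smult_mult_left smult_mult_right word_val_closed smult_closed mult.commute flip: smult_smult)
qed (simp add: eval_closed l_distr eval_add distrib_right)

lemma eval_adj: "eval A h (fadj p) = adj A (eval A h p)"
  by (induction p rule: free_star_induct_single)
    (simp_all add: fadj_single eval_single word_val_adj word_val_closed adj_smult fadj_add eval_add
      adj_add eval_closed)

lemma free_hom_eval: "free_hom A (eval A h)"
  unfolding free_hom_def
  by (simp add: eval_closed eval_add eval_mult eval_adj eval_single word_val_zero)

lemma eval_fgen: "eval A h (fgen g) = h g"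
  by (simp add: fgen_def eval_single word_val_letter smult_one h)

end

end

section \<open>The Hausdorff completion\<close>

text \<open>The class of a constant sequence, that is, the canonical map into the completion.\<close>

definition cls :: "('g free_star \<Rightarrow> real) \<Rightarrow> 'g free_star \<Rightarrow> (nat \<Rightarrow> 'g free_star) set" where
  "cls \<nu> p = seq_class \<nu> (\<lambda>n. p)"

context
  fixes \<nu> :: "'g free_star \<Rightarrow> real"
  assumes \<nu>: "cstar_seminorm \<nu>"
begin

lemmas cs = cs_triangle[OF \<nu>] cs_nonneg[OF \<nu>]

lemma cauchy_seqsD:
  assumes "X \<in> cauchy_seqs \<nu>" "0 < e"
  obtains M where "\<And>m n. M \<le> m \<Longrightarrow> M \<le> n \<Longrightarrow> \<nu> (X m - X n) < e"
  using assms unfolding cauchy_seqs_def by blast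

lemma cauchy_const [simp]: "(\<lambda>n. p) \<in> cauchy_seqs \<nu>"
  by (simp add: cauchy_seqs_def cs_zero[OF \<nu>])

lemma cauchy_norm_convergent:
  assumes "X \<in> cauchy_seqs \<nu>" shows "convergent (\<lambda>n. \<nu> (X n))"
proof -
  have "Cauchy (\<lambda>n. \<nu> (X n))"
  proof (rule metric_CauchyI)
    fix e :: real assume "0 < e"
    then obtain M where M: "\<And>m n. M \<le> m \<Longrightarrow> M \<le> n \<Longrightarrow> \<nu> (X m - X n) < e"
      using cauchy_seqsD[OF assms] by metis
    show "\<exists>M. \<forall>m\<ge>M. \<forall>n\<ge>M. dist (\<nu> (X m)) (\<nu> (X n)) < e"
      using M cs_abs_diff[OF \<nu>] unfolding dist_real_def by (meson order_le_less_trans)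
  qed
  then show ?thesis by (simp add: Cauchy_convergent_iff)
qed

lemma cauchy_bounded:
  assumes "X \<in> cauchy_seqs \<nu>" obtains B where "0 < B" "\<And>n. \<nu> (X n) \<le> B"
proof -
  have "Bseq (\<lambda>n. \<nu> (X n))"
    by (rule convergent_imp_Bseq[OF cauchy_norm_convergent[OF assms]])
  then show ?thesis using that by (auto simp: Bseq_def cs_nonneg[OF \<nu>])
qed

lemma cauchyI_le:
  assumes "\<And>m n. \<nu> (Z m - Z n) \<le> B * \<nu> (X m - X n) + B * \<nu> (Y m - Y n)" "0 < B"
    and X: "X \<in> cauchy_seqs \<nu>" and Y: "Y \<in> cauchy_seqs \<nu>"
  shows "Z \<in> cauchy_seqs \<nu>"
  unfolding cauchy_seqs_def
proof (intro CollectI allI impI)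
  fix e :: real assume e: "0 < e"
  obtain M where M: "\<And>m n. M \<le> m \<Longrightarrow> M \<le> n \<Longrightarrow> \<nu> (X m - X n) < e / (2 * B)"
    using cauchy_seqsD[OF X, of "e / (2 * B)"] e \<open>0 < B\<close> by (metis divide_pos_pos mult_pos_pos zero_less_numeral)
  obtain M' where M': "\<And>m n. M' \<le> m \<Longrightarrow> M' \<le> n \<Longrightarrow> \<nu> (Y m - Y n) < e / (2 * B)"
    using cauchy_seqsD[OF Y, of "e / (2 * B)"] e \<open>0 < B\<close> by (metis divide_pos_pos mult_pos_pos zero_less_numeral)
  show "\<exists>M. \<forall>m\<ge>M. \<forall>n\<ge>M. \<nu> (Z m - Z n) < e"
  proof (intro exI allI impI)
    fix m n assume mn: "max M M' \<le> m" "max M M' \<le> n"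
    have "B * \<nu> (X m - X n) < e / 2" "B * \<nu> (Y m - Y n) < e / 2"
      using M[of m n] M'[of m n] mn \<open>0 < B\<close> by (simp_all add: field_simps)
    then show "\<nu> (Z m - Z n) < e" using assms(1)[of m n] by linarith
  qed
qed

lemma cauchy_add:
  assumes "X \<in> cauchy_seqs \<nu>" "Y \<in> cauchy_seqs \<nu>"
  shows "(\<lambda>n. X n + Y n) \<in> cauchy_seqs \<nu>"
proof (rule cauchyI_le[OF _ _ assms, of _ 1])
  show "\<nu> (X m + Y m - (X n + Y n)) \<le> 1 * \<nu> (X m - X n) + 1 * \<nu> (Y m - Y n)" for m n
    using cs_triangle[OF \<nu>, of "X m - X n" "Y m - Y n"] by (simp add: algebra_simps)
qed simp

lemma cauchy_mult:
  assumes "X \<in> cauchy_seqs \<nu>" "Y \<in> cauchy_seqs \<nu>"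
  shows "(\<lambda>n. X n * Y n) \<in> cauchy_seqs \<nu>"
proof -
  obtain B where B: "0 < B" "\<And>n. \<nu> (X n) \<le> B" using cauchy_bounded assms(1) by blast
  obtain C where C: "0 < C" "\<And>n. \<nu> (Y n) \<le> C" using cauchy_bounded assms(2) by blast
  show ?thesis
  proof (rule cauchyI_le[OF _ _ assms, of _ "B + C"])
    fix m n
    have "\<nu> (X m - X n) * \<nu> (Y m) \<le> \<nu> (X m - X n) * (B + C)"
      using B C(2)[of m] by (intro mult_left_mono) (auto simp: cs)
    moreover have "\<nu> (X n) * \<nu> (Y m - Y n) \<le> (B + C) * \<nu> (Y m - Y n)"
      using C B(2)[of n] by (intro mult_right_mono) (auto simp: cs)
    ultimately show "\<nu> (X m * Y m - X n * Y n) \<le> (B + C) * \<nu> (X m - X n) + (B + C) * \<nu> (Y m - Y n)"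
      using cs_mult_diff[OF \<nu>, of "X m" "Y m" "X n" "Y n"] by (simp add: mult.commute)
  qed (use B C in simp)
qed

lemma cauchy_fscale:
  assumes "X \<in> cauchy_seqs \<nu>" shows "(\<lambda>n. fscale c (X n)) \<in> cauchy_seqs \<nu>"
  unfolding fscale_def by (rule cauchy_mult[OF cauchy_const assms])

lemma cauchy_adj:
  assumes "X \<in> cauchy_seqs \<nu>" shows "(\<lambda>n. fadj (X n)) \<in> cauchy_seqs \<nu>"
  using assms by (simp add: cauchy_seqs_def cs_adj[OF \<nu>] flip: fadj_diff)

lemma cauchy_diff:
  assumes "X \<in> cauchy_seqs \<nu>" "Y \<in> cauchy_seqs \<nu>"
  shows "(\<lambda>n. X n - Y n) \<in> cauchy_seqs \<nu>"
  using cauchy_add[OF assms(1) cauchy_fscale[OF assms(2), of "-1"]]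
  by (simp add: fscale_def single_uminus)

lemmas cauchy_intros = cauchy_const cauchy_add cauchy_mult cauchy_fscale cauchy_adj cauchy_diff

lemma equiv_null_rel: "equiv (cauchy_seqs \<nu>) (null_rel \<nu>)"
proof (rule equivI)
  show "refl_on (cauchy_seqs \<nu>) (null_rel \<nu>)"
    by (auto simp: refl_on_def null_rel_def cs_zero[OF \<nu>])
  show "null_rel \<nu> \<subseteq> cauchy_seqs \<nu> \<times> cauchy_seqs \<nu>" by (auto simp: null_rel_def)
  show "sym (null_rel \<nu>)" by (auto simp: sym_def null_rel_def cs_diff_commute[OF \<nu>])
  show "trans (null_rel \<nu>)"
  proof (rule transI)
    fix X Y Z assume XYZ: "(X, Y) \<in> null_rel \<nu>" "(Y, Z) \<in> null_rel \<nu>"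
    then have "(\<lambda>n. \<nu> (X n - Y n) + \<nu> (Y n - Z n)) \<longlonglongrightarrow> 0"
      using tendsto_add by (fastforce simp: null_rel_def)
    then have "(\<lambda>n. \<nu> (X n - Z n)) \<longlonglongrightarrow> 0"
      by (rule Lim_null_comparison[rotated]) (simp add: cs cs_triangle3[OF \<nu>])
    then show "(X, Z) \<in> null_rel \<nu>" using XYZ by (simp add: null_rel_def)
  qed
qed

lemma seq_class_eqI:
  assumes "X \<in> cauchy_seqs \<nu>" "Y \<in> cauchy_seqs \<nu>" "(\<lambda>n. \<nu> (X n - Y n)) \<longlonglongrightarrow> 0"
  shows "seq_class \<nu> X = seq_class \<nu> Y"
  unfolding seq_class_def
  by (rule equiv_class_eq[OF equiv_null_rel]) (use assms in \<open>simp add: null_rel_def\<close>)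

lemma null_relD:
  "(X, Y) \<in> null_rel \<nu> \<Longrightarrow> X \<in> cauchy_seqs \<nu> \<and> Y \<in> cauchy_seqs \<nu> \<and> (\<lambda>n. \<nu> (X n - Y n)) \<longlonglongrightarrow> 0"
  by (simp add: null_rel_def)

lemma completion_add:
  assumes "X \<in> cauchy_seqs \<nu>" "Y \<in> cauchy_seqs \<nu>"
  shows "seq_class \<nu> X \<oplus>\<^bsub>completion \<nu>\<^esub> seq_class \<nu> Y = seq_class \<nu> (\<lambda>n. X n + Y n)"
proof -
  have "congruent2 (null_rel \<nu>) (null_rel \<nu>) (\<lambda>X Y. seq_class \<nu> (\<lambda>n. X n + Y n))"
  proof (rule congruent2I')
    fix X X' Y Y' assume XY: "(X, X') \<in> null_rel \<nu>" "(Y, Y') \<in> null_rel \<nu>"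
    note D = null_relD[OF XY(1)] null_relD[OF XY(2)]
    show "seq_class \<nu> (\<lambda>n. X n + Y n) = seq_class \<nu> (\<lambda>n. X' n + Y' n)"
    proof (rule seq_class_eqI)
      show "(\<lambda>n. \<nu> (X n + Y n - (X' n + Y' n))) \<longlonglongrightarrow> 0"
      proof (rule Lim_null_comparison)
        show "\<forall>\<^sub>F n in sequentially. norm (\<nu> (X n + Y n - (X' n + Y' n))) \<le> \<nu> (X n - X' n) + \<nu> (Y n - Y' n)"
          using cs_triangle[OF \<nu>, of "X _ - X' _" "Y _ - Y' _"] by (simp add: cs algebra_simps)
        show "(\<lambda>n. \<nu> (X n - X' n) + \<nu> (Y n - Y' n)) \<longlonglongrightarrow> 0"
          using tendsto_add[of _ 0 _ _ 0] D by fastforce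
      qed
    qed (use D in \<open>auto intro: cauchy_intros\<close>)
  qed
  from UN_equiv_class2[OF equiv_null_rel equiv_null_rel this assms]
  show ?thesis by (simp add: completion_def seq_class_def)
qed

lemma completion_mult:
  assumes "X \<in> cauchy_seqs \<nu>" "Y \<in> cauchy_seqs \<nu>"
  shows "seq_class \<nu> X \<otimes>\<^bsub>completion \<nu>\<^esub> seq_class \<nu> Y = seq_class \<nu> (\<lambda>n. X n * Y n)"
proof -
  have "congruent2 (null_rel \<nu>) (null_rel \<nu>) (\<lambda>X Y. seq_class \<nu> (\<lambda>n. X n * Y n))"
  proof (rule congruent2I')
    fix X X' Y Y' assume XY: "(X, X') \<in> null_rel \<nu>" "(Y, Y') \<in> null_rel \<nu>"
    note D = null_relD[OF XY(1)] null_relD[OF XY(2)]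
    show "seq_class \<nu> (\<lambda>n. X n * Y n) = seq_class \<nu> (\<lambda>n. X' n * Y' n)"
    proof (rule seq_class_eqI)
      have "convergent (\<lambda>n. \<nu> (Y n))" "convergent (\<lambda>n. \<nu> (X' n))"
        using D cauchy_norm_convergent by auto
      then obtain a b where ab: "(\<lambda>n. \<nu> (Y n)) \<longlonglongrightarrow> a" "(\<lambda>n. \<nu> (X' n)) \<longlonglongrightarrow> b"
        by (auto simp: convergent_def)
      show "(\<lambda>n. \<nu> (X n * Y n - X' n * Y' n)) \<longlonglongrightarrow> 0"
      proof (rule Lim_null_comparison)
        show "\<forall>\<^sub>F n in sequentially. norm (\<nu> (X n * Y n - X' n * Y' n))
            \<le> \<nu> (X n - X' n) * \<nu> (Y n) + \<nu> (X' n) * \<nu> (Y n - Y' n)"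
          by (simp add: cs cs_mult_diff[OF \<nu>])
        show "(\<lambda>n. \<nu> (X n - X' n) * \<nu> (Y n) + \<nu> (X' n) * \<nu> (Y n - Y' n)) \<longlonglongrightarrow> 0"
          using tendsto_add[OF tendsto_mult[OF _ ab(1), of _ 0] tendsto_mult[OF ab(2), of _ 0]] D by simp
      qed
    qed (use D in \<open>auto intro: cauchy_intros\<close>)
  qed
  from UN_equiv_class2[OF equiv_null_rel equiv_null_rel this assms]
  show ?thesis by (simp add: completion_def seq_class_def)
qed

lemma completion_smult:
  assumes "X \<in> cauchy_seqs \<nu>"
  shows "c \<odot>\<^bsub>completion \<nu>\<^esub> seq_class \<nu> X = seq_class \<nu> (\<lambda>n. fscale c (X n))"
proof -
  have "congruent (null_rel \<nu>) (\<lambda>X. seq_class \<nu> (\<lambda>n. fscale c (X n)))"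
  proof (rule congruentI)
    fix X X' assume "(X, X') \<in> null_rel \<nu>"
    note D = null_relD[OF this]
    show "seq_class \<nu> (\<lambda>n. fscale c (X n)) = seq_class \<nu> (\<lambda>n. fscale c (X' n))"
      using D tendsto_mult_right_zero[of "\<lambda>n. \<nu> (X n - X' n)" _ "cmod c"]
      by (intro seq_class_eqI) (auto simp: fscale_def cs_scale[OF \<nu>] simp flip: right_diff_distrib
          intro: cauchy_intros)
  qed
  from UN_equiv_class[OF equiv_null_rel this assms]
  show ?thesis by (simp add: completion_def seq_class_def)
qed

lemma completion_adj:
  assumes "X \<in> cauchy_seqs \<nu>"
  shows "adj (completion \<nu>) (seq_class \<nu> X) = seq_class \<nu> (\<lambda>n. fadj (X n))"
proof -
  have "congruent (null_rel \<nu>) (\<lambda>X. seq_class \<nu> (\<lambda>n. fadj (X n)))"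
  proof (rule congruentI)
    fix X X' assume "(X, X') \<in> null_rel \<nu>"
    note D = null_relD[OF this]
    show "seq_class \<nu> (\<lambda>n. fadj (X n)) = seq_class \<nu> (\<lambda>n. fadj (X' n))"
      using D by (intro seq_class_eqI) (auto simp: cs_adj[OF \<nu>] simp flip: fadj_diff intro: cauchy_intros)
  qed
  from UN_equiv_class[OF equiv_null_rel this assms]
  show ?thesis by (simp add: completion_def seq_class_def)
qed

lemma completion_nrm:
  assumes X: "X \<in> cauchy_seqs \<nu>"
  shows "(\<lambda>n. \<nu> (X n)) \<longlonglongrightarrow> nrm (completion \<nu>) (seq_class \<nu> X)"
proof -
  define Y where "Y = (SOME Y. Y \<in> seq_class \<nu> X)"
  have "X \<in> seq_class \<nu> X"
    using equiv_class_self[OF equiv_null_rel X] by (simp add: seq_class_def)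
  then have "Y \<in> seq_class \<nu> X" unfolding Y_def by (rule someI[where P = "\<lambda>Y. Y \<in> seq_class \<nu> X"])
  then have "(X, Y) \<in> null_rel \<nu>" by (simp add: seq_class_def)
  note D = null_relD[OF this]
  have l: "(\<lambda>n. \<nu> (Y n)) \<longlonglongrightarrow> nrm (completion \<nu>) (seq_class \<nu> X)"
    using cauchy_norm_convergent[of Y] D by (simp add: completion_def convergent_LIMSEQ_iff Y_def)
  have "(\<lambda>n. \<nu> (X n) - \<nu> (Y n)) \<longlonglongrightarrow> 0"
    by (rule Lim_null_comparison[of _ "\<lambda>n. \<nu> (X n - Y n)"])
      (use D in \<open>simp_all add: cs_abs_diff[OF \<nu>]\<close>)
  from tendsto_add[OF this l] show ?thesis by simp
qed

lemma completion_carrier: "carrier (completion \<nu>) = seq_class \<nu> ` cauchy_seqs \<nu>"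
  by (auto simp: completion_def seq_class_def quotient_def)

lemma completion_one: "\<one>\<^bsub>completion \<nu>\<^esub> = seq_class \<nu> (\<lambda>n. 1)"
  and completion_zero: "\<zero>\<^bsub>completion \<nu>\<^esub> = seq_class \<nu> (\<lambda>n. 0)"
  by (simp_all add: completion_def)

lemmas completion_ops = completion_add completion_mult completion_smult completion_adj
  completion_one completion_zero

lemma completion_ring: "ring (completion \<nu>)"
proof (rule ringI)
  show "abelian_group (completion \<nu>)"
  proof (rule abelian_groupI)
    fix x assume "x \<in> carrier (completion \<nu>)"
    then obtain X where X: "X \<in> cauchy_seqs \<nu>" "x = seq_class \<nu> X" by (auto simp: completion_carrier)
    show "\<exists>y\<in>carrier (completion \<nu>). y \<oplus>\<^bsub>completion \<nu>\<^esub> x = \<zero>\<^bsub>completion \<nu>\<^esub>"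
      using X cauchy_diff[OF cauchy_const[of 0] X(1)]
      by (intro bexI[of _ "seq_class \<nu> (\<lambda>n. 0 - X n)"]) (auto simp: completion_ops completion_carrier)
  qed (auto simp: completion_carrier completion_ops cauchy_intros algebra_simps intro!: imageI)
  show "monoid (completion \<nu>)"
    by (rule monoidI) (auto simp: completion_carrier completion_ops cauchy_intros algebra_simps intro!: imageI)
qed (auto simp: completion_carrier completion_ops cauchy_intros algebra_simps)

lemma completion_minus:
  assumes "X \<in> cauchy_seqs \<nu>" "Y \<in> cauchy_seqs \<nu>"
  shows "seq_class \<nu> X \<ominus>\<^bsub>completion \<nu>\<^esub> seq_class \<nu> Y = seq_class \<nu> (\<lambda>n. X n - Y n)"
proof -
  interpret ring "completion \<nu>" by (rule completion_ring)
  have "\<ominus>\<^bsub>completion \<nu>\<^esub> seq_class \<nu> Y = seq_class \<nu> (\<lambda>n. 0 - Y n)"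
    using assms cauchy_diff[OF cauchy_const[of 0] assms(2)]
    by (intro minus_equality) (simp_all add: completion_carrier completion_ops)
  then show ?thesis using assms cauchy_diff[OF cauchy_const[of 0] assms(2)]
    by (simp add: a_minus_def completion_ops)
qed

lemma completion_nrm_triangle3:
  assumes "x \<in> carrier (completion \<nu>)" "y \<in> carrier (completion \<nu>)" "z \<in> carrier (completion \<nu>)"
  shows "nrm (completion \<nu>) (x \<ominus>\<^bsub>completion \<nu>\<^esub> z) \<le>
    nrm (completion \<nu>) (x \<ominus>\<^bsub>completion \<nu>\<^esub> y) + nrm (completion \<nu>) (y \<ominus>\<^bsub>completion \<nu>\<^esub> z)"
proof -
  obtain X Y Z where XYZ: "X \<in> cauchy_seqs \<nu>" "Y \<in> cauchy_seqs \<nu>" "Z \<in> cauchy_seqs \<nu>"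
    "x = seq_class \<nu> X" "y = seq_class \<nu> Y" "z = seq_class \<nu> Z"
    using assms by (auto simp: completion_carrier)
  have "\<nu> (X n - Z n) \<le> \<nu> (X n - Y n) + \<nu> (Y n - Z n)" for n by (rule cs_triangle3[OF \<nu>])
  then show ?thesis unfolding XYZ(4-6) using XYZ(1-3)
    by (auto simp: completion_minus intro!: LIMSEQ_le[OF completion_nrm tendsto_add[OF completion_nrm completion_nrm]] cauchy_intros)
qed

lemma completion_approx:
  assumes X: "X \<in> cauchy_seqs \<nu>"
  shows "(\<lambda>n. nrm (completion \<nu>) (cls \<nu> (X n) \<ominus>\<^bsub>completion \<nu>\<^esub> seq_class \<nu> X)) \<longlonglongrightarrow> 0"
proof (rule LIMSEQ_I)
  let ?A = "completion \<nu>"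
  fix e :: real assume e: "0 < e"
  obtain M where M: "\<And>m n. M \<le> m \<Longrightarrow> M \<le> n \<Longrightarrow> \<nu> (X m - X n) < e / 2"
    using cauchy_seqsD[OF X, of "e / 2"] e by (metis half_gt_zero)
  have "norm (nrm ?A (cls \<nu> (X n) \<ominus>\<^bsub>?A\<^esub> seq_class \<nu> X) - 0) < e" if "M \<le> n" for n
  proof -
    have c: "(\<lambda>m. X n - X m) \<in> cauchy_seqs \<nu>" by (intro cauchy_intros X)
    have "nrm ?A (seq_class \<nu> (\<lambda>m. X n - X m)) \<le> e / 2"
      by (rule LIMSEQ_le_const2[OF completion_nrm[OF c]]) (use M that in \<open>auto intro!: exI[of _ M] less_imp_le\<close>)
    moreover have "0 \<le> nrm ?A (seq_class \<nu> (\<lambda>m. X n - X m))"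
      by (rule LIMSEQ_le_const[OF completion_nrm[OF c]]) (simp add: cs)
    ultimately show ?thesis using e X by (simp add: cls_def completion_minus)
  qed
  then show "\<exists>no. \<forall>n\<ge>no. norm (nrm ?A (cls \<nu> (X n) \<ominus>\<^bsub>?A\<^esub> seq_class \<nu> X) - 0) < e" by blast
qed

lemma completion_complete:
  assumes X: "\<And>n. X n \<in> carrier (completion \<nu>)"
    and cauchy: "\<forall>e>0. \<exists>M. \<forall>m\<ge>M. \<forall>n\<ge>M. nrm (completion \<nu>) (X m \<ominus>\<^bsub>completion \<nu>\<^esub> X n) < e"
  shows "\<exists>x\<in>carrier (completion \<nu>). (\<lambda>n. nrm (completion \<nu>) (X n \<ominus>\<^bsub>completion \<nu>\<^esub> x)) \<longlonglongrightarrow> 0"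
proof -
  let ?A = "completion \<nu>"
  interpret ring ?A by (rule completion_ring)
  have "\<forall>n. \<exists>Y. Y \<in> cauchy_seqs \<nu> \<and> X n = seq_class \<nu> Y"
    using X by (auto simp: completion_carrier)
  then obtain Y where Y: "\<And>n. Y n \<in> cauchy_seqs \<nu>" "\<And>n. X n = seq_class \<nu> (Y n)" by metis
  have "\<exists>k. \<forall>m\<ge>k. \<nu> (Y n m - Y n k) \<le> 1 / Suc n" for n
  proof -
    obtain M where "\<And>m k. M \<le> m \<Longrightarrow> M \<le> k \<Longrightarrow> \<nu> (Y n m - Y n k) < 1 / Suc n"
      using cauchy_seqsD[OF Y(1)[of n], of "1 / Suc n"] by (metis divide_pos_pos zero_less_one of_nat_0_less_iff zero_less_Suc)
    then show ?thesis by (intro exI[of _ M]) (simp add: less_imp_le)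
  qed
  then obtain k where k: "\<And>n m. k n \<le> m \<Longrightarrow> \<nu> (Y n m - Y n (k n)) \<le> 1 / Suc n" by metis
  define p where "p n = Y n (k n)" for n
  have cp: "cls \<nu> q \<in> carrier ?A" for q by (auto simp: cls_def completion_carrier)
  have near: "nrm ?A (X n \<ominus>\<^bsub>?A\<^esub> cls \<nu> (p n)) \<le> 1 / Suc n" for n
    unfolding Y(2) cls_def completion_minus[OF Y(1) cauchy_const]
    by (rule LIMSEQ_le_const2[OF completion_nrm]) (use k in \<open>auto intro: cauchy_intros Y simp: p_def\<close>)
  have sw: "nrm ?A (x \<ominus>\<^bsub>?A\<^esub> y) = nrm ?A (y \<ominus>\<^bsub>?A\<^esub> x)" if xy: "x \<in> carrier ?A" "y \<in> carrier ?A" for x y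
  proof -
    obtain U V where UV: "U \<in> cauchy_seqs \<nu>" "V \<in> cauchy_seqs \<nu>" "x = seq_class \<nu> U" "y = seq_class \<nu> V"
      using xy by (auto simp: completion_carrier)
    show ?thesis unfolding UV(3,4) completion_minus[OF UV(1,2)] completion_minus[OF UV(2,1)]
      using completion_nrm[OF cauchy_diff[OF UV(1,2)]] completion_nrm[OF cauchy_diff[OF UV(2,1)]]
      by (simp add: cs_diff_commute[OF \<nu>, of "U _"] LIMSEQ_unique)
  qed
  have nc: "nrm ?A (cls \<nu> a \<ominus>\<^bsub>?A\<^esub> cls \<nu> b) = \<nu> (a - b)" for a b
    unfolding cls_def completion_minus[OF cauchy_const cauchy_const]
    using completion_nrm[OF cauchy_const[of "a - b"]] by (simp add: LIMSEQ_const_iff)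
  have p: "p \<in> cauchy_seqs \<nu>"
    unfolding cauchy_seqs_def
  proof (intro CollectI allI impI)
    fix e :: real assume e: "0 < e"
    obtain M where M: "\<forall>m\<ge>M. \<forall>n\<ge>M. nrm ?A (X m \<ominus>\<^bsub>?A\<^esub> X n) < e / 3"
      using cauchy e by (metis divide_pos_pos zero_less_numeral)
    obtain M' where M': "1 / Suc M' < e / 3"
      using e nat_approx_posE by (metis divide_pos_pos zero_less_numeral)
    have s: "1 / Suc n < e / 3" if "M' \<le> n" for n
    proof -
      have "1 / Suc n \<le> 1 / Suc M'" using that by (intro divide_left_mono) auto
      with M' show ?thesis by linarith
    qed
    show "\<exists>M. \<forall>m\<ge>M. \<forall>n\<ge>M. \<nu> (p m - p n) < e"
    proof (intro exI allI impI)
      fix m n assume mn: "max M M' \<le> m" "max M M' \<le> n"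
      have "\<nu> (p m - p n) \<le> nrm ?A (cls \<nu> (p m) \<ominus>\<^bsub>?A\<^esub> X m) + nrm ?A (X m \<ominus>\<^bsub>?A\<^esub> X n) + nrm ?A (X n \<ominus>\<^bsub>?A\<^esub> cls \<nu> (p n))"
        using completion_nrm_triangle3[OF cp[of "p m"] X[of m] cp[of "p n"]]
          completion_nrm_triangle3[OF X[of m] X[of n] cp[of "p n"]] by (simp add: nc)
      also have "\<dots> < e / 3 + e / 3 + e / 3"
        using near[of m] near[of n] s[of m] s[of n] M mn sw[OF cp[of "p m"] X[of m]] by (intro add_strict_mono) auto
      finally show "\<nu> (p m - p n) < e" by simp
    qed
  qed
  have lim: "(\<lambda>n. nrm ?A (cls \<nu> (p n) \<ominus>\<^bsub>?A\<^esub> seq_class \<nu> p)) \<longlonglongrightarrow> 0"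
    by (rule completion_approx[OF p])
  have nn: "0 \<le> nrm ?A (X n \<ominus>\<^bsub>?A\<^esub> seq_class \<nu> p)" for n
    unfolding Y(2) completion_minus[OF Y(1) p]
    by (rule LIMSEQ_le_const[OF completion_nrm[OF cauchy_diff[OF Y(1) p]]]) (simp add: cs)
  have sp: "seq_class \<nu> p \<in> carrier ?A" using p by (simp add: completion_carrier)
  have "(\<lambda>n. nrm ?A (X n \<ominus>\<^bsub>?A\<^esub> seq_class \<nu> p)) \<longlonglongrightarrow> 0"
  proof (rule Lim_null_comparison)
    show "(\<lambda>n. 1 / Suc n + nrm ?A (cls \<nu> (p n) \<ominus>\<^bsub>?A\<^esub> seq_class \<nu> p)) \<longlonglongrightarrow> 0"
      using tendsto_add[OF LIMSEQ_Suc[OF lim_1_over_n] lim] by simp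
    show "\<forall>\<^sub>F n in sequentially. norm (nrm ?A (X n \<ominus>\<^bsub>?A\<^esub> seq_class \<nu> p)) \<le> 1 / Suc n + nrm ?A (cls \<nu> (p n) \<ominus>\<^bsub>?A\<^esub> seq_class \<nu> p)"
    proof (intro always_eventually allI)
      fix n
      show "norm (nrm ?A (X n \<ominus>\<^bsub>?A\<^esub> seq_class \<nu> p)) \<le> 1 / Suc n + nrm ?A (cls \<nu> (p n) \<ominus>\<^bsub>?A\<^esub> seq_class \<nu> p)"
        using near[of n] completion_nrm_triangle3[OF X[of n] cp[of "p n"] sp] nn[of n] by simp
    qed
  qed
  then show ?thesis using p by (auto simp: completion_carrier)
qed

lemma cstar_algebra_completion: "cstar_algebra (completion \<nu>)"
proof -
  let ?A = "completion \<nu>"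
  interpret ring ?A by (rule completion_ring)
  show ?thesis
  proof unfold_locales
    fix x assume "x \<in> carrier ?A"
    then obtain X where X: "X \<in> cauchy_seqs \<nu>" "x = seq_class \<nu> X" by (auto simp: completion_carrier)
    note N = completion_nrm[OF X(1)]
    fix c d
    show "c \<odot>\<^bsub>?A\<^esub> x \<in> carrier ?A" using X by (simp add: completion_ops completion_carrier cauchy_intros)
    show "(c + d) \<odot>\<^bsub>?A\<^esub> x = c \<odot>\<^bsub>?A\<^esub> x \<oplus>\<^bsub>?A\<^esub> d \<odot>\<^bsub>?A\<^esub> x"
      using X by (simp add: completion_ops cauchy_intros) (simp add: fscale_def single_add distrib_right)
    show "(c * d) \<odot>\<^bsub>?A\<^esub> x = c \<odot>\<^bsub>?A\<^esub> (d \<odot>\<^bsub>?A\<^esub> x)"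
      using X by (simp add: completion_ops cauchy_intros) (simp add: fscale_def mult_single flip: mult.assoc)
    show "1 \<odot>\<^bsub>?A\<^esub> x = x" using X by (simp add: completion_ops fscale_def)
    show "adj ?A x \<in> carrier ?A" using X by (simp add: completion_ops completion_carrier cauchy_intros)
    show "adj ?A (adj ?A x) = x" using X by (simp add: completion_ops cauchy_intros)
    show "adj ?A (c \<odot>\<^bsub>?A\<^esub> x) = cnj c \<odot>\<^bsub>?A\<^esub> adj ?A x"
      using X by (simp add: completion_ops cauchy_intros fadj_fscale)
    show "nrm ?A x = 0 \<longleftrightarrow> x = \<zero>\<^bsub>?A\<^esub>"
    proof
      assume "nrm ?A x = 0"
      then show "x = \<zero>\<^bsub>?A\<^esub>" unfolding X(2) completion_zero using N X by (intro seq_class_eqI) auto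
    next
      assume x0: "x = \<zero>\<^bsub>?A\<^esub>"
      show "nrm ?A x = 0"
        unfolding x0 completion_zero
        using completion_nrm[OF cauchy_const[of 0]] by (simp add: cs_zero[OF \<nu>] LIMSEQ_const_iff)
    qed
    have "(\<lambda>n. \<nu> (fscale c (X n))) \<longlonglongrightarrow> cmod c * nrm ?A x"
      unfolding fscale_def cs_scale[OF \<nu>] X(2) by (intro tendsto_intros N)
    then show "nrm ?A (c \<odot>\<^bsub>?A\<^esub> x) = cmod c * nrm ?A x"
      using completion_nrm[OF cauchy_fscale[OF X(1), of c]] X by (simp add: completion_ops LIMSEQ_unique)
    have "(\<lambda>n. \<nu> (fadj (X n) * X n)) \<longlonglongrightarrow> (nrm ?A x)\<^sup>2"
      unfolding cs_star[OF \<nu>] X(2) by (intro tendsto_intros N)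
    moreover have "(\<lambda>n. fadj (X n) * X n) \<in> cauchy_seqs \<nu>" using X by (intro cauchy_intros)
    ultimately show "nrm ?A (adj ?A x \<otimes>\<^bsub>?A\<^esub> x) = (nrm ?A x)\<^sup>2"
      using completion_nrm[of "\<lambda>n. fadj (X n) * X n"] X by (simp add: completion_ops LIMSEQ_unique cauchy_intros)
    fix y assume "y \<in> carrier ?A"
    then obtain Y where Y: "Y \<in> cauchy_seqs \<nu>" "y = seq_class \<nu> Y" by (auto simp: completion_carrier)
    note M = completion_nrm[OF Y(1)]
    show "c \<odot>\<^bsub>?A\<^esub> (x \<oplus>\<^bsub>?A\<^esub> y) = c \<odot>\<^bsub>?A\<^esub> x \<oplus>\<^bsub>?A\<^esub> c \<odot>\<^bsub>?A\<^esub> y"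
      using X Y by (simp add: completion_ops cauchy_intros) (simp add: fscale_def distrib_left)
    show "(c \<odot>\<^bsub>?A\<^esub> x) \<otimes>\<^bsub>?A\<^esub> y = c \<odot>\<^bsub>?A\<^esub> (x \<otimes>\<^bsub>?A\<^esub> y)"
      using X Y by (simp add: completion_ops cauchy_intros) (simp add: fscale_def mult.assoc)
    show "x \<otimes>\<^bsub>?A\<^esub> (c \<odot>\<^bsub>?A\<^esub> y) = c \<odot>\<^bsub>?A\<^esub> (x \<otimes>\<^bsub>?A\<^esub> y)"
      using X Y by (simp add: completion_ops cauchy_intros)
        (simp add: fscale_def fconst_commute[of c "X _"] flip: mult.assoc)
    show "adj ?A (x \<oplus>\<^bsub>?A\<^esub> y) = adj ?A x \<oplus>\<^bsub>?A\<^esub> adj ?A y"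
      using X Y by (simp add: completion_ops cauchy_intros fadj_add)
    show "adj ?A (x \<otimes>\<^bsub>?A\<^esub> y) = adj ?A y \<otimes>\<^bsub>?A\<^esub> adj ?A x"
      using X Y by (simp add: completion_ops cauchy_intros fadj_mult)
    show "nrm ?A (x \<oplus>\<^bsub>?A\<^esub> y) \<le> nrm ?A x + nrm ?A y"
      unfolding X(2) Y(2) completion_add[OF X(1) Y(1)]
      by (rule LIMSEQ_le[OF completion_nrm[OF cauchy_add[OF X(1) Y(1)]] tendsto_add[OF N M]])
        (simp add: cs)
    show "nrm ?A (x \<otimes>\<^bsub>?A\<^esub> y) \<le> nrm ?A x * nrm ?A y"
      unfolding X(2) Y(2) completion_mult[OF X(1) Y(1)]
      by (rule LIMSEQ_le[OF completion_nrm[OF cauchy_mult[OF X(1) Y(1)]] tendsto_mult[OF N M]])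
        (simp add: cs_mult[OF \<nu>])
  qed (use completion_complete in blast)
qed

lemma free_hom_cls: "free_hom (completion \<nu>) (cls \<nu>)"
  unfolding free_hom_def cls_def
  by (auto simp: completion_ops completion_carrier fscale_def)

lemma nrm_cls: "nrm (completion \<nu>) (cls \<nu> p) = \<nu> p"
  unfolding cls_def using completion_nrm[OF cauchy_const[of p]] by (simp add: LIMSEQ_const_iff)

lemma completion_dense:
  assumes "x \<in> carrier (completion \<nu>)" "0 < e"
  obtains p where "nrm (completion \<nu>) (x \<ominus>\<^bsub>completion \<nu>\<^esub> cls \<nu> p) < e"
proof -
  interpret cstar_algebra "completion \<nu>" by (rule cstar_algebra_completion)
  obtain X where X: "X \<in> cauchy_seqs \<nu>" "x = seq_class \<nu> X" using assms by (auto simp: completion_carrier)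
  obtain n where "norm (nrm (completion \<nu>) (cls \<nu> (X n) \<ominus>\<^bsub>completion \<nu>\<^esub> x) - 0) < e"
    using LIMSEQ_D[OF completion_approx[OF X(1)] assms(2)] X(2) by blast
  then show ?thesis using that[of "X n"] assms(1) free_hom_cls
    by (simp add: nrm_minus_commute[of x] free_hom_def)
qed

end

section \<open>Universal C*-algebras\<close>

text \<open>The relators \<open>R\<close> bound each generator uniformly over all C*-seminorms that kill them; this
  is what makes the universal C*-algebra exist.\<close>

definition bounds_generators :: "'g free_star set \<Rightarrow> bool" where
  "bounds_generators R \<longleftrightarrow>
     (\<forall>g. \<exists>B. \<forall>\<nu>. cstar_seminorm \<nu> \<and> (\<forall>r\<in>R. \<nu> r = 0) \<longrightarrow> \<nu> (fgen g) \<le> B)"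

context
  fixes R :: "'g free_star set"
  assumes R: "bounds_generators R"
begin

lemma bounds_all: "\<exists>B\<ge>0. \<forall>\<nu>. cstar_seminorm \<nu> \<and> (\<forall>r\<in>R. \<nu> r = 0) \<longrightarrow> \<nu> p \<le> B"
proof (induction p rule: free_star_induct)
  case (const c)
  have "\<nu> (fconst c) \<le> cmod c" if "cstar_seminorm \<nu>" for \<nu> :: "'g free_star \<Rightarrow> real"
    using cs_const[OF that, of c] cs_one[OF that] by auto
  then show ?case by (intro exI[of _ "cmod c"]) simp
next
  case (gen g)
  obtain B where "\<forall>\<nu>. cstar_seminorm \<nu> \<and> (\<forall>r\<in>R. \<nu> r = 0) \<longrightarrow> \<nu> (fgen g) \<le> B"
    using R unfolding bounds_generators_def by blast
  then show ?case by (intro exI[of _ "max 0 B"]) (simp add: max.coboundedI2)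
next
  case (adj g)
  obtain B where "\<forall>\<nu>. cstar_seminorm \<nu> \<and> (\<forall>r\<in>R. \<nu> r = 0) \<longrightarrow> \<nu> (fgen g) \<le> B"
    using R unfolding bounds_generators_def by blast
  then show ?case by (intro exI[of _ "max 0 B"]) (simp add: max.coboundedI2 cs_adj)
next
  case (add p q)
  then obtain B C where "0 \<le> B" "0 \<le> C"
    "\<forall>\<nu>. cstar_seminorm \<nu> \<and> (\<forall>r\<in>R. \<nu> r = 0) \<longrightarrow> \<nu> p \<le> B"
    "\<forall>\<nu>. cstar_seminorm \<nu> \<and> (\<forall>r\<in>R. \<nu> r = 0) \<longrightarrow> \<nu> q \<le> C" by blast
  then have "\<nu> (p + q) \<le> B + C" if "cstar_seminorm \<nu>" "\<forall>r\<in>R. \<nu> r = 0" for \<nu> :: "'g free_star \<Rightarrow> real"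
    using cs_triangle[OF that(1), of p q] that by (meson add_mono order_trans)
  with \<open>0 \<le> B\<close> \<open>0 \<le> C\<close> show ?case by (intro exI[of _ "B + C"]) auto
next
  case (mult p q)
  then obtain B C where BC: "0 \<le> B" "0 \<le> C"
    "\<forall>\<nu>. cstar_seminorm \<nu> \<and> (\<forall>r\<in>R. \<nu> r = 0) \<longrightarrow> \<nu> p \<le> B"
    "\<forall>\<nu>. cstar_seminorm \<nu> \<and> (\<forall>r\<in>R. \<nu> r = 0) \<longrightarrow> \<nu> q \<le> C" by blast
  show ?case
  proof (intro exI[of _ "B * C"] conjI allI impI)
    fix \<nu> :: "'g free_star \<Rightarrow> real" assume \<nu>: "cstar_seminorm \<nu> \<and> (\<forall>r\<in>R. \<nu> r = 0)"
    then have "\<nu> p * \<nu> q \<le> B * C" using BC cs_nonneg by (intro mult_mono) auto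
    then show "\<nu> (p * q) \<le> B * C" using cs_mult[of \<nu> p q] \<nu> by linarith
  qed (use BC in simp)
qed

lemma universal_upper:
  assumes "cstar_seminorm \<nu>" "\<And>r. r \<in> R \<Longrightarrow> \<nu> r = 0"
  shows "\<nu> p \<le> universal_seminorm R p"
proof -
  have "bdd_above ((\<lambda>\<nu>. \<nu> p) ` {\<nu>. cstar_seminorm \<nu> \<and> (\<forall>r\<in>R. \<nu> r = 0)})"
    using bounds_all[of p] unfolding bdd_above_def by blast
  then show ?thesis unfolding universal_seminorm_def
    by (rule cSUP_upper[rotated]) (use assms in auto)
qed

lemma universal_least:
  assumes "\<And>\<nu>. cstar_seminorm \<nu> \<Longrightarrow> (\<And>r. r \<in> R \<Longrightarrow> \<nu> r = 0) \<Longrightarrow> \<nu> p \<le> B"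
  shows "universal_seminorm R p \<le> B"
proof -
  have "cstar_seminorm (\<lambda>_::'g free_star. 0)" by (simp add: cstar_seminorm_def)
  then show ?thesis unfolding universal_seminorm_def
    by (intro cSUP_least) (use assms in auto)
qed

lemma universal_nonneg: "0 \<le> universal_seminorm R p"
proof -
  have "cstar_seminorm (\<lambda>_::'g free_star. 0)" by (simp add: cstar_seminorm_def)
  from universal_upper[OF this] show ?thesis by simp
qed

lemma universal_vanishes: "r \<in> R \<Longrightarrow> universal_seminorm R r = 0"
  using universal_least[of r 0] universal_nonneg[of r] by simp

lemma cstar_seminorm_universal: "cstar_seminorm (universal_seminorm R)"
  unfolding cstar_seminorm_def
proof (intro conjI allI)
  let ?U = "universal_seminorm R"
  fix p q c
  show "?U (p + q) \<le> ?U p + ?U q"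
    by (rule universal_least) (meson add_mono cs_triangle order_trans universal_upper)
  show "?U (p * q) \<le> ?U p * ?U q"
    by (rule universal_least)
      (meson cs_mult cs_nonneg mult_mono order_trans universal_nonneg universal_upper)
  have le: "?U (fscale d p) \<le> cmod d * ?U p" for d p
    by (rule universal_least) (simp add: fscale_eq cs_scale mult_left_mono universal_upper)
  show "?U (fscale c p) = cmod c * ?U p"
  proof (cases "c = 0")
    case True
    then show ?thesis using le[of 0 p] universal_nonneg[of "fscale 0 p"] by simp
  next
    case False
    have "fscale (inverse c) (fscale c p) = p"
      using False by (simp add: fscale_def mult_single flip: mult.assoc)
    then have "cmod c * ?U p \<le> ?U (fscale c p)"
      using le[of "inverse c" "fscale c p"] False by (simp add: norm_inverse norm_divide field_simps)
    with le[of c p] show ?thesis by simp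
  qed
  show "?U (fadj p * p) = (?U p)\<^sup>2"
  proof (rule antisym)
    show "?U (fadj p * p) \<le> (?U p)\<^sup>2"
      by (rule universal_least) (simp add: cs_star power_mono cs_nonneg universal_upper)
    have "?U p \<le> sqrt (?U (fadj p * p))"
    proof (rule universal_least)
      fix \<nu> :: "'g free_star \<Rightarrow> real" assume \<nu>: "cstar_seminorm \<nu>" "\<And>r. r \<in> R \<Longrightarrow> \<nu> r = 0"
      have "(\<nu> p)\<^sup>2 \<le> ?U (fadj p * p)"
        using universal_upper[of \<nu>, OF \<nu>, of "fadj p * p"] cs_star[OF \<nu>(1)] by simp
      then show "\<nu> p \<le> sqrt (?U (fadj p * p))" by (simp add: real_le_rsqrt)
    qed
    from power_mono[OF this universal_nonneg, of 2]
    show "(?U p)\<^sup>2 \<le> ?U (fadj p * p)" using universal_nonneg[of "fadj p * p"] by simp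
  qed
qed

end

section \<open>Homomorphisms\<close>

lemma cstar_homD:
  assumes "f \<in> cstar_hom A B"
  shows "x \<in> carrier A \<Longrightarrow> f x \<in> carrier B"
    and "x \<in> carrier A \<Longrightarrow> y \<in> carrier A \<Longrightarrow> f (x \<oplus>\<^bsub>A\<^esub> y) = f x \<oplus>\<^bsub>B\<^esub> f y"
    and "x \<in> carrier A \<Longrightarrow> y \<in> carrier A \<Longrightarrow> f (x \<otimes>\<^bsub>A\<^esub> y) = f x \<otimes>\<^bsub>B\<^esub> f y"
    and "f \<one>\<^bsub>A\<^esub> = \<one>\<^bsub>B\<^esub>"
    and "x \<in> carrier A \<Longrightarrow> f (c \<odot>\<^bsub>A\<^esub> x) = c \<odot>\<^bsub>B\<^esub> f x"
    and "x \<in> carrier A \<Longrightarrow> f (adj A x) = adj B (f x)"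
  using assms unfolding cstar_hom_def ring_hom_def by blast+

lemma cstar_homI:
  assumes "\<And>x. x \<in> carrier A \<Longrightarrow> f x \<in> carrier B"
    and "\<And>x y. x \<in> carrier A \<Longrightarrow> y \<in> carrier A \<Longrightarrow> f (x \<oplus>\<^bsub>A\<^esub> y) = f x \<oplus>\<^bsub>B\<^esub> f y"
    and "\<And>x y. x \<in> carrier A \<Longrightarrow> y \<in> carrier A \<Longrightarrow> f (x \<otimes>\<^bsub>A\<^esub> y) = f x \<otimes>\<^bsub>B\<^esub> f y"
    and "f \<one>\<^bsub>A\<^esub> = \<one>\<^bsub>B\<^esub>"
    and "\<And>c x. x \<in> carrier A \<Longrightarrow> f (c \<odot>\<^bsub>A\<^esub> x) = c \<odot>\<^bsub>B\<^esub> f x"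
    and "\<And>x. x \<in> carrier A \<Longrightarrow> f (adj A x) = adj B (f x)"
  shows "f \<in> cstar_hom A B"
  using assms unfolding cstar_hom_def ring_hom_def by blast

lemma cstar_hom_comp:
  assumes "f \<in> cstar_hom A B" "g \<in> cstar_hom B C" shows "(\<lambda>x. g (f x)) \<in> cstar_hom A C"
  by (rule cstar_homI) (simp_all add: cstar_homD[OF assms(1)] cstar_homD[OF assms(2)])

lemma cstar_hom_id: "(\<lambda>x. x) \<in> cstar_hom A A"
  by (rule cstar_homI) simp_all

lemma cstar_hom_free_hom:
  assumes "f \<in> cstar_hom A B" "free_hom A e" "cstar_algebra A"
  shows "free_hom B (\<lambda>p. f (e p))"
proof -
  have "\<one>\<^bsub>A\<^esub> \<in> carrier A" using assms(3) by (simp add: cstar_algebra_def ring.ring_simprules)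
  then show ?thesis using assms(2) by (simp add: free_hom_def cstar_homD[OF assms(1)])
qed

lemma cstar_hom_minus_zero:
  assumes "f \<in> cstar_hom A B" "cstar_algebra A" "cstar_algebra B"
  shows "f \<zero>\<^bsub>A\<^esub> = \<zero>\<^bsub>B\<^esub>"
    and "x \<in> carrier A \<Longrightarrow> y \<in> carrier A \<Longrightarrow> f (x \<ominus>\<^bsub>A\<^esub> y) = f x \<ominus>\<^bsub>B\<^esub> f y"
proof -
  interpret A: cstar_algebra A by fact
  interpret B: cstar_algebra B by fact
  note h = cstar_homD[OF assms(1)]
  have "f \<zero>\<^bsub>A\<^esub> = f (0 \<odot>\<^bsub>A\<^esub> \<zero>\<^bsub>A\<^esub>)" by (simp add: A.smult_zero_right)
  also have "\<dots> = \<zero>\<^bsub>B\<^esub>" by (simp only: h A.zero_closed B.smult_zero_left)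
  finally show "f \<zero>\<^bsub>A\<^esub> = \<zero>\<^bsub>B\<^esub>" .
  show "f (x \<ominus>\<^bsub>A\<^esub> y) = f x \<ominus>\<^bsub>B\<^esub> f y" if xy: "x \<in> carrier A" "y \<in> carrier A"
  proof -
    have "f (x \<ominus>\<^bsub>A\<^esub> y) = f (x \<oplus>\<^bsub>A\<^esub> (-1) \<odot>\<^bsub>A\<^esub> y)"
      using xy by (simp only: A.smult_minus_one a_minus_def)
    also have "\<dots> = f x \<oplus>\<^bsub>B\<^esub> (-1) \<odot>\<^bsub>B\<^esub> f y"
      using xy by (simp only: h A.smult_closed)
    finally show ?thesis using xy by (simp only: h B.smult_minus_one a_minus_def)
  qed
qed

lemma cstar_hom_finsum:
  assumes "f \<in> cstar_hom A B" "cstar_algebra A" "cstar_algebra B" "\<And>i. i \<in> I \<Longrightarrow> x i \<in> carrier A"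
  shows "f (\<Oplus>\<^bsub>A\<^esub>i\<in>I. x i) = (\<Oplus>\<^bsub>B\<^esub>i\<in>I. f (x i))"
proof -
  interpret A: cstar_algebra A by fact
  interpret B: cstar_algebra B by fact
  note h = cstar_homD[OF assms(1)]
  show ?thesis using assms(4)
    by (induction I rule: infinite_finite_induct)
      (simp_all add: cstar_hom_minus_zero[OF assms(1-3)] A.finsum_insert B.finsum_insert h Pi_iff
        A.finsum_infinite B.finsum_infinite)
qed

lemma cstar_hom_eval:
  assumes f: "f \<in> cstar_hom A B" and A: "cstar_algebra A" and B: "cstar_algebra B"
    and h: "\<And>g. h g \<in> carrier A"
  shows "f (eval A h p) = eval B (\<lambda>g. f (h g)) p"
proof (rule free_hom_eqI)
  show "free_hom B (\<lambda>p. f (eval A h p))"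
    by (rule cstar_hom_free_hom[OF f cstar_algebra.free_hom_eval[OF A, where h = h, OF h] A])
  show "free_hom B (eval B (\<lambda>g. f (h g)))"
    by (rule cstar_algebra.free_hom_eval[OF B]) (simp add: cstar_homD[OF f] h)
  show "f (eval A h (fgen g)) = eval B (\<lambda>g. f (h g)) (fgen g)" for g
    using cstar_algebra.eval_fgen[OF A, where h = h, OF h] cstar_algebra.eval_fgen[OF B, of "\<lambda>g. f (h g)"]
    by (simp add: cstar_homD[OF f] h)
qed

text \<open>Contractive *-homomorphisms extend from the dense image of the free *-algebra by continuity.\<close>

lemma completion_extend:
  assumes \<nu>: "cstar_seminorm \<nu>" and A: "cstar_algebra A" and e: "free_hom A e"
    and le: "\<And>p. nrm A (e p) \<le> \<nu> p"
  obtains f where "f \<in> cstar_hom (completion \<nu>) A" "\<And>p. f (cls \<nu> p) = e p"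
proof -
  interpret A: cstar_algebra A by (rule A)
  interpret K: cstar_algebra "completion \<nu>" by (rule cstar_algebra_completion[OF \<nu>])
  let ?lim = "\<lambda>X y. y \<in> carrier A \<and> (\<lambda>n. nrm A (e (X n) \<ominus>\<^bsub>A\<^esub> y)) \<longlonglongrightarrow> 0"
  note ec = A.fh_closed[OF e] note em = A.fh_minus[OF e, symmetric]
  have ex: "\<exists>y. ?lim X y" if X: "X \<in> cauchy_seqs \<nu>" for X
  proof -
    have "\<exists>y\<in>carrier A. (\<lambda>n. nrm A (e (X n) \<ominus>\<^bsub>A\<^esub> y)) \<longlonglongrightarrow> 0"
    proof (rule A.complete)
      show "\<forall>\<epsilon>>0. \<exists>M. \<forall>m\<ge>M. \<forall>n\<ge>M. nrm A (e (X m) \<ominus>\<^bsub>A\<^esub> e (X n)) < \<epsilon>"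
      proof (intro allI impI)
        fix \<epsilon> :: real assume "0 < \<epsilon>"
        then obtain M where M: "\<And>m n. M \<le> m \<Longrightarrow> M \<le> n \<Longrightarrow> \<nu> (X m - X n) < \<epsilon>"
          using cauchy_seqsD[OF \<nu> X, of \<epsilon>] by metis
        show "\<exists>M. \<forall>m\<ge>M. \<forall>n\<ge>M. nrm A (e (X m) \<ominus>\<^bsub>A\<^esub> e (X n)) < \<epsilon>"
          by (intro exI[of _ M] allI impI, unfold em) (rule order_le_less_trans[OF le M])
      qed
    qed (simp add: ec)
    then show ?thesis by blast
  qed
  have uniq: "y = z" if "?lim X y" "?lim Y z" "X \<in> cauchy_seqs \<nu>" "Y \<in> cauchy_seqs \<nu>"
    "seq_class \<nu> X = seq_class \<nu> Y" for X Y y z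
  proof -
    have "(X, Y) \<in> null_rel \<nu>"
      using that(3-5) equiv_null_rel[OF \<nu>] unfolding seq_class_def by (simp add: eq_equiv_class_iff)
    then have "(\<lambda>n. \<nu> (Y n - X n)) \<longlonglongrightarrow> 0" by (simp add: null_rel_def cs_diff_commute[OF \<nu>])
    then have "(\<lambda>n. \<nu> (Y n - X n) + nrm A (e (X n) \<ominus>\<^bsub>A\<^esub> y)) \<longlonglongrightarrow> 0" using tendsto_add that(1) by fastforce
    then have "(\<lambda>n. nrm A (e (Y n) \<ominus>\<^bsub>A\<^esub> y)) \<longlonglongrightarrow> 0"
    proof (rule Lim_null_comparison[rotated], intro always_eventually allI)
      fix n
      show "norm (nrm A (e (Y n) \<ominus>\<^bsub>A\<^esub> y)) \<le> \<nu> (Y n - X n) + nrm A (e (X n) \<ominus>\<^bsub>A\<^esub> y)"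
        using A.nrm_triangle3[of "e (Y n)" "e (X n)" y] le[of "Y n - X n"] that(1)
        by (simp add: ec em A.nrm_nonneg)
    qed
    with that(1,2) show ?thesis by (intro A.lim_unique[of "\<lambda>n. e (Y n)" y z]) (simp_all add: ec)
  qed
  define f where "f x = (SOME y. \<exists>X\<in>cauchy_seqs \<nu>. x = seq_class \<nu> X \<and> ?lim X y)" for x
  have f: "?lim X (f (seq_class \<nu> X))" if X: "X \<in> cauchy_seqs \<nu>" for X
  proof -
    obtain y where y: "?lim X y" using ex[OF X] by blast
    have "\<exists>Y\<in>cauchy_seqs \<nu>. seq_class \<nu> X = seq_class \<nu> Y \<and> ?lim Y y"
      using y X by (intro bexI[of _ X]) simp_all
    then have "\<exists>Y\<in>cauchy_seqs \<nu>. seq_class \<nu> X = seq_class \<nu> Y \<and> ?lim Y (f (seq_class \<nu> X))"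
      unfolding f_def by (rule someI[where P = "\<lambda>y. \<exists>Y\<in>cauchy_seqs \<nu>. seq_class \<nu> X = seq_class \<nu> Y \<and> ?lim Y y"])
    then obtain Y where Y: "Y \<in> cauchy_seqs \<nu>" "seq_class \<nu> X = seq_class \<nu> Y" "?lim Y (f (seq_class \<nu> X))"
      by (elim bexE conjE) simp
    have "f (seq_class \<nu> X) = y" by (rule uniq[OF Y(3) y Y(1) X Y(2)[symmetric]])
    with y show ?thesis by simp
  qed
  have eqI: "f (seq_class \<nu> X) = y" if "X \<in> cauchy_seqs \<nu>" "?lim X y" for X y
    by (rule uniq[OF f[OF that(1)] that(2) that(1) that(1) refl])
  show ?thesis
  proof
    show "f (cls \<nu> p) = e p" for p
      unfolding cls_def using ec by (intro eqI cauchy_const[OF \<nu>]) (simp add: A.minus_eq A.r_neg A.nrm_zero)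
    show "f \<in> cstar_hom (completion \<nu>) A"
    proof (rule cstar_homI)
      fix x assume "x \<in> carrier (completion \<nu>)"
      then obtain X where X: "X \<in> cauchy_seqs \<nu>" "x = seq_class \<nu> X" by (auto simp: completion_carrier[OF \<nu>])
      note fX = f[OF X(1)]
      show "f x \<in> carrier A" using fX X by simp
      show "f (c \<odot>\<^bsub>completion \<nu>\<^esub> x) = c \<odot>\<^bsub>A\<^esub> f x" for c
        unfolding X(2) completion_smult[OF \<nu> X(1)] using fX A.lim_smult[of "\<lambda>n. e (X n)" "f (seq_class \<nu> X)" c]
        by (intro eqI cauchy_fscale[OF \<nu>] X) (simp add: A.fh_scale[OF e] A.smult_closed ec)
      show "f (adj (completion \<nu>) x) = adj A (f x)"
        unfolding X(2) completion_adj[OF \<nu> X(1)] using fX A.lim_adj[of "\<lambda>n. e (X n)" "f (seq_class \<nu> X)"]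
        by (intro eqI cauchy_adj[OF \<nu>] X) (simp add: A.fh_adj[OF e] A.adj_closed ec)
      fix y assume "y \<in> carrier (completion \<nu>)"
      then obtain Y where Y: "Y \<in> cauchy_seqs \<nu>" "y = seq_class \<nu> Y" by (auto simp: completion_carrier[OF \<nu>])
      note fY = f[OF Y(1)]
      show "f (x \<oplus>\<^bsub>completion \<nu>\<^esub> y) = f x \<oplus>\<^bsub>A\<^esub> f y"
        unfolding X(2) Y(2) completion_add[OF \<nu> X(1) Y(1)]
        using fX fY A.lim_add[of "\<lambda>n. e (X n)" "\<lambda>n. e (Y n)" "f (seq_class \<nu> X)" "f (seq_class \<nu> Y)"]
        by (intro eqI cauchy_add[OF \<nu>] X Y) (simp add: A.fh_add[OF e] ec)
      show "f (x \<otimes>\<^bsub>completion \<nu>\<^esub> y) = f x \<otimes>\<^bsub>A\<^esub> f y"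
        unfolding X(2) Y(2) completion_mult[OF \<nu> X(1) Y(1)]
        using fX fY A.lim_mult[of "\<lambda>n. e (X n)" "\<lambda>n. e (Y n)" "f (seq_class \<nu> X)" "f (seq_class \<nu> Y)"]
        by (intro eqI cauchy_mult[OF \<nu>] X Y) (simp add: A.fh_mult[OF e] ec)
    next
      show "f \<one>\<^bsub>completion \<nu>\<^esub> = \<one>\<^bsub>A\<^esub>"
        unfolding completion_one[OF \<nu>]
        by (intro eqI cauchy_const[OF \<nu>]) (simp add: A.fh_one[OF e] A.minus_eq A.r_neg A.nrm_zero)
    qed
  qed
qed

context
  fixes S :: "'g set" and R :: "'g free_star set"
  assumes SR: "bounds_generators (relators S R)"
begin

lemmas universal_cstar_seminorm = cstar_seminorm_universal[OF SR]

lemma cstar_algebra_universal: "cstar_algebra (universal_cstar S R)"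
  unfolding universal_cstar_def by (rule cstar_algebra_completion[OF universal_cstar_seminorm])

lemma ugen_eq: "ugen S R g = cls (universal_seminorm (relators S R)) (fgen g)"
  by (simp add: ugen_def cls_def)

lemma free_hom_universal: "free_hom (universal_cstar S R) (cls (universal_seminorm (relators S R)))"
  unfolding universal_cstar_def by (rule free_hom_cls[OF universal_cstar_seminorm])

lemma ugen_closed: "ugen S R g \<in> carrier (universal_cstar S R)"
  using free_hom_universal by (simp add: ugen_eq free_hom_def)

lemma cls_eq_eval: "cls (universal_seminorm (relators S R)) p = eval (universal_cstar S R) (ugen S R) p"
proof (rule free_hom_eqI[OF free_hom_universal])
  show "free_hom (universal_cstar S R) (eval (universal_cstar S R) (ugen S R))"
    by (rule cstar_algebra.free_hom_eval[OF cstar_algebra_universal ugen_closed])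
  show "cls (universal_seminorm (relators S R)) (fgen g) = eval (universal_cstar S R) (ugen S R) (fgen g)" for g
    using cstar_algebra.eval_fgen[OF cstar_algebra_universal, where h = "ugen S R", OF ugen_closed, of g]
    by (simp only: ugen_eq)
qed

lemma eval_ugen_eq_zero:
  assumes "r \<in> relators S R"
  shows "eval (universal_cstar S R) (ugen S R) r = \<zero>\<^bsub>universal_cstar S R\<^esub>"
proof -
  interpret cstar_algebra "universal_cstar S R" by (rule cstar_algebra_universal)
  have "nrm (universal_cstar S R) (cls (universal_seminorm (relators S R)) r) = 0"
    unfolding universal_cstar_def nrm_cls[OF universal_cstar_seminorm]
    by (rule universal_vanishes[OF SR assms])
  then show ?thesis
    unfolding cls_eq_eval[symmetric] using nrm_eq_zero[OF fh_closed[OF free_hom_universal]] by blast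
qed

lemma ugen_outside: "g \<notin> S \<Longrightarrow> ugen S R g = \<zero>\<^bsub>universal_cstar S R\<^esub>"
  using eval_ugen_eq_zero[of "fgen g"]
    cstar_algebra.eval_fgen[OF cstar_algebra_universal, where h = "ugen S R", OF ugen_closed, of g]
  by (simp add: relators_def)

text \<open>The universal property.\<close>

lemma universal_property:
  assumes A: "cstar_algebra A" and h: "\<And>g. h g \<in> carrier A"
    and rel: "\<And>r. r \<in> R \<Longrightarrow> eval A h r = \<zero>\<^bsub>A\<^esub>" and out: "\<And>g. g \<notin> S \<Longrightarrow> h g = \<zero>\<^bsub>A\<^esub>"
  obtains f where "f \<in> cstar_hom (universal_cstar S R) A" "\<And>g. f (ugen S R g) = h g"
proof -
  interpret A: cstar_algebra A by (rule A)
  have e: "free_hom A (eval A h)" by (rule A.free_hom_eval[OF h])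
  have "nrm A (eval A h p) \<le> universal_seminorm (relators S R) p" for p
  proof (rule universal_upper[OF SR A.cstar_seminorm_free_hom[OF e]])
    fix r assume "r \<in> relators S R"
    then consider "r \<in> R" | g where "g \<notin> S" "r = fgen g" by (auto simp: relators_def)
    then have "eval A h r = \<zero>\<^bsub>A\<^esub>"
      by cases (simp_all only: rel out A.eval_fgen[of h, OF h] not_False_eq_True)
    then show "nrm A (eval A h r) = 0" by (simp only: A.nrm_zero)
  qed
  from completion_extend[OF universal_cstar_seminorm A e this]
  obtain f where f: "f \<in> cstar_hom (completion (universal_seminorm (relators S R))) A"
    "\<And>p. f (cls (universal_seminorm (relators S R)) p) = eval A h p" by blast
  show ?thesis
  proof (rule that)
    show "f \<in> cstar_hom (universal_cstar S R) A" using f(1) by (simp only: universal_cstar_def)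
    show "f (ugen S R g) = h g" for g by (simp only: ugen_eq f(2) A.eval_fgen[of h, OF h])
  qed
qed

lemma closed_star_subalgebra_universal:
  assumes B: "closed_star_subalgebra B (universal_cstar S R)" and g: "\<And>g. g \<in> S \<Longrightarrow> ugen S R g \<in> B"
  shows "B = carrier (universal_cstar S R)"
proof
  let ?A = "universal_cstar S R" and ?\<nu> = "universal_seminorm (relators S R)"
  interpret A: cstar_algebra ?A by (rule cstar_algebra_universal)
  note fh = free_hom_universal
  have sr: "subring B ?A" and sm: "\<And>c x. x \<in> B \<Longrightarrow> c \<odot>\<^bsub>?A\<^esub> x \<in> B" and ad: "\<And>x. x \<in> B \<Longrightarrow> adj ?A x \<in> B"
    and cl: "\<And>X x. (\<And>n::nat. X n \<in> B) \<Longrightarrow> x \<in> carrier ?A \<Longrightarrow> (\<lambda>n. nrm ?A (X n \<ominus>\<^bsub>?A\<^esub> x)) \<longlonglongrightarrow> 0 \<Longrightarrow> x \<in> B"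
  proof -
    note B' = B[unfolded closed_star_subalgebra_def]
    show "subring B ?A" by (rule conjunct1[OF B'])
    show "c \<odot>\<^bsub>?A\<^esub> x \<in> B" if "x \<in> B" for c x using B' that by (elim conjE) (rule bspec, erule spec)
    show "adj ?A x \<in> B" if "x \<in> B" for x using B' that by (elim conjE) (erule bspec)
    show "x \<in> B" if "\<And>n::nat. X n \<in> B" "x \<in> carrier ?A" "(\<lambda>n. nrm ?A (X n \<ominus>\<^bsub>?A\<^esub> x)) \<longlonglongrightarrow> 0" for X x
      using conjunct2[OF conjunct2[OF conjunct2[OF B']], THEN spec, of X, THEN spec, of x] that by simp
  qed
  note srE = subringE[OF sr]
  show "B \<subseteq> carrier ?A" by (rule srE(1))
  have gB: "ugen S R g \<in> B" for g
  proof (cases "g \<in> S")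
    case False
    show ?thesis unfolding ugen_outside[OF False] by (rule srE(2))
  qed (rule g)
  have cB: "cls ?\<nu> p \<in> B" for p
  proof (induction p rule: free_star_induct)
    case (const c)
    show ?case unfolding A.fh_const[OF fh] by (rule sm[OF srE(3)])
  next
    case (gen g)
    show ?case by (rule gB[unfolded ugen_eq])
  next
    case (adj g)
    show ?case unfolding A.fh_adj[OF fh] by (rule ad[OF gB[unfolded ugen_eq]])
  next
    case (add p q)
    then show ?case unfolding A.fh_add[OF fh] by (rule srE(7))
  next
    case (mult p q)
    then show ?case unfolding A.fh_mult[OF fh] by (rule srE(6))
  qed
  show "carrier ?A \<subseteq> B"
  proof
    fix x assume x: "x \<in> carrier ?A"
    then obtain X where X: "X \<in> cauchy_seqs ?\<nu>" "x = seq_class ?\<nu> X"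
      by (auto simp: universal_cstar_def completion_carrier[OF universal_cstar_seminorm])
    have "(\<lambda>n. nrm ?A (cls ?\<nu> (X n) \<ominus>\<^bsub>?A\<^esub> x)) \<longlonglongrightarrow> 0"
      unfolding X(2) universal_cstar_def by (rule completion_approx[OF universal_cstar_seminorm X(1)])
    then show "x \<in> B" by (rule cl[OF cB x])
  qed
qed

end

section \<open>Characters of commutative C*-seminorms\<close>

lemma cstar_algebra_complex: "cstar_algebra complex_cstar"
proof -
  have "ring complex_cstar"
  proof (rule ringI)
    show "abelian_group complex_cstar"
    proof (rule abelian_groupI)
      fix x assume "x \<in> carrier complex_cstar"
      show "\<exists>y\<in>carrier complex_cstar. y \<oplus>\<^bsub>complex_cstar\<^esub> x = \<zero>\<^bsub>complex_cstar\<^esub>"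
        by (rule bexI[of _ "- x"]) (simp_all add: complex_cstar_def)
    qed (simp_all add: complex_cstar_def)
    show "monoid complex_cstar" by (rule monoidI) (simp_all add: complex_cstar_def)
  qed (simp_all add: complex_cstar_def algebra_simps)
  then interpret ring complex_cstar .
  have minus: "x \<ominus>\<^bsub>complex_cstar\<^esub> y = x - y" for x y
  proof -
    have "\<ominus>\<^bsub>complex_cstar\<^esub> y = - y"
      by (rule minus_equality) (simp_all add: complex_cstar_def)
    then show ?thesis by (simp add: a_minus_def) (simp add: complex_cstar_def)
  qed
  show ?thesis
  proof unfold_locales
    fix X :: "nat \<Rightarrow> complex"
    assume "\<forall>e>0. \<exists>M. \<forall>m\<ge>M. \<forall>n\<ge>M. nrm complex_cstar (X m \<ominus>\<^bsub>complex_cstar\<^esub> X n) < e"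
    then have "Cauchy X" unfolding minus by (simp add: Cauchy_def dist_norm complex_cstar_def)
    then obtain x where "X \<longlonglongrightarrow> x" using Cauchy_convergent convergent_def by blast
    then have "(\<lambda>n. cmod (X n - x)) \<longlonglongrightarrow> 0" using LIM_zero tendsto_norm_zero by blast
    then show "\<exists>x\<in>carrier complex_cstar. (\<lambda>n. nrm complex_cstar (X n \<ominus>\<^bsub>complex_cstar\<^esub> x)) \<longlonglongrightarrow> 0"
      unfolding minus by (intro bexI[of _ x]) (simp_all add: complex_cstar_def)
  qed (simp_all add: complex_cstar_def algebra_simps norm_triangle_ineq norm_mult power2_eq_square)
qed

text \<open>C*-seminorms whose completion is commutative.\<close>

definition commutative_seminorm :: "('g free_star \<Rightarrow> real) \<Rightarrow> bool" where
  "commutative_seminorm \<mu> \<longleftrightarrow> cstar_seminorm \<mu> \<and> (\<forall>x y. \<mu> (x * y - y * x) = 0)"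

text \<open>The localisation \<open>x \<mapsto> lim \<mu> (x z\<^sup>n)\<close> of a seminorm at a self-adjoint element of norm \<open>1\<close>: for
  the sup norm on a space, this is the sup norm on the subset where \<open>\<bar>z\<bar> = 1\<close>.\<close>

definition localize :: "('g free_star \<Rightarrow> real) \<Rightarrow> 'g free_star \<Rightarrow> 'g free_star \<Rightarrow> real" where
  "localize \<mu> z x = lim (\<lambda>n. \<mu> (x * z ^ n))"

context
  fixes \<mu> :: "'g free_star \<Rightarrow> real"
  assumes \<mu>: "commutative_seminorm \<mu>"
begin

lemma com_cs: "cstar_seminorm \<mu>" and com_null: "\<mu> (x * y - y * x) = 0"
  using \<mu> by (auto simp: commutative_seminorm_def)

lemma com_eq: "\<mu> (a * (x * y) * b) = \<mu> (a * (y * x) * b)"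
  using cs_null_mult[OF com_cs com_null, of a x y b]
  by (intro cs_eqI[OF com_cs]) (simp add: algebra_simps)

lemma com_localize:
  assumes z: "fadj z = z" "\<mu> z = 1"
  shows localize_lim: "(\<lambda>n. \<mu> (x * z ^ n)) \<longlonglongrightarrow> localize \<mu> z x"
    and localize_le: "localize \<mu> z x \<le> \<mu> (x * z ^ n)"
    and localize_one: "localize \<mu> z 1 = 1"
    and localize_cs: "cstar_seminorm (localize \<mu> z)"
    and localize_absorb: "(\<And>x. \<mu> (x * y) = \<mu> x) \<Longrightarrow> localize \<mu> z (x * y) = localize \<mu> z x"
proof -
  have dec: "decseq (\<lambda>n. \<mu> (x * z ^ n))" for x
    using cs_mult[OF com_cs, of "x * z ^ _" z] z
    by (intro decseq_SucI) (simp add: power_Suc2 mult.assoc del: power_Suc)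
  have conv: "(\<lambda>n. \<mu> (x * z ^ n)) \<longlonglongrightarrow> localize \<mu> z x" for x
  proof -
    obtain L where "(\<lambda>n. \<mu> (x * z ^ n)) \<longlonglongrightarrow> L"
      using decseq_convergent[OF dec, of 0] cs_nonneg[OF com_cs] by metis
    then show ?thesis by (simp add: localize_def limI)
  qed
  have conv2: "(\<lambda>n. \<mu> (x * z ^ (n + n))) \<longlonglongrightarrow> localize \<mu> z x" for x
    using LIMSEQ_subseq_LIMSEQ[OF conv, of "\<lambda>n. n + n"] by (simp add: strict_mono_def o_def)
  show "(\<lambda>n. \<mu> (x * z ^ n)) \<longlonglongrightarrow> localize \<mu> z x" by (rule conv)
  show "localize \<mu> z x \<le> \<mu> (x * z ^ n)" using decseq_ge[OF dec conv] .
  have star: "\<mu> (fadj x * x * z ^ (n + n)) = (\<mu> (x * z ^ n))\<^sup>2" for x n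
  proof -
    have "(\<mu> (x * z ^ n))\<^sup>2 = \<mu> (1 * (z ^ n * (fadj x * x)) * z ^ n)"
      using z by (simp add: fadj_mult fadj_power mult.assoc flip: cs_star[OF com_cs])
    also have "\<dots> = \<mu> (1 * ((fadj x * x) * z ^ n) * z ^ n)" by (rule com_eq)
    finally show ?thesis by (simp add: power_add mult.assoc)
  qed
  have one: "\<mu> 1 = 1"
    using cs_one[OF com_cs] cs_mult[OF com_cs, of z 1] z cs_nonneg[OF com_cs, of 1] by auto
  have "\<mu> (1 * z ^ (2 ^ k)) = 1" for k
  proof (induction k)
    case (Suc k)
    have "\<mu> (1 * z ^ (2 ^ k + 2 ^ k)) = (\<mu> (1 * z ^ (2 ^ k)))\<^sup>2" using star[of 1 "2 ^ k"] by simp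
    then show ?case using Suc by (simp add: mult_2)
  qed (use z in simp)
  moreover have "(\<lambda>k. \<mu> (1 * z ^ (2 ^ k))) \<longlonglongrightarrow> localize \<mu> z 1"
    using LIMSEQ_subseq_LIMSEQ[OF conv[of 1], of "\<lambda>k. 2 ^ k"] by (simp add: strict_mono_def o_def)
  ultimately show "localize \<mu> z 1 = 1" by (simp add: LIMSEQ_const_iff)
  show "localize \<mu> z (x * y) = localize \<mu> z x" if "\<And>x. \<mu> (x * y) = \<mu> x"
  proof -
    have "\<mu> (x * y * z ^ n) = \<mu> (x * z ^ n)" for n
      using com_eq[of x y "z ^ n" 1] that[of "x * z ^ n"] by (simp add: mult.assoc)
    then show ?thesis using conv[of "x * y"] conv[of x] LIMSEQ_unique by simp
  qed
  show "cstar_seminorm (localize \<mu> z)"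
    unfolding cstar_seminorm_def
  proof (intro conjI allI)
    fix p q c
    show "localize \<mu> z (p + q) \<le> localize \<mu> z p + localize \<mu> z q"
      by (rule LIMSEQ_le[OF conv tendsto_add[OF conv conv]])
        (simp add: distrib_right cs_triangle[OF com_cs])
    have "(\<lambda>n. \<mu> (fscale c p * z ^ n)) \<longlonglongrightarrow> cmod c * localize \<mu> z p"
      unfolding fscale_def mult.assoc cs_scale[OF com_cs] by (intro tendsto_intros conv)
    then show "localize \<mu> z (fscale c p) = cmod c * localize \<mu> z p" using conv LIMSEQ_unique by blast
    have "\<mu> (p * q * z ^ (n + n)) \<le> \<mu> (p * z ^ n) * \<mu> (q * z ^ n)" for n
      using com_eq[of p q "z ^ n" "z ^ n"] cs_mult[OF com_cs, of "p * z ^ n" "q * z ^ n"]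
      by (simp add: power_add mult.assoc)
    then show "localize \<mu> z (p * q) \<le> localize \<mu> z p * localize \<mu> z q"
      by (intro LIMSEQ_le[OF conv2 tendsto_mult[OF conv conv]]) simp
    have "(\<lambda>n. \<mu> (fadj p * p * z ^ (n + n))) \<longlonglongrightarrow> (localize \<mu> z p)\<^sup>2"
      unfolding star by (intro tendsto_intros conv)
    then show "localize \<mu> z (fadj p * p) = (localize \<mu> z p)\<^sup>2" using conv2 LIMSEQ_unique by blast
  qed
qed

lemma localize_commutative:
  assumes "fadj z = z" "\<mu> z = 1"
  shows "commutative_seminorm (localize \<mu> z)"
proof -
  note L = com_localize[OF assms]
  have "localize \<mu> z (x * y - y * x) = 0" for x y
    using L(2)[of "x * y - y * x" 0] com_null[of x y] cs_nonneg[OF L(4), of "x * y - y * x"] by simp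
  then show ?thesis using L(4) by (simp add: commutative_seminorm_def)
qed

text \<open>A seminorm that coincides with all its localisations is multiplicative.\<close>

lemma localize_invariant_multiplicative:
  assumes inv: "\<And>z x. fadj z = z \<Longrightarrow> \<mu> z = 1 \<Longrightarrow> localize \<mu> z x = \<mu> x"
  shows "\<mu> (x * w) = \<mu> x * \<mu> w"
proof -
  have unit: "\<mu> (x * z) = \<mu> x" if "fadj z = z" "\<mu> z = 1" for x z
    using inv[OF that, of x] localize_le[OF that, of x 1] cs_mult[OF com_cs, of x z] that by simp
  have sa: "\<mu> (x * z) = \<mu> x * \<mu> z" if z: "fadj z = z" for x z
  proof (cases "\<mu> z = 0")
    case True
    then show ?thesis using cs_null_mult[OF com_cs True, of x 1] by simp
  next
    case False
    define d where "d = complex_of_real (1 / \<mu> z)"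
    have pos: "0 < \<mu> z" using False cs_nonneg[OF com_cs, of z] by simp
    have "\<mu> (x * (fconst d * z)) = \<mu> x"
    proof (rule unit)
      show "fadj (fconst d * z) = fconst d * z"
        using z by (simp add: fadj_mult d_def fconst_commute)
      show "\<mu> (fconst d * z) = 1" unfolding cs_scale[OF com_cs] using pos by (simp add: d_def norm_divide)
    qed
    moreover have "x * (fconst d * z) = fconst d * (x * z)"
      by (metis fconst_commute mult.assoc)
    ultimately have "cmod d * \<mu> (x * z) = \<mu> x" using cs_scale[OF com_cs, of d "x * z"] by simp
    then show ?thesis using pos by (simp add: d_def norm_divide field_simps)
  qed
  have "(\<mu> (x * w))\<^sup>2 = \<mu> (1 * (fadj w * (fadj x * x)) * w)"
    by (simp add: fadj_mult mult.assoc flip: cs_star[OF com_cs])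
  also have "\<dots> = \<mu> ((fadj x * x) * (fadj w * w))"
    using com_eq[of 1 "fadj w" "fadj x * x" w] by (simp add: mult.assoc)
  also have "\<dots> = (\<mu> x * \<mu> w)\<^sup>2"
    by (subst sa) (simp_all add: fadj_mult cs_star[OF com_cs] power_mult_distrib)
  finally show ?thesis
    using cs_nonneg[OF com_cs] by (simp add: power2_eq_iff_nonneg)
qed

end

text \<open>Zorn's lemma gives a minimal seminorm below \<open>\<nu>\<close> for which \<open>1\<close> has norm \<open>1\<close> and multiplication by \<open>y\<close>
  is isometric; by minimality it coincides with its localisations, so it is multiplicative.\<close>

lemma exists_multiplicative_seminorm:
  fixes \<nu> :: "'g free_star \<Rightarrow> real"
  assumes \<nu>: "commutative_seminorm \<nu>" and y: "fadj y = y" "\<nu> y = 1"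
  obtains \<mu> where "cstar_seminorm \<mu>" "\<And>x. \<mu> x \<le> \<nu> x" "\<mu> 1 = 1" "\<mu> y = 1" "\<And>x w. \<mu> (x * w) = \<mu> x * \<mu> w"
proof -
  define K where "K = {m. commutative_seminorm m \<and> m \<le> \<nu> \<and> m 1 = 1 \<and> (\<forall>x. m (x * y) = m x)}"
  have y0: "localize \<nu> y \<in> K"
  proof -
    have "localize \<nu> y (x * y) = localize \<nu> y x" for x
    proof -
      have "(\<lambda>n. \<nu> (x * y ^ Suc n)) \<longlonglongrightarrow> localize \<nu> y x"
        using LIMSEQ_Suc[OF localize_lim[OF \<nu> y]] .
      moreover have "(\<lambda>n. \<nu> (x * y ^ Suc n)) \<longlonglongrightarrow> localize \<nu> y (x * y)"
        using localize_lim[OF \<nu> y, of "x * y"] by (simp add: mult.assoc)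
      ultimately show ?thesis using LIMSEQ_unique by blast
    qed
    then show ?thesis
      using localize_commutative[OF \<nu> y] localize_one[OF \<nu> y] localize_le[OF \<nu> y, of _ 0]
      by (simp add: K_def le_fun_def)
  qed
  have "\<exists>m\<in>K. \<forall>a\<in>K. a \<le> m \<longrightarrow> a = m"
  proof (rule predicate_Zorn[where P = "\<lambda>a b. b \<le> a"])
    show "partial_order_on K (relation_of (\<lambda>a b. b \<le> a) K)"
      by (rule partial_order_on_relation_ofI) auto
    fix C assume C: "C \<in> Chains (relation_of (\<lambda>a b. b \<le> a) K)"
    then have CK: "C \<subseteq> K" and chain: "\<And>a b. a \<in> C \<Longrightarrow> b \<in> C \<Longrightarrow> a \<le> b \<or> b \<le> a"
      by (auto simp: Chains_def relation_of_def)
    show "\<exists>u\<in>K. \<forall>a\<in>C. u \<le> a"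
    proof (cases "C = {}")
      case True
      then show ?thesis using y0 by auto
    next
      case False
      define u where "u x = (INF m\<in>C. m x)" for x
      have cs: "cstar_seminorm m" if "m \<in> C" for m
        using that CK by (auto simp: K_def commutative_seminorm_def)
      have bdd: "bdd_below ((\<lambda>m. m x) ` C)" for x
        using cs cs_nonneg by (intro bdd_belowI[of _ 0]) blast
      have le: "u x \<le> m x" if "m \<in> C" for m x unfolding u_def by (rule cINF_lower[OF bdd that])
      have ge: "B \<le> u x" if "\<And>m. m \<in> C \<Longrightarrow> B \<le> m x" for B x
        unfolding u_def by (rule cINF_greatest[OF False that])
      have approx: "\<exists>m\<in>C. m x < u x + e" if "0 < e" for x e
        using cINF_less_iff[OF False bdd, of x "u x + e"] that by (simp add: u_def)
      have approx2: "\<exists>m\<in>C. m x < u x + e \<and> m w < u w + e" if e: "0 < e" for x w e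
      proof -
        obtain m where m1: "m \<in> C" "m x < u x + e" using approx[OF e] by blast
        obtain m' where m2: "m' \<in> C" "m' w < u w + e" using approx[OF e] by blast
        note m = m1 m2
        from chain[OF m(1,3)] show ?thesis
        proof
          assume "m \<le> m'"
          then have "m w \<le> m' w" by (simp add: le_fun_def)
          then show ?thesis using m by (intro bexI[of _ m]) auto
        next
          assume "m' \<le> m"
          then have "m' x \<le> m x" by (simp add: le_fun_def)
          then show ?thesis using m by (intro bexI[of _ m']) auto
        qed
      qed
      have u0: "0 \<le> u x" for x using ge[of 0 x] cs cs_nonneg by blast
      obtain m0 where m0: "m0 \<in> C" using False by blast
      have lim: "\<exists>m. (\<forall>n::nat. m n \<in> C) \<and> (\<lambda>n. m n x) \<longlonglongrightarrow> u x \<and> (\<lambda>n. m n w) \<longlonglongrightarrow> u w" for x w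
      proof -
        have "\<forall>n::nat. \<exists>m. m \<in> C \<and> m x < u x + 1 / Suc n \<and> m w < u w + 1 / Suc n"
        proof
          fix n :: nat
          show "\<exists>m. m \<in> C \<and> m x < u x + 1 / Suc n \<and> m w < u w + 1 / Suc n"
            using approx2[of "1 / Suc n" x w] by (simp add: Bex_def)
        qed
        from choice[OF this] obtain m where m: "\<And>n. m n \<in> C \<and> m n x < u x + 1 / Suc n \<and> m n w < u w + 1 / Suc n"
          by blast
        have t: "(\<lambda>n. u x + 1 / Suc n) \<longlonglongrightarrow> u x" for x
          using tendsto_add[OF tendsto_const LIMSEQ_Suc[OF lim_1_over_n], of "u x"] by simp
        have "(\<lambda>n. m n x) \<longlonglongrightarrow> u x" "(\<lambda>n. m n w) \<longlonglongrightarrow> u w"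
          by (rule tendsto_sandwich[OF _ _ tendsto_const t]; use m le in \<open>auto intro!: always_eventually less_imp_le\<close>)+
        with m show ?thesis by blast
      qed
      have "cstar_seminorm u"
        unfolding cstar_seminorm_def
      proof (intro conjI allI)
        fix p q c
        obtain m where m: "\<And>n::nat. m n \<in> C" "(\<lambda>n. m n p) \<longlonglongrightarrow> u p" "(\<lambda>n. m n q) \<longlonglongrightarrow> u q"
          using lim[of p q] by blast
        have "u (p + q) \<le> m n p + m n q" for n
          using le[OF m(1), of "p + q" n] cs_triangle[OF cs[OF m(1)], of n p q] by simp
        then show "u (p + q) \<le> u p + u q"
          by (intro LIMSEQ_le_const[OF tendsto_add[OF m(2,3)]]) simp
        have "u (p * q) \<le> m n p * m n q" for n
          using le[OF m(1), of "p * q" n] cs_mult[OF cs[OF m(1)], of n p q] by simp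
        then show "u (p * q) \<le> u p * u q"
          by (intro LIMSEQ_le_const[OF tendsto_mult[OF m(2,3)]]) simp
        obtain m where m: "\<And>n::nat. m n \<in> C" "(\<lambda>n. m n p) \<longlonglongrightarrow> u p" "(\<lambda>n. m n (fscale c p)) \<longlonglongrightarrow> u (fscale c p)"
          using lim[of p "fscale c p"] by blast
        have "(\<lambda>n. m n (fscale c p)) \<longlonglongrightarrow> cmod c * u p"
          unfolding fscale_def cs_scale[OF cs[OF m(1)]] by (intro tendsto_intros m)
        then show "u (fscale c p) = cmod c * u p" using m(3) LIMSEQ_unique by blast
        obtain m where m: "\<And>n::nat. m n \<in> C" "(\<lambda>n. m n p) \<longlonglongrightarrow> u p" "(\<lambda>n. m n (fadj p * p)) \<longlonglongrightarrow> u (fadj p * p)"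
          using lim[of p "fadj p * p"] by blast
        have "(\<lambda>n. m n (fadj p * p)) \<longlonglongrightarrow> (u p)\<^sup>2"
          unfolding cs_star[OF cs[OF m(1)]] by (intro tendsto_intros m)
        then show "u (fadj p * p) = (u p)\<^sup>2" using m(3) LIMSEQ_unique by blast
      qed
      moreover have "u (x * w - w * x) = 0" for x w
        using le[OF m0, of "x * w - w * x"] u0[of "x * w - w * x"] m0 CK
        by (auto simp: K_def commutative_seminorm_def)
      moreover have "u x \<le> \<nu> x" for x
        using order_trans[OF le[OF m0, of x], of "\<nu> x"] m0 CK by (auto simp: K_def le_fun_def)
      moreover have "u 1 = 1"
      proof -
        have "u 1 = (INF m\<in>C. 1)" unfolding u_def by (rule INF_cong) (use CK in \<open>auto simp: K_def\<close>)
        then show ?thesis using False by simp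
      qed
      moreover have "u (x * y) = u x" for x
        unfolding u_def by (rule INF_cong) (use CK in \<open>auto simp: K_def\<close>)
      ultimately have "u \<in> K" by (simp add: K_def commutative_seminorm_def le_fun_def)
      then show ?thesis using le by (auto simp: le_fun_def)
    qed
  qed
  then obtain \<mu> where \<mu>K: "\<mu> \<in> K" and min: "\<And>a. a \<in> K \<Longrightarrow> a \<le> \<mu> \<Longrightarrow> a = \<mu>" by blast
  then have c: "commutative_seminorm \<mu>" and le: "\<mu> \<le> \<nu>" and one: "\<mu> 1 = 1" and ay: "\<And>x. \<mu> (x * y) = \<mu> x"
    by (auto simp: K_def)
  have inv: "localize \<mu> z x = \<mu> x" if z: "fadj z = z" "\<mu> z = 1" for z x
  proof -
    have le': "localize \<mu> z \<le> \<mu>" using localize_le[OF c z, of _ 0] by (simp add: le_fun_def)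
    moreover have "localize \<mu> z \<in> K"
      using localize_commutative[OF c z] localize_one[OF c z] localize_absorb[OF c z ay] order_trans[OF le' le]
      by (simp add: K_def)
    ultimately show ?thesis using min by metis
  qed
  show ?thesis
  proof (rule that[of \<mu>])
    show "cstar_seminorm \<mu>" by (rule com_cs[OF c])
    show "\<mu> x \<le> \<nu> x" for x using le by (simp add: le_fun_def)
    show "\<mu> y = 1" using ay[of 1] one by simp
    show "\<mu> (x * w) = \<mu> x * \<mu> w" for x w
      using localize_invariant_multiplicative[OF c inv] .
  qed (rule one)
qed

text \<open>The Gelfand--Mazur theorem for a multiplicative seminorm, by Ostrowski's argument: if the
  distance \<open>m\<close> from \<open>x\<close> to the scalars were positive and attained at \<open>c\<close>, the factors of
  \<open>(x - c)\<^sup>n - a\<^sup>n\<close> other than \<open>x - c - a\<close> would have norm at least \<open>m\<close>, and \<open>n \<rightarrow> \<infinity>\<close> would show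
  that the distance is \<open>m\<close> on all of the plane.\<close>

lemma multiplicative_seminorm_scalar:
  fixes \<mu> :: "'g free_star \<Rightarrow> real"
  assumes \<mu>: "cstar_seminorm \<mu>" and one: "\<mu> 1 = 1" and mult: "\<And>x w. \<mu> (x * w) = \<mu> x * \<mu> w"
  shows "\<exists>c. \<mu> (x - fconst c) = 0"
proof -
  define f where "f c = \<mu> (x - fconst c)" for c
  have const: "\<mu> (fconst c) = cmod c" for c using cs_const[OF \<mu>, of c] one by simp
  have lip: "\<bar>f c - f d\<bar> \<le> cmod (c - d)" for c d
    using cs_abs_diff[OF \<mu>, of "x - fconst c" "x - fconst d"] const[of "d - c"]
    by (simp add: f_def norm_minus_commute single_diff)
  have grow: "cmod c - \<mu> x \<le> f c" for c
    using cs_triangle_diff[OF \<mu>, of x "x - fconst c"] by (simp add: f_def const)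
  have "continuous_on (cball 0 (2 * \<mu> x)) f"
  proof (rule continuous_onI)
    fix e :: real and c :: complex assume "0 < e"
    then show "\<exists>d>0. \<forall>c'\<in>cball 0 (2 * \<mu> x). dist c' c < d \<longrightarrow> dist (f c') (f c) \<le> e"
      by (intro exI[of _ e] conjI ballI impI) (simp, simp add: dist_real_def dist_norm,
          rule order_trans[OF lip], simp)
  qed
  moreover have "cball (0::complex) (2 * \<mu> x) \<noteq> {}" using cs_nonneg[OF \<mu>, of x] by simp
  ultimately obtain c0 where c0: "\<And>c. c \<in> cball 0 (2 * \<mu> x) \<Longrightarrow> f c0 \<le> f c"
    using continuous_attains_inf[OF compact_cball] by blast
  define m where "m = f c0"
  have min: "m \<le> f c" for c
  proof (cases "c \<in> cball 0 (2 * \<mu> x)")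
    case False
    then have "\<mu> x \<le> f c" using grow[of c] by simp
    moreover have "m \<le> f 0" unfolding m_def by (rule c0) (simp add: cs_nonneg[OF \<mu>])
    ultimately show ?thesis by (simp add: f_def)
  qed (simp add: c0 m_def)
  have "m = 0"
  proof (rule ccontr)
    assume "m \<noteq> 0"
    then have pos: "0 < m" using cs_nonneg[OF \<mu>] by (simp add: m_def f_def order_less_le)
    have step: "f (c + a) = m" if c: "f c = m" and a: "cmod a < m" for c a
    proof -
      define w where "w = x - fconst c"
      have w: "\<mu> (w - fconst b) = f (c + b)" for b
        by (simp add: w_def f_def single_add algebra_simps)
      have pow: "\<mu> (p ^ n) = \<mu> p ^ n" for p n by (induction n) (simp_all add: one mult)
      have fac: "w ^ (2 * n) - fconst (b\<^sup>2) = (w ^ n - fconst b) * (w ^ n - fconst (- b))" for n b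
      proof -
        have 1: "fconst (b\<^sup>2) = fconst b * fconst b" by (simp add: fconst_mult power2_eq_square)
        have 2: "fconst (- b) = - fconst b" by (simp add: single_uminus)
        have 3: "fconst b * w ^ n = w ^ n * fconst b" by (rule fconst_commute)
        show ?thesis unfolding 1 2 mult_2 power_add using 3
          by (simp only: minus_diff_eq diff_minus_eq_add distrib_left left_diff_distrib) simp
      qed
      have low: "m ^ (2 ^ k) \<le> \<mu> (w ^ (2 ^ k) - fconst b)" for k b
      proof (induction k arbitrary: b)
        case 0
        then show ?case using min[of "c + b"] by (simp add: w)
      next
        case (Suc k)
        have "m ^ 2 ^ k * m ^ 2 ^ k \<le> \<mu> (w ^ 2 ^ k - fconst (csqrt b)) * \<mu> (w ^ 2 ^ k - fconst (- csqrt b))"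
          using Suc.IH[of "csqrt b"] Suc.IH[of "- csqrt b"] pos by (intro mult_mono) (auto simp: cs_nonneg[OF \<mu>])
        also have "\<dots> = \<mu> (w ^ (2 * 2 ^ k) - fconst b)"
          using fac[of "2 ^ k" "csqrt b"] by (simp add: mult)
        finally show ?case by (simp add: mult_2 power_add)
      qed
      have key: "f (c + a) * m ^ (2 ^ k) \<le> \<mu> (w ^ (2 ^ k) - fconst (a ^ (2 ^ k))) * m" for k
      proof (induction k)
        case 0
        then show ?case using w[of a] by simp
      next
        case (Suc k)
        let ?P = "\<mu> (w ^ 2 ^ k - fconst (a ^ 2 ^ k))" and ?Q = "\<mu> (w ^ 2 ^ k - fconst (- (a ^ 2 ^ k)))"
        have "f (c + a) * m ^ 2 ^ k * m ^ 2 ^ k \<le> (?P * m) * ?Q"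
          by (rule mult_mono[OF Suc low]) (use pos in \<open>auto simp: cs_nonneg[OF \<mu>]\<close>)
        also have "\<dots> = \<mu> (w ^ (2 * 2 ^ k) - fconst ((a ^ 2 ^ k)\<^sup>2)) * m"
          by (simp add: fac mult)
        finally show ?case by (simp add: mult_2 power_add power2_eq_square mult.assoc)
      qed
      have bound: "f (c + a) \<le> m * (1 + (cmod a / m) ^ (2 ^ k))" for k
      proof -
        have "\<mu> (w ^ (2 ^ k) - fconst (a ^ (2 ^ k))) \<le> m ^ 2 ^ k + cmod a ^ 2 ^ k"
          using cs_triangle_diff[OF \<mu>, of "w ^ (2 ^ k)" "fconst (a ^ (2 ^ k))"] w[of 0] c
          by (simp add: pow const norm_power)
        then have "f (c + a) * m ^ (2 ^ k) \<le> (m ^ 2 ^ k + cmod a ^ 2 ^ k) * m"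
          using key[of k] pos by (meson mult_right_mono order_trans less_imp_le)
        then show ?thesis using pos by (simp add: field_simps power_divide)
      qed
      have "(\<lambda>k. (cmod a / m) ^ (2 ^ k)) \<longlonglongrightarrow> 0"
        using LIMSEQ_subseq_LIMSEQ[OF LIMSEQ_realpow_zero[of "cmod a / m"], of "\<lambda>k. 2 ^ k"] a pos
        by (simp add: strict_mono_def o_def)
      then have "(\<lambda>k. m * (1 + (cmod a / m) ^ (2 ^ k))) \<longlonglongrightarrow> m * (1 + 0)" by (intro tendsto_intros)
      then have "f (c + a) \<le> m * (1 + 0)" by (rule LIMSEQ_le_const) (use bound in blast)
      then show ?thesis using min[of "c + a"] by simp
    qed
    have far: "f (c0 + of_nat n * of_real (m / 2)) = m" for n
    proof (induction n)
      case (Suc n)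
      have "cmod (of_real (m / 2)) < m" using pos by (simp add: norm_divide)
      from step[OF Suc this] show ?case by (simp add: algebra_simps add_divide_distrib)
    qed (simp add: m_def)
    obtain n :: nat where n: "m + \<mu> x + cmod c0 < real n * (m / 2)"
      using ex_less_of_nat_mult[of "m / 2" "m + \<mu> x + cmod c0"] pos half_gt_zero by blast
    have "real n * (m / 2) - cmod c0 \<le> cmod (c0 + of_nat n * of_real (m / 2))"
      using norm_diff_ineq[of "of_nat n * of_real (m / 2) :: complex" c0] pos
      by (simp add: norm_mult norm_divide add.commute)
    then show False using grow[of "c0 + of_nat n * of_real (m / 2)"] far[of n] n by linarith
  qed
  then show ?thesis by (auto simp: m_def f_def)
qed

theorem exists_character:
  fixes \<nu> :: "'g free_star \<Rightarrow> real"
  assumes \<nu>: "commutative_seminorm \<nu>" and one: "\<nu> 1 \<noteq> 0"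
  obtains \<phi> where "free_hom complex_cstar \<phi>" "\<And>q. cmod (\<phi> q) \<le> \<nu> q" "cmod (\<phi> p) = \<nu> p"
proof -
  note cs = com_cs[OF \<nu>]
  define y where "y = (if \<nu> p = 0 then 1 else fconst (of_real (1 / (\<nu> p)\<^sup>2)) * (fadj p * p))"
  have "fadj y = y" by (simp add: y_def fadj_mult fconst_commute)
  moreover have "\<nu> y = 1"
    using cs_one[OF cs] one cs_nonneg[OF cs, of p]
    by (simp add: y_def cs_scale[OF cs] cs_star[OF cs] norm_divide norm_power)
  ultimately obtain \<mu> where \<mu>: "cstar_seminorm \<mu>" "\<And>x. \<mu> x \<le> \<nu> x" "\<mu> 1 = 1" "\<mu> y = 1"
    "\<And>x w. \<mu> (x * w) = \<mu> x * \<mu> w"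
    using exists_multiplicative_seminorm[OF \<nu>] by metis
  have "\<forall>x. \<exists>c. \<mu> (x - fconst c) = 0" using multiplicative_seminorm_scalar[OF \<mu>(1,3,5)] by blast
  then obtain \<phi> where \<phi>: "\<And>x. \<mu> (x - fconst (\<phi> x)) = 0" by metis
  have uniq: "\<phi> x = c" if "\<mu> (x - fconst c) = 0" for x c
  proof -
    have "\<mu> (fconst (\<phi> x - c)) \<le> \<mu> (x - fconst c) + \<mu> (x - fconst (\<phi> x))"
      using cs_triangle_diff[OF \<mu>(1), of "x - fconst c" "x - fconst (\<phi> x)"] by (simp add: single_diff)
    then show ?thesis using that \<phi>[of x] cs_const[OF \<mu>(1), of "\<phi> x - c"] \<mu>(3) by simp
  qed
  have abs: "cmod (\<phi> x) = \<mu> x" for x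
    using cs_eqI[OF \<mu>(1) \<phi>[of x]] cs_const[OF \<mu>(1), of "\<phi> x"] \<mu>(3) by simp
  have add: "\<phi> (x + w) = \<phi> x + \<phi> w" for x w
  proof (rule uniq)
    have "\<mu> (x + w - fconst (\<phi> x + \<phi> w)) \<le> \<mu> (x - fconst (\<phi> x)) + \<mu> (w - fconst (\<phi> w))"
      using cs_triangle[OF \<mu>(1), of "x - fconst (\<phi> x)" "w - fconst (\<phi> w)"] by (simp add: single_add algebra_simps)
    then show "\<mu> (x + w - fconst (\<phi> x + \<phi> w)) = 0" using \<phi> cs_nonneg[OF \<mu>(1), of "x + w - fconst (\<phi> x + \<phi> w)"] by simp
  qed
  have mult: "\<phi> (x * w) = \<phi> x * \<phi> w" for x w
  proof (rule uniq)
    have "\<mu> (x * w - fconst (\<phi> x) * fconst (\<phi> w)) \<le> \<mu> (x - fconst (\<phi> x)) * \<mu> w + \<mu> (fconst (\<phi> x)) * \<mu> (w - fconst (\<phi> w))"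
      by (rule cs_mult_diff[OF \<mu>(1)])
    then show "\<mu> (x * w - fconst (\<phi> x * \<phi> w)) = 0"
      using \<phi> cs_nonneg[OF \<mu>(1), of "x * w - fconst (\<phi> x * \<phi> w)"] by (simp add: fconst_mult)
  qed
  have const: "\<phi> (fconst c) = c" for c by (rule uniq) (simp add: cs_zero[OF \<mu>(1)])
  have real: "Im (\<phi> h) = 0" if h: "fadj h = h" for h
  proof -
    have "cmod (\<phi> (h + fconst \<i>)) = cmod (\<phi> (h + fconst (- \<i>)))"
      using cs_adj[OF \<mu>(1), of "h + fconst \<i>"] h by (simp add: abs fadj_add)
    then have "(cmod (\<phi> h + \<i>))\<^sup>2 = (cmod (\<phi> h - \<i>))\<^sup>2" by (simp add: add const)
    then show ?thesis by (simp add: cmod_power2) (simp add: power2_eq_square algebra_simps)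
  qed
  have adj: "\<phi> (fadj x) = cnj (\<phi> x)" for x
  proof -
    have "Im (\<phi> (x + fadj x)) = 0" by (rule real) (simp add: fadj_add add.commute)
    moreover have "Im (\<phi> (fconst \<i> * x + fconst (- \<i>) * fadj x)) = 0"
      by (rule real) (simp add: fadj_add fadj_mult fconst_commute add.commute)
    ultimately show ?thesis by (simp add: add mult const complex_eq_iff)
  qed
  show ?thesis
  proof (rule that[of \<phi>])
    show "free_hom complex_cstar \<phi>"
      by (simp add: free_hom_def complex_cstar_def add mult const adj)
    show "cmod (\<phi> q) \<le> \<nu> q" for q using abs \<mu>(2) by simp
    show "cmod (\<phi> p) = \<nu> p"
    proof (cases "\<nu> p = 0")
      case True
      then show ?thesis using abs[of p] \<mu>(2)[of p] cs_nonneg[OF \<mu>(1), of p] by simp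
    next
      case False
      have "\<mu> y = (\<mu> p)\<^sup>2 / (\<nu> p)\<^sup>2"
        using False by (simp add: y_def cs_scale[OF \<mu>(1)] cs_star[OF \<mu>(1)] norm_divide norm_power)
      with \<mu>(4) have "(\<mu> p)\<^sup>2 / (\<nu> p)\<^sup>2 = 1" by metis
      then have "(\<mu> p)\<^sup>2 = (\<nu> p)\<^sup>2" using False by simp
      then have "\<mu> p = \<nu> p"
        using power2_eq_iff_nonneg cs_nonneg[OF \<mu>(1), of p] cs_nonneg[OF cs, of p] by blast
      with abs[of p] show ?thesis by simp
    qed
  qed
qed

section \<open>Functional calculus and its consequences\<close>

text \<open>The value of a polynomial at real scalars.\<close>

abbreviation real_eval :: "('g \<Rightarrow> real) \<Rightarrow> 'g free_star \<Rightarrow> complex" where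
  "real_eval t \<equiv> eval complex_cstar (\<lambda>g. complex_of_real (t g))"

lemma complex_carrier: "x \<in> carrier complex_cstar"
  by (simp add: complex_cstar_def)

lemma free_hom_complex_eval: "free_hom complex_cstar (eval complex_cstar z)"
  by (rule cstar_algebra.free_hom_eval[OF cstar_algebra_complex complex_carrier])

lemma free_hom_complexD:
  assumes "free_hom complex_cstar \<phi>"
  shows "\<phi> (p + q) = \<phi> p + \<phi> q" "\<phi> (p * q) = \<phi> p * \<phi> q" "\<phi> (fconst c) = c" "\<phi> (fadj p) = cnj (\<phi> p)"
  using assms unfolding free_hom_def complex_cstar_def by simp_all

lemma complex_eval_simps:
  fixes z :: "'g \<Rightarrow> complex"
  shows "eval complex_cstar z (p + q) = eval complex_cstar z p + eval complex_cstar z q"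
    and "eval complex_cstar z (p * q) = eval complex_cstar z p * eval complex_cstar z q"
    and "eval complex_cstar z (fconst c) = c"
    and "eval complex_cstar z (fgen g) = z g"
    and "eval complex_cstar z (fadj p) = cnj (eval complex_cstar z p)"
    and "eval complex_cstar z (- p) = - eval complex_cstar z p"
    and "eval complex_cstar z (p - q) = eval complex_cstar z p - eval complex_cstar z q"
    and "eval complex_cstar z 1 = 1"
    and "eval complex_cstar z 0 = 0"
    and "eval complex_cstar z (p ^ n) = eval complex_cstar z p ^ n"
    and "eval complex_cstar z (\<Sum>i\<in>I. f i) = (\<Sum>i\<in>I. eval complex_cstar z (f i))"
proof -
  note F = free_hom_complexD[OF free_hom_complex_eval[of z]]
  show add: "eval complex_cstar z (p + q) = eval complex_cstar z p + eval complex_cstar z q" for p q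
    by (rule F)
  show mult: "eval complex_cstar z (p * q) = eval complex_cstar z p * eval complex_cstar z q" for p q
    by (rule F)
  show const: "eval complex_cstar z (fconst c) = c" for c
    by (rule F)
  show "eval complex_cstar z (fadj p) = cnj (eval complex_cstar z p)"
    by (rule F)
  show "eval complex_cstar z (fgen g) = z g"
    by (rule cstar_algebra.eval_fgen[OF cstar_algebra_complex complex_carrier])
  show one: "eval complex_cstar z 1 = 1" and zero: "eval complex_cstar z 0 = 0"
    using const[of 1] const[of 0] by simp_all
  show um: "eval complex_cstar z (- p) = - eval complex_cstar z p" for p
    using add[of p "- p"] zero by (simp add: add_eq_0_iff)
  show "eval complex_cstar z (p - q) = eval complex_cstar z p - eval complex_cstar z q"
    using add[of p "- q"] um by simp
  show "eval complex_cstar z (p ^ n) = eval complex_cstar z p ^ n"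
    by (induction n) (simp_all add: one mult)
  show "eval complex_cstar z (\<Sum>i\<in>I. f i) = (\<Sum>i\<in>I. eval complex_cstar z (f i))"
    by (induction I rule: infinite_finite_induct) (simp_all add: zero add)
qed

context cstar_algebra
begin

lemma commute_eval:
  assumes h: "\<And>g. h g \<in> carrier A" and x: "x \<in> carrier A"
    and comm: "\<And>g. x \<otimes> h g = h g \<otimes> x" "\<And>g. x \<otimes> adj A (h g) = adj A (h g) \<otimes> x"
  shows "x \<otimes> eval A h p = eval A h p \<otimes> x"
proof -
  note fh = free_hom_eval[of h, OF h] note c = fh_closed[OF fh]
  show ?thesis
  proof (induction p rule: free_star_induct)
    case (const c)
    then show ?case by (simp add: fh_const[OF fh] smult_mult_left smult_mult_right x)
  next
    case (gen g)
    then show ?case using comm(1) eval_fgen[of h, OF h] by simp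
  next
    case (adj g)
    then show ?case using comm(2) eval_fgen[of h, OF h] by (simp add: fh_adj[OF fh])
  next
    case (add p q)
    then show ?case by (simp add: fh_add[OF fh] l_distr r_distr c x)
  next
    case (mult p q)
    have "x \<otimes> (eval A h p \<otimes> eval A h q) = (x \<otimes> eval A h p) \<otimes> eval A h q"
      using c x by (simp add: m_assoc)
    also have "\<dots> = eval A h p \<otimes> (x \<otimes> eval A h q)" unfolding mult(1) using c x by (simp add: m_assoc)
    also have "\<dots> = (eval A h p \<otimes> eval A h q) \<otimes> x" unfolding mult(2) using c x by (simp add: m_assoc)
    finally show ?case by (simp add: fh_mult[OF fh])
  qed
qed

lemma eval_commutative_seminorm:
  assumes h: "\<And>g. h g \<in> carrier A" "\<And>g. adj A (h g) = h g" "\<And>g g'. h g \<otimes> h g' = h g' \<otimes> h g"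
  shows "commutative_seminorm (\<lambda>p. nrm A (eval A h p))"
proof -
  note fh = free_hom_eval[of h, OF h(1)] note c = fh_closed[OF fh]
  have g: "h g \<otimes> eval A h p = eval A h p \<otimes> h g" for g p
    by (rule commute_eval[of h, OF h(1) h(1)]) (simp_all add: h)
  have "eval A h q \<otimes> eval A h p = eval A h p \<otimes> eval A h q" for p q
    by (rule commute_eval[of h, OF h(1) c]) (simp_all add: h g)
  then have "nrm A (eval A h (p * q - q * p)) = 0" for p q
    using c by (simp add: fh_minus[OF fh] fh_mult[OF fh] nrm_minus_eq_zero)
  then show ?thesis using cstar_seminorm_free_hom[OF fh] by (simp add: commutative_seminorm_def)
qed

text \<open>Commuting self-adjoint elements have a joint spectral value at which any given polynomial in
  them attains its norm.\<close>

lemma joint_spectral_value: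
  assumes h: "\<And>g. h g \<in> carrier A" "\<And>g. adj A (h g) = h g" "\<And>g g'. h g \<otimes> h g' = h g' \<otimes> h g"
    and one: "\<one> \<noteq> \<zero>"
  obtains t where "\<And>q. cmod (real_eval t q) \<le> nrm A (eval A h q)" "cmod (real_eval t p) = nrm A (eval A h p)"
proof -
  note fh = free_hom_eval[of h, OF h(1)]
  have "nrm A (eval A h 1) \<noteq> 0" using one by (simp add: fh_one[OF fh] nrm_eq_zero)
  then have "\<exists>\<phi>. free_hom complex_cstar \<phi> \<and> (\<forall>q. cmod (\<phi> q) \<le> nrm A (eval A h q)) \<and> cmod (\<phi> p) = nrm A (eval A h p)"
  proof (rule exists_character[OF eval_commutative_seminorm[of h, OF h], of p])
    fix \<phi> assume "free_hom complex_cstar \<phi>" "\<And>q. cmod (\<phi> q) \<le> nrm A (eval A h q)" "cmod (\<phi> p) = nrm A (eval A h p)"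
    then show ?thesis by (intro exI[of _ \<phi>] conjI allI)
  qed
  then obtain \<phi> where "free_hom complex_cstar \<phi> \<and> (\<forall>q. cmod (\<phi> q) \<le> nrm A (eval A h q)) \<and> cmod (\<phi> p) = nrm A (eval A h p)"
    by (rule exE)
  then have \<phi>: "free_hom complex_cstar \<phi>" "\<And>q. cmod (\<phi> q) \<le> nrm A (eval A h q)"
    "cmod (\<phi> p) = nrm A (eval A h p)" by simp_all
  have im: "Im (\<phi> (fgen g)) = 0" for g
  proof -
    have "eval A h (fadj (fgen g) + fscale (-1) (fgen g)) = h g \<oplus> \<ominus> h g"
      by (simp only: fh_add[OF fh] fh_adj[OF fh] fh_scale[OF fh] eval_fgen[of h, OF h(1)] h(2)
          smult_minus_one[OF h(1)])
    then have "eval A h (fadj (fgen g) + fconst (-1) * fgen g) = \<zero>"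
      by (simp only: r_neg[OF h(1)] fscale_eq)
    then have "cmod (\<phi> (fadj (fgen g) + fconst (-1) * fgen g)) \<le> 0"
      using \<phi>(2)[of "fadj (fgen g) + fconst (-1) * fgen g"] by (simp only: nrm_zero)
    moreover have "\<phi> (fadj (fgen g) + fconst (-1) * fgen g) = cnj (\<phi> (fgen g)) + (-1) * \<phi> (fgen g)"
    proof -
      show ?thesis by (simp only: free_hom_complexD[OF \<phi>(1)])
    qed
    ultimately have "cmod (cnj (\<phi> (fgen g)) - \<phi> (fgen g)) \<le> 0" by simp
    then have "cnj (\<phi> (fgen g)) = \<phi> (fgen g)" by simp
    then show ?thesis by (metis Reals_cnj_iff complex_is_Real_iff)
  qed
  have eq: "\<phi> q = real_eval (\<lambda>g. Re (\<phi> (fgen g))) q" for q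
    by (rule free_hom_eqI[OF \<phi>(1) free_hom_complex_eval])
      (simp add: complex_eval_simps complex_eq_iff im)
  show ?thesis
    by (rule that[of "\<lambda>g. Re (\<phi> (fgen g))"]) (simp_all only: \<phi>(2,3) eq[symmetric])
qed

lemma nrm_trivial:
  assumes "\<one> = \<zero>" "x \<in> carrier A" shows "nrm A x = 0"
proof -
  have "x = \<zero>" using assms by (metis r_one r_null)
  then show ?thesis by (simp add: nrm_zero)
qed

abbreviation poly1 :: "'a \<Rightarrow> unit free_star \<Rightarrow> 'a" where
  "poly1 h \<equiv> eval A (\<lambda>_. h)"

lemma free_hom_poly1: "h \<in> carrier A \<Longrightarrow> free_hom A (poly1 h)"
  by (rule free_hom_eval)

lemma poly1_X: "h \<in> carrier A \<Longrightarrow> poly1 h (fgen ()) = h"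
  by (rule eval_fgen)

lemma spectral_value:
  assumes h: "h \<in> carrier A" "adj A h = h" and one: "\<one> \<noteq> \<zero>"
  obtains t :: real where "\<And>q. cmod (real_eval (\<lambda>_. t) q) \<le> nrm A (poly1 h q)"
    "cmod (real_eval (\<lambda>_. t) p) = nrm A (poly1 h p)" "\<bar>t\<bar> \<le> nrm A h"
proof -
  obtain s :: "unit \<Rightarrow> real" where s: "\<And>q. cmod (real_eval s q) \<le> nrm A (poly1 h q)"
    "cmod (real_eval s p) = nrm A (poly1 h p)"
    using joint_spectral_value[of "\<lambda>_. h" p] h one by metis
  have "s = (\<lambda>_. s ())" by auto
  then obtain t where t: "s = (\<lambda>_. t)" by blast
  have "\<bar>t\<bar> \<le> nrm A h" using s(1)[of "fgen ()"] by (simp add: t complex_eval_simps poly1_X h)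
  with s show ?thesis using that t by blast
qed

lemma nrm_poly1_le:
  assumes h: "h \<in> carrier A" "adj A h = h" and b: "0 \<le> b"
    and le: "\<And>t. \<bar>t\<bar> \<le> nrm A h \<Longrightarrow> cmod (real_eval (\<lambda>_. t) p) \<le> b"
  shows "nrm A (poly1 h p) \<le> b"
proof (cases "\<one> = \<zero>")
  case True
  then show ?thesis using nrm_trivial fh_closed[OF free_hom_poly1[OF h(1)]] b by simp
next
  case False
  from spectral_value[OF h False, of p] obtain t :: real where
    "cmod (real_eval (\<lambda>_. t) p) = nrm A (poly1 h p)" "\<bar>t\<bar> \<le> nrm A h" by blast
  then show ?thesis using le[of t] by simp
qed

text \<open>Positivity of \<open>q\<close>, by the norm criterion for self-adjoint elements \<open>\<parallel>c - q\<parallel> \<le> c\<close> for all large \<open>c\<close>.  In this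
  form sums are easily seen to be positive.\<close>

definition nonneg :: "'a \<Rightarrow> bool" where
  "nonneg q \<longleftrightarrow> q \<in> carrier A \<and> (\<exists>c0. \<forall>c\<ge>c0. nrm A (complex_of_real c \<odot> \<one> \<ominus> q) \<le> c)"

lemma nonneg_square:
  assumes x: "x \<in> carrier A" "adj A x = x"
  shows "nonneg (x \<otimes> x)"
  unfolding nonneg_def
proof (intro conjI exI[of _ "(nrm A x)\<^sup>2"] allI impI)
  fix c assume c: "(nrm A x)\<^sup>2 \<le> c"
  note fh = free_hom_poly1[OF x(1)]
  have "nrm A (poly1 x (fconst (of_real c) - fgen () * fgen ())) \<le> c"
  proof (rule nrm_poly1_le[OF x])
    fix t assume "\<bar>t\<bar> \<le> nrm A x"
    then have "t * t \<le> c" using c power_mono[of "\<bar>t\<bar>" "nrm A x" 2] by (simp add: power2_eq_square)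
    then have "\<bar>c - t * t\<bar> \<le> c" using c zero_le_square[of t] by linarith
    then show "cmod (real_eval (\<lambda>_. t) (fconst (of_real c) - fgen () * fgen ())) \<le> c"
      unfolding complex_eval_simps by (simp flip: of_real_mult of_real_diff)
  qed (use c in \<open>simp add: order_trans[OF zero_le_power2]\<close>)
  then show "nrm A (complex_of_real c \<odot> \<one> \<ominus> x \<otimes> x) \<le> c"
    by (simp add: fh_minus[OF fh] fh_mult[OF fh] fh_const[OF fh] poly1_X x)
qed (simp add: x)

lemma nonneg_zero: "nonneg \<zero>"
proof -
  have n1: "nrm A \<one> \<le> 1"
    using cs_one[OF cstar_seminorm_free_hom[OF free_hom_poly1[of \<zero>]]] fh_one[OF free_hom_poly1[of \<zero>]] by auto
  show ?thesis unfolding nonneg_def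
  proof (intro conjI exI[of _ 0] allI impI)
    fix c :: real assume "0 \<le> c"
    then show "nrm A (complex_of_real c \<odot> \<one> \<ominus> \<zero>) \<le> c"
      using n1 by (simp add: a_minus_def smult_closed nrm_smult mult_left_le)
  qed simp
qed

lemma nonneg_add:
  assumes "nonneg q" "nonneg r" shows "nonneg (q \<oplus> r)"
proof -
  obtain c d where cd: "\<And>e. c \<le> e \<Longrightarrow> nrm A (complex_of_real e \<odot> \<one> \<ominus> q) \<le> e"
    "\<And>e. d \<le> e \<Longrightarrow> nrm A (complex_of_real e \<odot> \<one> \<ominus> r) \<le> e" and qr: "q \<in> carrier A" "r \<in> carrier A"
    using assms unfolding nonneg_def by blast
  show ?thesis unfolding nonneg_def
  proof (intro conjI exI[of _ "c + d"] allI impI)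
    fix e assume e: "c + d \<le> e"
    have "complex_of_real e = of_real (e - d) + of_real d" by simp
    then have "complex_of_real e \<odot> \<one> \<ominus> (q \<oplus> r) = (complex_of_real (e - d) \<odot> \<one> \<ominus> q) \<oplus> (complex_of_real d \<odot> \<one> \<ominus> r)"
      using qr by (simp only: smult_add_left one_closed)
        (simp add: a_minus_def minus_add a_ac smult_closed del: of_real_diff)
    then have "nrm A (complex_of_real e \<odot> \<one> \<ominus> (q \<oplus> r)) \<le> (e - d) + d"
      using cd(1)[of "e - d"] cd(2)[of d] e qr
        nrm_triangle[of "complex_of_real (e - d) \<odot> \<one> \<ominus> q" "complex_of_real d \<odot> \<one> \<ominus> r"]
      by (simp add: smult_closed del: of_real_diff)
    then show "nrm A (complex_of_real e \<odot> \<one> \<ominus> (q \<oplus> r)) \<le> e" by simp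
  qed (simp add: qr)
qed

lemma nonneg_finsum:
  assumes "\<And>i. i \<in> I \<Longrightarrow> nonneg (q i)" shows "nonneg (\<Oplus>i\<in>I. q i)"
  using assms
proof (induction I rule: infinite_finite_induct)
  case (insert i I)
  then have "q \<in> I \<rightarrow> carrier A" "q i \<in> carrier A" by (auto simp: nonneg_def)
  then show ?case using insert by (simp add: finsum_insert nonneg_add)
qed (simp_all add: nonneg_zero finsum_infinite)

lemma square_le_one:
  assumes x: "x \<in> carrier A" "adj A x = x" and q: "nonneg q" and sum: "x \<otimes> x \<oplus> q = \<one>"
  shows "nrm A x \<le> 1"
proof (cases "\<one> = \<zero>")
  case True
  then show ?thesis using nrm_trivial x by simp
next
  case False
  obtain c where c: "\<And>e. c \<le> e \<Longrightarrow> nrm A (complex_of_real e \<odot> \<one> \<ominus> q) \<le> e" and qc: "q \<in> carrier A"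
    using q unfolding nonneg_def by blast
  define e where "e = max c 1"
  let ?p = "fconst (of_real (e - 1)) + fgen () * fgen ()"
  note fh = free_hom_poly1[OF x(1)]
  have "complex_of_real e = of_real (e - 1) + 1" by simp
  then have "complex_of_real e \<odot> \<one> \<ominus> q = complex_of_real (e - 1) \<odot> \<one> \<oplus> (x \<otimes> x \<oplus> q) \<ominus> q"
    by (simp only: smult_add_left one_closed smult_one sum)
  also have "\<dots> = complex_of_real (e - 1) \<odot> \<one> \<oplus> x \<otimes> x"
    using x qc by (simp add: a_minus_def a_assoc r_neg smult_closed del: of_real_diff)
  also have "\<dots> = poly1 x ?p"
    by (simp add: fh_add[OF fh] fh_mult[OF fh] fh_const[OF fh] poly1_X x del: of_real_diff)
  finally have le: "nrm A (poly1 x ?p) \<le> e" using c[of e] by (simp add: e_def)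
  obtain t :: real where t: "\<And>q. cmod (real_eval (\<lambda>_. t) q) \<le> nrm A (poly1 x q)"
    "cmod (real_eval (\<lambda>_. t) (fgen ())) = nrm A (poly1 x (fgen ()))"
    using spectral_value[OF x False] by metis
  have "cmod (of_real (e - 1 + t * t)) \<le> e"
    using order_trans[OF t(1)[of ?p] le] by (simp add: complex_eval_simps)
  then have "t * t \<le> 1" unfolding norm_of_real by linarith
  then have "\<bar>t\<bar> \<le> 1" using abs_square_le_1[of t] by (simp add: power2_eq_square)
  then show ?thesis using t(2) by (simp add: complex_eval_simps poly1_X x)
qed

lemma sum_squares_bound:
  assumes I: "finite I" "i \<in> I" and x: "\<And>j. j \<in> I \<Longrightarrow> x j \<in> carrier A" "\<And>j. j \<in> I \<Longrightarrow> adj A (x j) = x j"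
    and sum: "(\<Oplus>j\<in>I. x j \<otimes> x j) = \<one>"
  shows "nrm A (x i) \<le> 1"
proof (rule square_le_one)
  show "x i \<in> carrier A" "adj A (x i) = x i" using I x by auto
  show "nonneg (\<Oplus>j\<in>I - {i}. x j \<otimes> x j)" by (rule nonneg_finsum) (auto simp: nonneg_square x)
  have "(\<Oplus>j\<in>insert i (I - {i}). x j \<otimes> x j) = \<one>" using sum I by (simp add: insert_absorb)
  then show "x i \<otimes> x i \<oplus> (\<Oplus>j\<in>I - {i}. x j \<otimes> x j) = \<one>"
    using I x by (subst (asm) finsum_insert) auto
qed

lemma series_converges:
  assumes x: "\<And>n::nat. x n \<in> carrier A" "\<And>n. nrm A (x n) \<le> b n" and b: "summable b"
  obtains y where "y \<in> carrier A" "(\<lambda>n. nrm A ((\<Oplus>i\<in>{..<n}. x i) \<ominus> y)) \<longlonglongrightarrow> 0"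
proof -
  define s where "s n = (\<Oplus>i\<in>{..<n}. x i)" for n
  have sc: "s n \<in> carrier A" for n unfolding s_def using x by (intro finsum_closed) auto
  have s: "s (Suc n) = x n \<oplus> s n" for n
    unfolding s_def lessThan_Suc using x by (subst finsum_insert) auto
  have step: "nrm A (s m \<ominus> s n) \<le> sum b {..<m} - sum b {..<n}" if "n \<le> m" for m n
    using that
  proof (induction m rule: dec_induct)
    case base
    then show ?case using sc by (simp add: a_minus_def r_neg nrm_zero)
  next
    case (step m)
    have "s (Suc m) \<ominus> s n = x m \<oplus> (s m \<ominus> s n)" using sc x by (simp add: s a_minus_def a_assoc)
    then show ?case using nrm_triangle[of "x m" "s m \<ominus> s n"] x(1,2)[of m] sc step by simp
  qed
  have "\<exists>y\<in>carrier A. (\<lambda>n. nrm A (s n \<ominus> y)) \<longlonglongrightarrow> 0"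
  proof (rule complete[OF sc], intro allI impI)
    fix e :: real assume "0 < e"
    moreover have "Cauchy (\<lambda>n. sum b {..<n})"
      using b by (simp add: summable_iff_convergent Cauchy_convergent_iff)
    ultimately obtain M where M: "\<And>m n. M \<le> m \<Longrightarrow> M \<le> n \<Longrightarrow> \<bar>sum b {..<m} - sum b {..<n}\<bar> < e"
      unfolding Cauchy_def dist_real_def by blast
    have "nrm A (s m \<ominus> s n) < e" if "M \<le> m" "M \<le> n" for m n
    proof (cases "n \<le> m")
      case True
      then show ?thesis using step[of n m] M[OF that] by linarith
    next
      case False
      then show ?thesis using step[of m n] M[OF that] nrm_minus_commute[OF sc sc, of m n] by linarith
    qed
    then show "\<exists>M. \<forall>m\<ge>M. \<forall>n\<ge>M. nrm A (s m \<ominus> s n) < e" by blast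
  qed
  then show ?thesis using that by (auto simp: s_def)
qed

text \<open>The inverse of \<open>1 - k\<close> by the Neumann series.\<close>

lemma neumann:
  assumes k: "k \<in> carrier A" "adj A k = k" "nrm A k < 1"
    and h: "h \<in> carrier A" "h \<otimes> k = k \<otimes> h"
  obtains y where "y \<in> carrier A" "adj A y = y" "h \<otimes> y = y \<otimes> h" "y \<otimes> (\<one> \<ominus> k) = \<one>"
proof -
  note fh = free_hom_poly1[OF k(1)] note cs = cstar_seminorm_free_hom[OF fh]
  let ?X = "fgen () :: unit free_star"
  define p where "p n = (\<Sum>i<n. ?X ^ i)" for n
  have "nrm A (poly1 k (?X ^ n)) \<le> nrm A k ^ n" for n
    using cs_power_le[OF cs, of ?X n] cs_one[OF cs] by (auto simp: poly1_X k)
  from series_converges[OF fh_closed[OF fh] this summable_geometric] k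
  obtain y where y: "y \<in> carrier A" and "(\<lambda>n. nrm A ((\<Oplus>i\<in>{..<n}. poly1 k (?X ^ i)) \<ominus> y)) \<longlonglongrightarrow> 0"
    using nrm_nonneg[OF k(1)] by (auto simp: abs_of_nonneg)
  then have lim: "(\<lambda>n. nrm A (poly1 k (p n) \<ominus> y)) \<longlonglongrightarrow> 0" by (simp add: p_def fh_sum[OF fh])
  have pc: "poly1 k (p n) \<in> carrier A" for n by (rule fh_closed[OF fh])
  have const: "(\<lambda>n::nat. nrm A (x \<ominus> x)) \<longlonglongrightarrow> 0" if "x \<in> carrier A" for x
    using that by (simp add: a_minus_def r_neg nrm_zero)
  show ?thesis
  proof (rule that[OF y])
    have a: "adj A (poly1 k (p n)) = poly1 k (p n)" for n
    proof (induction n)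
      case (Suc n)
      have X: "adj A (poly1 k (?X ^ i)) = poly1 k (?X ^ i)" for i
      proof (induction i)
        case (Suc i)
        have "adj A (poly1 k (?X ^ Suc i)) = adj A (poly1 k (?X ^ i) \<otimes> k)"
          by (simp add: power_Suc2 fh_mult[OF fh] poly1_X k del: power_Suc)
        also have "\<dots> = poly1 k (?X ^ Suc i)"
          using Suc fh_closed[OF fh] by (simp add: adj_mult k fh_mult[OF fh] poly1_X)
        finally show ?case .
      qed (simp add: fh_one[OF fh] adj_one)
      show ?case using Suc X fh_closed[OF fh] by (simp add: p_def fh_add[OF fh] adj_add)
    qed (simp add: p_def fh_zero[OF fh] adj_zero)
    show "adj A y = y"
      by (rule lim_unique[OF pc adj_closed[OF y] y _ lim]) (use lim_adj[OF pc y lim] in \<open>simp add: a\<close>)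
    have c: "h \<otimes> poly1 k (p n) = poly1 k (p n) \<otimes> h" for n
      by (rule commute_eval) (simp_all add: k h)
    have hc: "h \<otimes> poly1 k (p n) \<in> carrier A" for n using h pc by simp
    show "h \<otimes> y = y \<otimes> h"
    proof (rule lim_unique[OF hc])
      show "(\<lambda>n. nrm A (h \<otimes> poly1 k (p n) \<ominus> h \<otimes> y)) \<longlonglongrightarrow> 0"
        by (rule lim_mult[OF h(1) pc h(1) y const[OF h(1)] lim])
      show "(\<lambda>n. nrm A (h \<otimes> poly1 k (p n) \<ominus> y \<otimes> h)) \<longlonglongrightarrow> 0"
        unfolding c by (rule lim_mult[OF pc h(1) y h(1) lim const[OF h(1)]])
    qed (simp_all add: h y)
    have "p n * (1 - ?X) = 1 - ?X ^ n" for n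
    proof (induction n)
      case (Suc n)
      have "p (Suc n) * (1 - ?X) = p n * (1 - ?X) + ?X ^ n * (1 - ?X)" by (simp add: p_def distrib_right)
      then show ?case unfolding Suc by (simp add: right_diff_distrib power_commutes)
    qed (simp add: p_def)
    then have tele: "poly1 k (p n) \<otimes> (\<one> \<ominus> k) = \<one> \<ominus> poly1 k (?X ^ n)" for n
      using fh_mult[OF fh, of "p n" "1 - ?X"] by (simp add: fh_minus[OF fh] fh_one[OF fh] poly1_X k)
    have kc: "\<one> \<ominus> k \<in> carrier A" using k by simp
    show "y \<otimes> (\<one> \<ominus> k) = \<one>"
    proof (rule lim_unique[OF m_closed[OF pc kc]])
      show "(\<lambda>n. nrm A (poly1 k (p n) \<otimes> (\<one> \<ominus> k) \<ominus> y \<otimes> (\<one> \<ominus> k))) \<longlonglongrightarrow> 0"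
        by (rule lim_mult[OF pc kc y kc lim const[OF kc]])
      have "nrm A (\<one> \<ominus> poly1 k (?X ^ n) \<ominus> \<one>) = nrm A (poly1 k (?X ^ n))" for n
      proof -
        have "\<one> \<ominus> poly1 k (?X ^ n) \<ominus> \<one> = \<ominus> poly1 k (?X ^ n)"
          using fh_closed[OF fh] by (simp add: a_minus_def a_comm[of \<one>] a_assoc r_neg)
        then show ?thesis by (simp add: nrm_uminus fh_closed[OF fh])
      qed
      moreover have "(\<lambda>n. nrm A (poly1 k (?X ^ n))) \<longlonglongrightarrow> 0"
      proof (rule Lim_null_comparison)
        show "\<forall>\<^sub>F n in sequentially. norm (nrm A (poly1 k (?X ^ n))) \<le> nrm A k ^ n"
          using \<open>\<And>n. nrm A (poly1 k (?X ^ n)) \<le> nrm A k ^ n\<close> by (simp add: nrm_nonneg fh_closed[OF fh])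
        show "(\<lambda>n. nrm A k ^ n) \<longlonglongrightarrow> 0" by (rule LIMSEQ_realpow_zero) (use k nrm_nonneg in auto)
      qed
      ultimately show "(\<lambda>n. nrm A (poly1 k (p n) \<otimes> (\<one> \<ominus> k) \<ominus> \<one>)) \<longlonglongrightarrow> 0" by (simp add: tele)
    qed (simp_all add: kc y)
  qed
qed

end

section \<open>Automatic continuity and closed range of *-homomorphisms\<close>

text \<open>If \<open>\<parallel>f h\<parallel> = s\<close> exceeds \<open>\<parallel>h\<parallel>\<close> for a self-adjoint \<open>h\<close>, then \<open>1 - h\<^sup>2 / s\<^sup>2\<close> is invertible by the Neumann series,
  although its image vanishes at a spectral value of \<open>f h\<close>.\<close>

lemma cstar_hom_contractive:
  assumes f: "f \<in> cstar_hom A B" and A: "cstar_algebra A" and B: "cstar_algebra B" and x: "x \<in> carrier A"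
  shows "nrm B (f x) \<le> nrm A x"
proof -
  interpret A: cstar_algebra A by fact
  interpret B: cstar_algebra B by fact
  note hom = cstar_homD[OF f] note hom0 = cstar_hom_minus_zero[OF f A B]
  have sa: "nrm B (f h) \<le> nrm A h" if h: "h \<in> carrier A" "adj A h = h" for h
  proof (rule ccontr)
    assume "\<not> nrm B (f h) \<le> nrm A h"
    then have less: "nrm A h < nrm B (f h)" by simp
    define s where "s = nrm B (f h)"
    have s: "0 < s" using less A.nrm_nonneg[OF h(1)] by (simp add: s_def)
    have one: "\<one>\<^bsub>B\<^esub> \<noteq> \<zero>\<^bsub>B\<^esub>" using B.nrm_trivial[of "f h"] hom(1)[OF h(1)] s by (auto simp: s_def)
    define c where "c = complex_of_real (1 / s\<^sup>2)"
    define k where "k = c \<odot>\<^bsub>A\<^esub> (h \<otimes>\<^bsub>A\<^esub> h)"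
    have k: "k \<in> carrier A" using h by (simp add: k_def A.smult_closed)
    have "nrm A (h \<otimes>\<^bsub>A\<^esub> h) = (nrm A h)\<^sup>2" using A.cstar_identity[OF h(1)] h by simp
    then have "nrm A k = (nrm A h)\<^sup>2 / s\<^sup>2" using h s by (simp add: k_def A.nrm_smult c_def norm_divide norm_power)
    also have "\<dots> < 1" using less A.nrm_nonneg[OF h(1)] s by (simp add: s_def power_strict_mono)
    finally have k1: "nrm A k < 1" .
    have "adj A k = k" using h by (simp add: k_def A.adj_smult A.adj_mult c_def)
    moreover have "h \<otimes>\<^bsub>A\<^esub> k = k \<otimes>\<^bsub>A\<^esub> h" using h by (simp add: k_def A.smult_mult_left A.smult_mult_right A.m_assoc)
    ultimately obtain y where y: "y \<in> carrier A" "adj A y = y" "h \<otimes>\<^bsub>A\<^esub> y = y \<otimes>\<^bsub>A\<^esub> h"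
      "y \<otimes>\<^bsub>A\<^esub> (\<one>\<^bsub>A\<^esub> \<ominus>\<^bsub>A\<^esub> k) = \<one>\<^bsub>A\<^esub>" using A.neumann[OF k _ k1 h(1)] by blast
    define g where "g b = (if b then f h else f y)" for b
    have gc: "g b \<in> carrier B" for b using hom(1) h y by (simp add: g_def)
    have ga: "adj B (g b) = g b" for b using hom(6)[of h] hom(6)[of y] h y by (simp add: g_def)
    have gg: "g b \<otimes>\<^bsub>B\<^esub> g b' = g b' \<otimes>\<^bsub>B\<^esub> g b" for b b'
      using hom(3)[of h y] hom(3)[of y h] h y by (simp add: g_def)
    note fh = B.free_hom_eval[of g, OF gc]
    obtain t where t: "\<And>q. cmod (real_eval t q) \<le> nrm B (eval B g q)"
      "cmod (real_eval t (fgen True)) = nrm B (eval B g (fgen True))"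
      using B.joint_spectral_value[of g, OF gc ga gg one] by metis
    let ?q = "fgen False * (1 - fconst c * (fgen True * fgen True)) - 1"
    have "eval B g ?q = f y \<otimes>\<^bsub>B\<^esub> (\<one>\<^bsub>B\<^esub> \<ominus>\<^bsub>B\<^esub> c \<odot>\<^bsub>B\<^esub> (f h \<otimes>\<^bsub>B\<^esub> f h)) \<ominus>\<^bsub>B\<^esub> \<one>\<^bsub>B\<^esub>"
      using hom(1) h y B.eval_fgen[of g, OF gc]
      by (simp add: B.fh_minus[OF fh] B.fh_mult[OF fh] B.fh_one[OF fh] B.fh_const[OF fh] B.smult_mult_left)
        (simp add: g_def B.smult_mult_left)
    also have "f y \<otimes>\<^bsub>B\<^esub> (\<one>\<^bsub>B\<^esub> \<ominus>\<^bsub>B\<^esub> c \<odot>\<^bsub>B\<^esub> (f h \<otimes>\<^bsub>B\<^esub> f h)) = f (y \<otimes>\<^bsub>A\<^esub> (\<one>\<^bsub>A\<^esub> \<ominus>\<^bsub>A\<^esub> k))"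
      using h(1) y(1) k by (simp add: hom hom0 k_def A.smult_closed)
    also have "\<dots> = \<one>\<^bsub>B\<^esub>" by (simp only: y(4) hom(4))
    finally have "eval B g ?q = \<zero>\<^bsub>B\<^esub>" by (simp add: a_minus_def B.r_neg)
    then have "real_eval t ?q = 0" using t(1)[of ?q] by (simp add: B.nrm_zero)
    then have eq: "of_real (t False) * (1 - c * (of_real (t True) * of_real (t True))) = 1"
      by (simp add: complex_eval_simps)
    have "\<bar>t True\<bar> = s" using t(2) B.eval_fgen[of g, OF gc] by (simp add: complex_eval_simps s_def g_def)
    then have "t True * t True = s\<^sup>2" by (metis abs_mult_self power2_eq_square)
    then have "c * (of_real (t True) * of_real (t True)) = 1"
      using s by (simp add: c_def flip: of_real_mult)
    with eq show False by simp
  qed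
  have "(nrm B (f x))\<^sup>2 = nrm B (f (adj A x \<otimes>\<^bsub>A\<^esub> x))"
    using B.cstar_identity[of "f x"] x by (simp add: hom A.adj_closed)
  also have "\<dots> \<le> nrm A (adj A x \<otimes>\<^bsub>A\<^esub> x)"
    using x by (intro sa) (simp_all add: A.adj_closed A.adj_mult A.adj_adj)
  also have "\<dots> = (nrm A x)\<^sup>2" by (rule A.cstar_identity[OF x])
  finally show ?thesis using A.nrm_nonneg[OF x] power2_le_imp_le by blast
qed

text \<open>The polynomials \<open>(1 - t\<^sup>2 / n)\<^sup>n\<close>, applied to \<open>h = a\<^sup>* a\<close>, serve as cut-off functions: multiplying \<open>a\<close> by
  them bounds its norm by \<open>1\<close> and changes \<open>f a\<close> little, because \<open>f h\<close> is small.\<close>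

lemma cutoff_estimates:
  fixes t :: real and n :: nat
  assumes t: "t\<^sup>2 \<le> real n" and n: "0 < n"
  defines "g \<equiv> (1 - t\<^sup>2 / real n) ^ n"
  shows "0 \<le> g" "\<bar>t\<bar> * g\<^sup>2 \<le> 1" "0 \<le> 1 - g" "1 - g \<le> t\<^sup>2"
proof -
  define z where "z = t\<^sup>2 / real n"
  have z: "0 \<le> z" "z \<le> 1" "real n * z = t\<^sup>2" using t n by (simp_all add: z_def)
  have gz: "g = (1 - z) ^ n" by (simp add: g_def z_def)
  show g0: "0 \<le> g" using z by (simp add: gz)
  have "(1 + real n * z) \<le> (1 + z) ^ n" by (rule Bernoulli_inequality) (use z in simp)
  then have "g * (1 + t\<^sup>2) \<le> (1 - z) ^ n * (1 + z) ^ n"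
    unfolding gz z(3)[symmetric] using z by (intro mult_left_mono) auto
  also have "\<dots> = (1 - z * z) ^ n" by (simp add: algebra_simps flip: power_mult_distrib)
  also have "\<dots> \<le> 1" using z by (intro power_le_one) (auto simp: mult_le_one)
  finally have g1: "g * (1 + t\<^sup>2) \<le> 1" .
  have "\<bar>t\<bar> \<le> 1 + t\<^sup>2" using zero_le_power2[of "\<bar>t\<bar> - 1"] zero_le_power2[of t] by (simp add: power2_diff)
  then have "\<bar>t\<bar> * g \<le> (1 + t\<^sup>2) * g" using g0 by (rule mult_right_mono)
  then have tg: "\<bar>t\<bar> * g \<le> 1" using g1 by (simp add: mult.commute)
  have g1': "g \<le> 1" using z by (simp add: gz power_le_one)
  have "(\<bar>t\<bar> * g) * g \<le> 1 * 1" using tg g1' g0 by (intro mult_mono) auto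
  then show "\<bar>t\<bar> * g\<^sup>2 \<le> 1" by (simp add: power2_eq_square)
  show "0 \<le> 1 - g" using g1' by simp
  have "1 + real n * (- z) \<le> (1 + (- z)) ^ n" by (rule Bernoulli_inequality) (use z in simp)
  then show "1 - g \<le> t\<^sup>2" using z(3) by (simp add: gz)
qed

lemma cstar_hom_cutoff:
  assumes f: "f \<in> cstar_hom A B" and A: "cstar_algebra A" and B: "cstar_algebra B"
    and a: "a \<in> carrier A" and small: "nrm B (f a) \<le> 1 / 2"
  obtains a' where "a' \<in> carrier A" "nrm A a' \<le> 1" "nrm B (f a \<ominus>\<^bsub>B\<^esub> f a') \<le> 1 / 16"
proof -
  interpret A: cstar_algebra A by fact
  interpret B: cstar_algebra B by fact
  note hom = cstar_homD[OF f] note hom0 = cstar_hom_minus_zero[OF f A B]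
  let ?X = "fgen () :: unit free_star"
  define h where "h = adj A a \<otimes>\<^bsub>A\<^esub> a"
  have h: "h \<in> carrier A" "adj A h = h" using a by (simp_all add: h_def A.adj_closed A.adj_mult A.adj_adj)
  have fh: "f h \<in> carrier B" "adj B (f h) = f h" using hom(1)[OF h(1)] hom(6)[OF h(1)] h by auto
  have fh_eq: "f h = adj B (f a) \<otimes>\<^bsub>B\<^esub> f a" using a by (simp add: h_def hom A.adj_closed)
  obtain n0 :: nat where "(nrm A h)\<^sup>2 \<le> real n0" using real_arch_simple by blast
  then obtain n :: nat where n: "(nrm A h)\<^sup>2 \<le> real n" "0 < n" using that[of "Suc n0"]
    by (metis le_SucI of_nat_le_iff order_trans zero_less_Suc le_refl)
  define g where "g = (1 - fconst (of_real (1 / real n)) * (?X * ?X)) ^ n"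
  have ev: "real_eval (\<lambda>_. t) g = of_real ((1 - t\<^sup>2 / real n) ^ n)" for t
    by (simp add: g_def complex_eval_simps power2_eq_square)
  note FA = A.free_hom_poly1[OF h(1)] note FB = B.free_hom_poly1[OF fh(1)]
  let ?G = "eval A (\<lambda>_. h) g"
  have GA: "?G \<in> carrier A" by (rule A.fh_closed[OF FA])
  have fG: "f ?G = eval B (\<lambda>_. f h) g" by (rule cstar_hom_eval[OF f A B h(1)])
  show ?thesis
  proof (rule that[of "a \<otimes>\<^bsub>A\<^esub> ?G"])
    show "a \<otimes>\<^bsub>A\<^esub> ?G \<in> carrier A" using a GA by simp
    have "(nrm A (a \<otimes>\<^bsub>A\<^esub> ?G))\<^sup>2 = nrm A (adj A ?G \<otimes>\<^bsub>A\<^esub> h \<otimes>\<^bsub>A\<^esub> ?G)"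
      using A.cstar_identity[of "a \<otimes>\<^bsub>A\<^esub> ?G"] a GA by (simp add: A.adj_mult A.adj_closed A.m_assoc h_def)
    also have "\<dots> = nrm A (eval A (\<lambda>_. h) (fadj g * ?X * g))"
      by (simp add: A.fh_mult[OF FA] A.fh_adj[OF FA] A.poly1_X h)
    also have "\<dots> \<le> 1"
    proof (rule A.nrm_poly1_le[OF h])
      fix t :: real assume "\<bar>t\<bar> \<le> nrm A h"
      then have "t\<^sup>2 \<le> real n" using n(1) power_mono[of "\<bar>t\<bar>" "nrm A h" 2] by simp
      note c = cutoff_estimates[OF this n(2)]
      have "cmod (real_eval (\<lambda>_. t) (fadj g * ?X * g)) = \<bar>t\<bar> * ((1 - t\<^sup>2 / real n) ^ n)\<^sup>2"
        by (simp only: complex_eval_simps ev complex_cnj_complex_of_real norm_mult norm_of_real power2_eq_square abs_of_nonneg[OF c(1)[unfolded power2_eq_square]] mult_ac)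
      then show "cmod (real_eval (\<lambda>_. t) (fadj g * ?X * g)) \<le> 1" using c(2) by simp
    qed simp
    finally show "nrm A (a \<otimes>\<^bsub>A\<^esub> ?G) \<le> 1" using abs_square_le_1 A.nrm_nonneg[of "a \<otimes>\<^bsub>A\<^esub> ?G"] a GA by fastforce
    let ?H = "eval B (\<lambda>_. f h) (1 - g)"
    have HB: "?H \<in> carrier B" by (rule B.fh_closed[OF FB])
    have "f a \<ominus>\<^bsub>B\<^esub> f (a \<otimes>\<^bsub>A\<^esub> ?G) = f a \<otimes>\<^bsub>B\<^esub> ?H"
      using a GA hom(1)[OF a] B.fh_closed[OF FB, of g]
      by (simp add: hom(3) fG B.fh_minus[OF FB] B.fh_one[OF FB] a_minus_def B.r_distr B.r_minus)
    then have "(nrm B (f a \<ominus>\<^bsub>B\<^esub> f (a \<otimes>\<^bsub>A\<^esub> ?G)))\<^sup>2 = nrm B (adj B ?H \<otimes>\<^bsub>B\<^esub> f h \<otimes>\<^bsub>B\<^esub> ?H)"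
      using B.cstar_identity[of "f a \<otimes>\<^bsub>B\<^esub> ?H"] hom(1)[OF a] HB
      by (simp add: B.adj_mult B.adj_closed B.m_assoc fh_eq)
    also have "\<dots> = nrm B (eval B (\<lambda>_. f h) (fadj (1 - g) * ?X * (1 - g)))"
      using B.fh_mult[OF FB] B.fh_adj[OF FB] B.poly1_X[OF fh(1)] by metis
    also have "\<dots> \<le> (1 / 16)\<^sup>2"
    proof (rule B.nrm_poly1_le[OF fh])
      fix t :: real assume t: "\<bar>t\<bar> \<le> nrm B (f h)"
      have "nrm B (f h) = (nrm B (f a))\<^sup>2" unfolding fh_eq by (rule B.cstar_identity[OF hom(1)[OF a]])
      also have "\<dots> \<le> (1 / 2)\<^sup>2" using small B.nrm_nonneg[OF hom(1)[OF a]] by (rule power_mono)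
      finally have t4: "\<bar>t\<bar> \<le> 1 / 4" using t by (simp add: power2_eq_square)
      then have t16: "t\<^sup>2 \<le> 1 / 16" using power_mono[of "\<bar>t\<bar>" "1 / 4" 2] by (simp add: power2_eq_square)
      moreover have "1 \<le> real n" using n(2) by simp
      ultimately have "t\<^sup>2 \<le> real n" by linarith
      note c = cutoff_estimates[OF this n(2)]
      let ?d = "1 - (1 - t\<^sup>2 / real n) ^ n"
      have "real_eval (\<lambda>_. t) (1 - g) = of_real ?d" by (simp add: complex_eval_simps ev)
      then have "cmod (real_eval (\<lambda>_. t) (fadj (1 - g) * ?X * (1 - g))) = \<bar>t\<bar> * (?d * ?d)"
        using c(3) by (simp only: complex_eval_simps(2,4,5) complex_cnj_complex_of_real norm_mult norm_of_real abs_of_nonneg mult_ac)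
      also have "\<dots> \<le> 1 * (1 / 16 * (1 / 16))"
        using c(3,4) t16 t4 by (intro mult_mono) auto
      finally show "cmod (real_eval (\<lambda>_. t) (fadj (1 - g) * ?X * (1 - g))) \<le> (1 / 16)\<^sup>2"
        by (simp add: power2_eq_square)
    qed simp
    finally show "nrm B (f a \<ominus>\<^bsub>B\<^esub> f (a \<otimes>\<^bsub>A\<^esub> ?G)) \<le> 1 / 16"
      by (rule power2_le_imp_le) simp
  qed
qed

text \<open>A *-homomorphism with dense range is surjective: elements of the range can be lifted, up to a
  small error, with control of the norm, and then one sums a geometric series of lifts.\<close>

theorem cstar_hom_surjective:
  assumes f: "f \<in> cstar_hom A B" and A: "cstar_algebra A" and B: "cstar_algebra B"
    and dense: "\<And>b e. b \<in> carrier B \<Longrightarrow> 0 < e \<Longrightarrow> \<exists>a\<in>carrier A. nrm B (b \<ominus>\<^bsub>B\<^esub> f a) < e"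
  shows "f ` carrier A = carrier B"
proof
  interpret A: cstar_algebra A by fact
  interpret B: cstar_algebra B by fact
  note hom = cstar_homD[OF f] note hom0 = cstar_hom_minus_zero[OF f A B]
  show "f ` carrier A \<subseteq> carrier B" using hom(1) by blast
  have lift: "\<exists>a. a \<in> carrier A \<and> nrm A a \<le> 4 * r \<and> nrm B (b \<ominus>\<^bsub>B\<^esub> f a) \<le> r / 2"
    if b: "b \<in> carrier B" "nrm B b \<le> r" "0 < r" for b r
  proof -
    define c where "c = complex_of_real (1 / (4 * r))"
    define b' where "b' = c \<odot>\<^bsub>B\<^esub> b"
    have b': "b' \<in> carrier B" using b by (simp add: b'_def B.smult_closed)
    have nb': "nrm B b' \<le> 1 / 4" using b by (simp add: b'_def B.nrm_smult c_def norm_divide norm_mult field_simps)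
    obtain a where a: "a \<in> carrier A" "nrm B (b' \<ominus>\<^bsub>B\<^esub> f a) < 1 / 16" using dense[OF b', of "1 / 16"] by auto
    have fa: "f a \<in> carrier B" using hom(1) a by blast
    have "nrm B (f a) \<le> 1 / 2" using B.nrm_abs_diff[OF b' fa] nb' a(2) by linarith
    from cstar_hom_cutoff[OF f A B a(1) this] obtain a' where a': "a' \<in> carrier A" "nrm A a' \<le> 1"
      "nrm B (f a \<ominus>\<^bsub>B\<^esub> f a') \<le> 1 / 16" by blast
    have fa': "f a' \<in> carrier B" using hom(1) a' by blast
    define d where "d = complex_of_real (4 * r)"
    have dc: "d \<odot>\<^bsub>B\<^esub> b' = b"
      using b by (simp add: b'_def d_def c_def B.smult_one flip: B.smult_smult of_real_mult)
    have nd: "cmod d = 4 * r" using b(3) by (simp add: d_def norm_mult)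
    have "nrm B (b' \<ominus>\<^bsub>B\<^esub> f a') \<le> 1 / 8" using B.nrm_triangle3[OF b' fa fa'] a(2) a'(3) by linarith
    moreover have "b \<ominus>\<^bsub>B\<^esub> f (d \<odot>\<^bsub>A\<^esub> a') = d \<odot>\<^bsub>B\<^esub> (b' \<ominus>\<^bsub>B\<^esub> f a')"
      by (simp add: hom(5)[OF a'(1)] B.smult_diff_right b' fa' dc)
    ultimately have "nrm B (b \<ominus>\<^bsub>B\<^esub> f (d \<odot>\<^bsub>A\<^esub> a')) \<le> r / 2"
      using b(3) b' fa' by (simp add: B.nrm_smult nd)
    moreover have "nrm A (d \<odot>\<^bsub>A\<^esub> a') \<le> 4 * r" using a' b(3) by (simp add: A.nrm_smult nd)
    ultimately show ?thesis using a' by (intro exI[of _ "d \<odot>\<^bsub>A\<^esub> a'"]) (simp add: A.smult_closed)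
  qed
  define pick where "pick b r = (SOME a. a \<in> carrier A \<and> nrm A a \<le> 4 * r \<and> nrm B (b \<ominus>\<^bsub>B\<^esub> f a) \<le> r / 2)" for b r
  have pick: "pick b r \<in> carrier A" "nrm A (pick b r) \<le> 4 * r" "nrm B (b \<ominus>\<^bsub>B\<^esub> f (pick b r)) \<le> r / 2"
    if "b \<in> carrier B" "nrm B b \<le> r" "0 < r" for b r
    using someI_ex[OF lift[OF that]] unfolding pick_def by auto
  show "carrier B \<subseteq> f ` carrier A"
  proof
    fix b assume b: "b \<in> carrier B"
    define r where "r n = (nrm B b + 1) * (1 / 2) ^ n" for n :: nat
    define rest where "rest = rec_nat b (\<lambda>n c. c \<ominus>\<^bsub>B\<^esub> f (pick c (r n)))"
    have rest0: "rest 0 = b" and restS: "rest (Suc n) = rest n \<ominus>\<^bsub>B\<^esub> f (pick (rest n) (r n))" for n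
      by (simp_all add: rest_def)
    have rpos: "0 < r n" and rS: "r (Suc n) = r n / 2" for n
      using B.nrm_nonneg[OF b] by (simp_all add: r_def)
    have inv: "rest n \<in> carrier B \<and> nrm B (rest n) \<le> r n" for n
    proof (induction n)
      case 0
      then show ?case using b by (simp add: rest0 r_def)
    next
      case (Suc n)
      then show ?case using pick[of "rest n" "r n"] rpos hom(1) by (simp add: restS rS)
    qed
    define a where "a n = pick (rest n) (r n)" for n
    have a: "a n \<in> carrier A" "nrm A (a n) \<le> 4 * r n" for n
      using pick[of "rest n" "r n"] inv[of n] rpos[of n] by (simp_all add: a_def)
    have "summable (\<lambda>n. 4 * r n)" unfolding r_def by (intro summable_mult summable_geometric) simp
    from A.series_converges[OF a this] obtain y where y: "y \<in> carrier A"
      and lim: "(\<lambda>n. nrm A ((\<Oplus>\<^bsub>A\<^esub>i\<in>{..<n}. a i) \<ominus>\<^bsub>A\<^esub> y)) \<longlonglongrightarrow> 0" by blast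
    let ?s = "\<lambda>n. \<Oplus>\<^bsub>A\<^esub>i\<in>{..<n}. a i"
    have sc: "?s n \<in> carrier A" for n using a by (intro A.finsum_closed) auto
    have fs: "f (?s n) \<in> carrier B" for n using hom(1) sc by blast
    have s: "b \<ominus>\<^bsub>B\<^esub> f (?s n) = rest n" for n
    proof (induction n)
      case 0
      then show ?case using b by (simp add: rest0 hom0 a_minus_def)
    next
      case (Suc n)
      have fa: "f (a n) \<in> carrier B" using hom(1) a by blast
      have "?s (Suc n) = a n \<oplus>\<^bsub>A\<^esub> ?s n" unfolding lessThan_Suc using a by (subst A.finsum_insert) auto
      then have "b \<ominus>\<^bsub>B\<^esub> f (?s (Suc n)) = (b \<ominus>\<^bsub>B\<^esub> f (?s n)) \<ominus>\<^bsub>B\<^esub> f (a n)"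
        using b fs[of n] fa by (simp add: hom(2) a sc a_minus_def B.minus_add B.a_ac)
      also have "\<dots> = rest n \<ominus>\<^bsub>B\<^esub> f (a n)" unfolding Suc ..
      also have "\<dots> = rest (Suc n)" unfolding restS a_def ..
      finally show ?case .
    qed
    have fy: "f y \<in> carrier B" using hom(1) y by blast
    have "(\<lambda>n. nrm B (f (?s n) \<ominus>\<^bsub>B\<^esub> f y)) \<longlonglongrightarrow> 0"
    proof (rule Lim_null_comparison[OF _ lim], intro always_eventually allI)
      fix n
      show "norm (nrm B (f (?s n) \<ominus>\<^bsub>B\<^esub> f y)) \<le> nrm A (?s n \<ominus>\<^bsub>A\<^esub> y)"
        using cstar_hom_contractive[OF f A B, of "?s n \<ominus>\<^bsub>A\<^esub> y"] sc y fs fy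
        by (simp add: hom0 B.nrm_nonneg)
    qed
    moreover have "(\<lambda>n. nrm B (f (?s n) \<ominus>\<^bsub>B\<^esub> b)) \<longlonglongrightarrow> 0"
    proof (rule Lim_null_comparison)
      show "\<forall>\<^sub>F n in sequentially. norm (nrm B (f (?s n) \<ominus>\<^bsub>B\<^esub> b)) \<le> r n"
        using inv b fs by (simp add: B.nrm_minus_commute[OF fs b] s B.nrm_nonneg)
      have "(\<lambda>n. (1 / 2 :: real) ^ n) \<longlonglongrightarrow> 0" by (rule LIMSEQ_realpow_zero) auto
      then show "r \<longlonglongrightarrow> 0" unfolding r_def by (rule tendsto_mult_right_zero)
    qed
    ultimately have "f y = b" by (intro B.lim_unique[OF fs fy b])
    then show "b \<in> f ` carrier A" using y by blast
  qed
qed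

section \<open>Matrices over a C*-algebra\<close>

type_synonym 'a mat = "nat \<Rightarrow> nat \<Rightarrow> 'a"

text \<open>Square matrices over \<open>A\<close> with rows and columns indexed by \<open>I\<close>, extended by zero so that
  matrix identities are equalities of functions.\<close>

definition cmat :: "'a cstar \<Rightarrow> nat set \<Rightarrow> 'a mat set" where
  "cmat A I = {a. \<forall>i j. a i j \<in> carrier A \<and> (i \<notin> I \<or> j \<notin> I \<longrightarrow> a i j = \<zero>\<^bsub>A\<^esub>)}"

text \<open>Matrix product and identity matrix.\<close>

definition mmul :: "'a cstar \<Rightarrow> nat set \<Rightarrow> 'a mat \<Rightarrow> 'a mat \<Rightarrow> 'a mat" where
  "mmul A I a b i j = (\<Oplus>\<^bsub>A\<^esub>k\<in>I. a i k \<otimes>\<^bsub>A\<^esub> b k j)"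

definition mone :: "'a cstar \<Rightarrow> nat set \<Rightarrow> 'a mat" where
  "mone A I i j = (if i \<in> I \<and> i = j then \<one>\<^bsub>A\<^esub> else \<zero>\<^bsub>A\<^esub>)"

abbreviation (input) tpose :: "'a mat \<Rightarrow> 'a mat" where
  "tpose a \<equiv> \<lambda>i j. a j i"

text \<open>A real matrix, viewed as a matrix of scalar multiples of the unit.\<close>

definition smat :: "'a cstar \<Rightarrow> nat set \<Rightarrow> (nat \<Rightarrow> nat \<Rightarrow> real) \<Rightarrow> 'a mat" where
  "smat A I F i j = (if i \<in> I \<and> j \<in> I then complex_of_real (F i j) \<odot>\<^bsub>A\<^esub> \<one>\<^bsub>A\<^esub> else \<zero>\<^bsub>A\<^esub>)"

text \<open>The block matrix with blocks \<open>1\<close> and \<open>w\<close>.\<close>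

definition blk :: "'a cstar \<Rightarrow> 'a mat \<Rightarrow> 'a mat" where
  "blk A w i j = (if i = 0 \<and> j = 0 then \<one>\<^bsub>A\<^esub> else w i j)"

text \<open>Matrices with self-adjoint entries that are inverse to their transpose.\<close>

definition orth :: "'a cstar \<Rightarrow> nat set \<Rightarrow> 'a mat \<Rightarrow> bool" where
  "orth A I u \<longleftrightarrow> u \<in> cmat A I \<and> (\<forall>i j. adj A (u i j) = u i j) \<and>
     mmul A I u (tpose u) = mone A I \<and> mmul A I (tpose u) u = mone A I"

lemma cmatD: "a \<in> cmat A I \<Longrightarrow> a i j \<in> carrier A"
  and cmat_outside: "a \<in> cmat A I \<Longrightarrow> i \<notin> I \<or> j \<notin> I \<Longrightarrow> a i j = \<zero>\<^bsub>A\<^esub>"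
  by (simp_all add: cmat_def)

lemma cmat_tpose: "a \<in> cmat A I \<Longrightarrow> tpose a \<in> cmat A I"
  by (auto simp: cmat_def)

context cstar_algebra
begin

lemma finsum_eqI:
  assumes "\<And>i. i \<in> I \<Longrightarrow> f i = g i" "\<And>i. i \<in> I \<Longrightarrow> g i \<in> carrier A"
  shows "(\<Oplus>i\<in>I. f i) = (\<Oplus>i\<in>I. g i)"
  by (rule finsum_cong') (use assms in auto)

lemma finsum_mem: "(\<And>i. i \<in> I \<Longrightarrow> f i \<in> carrier A) \<Longrightarrow> (\<Oplus>i\<in>I. f i) \<in> carrier A"
  by (rule finsum_closed) auto

lemma finsum_insert': "finite I \<Longrightarrow> i \<notin> I \<Longrightarrow> (\<And>j. j \<in> insert i I \<Longrightarrow> f j \<in> carrier A) \<Longrightarrow>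
    (\<Oplus>j\<in>insert i I. f j) = f i \<oplus> (\<Oplus>j\<in>I. f j)"
  by (rule finsum_insert) auto

lemma finsum_swap:
  assumes J: "finite J" and f: "\<And>i j. i \<in> I \<Longrightarrow> j \<in> J \<Longrightarrow> f i j \<in> carrier A"
  shows "(\<Oplus>i\<in>I. \<Oplus>j\<in>J. f i j) = (\<Oplus>j\<in>J. \<Oplus>i\<in>I. f i j)"
  using f
proof (induction I rule: infinite_finite_induct)
  case (insert i I)
  have fc: "\<And>i' j. i' \<in> insert i I \<Longrightarrow> j \<in> J \<Longrightarrow> f i' j \<in> carrier A" by (rule insert.prems)
  have IH: "(\<Oplus>i\<in>I. \<Oplus>j\<in>J. f i j) = (\<Oplus>j\<in>J. \<Oplus>i\<in>I. f i j)"
    by (rule insert.IH) (rule fc, simp)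
  have "(\<Oplus>i\<in>insert i I. \<Oplus>j\<in>J. f i j) = (\<Oplus>j\<in>J. f i j) \<oplus> (\<Oplus>i\<in>I. \<Oplus>j\<in>J. f i j)"
    using insert.hyps by (rule finsum_insert') (rule finsum_mem, rule fc)
  also have "\<dots> = (\<Oplus>j\<in>J. f i j \<oplus> (\<Oplus>i\<in>I. f i j))"
    unfolding IH by (rule finsum_addf[symmetric]) (auto intro!: finsum_mem fc)
  also have "\<dots> = (\<Oplus>j\<in>J. \<Oplus>i\<in>insert i I. f i j)"
  proof (rule finsum_eqI)
    fix j assume j: "j \<in> J"
    show "f i j \<oplus> (\<Oplus>i\<in>I. f i j) = (\<Oplus>i\<in>insert i I. f i j)"
      by (rule finsum_insert'[symmetric, OF insert.hyps]) (rule fc[OF _ j])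
    show "(\<Oplus>i\<in>insert i I. f i j) \<in> carrier A" by (rule finsum_mem) (rule fc[OF _ j])
  qed
  finally show ?case .
qed (simp_all add: finsum_infinite)

lemma finsum_zero': "(\<And>i. i \<in> I \<Longrightarrow> f i = \<zero>) \<Longrightarrow> (\<Oplus>i\<in>I. f i) = \<zero>"
  by (rule add.finprod_one_eqI)

lemma finsum_single:
  assumes "finite I" "i \<in> I" "x \<in> carrier A"
  shows "(\<Oplus>j\<in>I. if i = j then x else \<zero>) = x"
  using add.finprod_singleton[of i I "\<lambda>_. x"] assms by simp

lemma mmul_cmat:
  assumes "a \<in> cmat A I" "b \<in> cmat A I" shows "mmul A I a b \<in> cmat A I"
proof -
  have "mmul A I a b i j \<in> carrier A" for i j
    unfolding mmul_def by (rule finsum_mem) (simp add: cmatD[OF assms(1)] cmatD[OF assms(2)])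
  moreover have "mmul A I a b i j = \<zero>" if "i \<notin> I \<or> j \<notin> I" for i j
    unfolding mmul_def
  proof (rule finsum_zero')
    fix k
    have "a i k = \<zero> \<or> b k j = \<zero>" using that cmat_outside[OF assms(1)] cmat_outside[OF assms(2)] by blast
    then show "a i k \<otimes> b k j = \<zero>" using cmatD[OF assms(1), of i k] cmatD[OF assms(2), of k j] by auto
  qed
  ultimately show ?thesis by (simp add: cmat_def)
qed

lemma mmul_assoc:
  assumes I: "finite I" and a: "a \<in> cmat A I" and b: "b \<in> cmat A I" and c: "c \<in> cmat A I"
  shows "mmul A I (mmul A I a b) c = mmul A I a (mmul A I b c)"
proof (intro ext)
  fix i j
  note C = cmatD[OF a] cmatD[OF b] cmatD[OF c]
  have "mmul A I (mmul A I a b) c i j = (\<Oplus>k\<in>I. \<Oplus>l\<in>I. a i l \<otimes> b l k \<otimes> c k j)"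
    unfolding mmul_def
  proof (rule finsum_eqI)
    fix k
    show "(\<Oplus>l\<in>I. a i l \<otimes> b l k) \<otimes> c k j = (\<Oplus>l\<in>I. a i l \<otimes> b l k \<otimes> c k j)"
      by (rule finsum_ldistr[OF I]) (simp_all add: C)
  qed (rule finsum_mem, simp add: C)
  also have "\<dots> = (\<Oplus>l\<in>I. \<Oplus>k\<in>I. a i l \<otimes> b l k \<otimes> c k j)"
    by (rule finsum_swap[OF I]) (simp add: C)
  also have "\<dots> = mmul A I a (mmul A I b c) i j"
    unfolding mmul_def
  proof (rule finsum_eqI)
    fix l
    have "(\<Oplus>k\<in>I. a i l \<otimes> b l k \<otimes> c k j) = (\<Oplus>k\<in>I. a i l \<otimes> (b l k \<otimes> c k j))"
      by (simp add: C m_assoc)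
    also have "\<dots> = a i l \<otimes> (\<Oplus>k\<in>I. b l k \<otimes> c k j)"
      by (rule finsum_rdistr[OF I, symmetric]) (simp_all add: C)
    finally show "(\<Oplus>k\<in>I. a i l \<otimes> b l k \<otimes> c k j) = a i l \<otimes> (\<Oplus>k\<in>I. b l k \<otimes> c k j)" .
    show "a i l \<otimes> (\<Oplus>k\<in>I. b l k \<otimes> c k j) \<in> carrier A"
      by (rule m_closed[OF C(1) finsum_mem]) (simp add: C)
  qed
  finally show "mmul A I (mmul A I a b) c i j = mmul A I a (mmul A I b c) i j" .
qed

lemma mone_cmat: "mone A I \<in> cmat A I"
  unfolding cmat_def mone_def by simp

lemma mmul_one:
  assumes I: "finite I" and a: "a \<in> cmat A I"
  shows mmul_one_left: "mmul A I (mone A I) a = a" and mmul_one_right: "mmul A I a (mone A I) = a"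
proof -
  have "mmul A I (mone A I) a i j = a i j" for i j
  proof (cases "i \<in> I")
    case True
    have "mmul A I (mone A I) a i j = (\<Oplus>k\<in>I. if i = k then a i j else \<zero>)"
      unfolding mmul_def by (rule finsum_eqI) (simp_all add: True cmatD[OF a] mone_def)
    then show ?thesis using finsum_single[OF I True cmatD[OF a]] by simp
  next
    case False
    have "mmul A I (mone A I) a i j = \<zero>"
      unfolding mmul_def by (rule finsum_zero') (use False in \<open>auto simp: mone_def cmatD[OF a]\<close>)
    then show ?thesis using cmat_outside[OF a, of i j] False by simp
  qed
  then show "mmul A I (mone A I) a = a" by (intro ext)
  have "mmul A I a (mone A I) i j = a i j" for i j
  proof (cases "j \<in> I")
    case True
    have "mmul A I a (mone A I) i j = (\<Oplus>k\<in>I. if j = k then a i j else \<zero>)"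
      unfolding mmul_def by (rule finsum_eqI) (simp_all add: True cmatD[OF a] mone_def)
    then show ?thesis using finsum_single[OF I True cmatD[OF a]] by simp
  next
    case False
    have "mmul A I a (mone A I) i j = \<zero>"
      unfolding mmul_def by (rule finsum_zero') (use False in \<open>auto simp: mone_def cmatD[OF a]\<close>)
    then show ?thesis using cmat_outside[OF a, of i j] False by simp
  qed
  then show "mmul A I a (mone A I) = a" by (intro ext)
qed

lemma smat_cmat: "smat A I F \<in> cmat A I"
  by (simp add: cmat_def smat_def smult_closed)

lemma smat_tpose: "tpose (smat A I F) = smat A I (tpose F)"
  by (intro ext) (simp add: smat_def)

lemma smat_left:
  assumes a: "a \<in> cmat A I" and i: "i \<in> I"
  shows "mmul A I (smat A I F) a i j = (\<Oplus>k\<in>I. complex_of_real (F i k) \<odot> a k j)"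
  unfolding mmul_def
  by (rule finsum_eqI) (simp_all add: i smat_def cmatD[OF a] smult_mult_left smult_closed)

lemma smat_right:
  assumes a: "a \<in> cmat A I" and j: "j \<in> I"
  shows "mmul A I a (smat A I F) i j = (\<Oplus>k\<in>I. complex_of_real (F k j) \<odot> a i k)"
  unfolding mmul_def
  by (rule finsum_eqI) (simp_all add: j smat_def cmatD[OF a] smult_mult_right smult_closed)

lemma smat_commute_tpose:
  assumes a: "a \<in> cmat A I"
  shows "tpose (mmul A I (smat A I F) a) = mmul A I (tpose a) (tpose (smat A I F))"
    and "tpose (mmul A I a (smat A I F)) = mmul A I (tpose (smat A I F)) (tpose a)"
proof -
  have c: "smat A I F i j \<otimes> x = x \<otimes> smat A I F i j" if "x \<in> carrier A" for x i j
    using that by (simp add: smat_def smult_mult_left smult_mult_right)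
  show "tpose (mmul A I (smat A I F) a) = mmul A I (tpose a) (tpose (smat A I F))"
    unfolding mmul_def using cmatD[OF a] by (simp add: c)
  show "tpose (mmul A I a (smat A I F)) = mmul A I (tpose (smat A I F)) (tpose a)"
    unfolding mmul_def using cmatD[OF a] by (simp add: c)
qed

lemma smat_adj:
  assumes a: "a \<in> cmat A I" and sa: "\<And>i j. adj A (a i j) = a i j"
  shows "adj A (mmul A I (smat A I F) a i j) = mmul A I (smat A I F) a i j"
    and "adj A (mmul A I a (smat A I F) i j) = mmul A I a (smat A I F) i j"
proof -
  have c1: "adj A (smat A I F i j) = smat A I F i j" for i j
    by (simp add: smat_def adj_smult adj_one adj_zero)
  have c2: "smat A I F i j \<otimes> x = x \<otimes> smat A I F i j" if "x \<in> carrier A" for x i j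
    using that by (simp add: smat_def smult_mult_left smult_mult_right)
  note c = c1 c2
  show "adj A (mmul A I (smat A I F) a i j) = mmul A I (smat A I F) a i j"
    unfolding mmul_def using cmatD[OF a] cmatD[OF smat_cmat] by (simp add: adj_finsum adj_mult sa c)
  show "adj A (mmul A I a (smat A I F) i j) = mmul A I a (smat A I F) i j"
    unfolding mmul_def using cmatD[OF a] cmatD[OF smat_cmat] by (simp add: adj_finsum adj_mult sa c)
qed

lemma finsum_smult_left:
  assumes "x \<in> carrier A" shows "(\<Oplus>i\<in>I. c i \<odot> x) = (\<Sum>i\<in>I. c i) \<odot> x"
  by (induction I rule: infinite_finite_induct)
    (simp_all add: assms finsum_infinite smult_zero_left finsum_insert smult_closed smult_add_left)

lemma smat_smat: "mmul A I (smat A I G) (smat A I H) = smat A I (\<lambda>i j. \<Sum>k\<in>I. G i k * H k j)"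
proof (rule ext, rule ext)
  fix i j
  show "mmul A I (smat A I G) (smat A I H) i j = smat A I (\<lambda>i j. \<Sum>k\<in>I. G i k * H k j) i j"
  proof (cases "i \<in> I \<and> j \<in> I")
    case True
    have "mmul A I (smat A I G) (smat A I H) i j = (\<Oplus>k\<in>I. complex_of_real (G i k * H k j) \<odot> \<one>)"
      unfolding mmul_def
      by (rule finsum_eqI) (use True in \<open>auto simp: smat_def smult_mult_left smult_closed smult_smult\<close>)
    then show ?thesis using True by (simp add: finsum_smult_left smat_def)
  next
    case False
    then show ?thesis using cmat_outside[OF mmul_cmat[OF smat_cmat smat_cmat], of i I j] by (auto simp: smat_def)
  qed
qed

lemma smat_mult:
  assumes "\<And>i j. i \<in> I \<Longrightarrow> j \<in> I \<Longrightarrow> (\<Sum>k\<in>I. F i k * G k j) = of_bool (i = j)"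
  shows "mmul A I (smat A I F) (smat A I G) = mone A I"
  unfolding smat_smat using assms by (auto simp: smat_def mone_def fun_eq_iff smult_one smult_zero_left)

lemma blk_cmat: "1 \<le> N \<Longrightarrow> w \<in> cmat A {1..<N} \<Longrightarrow> blk A w \<in> cmat A {0..<N}"
  by (auto simp: cmat_def blk_def)

lemma blk_tpose: "tpose (blk A w) = blk A (tpose w)"
  by (intro ext) (auto simp: blk_def)

lemma blk_one: "1 \<le> N \<Longrightarrow> blk A (mone A {1..<N}) = mone A {0..<N}"
  by (intro ext) (auto simp: blk_def mone_def)

lemma blk_inj:
  assumes "w \<in> cmat A {1..<N}" "w' \<in> cmat A {1..<N}" "blk A w = blk A w'"
  shows "w = w'"
proof (intro ext)
  fix i j
  show "w i j = w' i j"
  proof (cases "i = 0 \<and> j = 0")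
    case True
    then show ?thesis using assms(1,2) by (simp add: cmat_def)
  next
    case False
    then show ?thesis using fun_cong[OF fun_cong[OF assms(3)], of i j] by (auto simp: blk_def)
  qed
qed

lemma blk_mmul:
  assumes N: "1 \<le> N" and w: "w \<in> cmat A {1..<N}" and w': "w' \<in> cmat A {1..<N}"
  shows "mmul A {0..<N} (blk A w) (blk A w') = blk A (mmul A {1..<N} w w')"
proof (intro ext)
  fix i j
  have set: "{0..<N} = insert 0 {1..<N}" using N by auto
  note C = cmatD[OF w] cmatD[OF w'] cmatD[OF blk_cmat[OF N w]] cmatD[OF blk_cmat[OF N w']]
  have "mmul A {0..<N} (blk A w) (blk A w') i j =
      blk A w i 0 \<otimes> blk A w' 0 j \<oplus> (\<Oplus>k\<in>{1..<N}. blk A w i k \<otimes> blk A w' k j)"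
    unfolding mmul_def set by (rule finsum_insert') (auto simp: C)
  also have "(\<Oplus>k\<in>{1..<N}. blk A w i k \<otimes> blk A w' k j) = mmul A {1..<N} w w' i j"
    unfolding mmul_def by (rule finsum_eqI) (auto simp: C blk_def)
  also have "blk A w i 0 \<otimes> blk A w' 0 j = (if i = 0 \<and> j = 0 then \<one> else \<zero>)"
    using w w' by (auto simp: blk_def cmat_def)
  finally show "mmul A {0..<N} (blk A w) (blk A w') i j = blk A (mmul A {1..<N} w w') i j"
    unfolding blk_def[of A "mmul A {1..<N} w w'"]
    using cmatD[OF mmul_cmat[OF w w'], of i j] cmat_outside[OF mmul_cmat[OF w w'], of 0 0] by auto
qed

lemma orthD:
  assumes "orth A I u"
  shows "u \<in> cmat A I" "u i j \<in> carrier A" "adj A (u i j) = u i j"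
    "mmul A I u (tpose u) = mone A I" "mmul A I (tpose u) u = mone A I"
  using assms by (auto simp: orth_def cmat_def)

lemma orth_blk:
  assumes N: "1 \<le> N" and w: "w \<in> cmat A {1..<N}"
  shows "orth A {0..<N} (blk A w) \<longleftrightarrow> orth A {1..<N} w"
proof -
  note wt = cmat_tpose[OF w]
  have inj: "blk A (mmul A {1..<N} x y) = mone A {0..<N} \<longleftrightarrow> mmul A {1..<N} x y = mone A {1..<N}"
    if "x \<in> cmat A {1..<N}" "y \<in> cmat A {1..<N}" for x y
    using blk_inj[OF mmul_cmat[OF that] mone_cmat] blk_one[OF N] by metis
  have "adj A (blk A w i j) = blk A w i j \<longleftrightarrow> adj A (w i j) = w i j" for i j
    using cmat_outside[OF w, of 0 0] by (cases "i = 0 \<and> j = 0") (simp_all add: blk_def adj_one adj_zero)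
  then show ?thesis
    unfolding orth_def blk_tpose blk_mmul[OF N w wt] blk_mmul[OF N wt w] inj[OF w wt] inj[OF wt w]
    using w blk_cmat[OF N w] by simp
qed

end

text \<open>Conjugation by an orthogonal matrix \<open>F\<close> whose first column is \<open>\<xi> / \<surd>N\<close>.\<close>

definition rot :: "'a cstar \<Rightarrow> nat \<Rightarrow> (nat \<Rightarrow> nat \<Rightarrow> real) \<Rightarrow> 'a mat \<Rightarrow> 'a mat" where
  "rot A N F v = mmul A {0..<N} (smat A {0..<N} F) (mmul A {0..<N} v (smat A {0..<N} (tpose F)))"

abbreviation unrot :: "'a cstar \<Rightarrow> nat \<Rightarrow> (nat \<Rightarrow> nat \<Rightarrow> real) \<Rightarrow> 'a mat \<Rightarrow> 'a mat" where
  "unrot A N F \<equiv> rot A N (tpose F)"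

text \<open>The hypothesis \<open>F e\<^sub>0 = \<xi> / \<surd>N\<close> is stated for the entries of the first column.\<close>

locale bistochastic_basis =
  fixes N :: nat and F :: "nat \<Rightarrow> nat \<Rightarrow> real"
  assumes N: "1 \<le> N" and F: "F \<in> orthogonal_matrices {0..<N}"
    and F0: "\<And>i. i < N \<Longrightarrow> F i 0 = 1 / sqrt (real N)"

locale rotated_algebra = cstar_algebra A + bistochastic_basis N F
  for A :: "'a cstar" (structure) and N F
begin

abbreviation "II \<equiv> {0..<N}"
abbreviation "Fm \<equiv> smat A II F"
abbreviation "Ft \<equiv> smat A II (tpose F)"

lemma Fm_Ft: "mmul A II Fm Ft = mone A II" and Ft_Fm: "mmul A II Ft Fm = mone A II"
  by (rule smat_mult; use F in \<open>simp add: orthogonal_matrices_def\<close>)+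

lemmas mm = mmul_cmat mmul_assoc mmul_one smat_cmat

lemma cancel:
  assumes "a \<in> cmat A II"
  shows "mmul A II Fm (mmul A II Ft a) = a" "mmul A II Ft (mmul A II Fm a) = a"
  using assms by (simp_all add: mm Fm_Ft Ft_Fm flip: mmul_assoc)

lemma rot_cmat: "v \<in> cmat A II \<Longrightarrow> rot A N G v \<in> cmat A II"
  by (simp add: rot_def mm)

lemma rot_mmul:
  assumes "v \<in> cmat A II" "v' \<in> cmat A II"
  shows "mmul A II (rot A N F v) (rot A N F v') = rot A N F (mmul A II v v')"
    and "mmul A II (unrot A N F v) (unrot A N F v') = unrot A N F (mmul A II v v')"
  using assms by (simp_all add: rot_def mm cancel)

lemma rot_unrot:
  assumes "v \<in> cmat A II"
  shows "rot A N F (unrot A N F v) = v" "unrot A N F (rot A N F v) = v"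
  using assms by (simp_all add: rot_def mm cancel Fm_Ft Ft_Fm)

lemma rot_one: "rot A N F (mone A II) = mone A II" "unrot A N F (mone A II) = mone A II"
  by (simp_all add: rot_def mm Fm_Ft Ft_Fm)

lemma rot_tpose:
  assumes v: "v \<in> cmat A II"
  shows "tpose (rot A N G v) = rot A N G (tpose v)"
proof -
  have "tpose (rot A N G v) = mmul A II (tpose (mmul A II v (smat A II (tpose G)))) (smat A II (tpose G))"
    unfolding rot_def using smat_commute_tpose(1)[OF mmul_cmat[OF v smat_cmat], of G] by (simp add: smat_tpose)
  also have "tpose (mmul A II v (smat A II (tpose G))) = mmul A II (smat A II G) (tpose v)"
    using smat_commute_tpose(2)[OF v, of "tpose G"] by (simp add: smat_tpose)
  finally show ?thesis using cmat_tpose[OF v] by (simp add: rot_def mm)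
qed

lemma rot_adj:
  assumes "v \<in> cmat A II" "\<And>i j. adj A (v i j) = v i j"
  shows "adj A (rot A N G v i j) = rot A N G v i j"
  unfolding rot_def by (intro smat_adj mm assms)

lemma rot_orth: "orth A II v \<Longrightarrow> orth A II (rot A N F v)" "orth A II v \<Longrightarrow> orth A II (unrot A N F v)"
  by (simp_all add: orth_def rot_cmat rot_adj rot_tpose rot_mmul rot_one cmat_tpose)

lemma col0:
  assumes a: "a \<in> cmat A II" and i: "i \<in> II"
  shows "mmul A II a Fm i 0 = complex_of_real (1 / sqrt (real N)) \<odot> (\<Oplus>j\<in>II. a i j)"
proof -
  have "mmul A II a Fm i 0 = (\<Oplus>k\<in>II. complex_of_real (1 / sqrt (real N)) \<odot> a i k)"
    using N by (subst smat_right[OF a]) (auto intro!: finsum_eqI simp: smult_closed F0 cmatD[OF a])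
  also have "\<dots> = complex_of_real (1 / sqrt (real N)) \<odot> (\<Oplus>j\<in>II. a i j)"
    by (rule smult_finsum[symmetric]) (rule cmatD[OF a])
  finally show ?thesis .
qed

lemma rot_row_sum:
  assumes w: "w \<in> cmat A {1..<N}" and i: "i \<in> II"
  shows "(\<Oplus>j\<in>II. rot A N F (blk A w) i j) = \<one>"
proof -
  let ?u = "rot A N F (blk A w)" and ?s = "complex_of_real (1 / sqrt (real N))"
  note b = blk_cmat[OF N w] note u = rot_cmat[OF b, of F]
  have "mmul A II ?u Fm = mmul A II Fm (blk A w)" by (simp add: rot_def mm b Ft_Fm)
  moreover have "mmul A II Fm (blk A w) i 0 = mmul A II Fm (mone A II) i 0"
  proof -
    have "blk A w k 0 = mone A II k 0" for k using w N by (auto simp: blk_def mone_def cmat_def)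
    then show ?thesis by (simp add: mmul_def)
  qed
  ultimately have "?s \<odot> (\<Oplus>j\<in>II. ?u i j) = ?s \<odot> \<one>"
    using col0[OF u i] i N F0 by (simp add: mm smat_def)
  then have "complex_of_real (sqrt (real N)) \<odot> (?s \<odot> (\<Oplus>j\<in>II. ?u i j)) = complex_of_real (sqrt (real N)) \<odot> (?s \<odot> \<one>)"
    by simp
  then show ?thesis using N finsum_closed[of "?u i" II] cmatD[OF u]
    by (simp add: smult_one Pi_iff flip: smult_smult of_real_mult)
qed

text \<open>The matrices of the form \<open>F diag(1, w) F\<^sup>t\<close> are exactly those with row sums \<open>1\<close>.\<close>

lemma unrot_bistochastic:
  assumes u: "orth A II u" and row: "\<And>i. i \<in> II \<Longrightarrow> (\<Oplus>j\<in>II. u i j) = \<one>"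
  obtains w where "orth A {1..<N} w" "unrot A N F u = blk A w" "rot A N F (blk A w) = u"
proof -
  note uc = orthD(1)[OF u]
  have first: "unrot A N F a i 0 = mone A II i 0"
    if a: "a \<in> cmat A II" and f: "\<And>k. k \<in> II \<Longrightarrow> mmul A II a Fm k 0 = Fm k 0" for a i
  proof -
    have "unrot A N F a i 0 = mmul A II Ft (mmul A II a Fm) i 0" by (simp add: rot_def)
    also have "\<dots> = mmul A II Ft Fm i 0"
      unfolding mmul_def[of A II Ft] by (rule finsum_eqI) (simp_all add: f cmatD[OF smat_cmat])
    finally show ?thesis by (simp add: Ft_Fm)
  qed
  have uF: "mmul A II u Fm k 0 = Fm k 0" if "k \<in> II" for k
    using col0[OF uc that] row[OF that] that N F0 by (simp add: smat_def)
  have utF: "mmul A II (tpose u) Fm k 0 = Fm k 0" if "k \<in> II" for k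
  proof -
    have "Fm k 0 = mmul A II (tpose u) (mmul A II u Fm) k 0"
      using cmat_tpose[OF uc] uc orthD(5)[OF u] by (simp add: mm flip: mmul_assoc)
    also have "\<dots> = mmul A II (tpose u) Fm k 0"
      unfolding mmul_def[of A II "tpose u"]
      by (rule finsum_eqI) (simp_all add: uF cmatD[OF uc] cmatD[OF smat_cmat])
    finally show ?thesis by simp
  qed
  let ?v = "unrot A N F u"
  have v0: "?v i 0 = mone A II i 0" for i by (rule first[OF uc uF])
  have v0': "?v 0 j = mone A II j 0" for j
    using first[OF cmat_tpose[OF uc] utF, of j] fun_cong[OF fun_cong[OF rot_tpose[OF uc, of "tpose F"]], of 0 j] by simp
  define w where "w i j = (if i = 0 \<or> j = 0 then \<zero> else ?v i j)" for i j
  have vc: "?v \<in> cmat A II" by (rule rot_cmat[OF uc])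
  have w: "w \<in> cmat A {1..<N}" using vc by (auto simp: cmat_def w_def)
  have b: "blk A w = ?v"
  proof (intro ext)
    fix i j show "blk A w i j = ?v i j"
      using v0[of i] v0'[of j] N by (auto simp: blk_def w_def mone_def)
  qed
  show ?thesis
  proof (rule that[of w])
    show "orth A {1..<N} w" using rot_orth(2)[OF u] unfolding b[symmetric] orth_blk[OF N w] .
    show "?v = blk A w" by (rule b[symmetric])
    show "rot A N F (blk A w) = u" unfolding b by (rule rot_unrot[OF uc])
  qed
qed

end

lemma cstar_hom_mmul:
  assumes f: "f \<in> cstar_hom A B" and A: "cstar_algebra A" and B: "cstar_algebra B"
    and a: "a \<in> cmat A I" and b: "b \<in> cmat A I"
  shows "f (mmul A I a b i j) = mmul B I (\<lambda>i j. f (a i j)) (\<lambda>i j. f (b i j)) i j"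
proof -
  interpret A: cstar_algebra A by fact
  have "f (mmul A I a b i j) = (\<Oplus>\<^bsub>B\<^esub>k\<in>I. f (a i k \<otimes>\<^bsub>A\<^esub> b k j))"
    unfolding mmul_def by (rule cstar_hom_finsum[OF f A B]) (simp add: cmatD[OF a] cmatD[OF b])
  then show ?thesis by (simp add: mmul_def cstar_homD(3)[OF f] cmatD[OF a] cmatD[OF b])
qed

lemma cstar_hom_smat:
  assumes f: "f \<in> cstar_hom A B" and A: "cstar_algebra A" and B: "cstar_algebra B"
  shows "f (smat A I F i j) = smat B I F i j"
proof -
  interpret A: cstar_algebra A by fact
  show ?thesis by (simp add: smat_def cstar_homD[OF f] cstar_hom_minus_zero[OF f A B])
qed

lemma cstar_hom_rot:
  assumes f: "f \<in> cstar_hom A B" and A: "cstar_algebra A" and B: "cstar_algebra B"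
    and v: "v \<in> cmat A {0..<N}"
  shows "f (rot A N F v i j) = rot B N F (\<lambda>i j. f (v i j)) i j"
proof -
  interpret A: cstar_algebra A by fact
  show ?thesis
    unfolding rot_def cstar_hom_mmul[OF f A B A.smat_cmat A.mmul_cmat[OF v A.smat_cmat]]
      cstar_hom_mmul[OF f A B v A.smat_cmat] cstar_hom_smat[OF f A B] ..
qed

lemma cstar_hom_blk:
  assumes f: "f \<in> cstar_hom A B"
  shows "f (blk A w i j) = blk B (\<lambda>i j. f (w i j)) i j"
  by (simp add: blk_def cstar_homD[OF f])

lemma cstar_hom_cmat:
  assumes f: "f \<in> cstar_hom A B" and A: "cstar_algebra A" and B: "cstar_algebra B"
    and v: "v \<in> cmat A I"
  shows "(\<lambda>i j. f (v i j)) \<in> cmat B I"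
  using v by (auto simp: cmat_def cstar_homD[OF f] cstar_hom_minus_zero[OF f A B])

lemma cstar_hom_orth:
  assumes f: "f \<in> cstar_hom A B" and A: "cstar_algebra A" and B: "cstar_algebra B"
    and u: "orth A I u"
  shows "orth B I (\<lambda>i j. f (u i j))"
proof -
  interpret A: cstar_algebra A by fact
  note uc = A.orthD(1)[OF u] note utc = cmat_tpose[OF uc]
  have one: "(\<lambda>i j. f (mone A I i j)) = mone B I"
    by (intro ext) (auto simp: mone_def cstar_homD[OF f] cstar_hom_minus_zero[OF f A B])
  have "mmul B I (\<lambda>i j. f (u i j)) (\<lambda>i j. f (u j i)) = mone B I"
    "mmul B I (\<lambda>i j. f (u j i)) (\<lambda>i j. f (u i j)) = mone B I"
    using cstar_hom_mmul[OF f A B uc utc] cstar_hom_mmul[OF f A B utc uc] A.orthD(4,5)[OF u]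
    by (simp_all add: fun_eq_iff flip: one)
  moreover have "adj B (f (u i j)) = f (u i j)" for i j
    using cstar_homD(6)[OF f A.orthD(2)[OF u], of i j] A.orthD(3)[OF u] by simp
  ultimately show ?thesis using cstar_hom_cmat[OF f A B uc] by (simp add: orth_def)
qed

section \<open>The universal quantum groups\<close>

text \<open>The relations \<open>abc = cba\<close> and \<open>ab = ba\<close> between the entries of a matrix, and the relation \<open>u \<xi> = \<xi>\<close>.\<close>

definition half_comm :: "'a cstar \<Rightarrow> 'a mat \<Rightarrow> bool" where
  "half_comm A u \<longleftrightarrow> (\<forall>i j k l m n. u i j \<otimes>\<^bsub>A\<^esub> u k l \<otimes>\<^bsub>A\<^esub> u m n = u m n \<otimes>\<^bsub>A\<^esub> u k l \<otimes>\<^bsub>A\<^esub> u i j)"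

definition comm :: "'a cstar \<Rightarrow> 'a mat \<Rightarrow> bool" where
  "comm A u \<longleftrightarrow> (\<forall>i j k l. u i j \<otimes>\<^bsub>A\<^esub> u k l = u k l \<otimes>\<^bsub>A\<^esub> u i j)"

definition row_sums_one :: "'a cstar \<Rightarrow> nat set \<Rightarrow> 'a mat \<Rightarrow> bool" where
  "row_sums_one A I u \<longleftrightarrow> (\<forall>i\<in>I. (\<Oplus>\<^bsub>A\<^esub>j\<in>I. u i j) = \<one>\<^bsub>A\<^esub>)"

context cstar_algebra
begin

context
  fixes h :: "nat \<times> nat \<Rightarrow> 'a" and I :: "nat set"
  assumes hc: "(\<lambda>i j. h (i, j)) \<in> cmat A I"
begin

lemma h_closed: "h g \<in> carrier A"
  using cmatD[OF hc, of "fst g" "snd g"] by simp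

lemmas ev_hom = free_hom_eval[of h, OF h_closed]

lemma eval_generator_ops:
  "eval A h (fgen g) = h g" "eval A h (p - q) = eval A h p \<ominus> eval A h q"
  "eval A h (p * q) = eval A h p \<otimes> eval A h q" "eval A h (fadj p) = adj A (eval A h p)"
  "eval A h (\<Sum>k\<in>I. f k) = (\<Oplus>k\<in>I. eval A h (f k))"
  "eval A h (of_bool b) = (if b then \<one> else \<zero>)" "eval A h 1 = \<one>"
  using eval_fgen[of h, OF h_closed] fh_minus[OF ev_hom] fh_mult[OF ev_hom] fh_adj[OF ev_hom]
    fh_sum[OF ev_hom] fh_of_bool[OF ev_hom] fh_one[OF ev_hom]
  by (simp_all only:)

lemma eval_orthogonal_rel:
  "(\<forall>r\<in>orthogonal_rel I. eval A h r = \<zero>) \<longleftrightarrow> orth A I (\<lambda>i j. h (i, j))"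
proof -
  let ?u = "\<lambda>i j. h (i, j)"
  let ?d = "\<lambda>i j. if i = j then \<one> else \<zero>"
  have fs: "(\<Oplus>k\<in>I. h (f k) \<otimes> h (g k)) \<in> carrier A" for f g by (rule finsum_mem) (simp add: h_closed)
  have "(\<forall>r\<in>orthogonal_rel I. eval A h r = \<zero>) \<longleftrightarrow>
      (\<forall>i\<in>I. \<forall>j\<in>I. eval A h (fgen (i, j) - fadj (fgen (i, j))) = \<zero>) \<and>
      (\<forall>i\<in>I. \<forall>j\<in>I. eval A h ((\<Sum>k\<in>I. fgen (i, k) * fgen (j, k)) - of_bool (i = j)) = \<zero>) \<and>
      (\<forall>i\<in>I. \<forall>j\<in>I. eval A h ((\<Sum>k\<in>I. fgen (k, i) * fgen (k, j)) - of_bool (i = j)) = \<zero>)"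
    unfolding orthogonal_rel_def by blast
  also have "\<dots> \<longleftrightarrow> (\<forall>i\<in>I. \<forall>j\<in>I. h (i, j) = adj A (h (i, j))) \<and>
      (\<forall>i\<in>I. \<forall>j\<in>I. mmul A I ?u (tpose ?u) i j = ?d i j) \<and>
      (\<forall>i\<in>I. \<forall>j\<in>I. mmul A I (tpose ?u) ?u i j = ?d i j)"
    unfolding eval_generator_ops mmul_def using h_closed fs
    by (simp add: adj_closed r_right_minus_eq)
  also have "(\<forall>i\<in>I. \<forall>j\<in>I. h (i, j) = adj A (h (i, j))) \<longleftrightarrow> (\<forall>i j. adj A (h (i, j)) = h (i, j))"
    using cmat_outside[OF hc] by (metis adj_zero)
  also have "(\<forall>i\<in>I. \<forall>j\<in>I. mmul A I ?u (tpose ?u) i j = ?d i j) \<longleftrightarrow> mmul A I ?u (tpose ?u) = mone A I"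
    using cmat_outside[OF mmul_cmat[OF hc cmat_tpose[OF hc]]] unfolding fun_eq_iff mone_def by auto
  also have "(\<forall>i\<in>I. \<forall>j\<in>I. mmul A I (tpose ?u) ?u i j = ?d i j) \<longleftrightarrow> mmul A I (tpose ?u) ?u = mone A I"
    using cmat_outside[OF mmul_cmat[OF cmat_tpose[OF hc] hc]] unfolding fun_eq_iff mone_def by auto
  finally show ?thesis using hc by (simp add: orth_def)
qed

lemma eval_half_commutation_rel:
  "(\<forall>r\<in>half_commutation_rel I. eval A h r = \<zero>) \<longleftrightarrow> half_comm A (\<lambda>i j. h (i, j))"
proof -
  have "(\<forall>r\<in>half_commutation_rel I. eval A h r = \<zero>) \<longleftrightarrow>
      (\<forall>a\<in>I\<times>I. \<forall>b\<in>I\<times>I. \<forall>c\<in>I\<times>I. eval A h (fgen a * fgen b * fgen c - fgen c * fgen b * fgen a) = \<zero>)"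
    unfolding half_commutation_rel_def by blast
  also have "\<dots> \<longleftrightarrow> (\<forall>a\<in>I\<times>I. \<forall>b\<in>I\<times>I. \<forall>c\<in>I\<times>I. h a \<otimes> h b \<otimes> h c = h c \<otimes> h b \<otimes> h a)"
    unfolding eval_generator_ops using h_closed by (simp add: r_right_minus_eq)
  also have "\<dots> \<longleftrightarrow> (\<forall>a b c. h a \<otimes> h b \<otimes> h c = h c \<otimes> h b \<otimes> h a)"
  proof -
    have z: "h a = \<zero>" if "a \<notin> I \<times> I" for a using cmat_outside[OF hc, of "fst a" "snd a"] that by (cases a) auto
    have "h a \<otimes> h b \<otimes> h c = h c \<otimes> h b \<otimes> h a" if "a \<notin> I \<times> I \<or> b \<notin> I \<times> I \<or> c \<notin> I \<times> I" for a b c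
      using that by (elim disjE) (simp_all add: z h_closed)
    then show ?thesis by blast
  qed
  finally show ?thesis by (simp add: half_comm_def)
qed

lemma eval_commutation_rel:
  "(\<forall>r\<in>commutation_rel I. eval A h r = \<zero>) \<longleftrightarrow> comm A (\<lambda>i j. h (i, j))"
proof -
  have "(\<forall>r\<in>commutation_rel I. eval A h r = \<zero>) \<longleftrightarrow>
      (\<forall>a\<in>I\<times>I. \<forall>b\<in>I\<times>I. eval A h (fgen a * fgen b - fgen b * fgen a) = \<zero>)"
    unfolding commutation_rel_def by blast
  also have "\<dots> \<longleftrightarrow> (\<forall>a\<in>I\<times>I. \<forall>b\<in>I\<times>I. h a \<otimes> h b = h b \<otimes> h a)"
    unfolding eval_generator_ops using h_closed by (simp add: r_right_minus_eq)
  also have "\<dots> \<longleftrightarrow> (\<forall>a b. h a \<otimes> h b = h b \<otimes> h a)"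
  proof -
    have z: "h a = \<zero>" if "a \<notin> I \<times> I" for a using cmat_outside[OF hc, of "fst a" "snd a"] that by (cases a) auto
    have "h a \<otimes> h b = h b \<otimes> h a" if "a \<notin> I \<times> I \<or> b \<notin> I \<times> I" for a b
      using that by (elim disjE) (simp_all add: z h_closed)
    then show ?thesis by blast
  qed
  finally show ?thesis by (simp add: comm_def)
qed

lemma eval_bistochastic_rel:
  "(\<forall>r\<in>bistochastic_rel I. eval A h r = \<zero>) \<longleftrightarrow> row_sums_one A I (\<lambda>i j. h (i, j))"
proof -
  have fs: "(\<Oplus>k\<in>I. h (i, k)) \<in> carrier A" for i by (rule finsum_mem) (simp add: h_closed)
  have "(\<forall>r\<in>bistochastic_rel I. eval A h r = \<zero>) \<longleftrightarrow> (\<forall>i\<in>I. eval A h ((\<Sum>j\<in>I. fgen (i, j)) - 1) = \<zero>)"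
    unfolding bistochastic_rel_def by blast
  then show ?thesis unfolding eval_generator_ops row_sums_one_def using fs by (simp add: r_right_minus_eq)
qed

lemma eval_unitary_rel:
  assumes "orth A I (\<lambda>i j. h (i, j))" "r \<in> unitary_rel I"
  shows "eval A h r = \<zero>"
proof -
  note o = orthD[OF assms(1)]
  have d: "(if i = j then \<one> else \<zero>) = mone A I i j" if "i \<in> I" for i j using that by (simp add: mone_def)
  have "(\<Oplus>k\<in>I. h (i, k) \<otimes> h (j, k)) = mone A I i j" "(\<Oplus>k\<in>I. h (k, i) \<otimes> h (k, j)) = mone A I i j" for i j
    using fun_cong[OF fun_cong[OF o(4)], of i j] fun_cong[OF fun_cong[OF o(5)], of i j]
    by (simp_all add: mmul_def)
  then show ?thesis using assms(2) cmatD[OF mone_cmat]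
    unfolding unitary_rel_def by (auto simp: eval_generator_ops o(3) d)
qed

end

end

text \<open>Universal bounds on the generators: for orthogonal relations the rows are sums of squares of
  self-adjoint elements equal to \<open>1\<close>; for the unitary ones, the real and imaginary parts satisfy
  such a relation, since both \<open>u\<close> and its conjugate are unitary.\<close>

lemma bounds_orthogonal:
  assumes I: "finite I" and R: "orthogonal_rel I \<subseteq> R"
  shows "bounds_generators (relators (I \<times> I) R)"
  unfolding bounds_generators_def
proof (intro allI exI[of _ 1] impI)
  fix g :: "nat \<times> nat" and \<nu> :: "(nat \<times> nat) free_star \<Rightarrow> real"
  assume "cstar_seminorm \<nu> \<and> (\<forall>r\<in>relators (I \<times> I) R. \<nu> r = 0)"
  then have \<nu>: "cstar_seminorm \<nu>" and null: "\<And>r. r \<in> relators (I \<times> I) R \<Longrightarrow> \<nu> r = 0" by simp_all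
  interpret A: cstar_algebra "completion \<nu>" by (rule cstar_algebra_completion[OF \<nu>])
  let ?A = "completion \<nu>"
  define h where "h g = cls \<nu> (fgen g)" for g
  note fh = free_hom_cls[OF \<nu>] note cl = A.fh_closed[OF fh]
  have hcl: "h g \<in> carrier ?A" for g by (simp only: h_def cl)
  have z: "cls \<nu> r = \<zero>\<^bsub>?A\<^esub>" if "r \<in> relators (I \<times> I) R" for r
    using null[OF that] A.nrm_eq_zero[OF cl, of r] by (simp add: nrm_cls[OF \<nu>])
  have ev: "eval ?A h p = cls \<nu> p" for p
    by (rule free_hom_eqI[OF A.free_hom_eval[of h, OF hcl] fh]) (simp only: A.eval_fgen[of h, OF hcl] h_def)
  have hc: "(\<lambda>i j. h (i, j)) \<in> cmat ?A I"
    unfolding cmat_def using hcl z[of "fgen _"] by (auto simp: h_def relators_def)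
  have o: "orth ?A I (\<lambda>i j. h (i, j))"
    unfolding A.eval_orthogonal_rel[OF hc, symmetric] ev using z R by (auto simp: relators_def)
  show "\<nu> (fgen g) \<le> 1"
  proof (cases "g \<in> I \<times> I")
    case True
    then obtain i j where g: "g = (i, j)" "i \<in> I" "j \<in> I" by blast
    have "(\<Oplus>\<^bsub>?A\<^esub>k\<in>I. h (i, k) \<otimes>\<^bsub>?A\<^esub> h (i, k)) = \<one>\<^bsub>?A\<^esub>"
      using fun_cong[OF fun_cong[OF A.orthD(4)[OF o]], of i i] g by (simp add: mmul_def mone_def)
    from A.sum_squares_bound[OF I g(3) hcl A.orthD(3)[OF o] this]
    show ?thesis by (simp add: h_def g nrm_cls[OF \<nu>])
  next
    case False
    then show ?thesis using null[of "fgen g"] by (simp add: relators_def)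
  qed
qed

lemma real_imaginary_squares:
  fixes X Y :: "'g free_star"
  defines "P \<equiv> fconst (1/2) * (X + Y)" and "Q \<equiv> fconst (- \<i>/2) * (X - Y)"
  shows "P * P + Q * Q = fconst (1/2) * (X * Y + Y * X)" "X = P + fconst \<i> * Q"
proof -
  have c: "fconst a * V * (fconst b * W) = fconst (a * b) * (V * W)" for a b and V W :: "'g free_star"
    by (metis fconst_commute fconst_mult mult.assoc)
  have PP: "P * P = fconst (1/4) * ((X + Y) * (X + Y))" unfolding P_def c by simp
  have "Q * Q = fconst (- (1/4)) * ((X - Y) * (X - Y))" unfolding Q_def c by (simp add: power2_eq_square)
  then have QQ: "Q * Q = - (fconst (1/4) * ((X - Y) * (X - Y)))" by (simp add: single_uminus)
  have "P * P + Q * Q = fconst (1/4) * ((X + Y) * (X + Y) - (X - Y) * (X - Y))"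
    unfolding PP QQ by (simp add: right_diff_distrib)
  also have "(X + Y) * (X + Y) - (X - Y) * (X - Y) = (X * Y + Y * X) + (X * Y + Y * X)"
    by (simp add: algebra_simps)
  also have "fconst (1/4) * \<dots> = (fconst (1/4) + fconst (1/4)) * (X * Y + Y * X)"
    by (simp add: distrib_left distrib_right)
  also have "fconst (1/4) + fconst (1/4) = fconst (1/2)" by (simp flip: single_add)
  finally show "P * P + Q * Q = fconst (1/2) * (X * Y + Y * X)" .
  have "fconst \<i> * Q = fconst (1/2) * (X - Y)"
    unfolding Q_def mult.assoc[symmetric] fconst_mult by simp
  then have "P + fconst \<i> * Q = fconst (1/2) * (X + X)" by (simp add: P_def algebra_simps)
  also have "\<dots> = (fconst (1/2) + fconst (1/2)) * X" by (simp add: distrib_left distrib_right)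
  also have "fconst (1/2) + fconst (1/2) = 1" by (simp flip: single_add)
  finally show "X = P + fconst \<i> * Q" by simp
qed

lemma bounds_unitary:
  assumes I: "finite I"
  shows "bounds_generators (relators (I \<times> I) (unitary_rel I))"
  unfolding bounds_generators_def
proof (intro allI exI[of _ 2] impI)
  fix g :: "nat \<times> nat" and \<nu> :: "(nat \<times> nat) free_star \<Rightarrow> real"
  assume "cstar_seminorm \<nu> \<and> (\<forall>r\<in>relators (I \<times> I) (unitary_rel I). \<nu> r = 0)"
  then have \<nu>: "cstar_seminorm \<nu>" and null: "\<And>r. r \<in> relators (I \<times> I) (unitary_rel I) \<Longrightarrow> \<nu> r = 0" by simp_all
  interpret A: cstar_algebra "completion \<nu>" by (rule cstar_algebra_completion[OF \<nu>])
  let ?A = "completion \<nu>"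
  note fh = free_hom_cls[OF \<nu>] note cl = A.fh_closed[OF fh]
  show "\<nu> (fgen g) \<le> 2"
  proof (cases "g \<in> I \<times> I")
    case True
    then obtain i j where g: "g = (i, j)" "i \<in> I" "j \<in> I" by blast
    define P where "P k = fconst (1/2) * (fgen (i, k) + fadj (fgen (i, k)))" for k :: nat
    define Q where "Q k = fconst (- \<i>/2) * (fgen (i, k) - fadj (fgen (i, k)))" for k :: nat
    have sa: "fadj (P k) = P k" "fadj (Q k) = Q k" for k
    proof -
      have m: "fconst (- \<i>/2) = - fconst (\<i>/2)" using single_uminus[of 0 "\<i>/2"] by simp
      show "fadj (P k) = P k" by (simp add: P_def fadj_mult fadj_add fconst_commute add.commute)
      have "fadj (Q k) = (fadj (fgen (i, k)) - fgen (i, k)) * fconst (\<i>/2)"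
        by (simp add: Q_def fadj_mult fadj_diff)
      also have "\<dots> = fconst (\<i>/2) * (fadj (fgen (i, k)) - fgen (i, k))" by (rule fconst_commute[symmetric])
      also have "\<dots> = Q k" unfolding Q_def m by (simp add: right_diff_distrib)
      finally show "fadj (Q k) = Q k" .
    qed
    define r1 where "r1 = (\<Sum>k\<in>I. fgen (i, k) * fadj (fgen (i, k))) - of_bool (i = i)"
    define r2 where "r2 = (\<Sum>k\<in>I. fadj (fgen (i, k)) * fgen (i, k)) - of_bool (i = i)"
    have "(\<Sum>k\<in>I. P k * P k + Q k * Q k) - 1 = fconst (1/2) * (r1 + r2)"
    proof -
      have "(\<Sum>k\<in>I. P k * P k + Q k * Q k) =
          fconst (1/2) * ((\<Sum>k\<in>I. fgen (i, k) * fadj (fgen (i, k))) + (\<Sum>k\<in>I. fadj (fgen (i, k)) * fgen (i, k)))"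
      proof -
        have "P k * P k + Q k * Q k =
            fconst (1/2) * (fgen (i, k) * fadj (fgen (i, k)) + fadj (fgen (i, k)) * fgen (i, k))" for k
          unfolding P_def Q_def by (rule real_imaginary_squares(1))
        then show ?thesis by (simp only: distrib_left sum.distrib sum_distrib_left)
      qed
      also have "\<dots> = fconst (1/2) * ((r1 + r2) + (1 + 1))"
        by (rule arg_cong[where f = "\<lambda>x. fconst (1/2) * x"]) (simp add: r1_def r2_def algebra_simps)
      also have "\<dots> = fconst (1/2) * (r1 + r2) + (fconst (1/2) + fconst (1/2))" by (simp only: distrib_left mult_1_right)
      also have "fconst (1/2) + fconst (1/2) = (1 :: (nat \<times> nat) free_star)" by (simp flip: single_add)
      finally show ?thesis by simp
    qed
    moreover have "\<nu> (fconst (1/2) * (r1 + r2)) = 0"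
    proof -
      have "r1 \<in> unitary_rel I" unfolding unitary_rel_def r1_def using g(2) by blast
      moreover have "r2 \<in> unitary_rel I" unfolding unitary_rel_def r2_def using g(2) by blast
      ultimately have "\<nu> r1 = 0" "\<nu> r2 = 0" using null by (auto simp: relators_def)
      then have "\<nu> (r1 + r2) = 0" using cs_triangle[OF \<nu>, of r1 r2] cs_nonneg[OF \<nu>, of "r1 + r2"] by simp
      then show ?thesis by (simp add: cs_scale[OF \<nu>])
    qed
    ultimately have "nrm ?A (cls \<nu> ((\<Sum>k\<in>I. P k * P k + Q k * Q k) - 1)) = 0" by (simp add: nrm_cls[OF \<nu>])
    then have "cls \<nu> (\<Sum>k\<in>I. P k * P k + Q k * Q k) = \<one>\<^bsub>?A\<^esub>"
      using cl by (simp add: A.fh_minus[OF fh] A.fh_one[OF fh] A.nrm_minus_eq_zero)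
    then have sum: "(\<Oplus>\<^bsub>?A\<^esub>k\<in>I. cls \<nu> (P k * P k + Q k * Q k)) = \<one>\<^bsub>?A\<^esub>" by (simp only: A.fh_sum[OF fh])
    define p where "p k = cls \<nu> (P k)" for k
    define q where "q k = cls \<nu> (Q k)" for k
    have pq: "p k \<in> carrier ?A" "q k \<in> carrier ?A" "adj ?A (p k) = p k" "adj ?A (q k) = q k" for k
      using cl A.fh_adj[OF fh, symmetric] by (simp_all add: p_def q_def sa)
    have e: "cls \<nu> (P k * P k + Q k * Q k) = p k \<otimes>\<^bsub>?A\<^esub> p k \<oplus>\<^bsub>?A\<^esub> q k \<otimes>\<^bsub>?A\<^esub> q k" for k
      by (simp add: p_def q_def A.fh_add[OF fh] A.fh_mult[OF fh])
    let ?s = "\<lambda>k. p k \<otimes>\<^bsub>?A\<^esub> p k \<oplus>\<^bsub>?A\<^esub> q k \<otimes>\<^bsub>?A\<^esub> q k"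
    let ?rest = "\<Oplus>\<^bsub>?A\<^esub>k\<in>I - {j}. ?s k"
    have nn: "A.nonneg ?rest" by (rule A.nonneg_finsum) (intro A.nonneg_add A.nonneg_square pq)
    have rc: "?rest \<in> carrier ?A" by (rule A.finsum_mem) (simp add: pq)
    have "I = insert j (I - {j})" using g by auto
    then have "(\<Oplus>\<^bsub>?A\<^esub>k\<in>I. ?s k) = (\<Oplus>\<^bsub>?A\<^esub>k\<in>insert j (I - {j}). ?s k)" by simp
    also have "\<dots> = ?s j \<oplus>\<^bsub>?A\<^esub> ?rest" using I by (intro A.finsum_insert') (auto simp: pq)
    finally have split: "?s j \<oplus>\<^bsub>?A\<^esub> ?rest = \<one>\<^bsub>?A\<^esub>" using sum by (simp only: e)
    have "nrm ?A (p j) \<le> 1"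
      by (rule A.square_le_one[OF pq(1,3) A.nonneg_add[OF A.nonneg_square[OF pq(2,4)] nn]])
        (use split in \<open>simp add: pq rc A.a_assoc\<close>)
    moreover have "nrm ?A (q j) \<le> 1"
      by (rule A.square_le_one[OF pq(2,4) A.nonneg_add[OF A.nonneg_square[OF pq(1,3)] nn]])
        (use split in \<open>simp add: pq rc A.a_ac\<close>)
    moreover have "\<nu> (fgen g) \<le> \<nu> (P j) + \<nu> (fconst \<i> * Q j)"
      using cs_triangle[OF \<nu>, of "P j" "fconst \<i> * Q j"]
      unfolding P_def Q_def real_imaginary_squares(2)[symmetric] g .
    ultimately show ?thesis by (simp add: p_def q_def nrm_cls[OF \<nu>] cs_scale[OF \<nu>])
  next
    case False
    then show ?thesis using null[of "fgen g"] by (simp add: relators_def)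
  qed
qed

lemma cstar_hom_unique:
  assumes SR: "bounds_generators (relators S R)" and B: "cstar_algebra B"
    and f: "f \<in> cstar_hom (universal_cstar S R) B" and g: "g \<in> cstar_hom (universal_cstar S R) B"
    and eq: "\<And>s. s \<in> S \<Longrightarrow> f (ugen S R s) = g (ugen S R s)" and x: "x \<in> carrier (universal_cstar S R)"
  shows "f x = g x"
proof -
  let ?A = "universal_cstar S R"
  interpret A: cstar_algebra ?A by (rule cstar_algebra_universal[OF SR])
  interpret B: cstar_algebra B by fact
  note hf = cstar_homD[OF f] note hg = cstar_homD[OF g]
  note mf = cstar_hom_minus_zero[OF f A.cstar_algebra_axioms B] note mg = cstar_hom_minus_zero[OF g A.cstar_algebra_axioms B]
  let ?E = "{x \<in> carrier ?A. f x = g x}"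
  have "closed_star_subalgebra ?E ?A"
    unfolding closed_star_subalgebra_def
  proof (intro conjI allI ballI impI)
    show "subring ?E ?A"
    proof (rule A.subringI)
      fix h assume "h \<in> ?E"
      then have "f (\<zero>\<^bsub>?A\<^esub> \<ominus>\<^bsub>?A\<^esub> h) = g (\<zero>\<^bsub>?A\<^esub> \<ominus>\<^bsub>?A\<^esub> h)" by (simp add: mf mg)
      then show "\<ominus>\<^bsub>?A\<^esub> h \<in> ?E" using \<open>h \<in> ?E\<close> by (simp add: a_minus_def)
    qed (auto simp: hf hg)
    fix X y assume X: "\<forall>n. X n \<in> ?E" and y: "y \<in> carrier ?A" and lim: "(\<lambda>n::nat. nrm ?A (X n \<ominus>\<^bsub>?A\<^esub> y)) \<longlonglongrightarrow> 0"
    have Xc: "X n \<in> carrier ?A" and Xe: "f (X n) = g (X n)" for n using X by auto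
    have l: "(\<lambda>n. nrm B (k (X n) \<ominus>\<^bsub>B\<^esub> k y)) \<longlonglongrightarrow> 0" if k: "k \<in> cstar_hom ?A B" for k
    proof (rule Lim_null_comparison[OF _ lim], intro always_eventually allI)
      fix n
      have "nrm B (k (X n \<ominus>\<^bsub>?A\<^esub> y)) \<le> nrm ?A (X n \<ominus>\<^bsub>?A\<^esub> y)"
        by (rule cstar_hom_contractive[OF k A.cstar_algebra_axioms B]) (simp add: Xc y)
      then show "norm (nrm B (k (X n) \<ominus>\<^bsub>B\<^esub> k y)) \<le> nrm ?A (X n \<ominus>\<^bsub>?A\<^esub> y)"
        using cstar_homD(1)[OF k Xc] cstar_homD(1)[OF k y]
        by (simp add: cstar_hom_minus_zero[OF k A.cstar_algebra_axioms B] Xc y B.nrm_nonneg)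
    qed
    have "f y = g y"
      by (rule B.lim_unique[of "\<lambda>n. f (X n)"]) (use l[OF f] l[OF g] Xc y in \<open>simp_all add: Xe hf hg\<close>)
    then show "y \<in> ?E" using y by simp
  qed (auto simp: hf hg A.smult_closed A.adj_closed)
  moreover have "ugen S R s \<in> ?E" if "s \<in> S" for s using eq[OF that] ugen_closed[OF SR] by simp
  ultimately have "?E = carrier ?A" by (rule closed_star_subalgebra_universal[OF SR])
  then show ?thesis using x by blast
qed

lemma cstar_hom_onto_universal:
  assumes SR: "bounds_generators (relators S R)" and A: "cstar_algebra A"
    and f: "f \<in> cstar_hom A (universal_cstar S R)" and gen: "\<And>s. s \<in> S \<Longrightarrow> ugen S R s \<in> f ` carrier A"
  shows "f ` carrier A = carrier (universal_cstar S R)"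
proof (rule cstar_hom_surjective[OF f A cstar_algebra_universal[OF SR]])
  let ?B = "universal_cstar S R" and ?\<nu> = "universal_seminorm (relators S R)"
  interpret A: cstar_algebra A by fact
  interpret B: cstar_algebra ?B by (rule cstar_algebra_universal[OF SR])
  note h = cstar_homD[OF f] note fh = free_hom_universal[OF SR]
  have g: "ugen S R s \<in> f ` carrier A" for s
  proof (cases "s \<in> S")
    case False
    have "\<zero>\<^bsub>?B\<^esub> = f \<zero>\<^bsub>A\<^esub>" using cstar_hom_minus_zero(1)[OF f A B.cstar_algebra_axioms] by simp
    then show ?thesis unfolding ugen_outside[OF SR False] by (rule image_eqI) simp
  qed (rule gen)
  have c: "cls ?\<nu> p \<in> f ` carrier A" for p
  proof (induction p rule: free_star_induct)
    case (const c)
    have "cls ?\<nu> (fconst c) = f (c \<odot>\<^bsub>A\<^esub> \<one>\<^bsub>A\<^esub>)" by (simp add: B.fh_const[OF fh] h)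
    then show ?case by (rule image_eqI) (simp add: A.smult_closed)
  next
    case (gen s)
    show ?case by (rule g[unfolded ugen_eq[OF SR]])
  next
    case (adj s)
    obtain a where "a \<in> carrier A" "cls ?\<nu> (fgen s) = f a" using g[of s] unfolding ugen_eq[OF SR] by blast
    then have "cls ?\<nu> (fadj (fgen s)) = f (adj A a)" by (simp add: B.fh_adj[OF fh] h)
    then show ?case by (rule image_eqI) (simp add: A.adj_closed \<open>a \<in> carrier A\<close>)
  next
    case (add p q)
    then obtain a b where ab: "a \<in> carrier A" "b \<in> carrier A" "cls ?\<nu> p = f a" "cls ?\<nu> q = f b" by blast
    then have "cls ?\<nu> (p + q) = f (a \<oplus>\<^bsub>A\<^esub> b)" by (simp add: B.fh_add[OF fh] h)
    then show ?case by (rule image_eqI) (simp add: ab)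
  next
    case (mult p q)
    then obtain a b where ab: "a \<in> carrier A" "b \<in> carrier A" "cls ?\<nu> p = f a" "cls ?\<nu> q = f b" by blast
    then have "cls ?\<nu> (p * q) = f (a \<otimes>\<^bsub>A\<^esub> b)" by (simp add: B.fh_mult[OF fh] h)
    then show ?case by (rule image_eqI) (simp add: ab)
  qed
  fix b and e :: real assume "b \<in> carrier ?B" "0 < e"
  then obtain p where "nrm ?B (b \<ominus>\<^bsub>?B\<^esub> cls ?\<nu> p) < e"
    using completion_dense[OF universal_cstar_seminorm[OF SR]] unfolding universal_cstar_def by metis
  then show "\<exists>a\<in>carrier A. nrm ?B (b \<ominus>\<^bsub>?B\<^esub> f a) < e" using c[of p] by force
qed

section \<open>Universal properties and quantum subgroups\<close>

context
  fixes I :: "nat set" and R :: "(nat \<times> nat) free_star set"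
  assumes SR: "bounds_generators (relators (I \<times> I) R)"
begin

lemma universal_qgroup_simps: "alg (universal_qgroup I R) = universal_cstar (I \<times> I) R" "ind (universal_qgroup I R) = I" "fund (universal_qgroup I R) i j = ugen (I \<times> I) R (i, j)"
  by (simp_all add: universal_qgroup_def)

lemma cstar_algebra_qgroup: "cstar_algebra (alg (universal_qgroup I R))"
  unfolding universal_qgroup_simps by (rule cstar_algebra_universal[OF SR])

lemma fund_cmat: "fund (universal_qgroup I R) \<in> cmat (alg (universal_qgroup I R)) I"
  unfolding cmat_def universal_qgroup_simps using ugen_closed[OF SR] ugen_outside[OF SR] by auto

lemma fund_rel: "r \<in> R \<Longrightarrow> eval (alg (universal_qgroup I R)) (\<lambda>g. fund (universal_qgroup I R) (fst g) (snd g)) r = \<zero>\<^bsub>alg (universal_qgroup I R)\<^esub>"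
  using eval_ugen_eq_zero[OF SR, of r] by (simp add: universal_qgroup_simps relators_def)

lemma qgroup_hom:
  assumes A: "cstar_algebra A" and u: "u \<in> cmat A I"
    and rel: "\<And>r. r \<in> R \<Longrightarrow> eval A (\<lambda>g. u (fst g) (snd g)) r = \<zero>\<^bsub>A\<^esub>"
  shows "\<exists>f\<in>cstar_hom (alg (universal_qgroup I R)) A. \<forall>i j. f (fund (universal_qgroup I R) i j) = u i j"
proof -
  have c: "(\<lambda>g. u (fst g) (snd g)) g \<in> carrier A" for g by (simp add: cmatD[OF u])
  have o: "(\<lambda>g. u (fst g) (snd g)) g = \<zero>\<^bsub>A\<^esub>" if "g \<notin> I \<times> I" for g
    using cmat_outside[OF u, of "fst g" "snd g"] that by (cases g) auto
  show ?thesis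
  proof (rule universal_property[OF SR A c rel o])
    fix f assume "f \<in> cstar_hom (universal_cstar (I \<times> I) R) A"
      "\<And>g. f (ugen (I \<times> I) R g) = u (fst g) (snd g)"
    then show ?thesis by (intro bexI[of _ f] allI) (simp_all only: universal_qgroup_simps fst_conv snd_conv)
  qed
qed

lemma qgroup_hom_unique:
  assumes "cstar_algebra B" "f \<in> cstar_hom (alg (universal_qgroup I R)) B" "g \<in> cstar_hom (alg (universal_qgroup I R)) B"
    and "\<And>i j. i \<in> I \<Longrightarrow> j \<in> I \<Longrightarrow> f (fund (universal_qgroup I R) i j) = g (fund (universal_qgroup I R) i j)" and "x \<in> carrier (alg (universal_qgroup I R))"
  shows "f x = g x"
  by (rule cstar_hom_unique[OF SR assms(1)]) (use assms(2-) in \<open>auto simp: universal_qgroup_simps\<close>)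

lemma qgroup_hom_onto:
  assumes "cstar_algebra A" "f \<in> cstar_hom A (alg (universal_qgroup I R))" "\<And>i j. i \<in> I \<Longrightarrow> j \<in> I \<Longrightarrow> fund (universal_qgroup I R) i j \<in> f ` carrier A"
  shows "f ` carrier A = carrier (alg (universal_qgroup I R))"
  unfolding universal_qgroup_simps
  by (rule cstar_hom_onto_universal[OF SR assms(1)]) (use assms(2-) in \<open>auto simp: universal_qgroup_simps\<close>)

lemma qgroup_generated:
  assumes "closed_star_subalgebra B (alg (universal_qgroup I R))" "\<And>i j. i \<in> I \<Longrightarrow> j \<in> I \<Longrightarrow> fund (universal_qgroup I R) i j \<in> B"
  shows "B = carrier (alg (universal_qgroup I R))"
  unfolding universal_qgroup_simps
  by (rule closed_star_subalgebra_universal[OF SR]) (use assms in \<open>auto simp: universal_qgroup_simps\<close>)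

end

lemma restriction_mapI:
  assumes SR: "bounds_generators (relators (I \<times> I) R)" and SR': "bounds_generators (relators (I \<times> I) R')"
    and f: "f \<in> cstar_hom (alg (universal_qgroup I R)) (alg (universal_qgroup I R'))"
    and eq: "\<And>i j. f (fund (universal_qgroup I R) i j) = fund (universal_qgroup I R') i j"
  shows "restriction_map (universal_qgroup I R') (universal_qgroup I R) f"
proof -
  have "f ` carrier (alg (universal_qgroup I R)) = carrier (alg (universal_qgroup I R'))"
    by (rule qgroup_hom_onto[OF SR' cstar_algebra_qgroup[OF SR] f])
      (metis eq fund_cmat[OF SR] cmatD image_eqI)
  then show ?thesis using f eq by (simp add: restriction_map_def universal_qgroup_def)
qed

text \<open>Adding relations gives a quantum subgroup.\<close>

lemma universal_restriction:
  assumes SR: "bounds_generators (relators (I \<times> I) R)" and SR': "bounds_generators (relators (I \<times> I) R')"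
    and RR': "R \<subseteq> R'"
  shows "\<exists>f. restriction_map (universal_qgroup I R') (universal_qgroup I R) f"
proof -
  have "\<exists>f\<in>cstar_hom (alg (universal_qgroup I R)) (alg (universal_qgroup I R')).
      \<forall>i j. f (fund (universal_qgroup I R) i j) = fund (universal_qgroup I R') i j"
    by (rule qgroup_hom[OF SR cstar_algebra_qgroup[OF SR'] fund_cmat[OF SR'] fund_rel[OF SR']])
      (use RR' in blast)
  then obtain f where "f \<in> cstar_hom (alg (universal_qgroup I R)) (alg (universal_qgroup I R'))"
    "\<And>i j. f (fund (universal_qgroup I R) i j) = fund (universal_qgroup I R') i j" by blast
  then show ?thesis using restriction_mapI[OF SR SR'] by blast
qed

section \<open>The isomorphism induced by \<open>F\<close>\<close>

context bistochastic_basis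
begin

abbreviation "J \<equiv> {1..<N}"
abbreviation "I0 \<equiv> {0..<N}"

lemma bounds_J: "orthogonal_rel J \<subseteq> R \<Longrightarrow> bounds_generators (relators (J \<times> J) R)"
  and bounds_I0: "orthogonal_rel I0 \<subseteq> R \<Longrightarrow> bounds_generators (relators (I0 \<times> I0) R)"
  by (rule bounds_orthogonal; simp)+

lemmas bO = bounds_J[of "orthogonal_rel J", OF order_refl]
lemmas bS = bounds_J[of "orthogonal_rel J \<union> half_commutation_rel J", OF Un_upper1]
lemmas bC = bounds_J[of "orthogonal_rel J \<union> commutation_rel J", OF Un_upper1]
lemmas bB = bounds_I0[of "orthogonal_rel I0 \<union> bistochastic_rel I0", OF Un_upper1]
lemmas bU = bounds_unitary[of I0, OF finite_atLeastLessThan]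

lemmas qdefs = O_plus_def O_star_def O_comm_def B_plus_def U_plus_def

lemma algebras:
  "cstar_algebra (alg (O_plus J))" "cstar_algebra (alg (O_star J))" "cstar_algebra (alg (O_comm J))"
  "cstar_algebra (alg (B_plus I0))" "cstar_algebra (alg (U_plus I0))"
  unfolding qdefs using cstar_algebra_qgroup[OF bO] cstar_algebra_qgroup[OF bS] cstar_algebra_qgroup[OF bC]
    cstar_algebra_qgroup[OF bB] cstar_algebra_qgroup[OF bU] by simp_all

lemma rotated: "cstar_algebra A \<Longrightarrow> rotated_algebra A N F"
  by (simp add: rotated_algebra_def bistochastic_basis_axioms)

lemma funds:
  "orth (alg (O_plus J)) J (fund (O_plus J))"
  "orth (alg (O_star J)) J (fund (O_star J))" "half_comm (alg (O_star J)) (fund (O_star J))"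
  "orth (alg (O_comm J)) J (fund (O_comm J))" "comm (alg (O_comm J)) (fund (O_comm J))"
  "orth (alg (B_plus I0)) I0 (fund (B_plus I0))" "row_sums_one (alg (B_plus I0)) I0 (fund (B_plus I0))"
proof -
  have e: "fund G = (\<lambda>i j. (\<lambda>g. fund G (fst g) (snd g)) (i, j))" for G :: "'z qgroup" by simp
  note E = cstar_algebra.eval_orthogonal_rel cstar_algebra.eval_half_commutation_rel
    cstar_algebra.eval_commutation_rel cstar_algebra.eval_bistochastic_rel
  show "orth (alg (O_plus J)) J (fund (O_plus J))"
    using E(1)[OF cstar_algebra_qgroup[OF bO], of "\<lambda>g. fund (universal_qgroup J (orthogonal_rel J)) (fst g) (snd g)" J]
      fund_cmat[OF bO] fund_rel[OF bO] by (simp add: qdefs)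
  let ?h = "\<lambda>g. fund (universal_qgroup J (orthogonal_rel J \<union> half_commutation_rel J)) (fst g) (snd g)"
  show "orth (alg (O_star J)) J (fund (O_star J))" "half_comm (alg (O_star J)) (fund (O_star J))"
    using E(1)[OF cstar_algebra_qgroup[OF bS], of ?h J] E(2)[OF cstar_algebra_qgroup[OF bS], of ?h J]
      fund_cmat[OF bS] fund_rel[OF bS] by (simp_all add: qdefs)
  let ?h = "\<lambda>g. fund (universal_qgroup J (orthogonal_rel J \<union> commutation_rel J)) (fst g) (snd g)"
  show "orth (alg (O_comm J)) J (fund (O_comm J))" "comm (alg (O_comm J)) (fund (O_comm J))"
    using E(1)[OF cstar_algebra_qgroup[OF bC], of ?h J] E(3)[OF cstar_algebra_qgroup[OF bC], of ?h J]
      fund_cmat[OF bC] fund_rel[OF bC] by (simp_all add: qdefs)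
  let ?h = "\<lambda>g. fund (universal_qgroup I0 (orthogonal_rel I0 \<union> bistochastic_rel I0)) (fst g) (snd g)"
  show "orth (alg (B_plus I0)) I0 (fund (B_plus I0))" "row_sums_one (alg (B_plus I0)) I0 (fund (B_plus I0))"
    using E(1)[OF cstar_algebra_qgroup[OF bB], of ?h I0] E(4)[OF cstar_algebra_qgroup[OF bB], of ?h I0]
      fund_cmat[OF bB] fund_rel[OF bB] by (simp_all add: qdefs)
qed

lemma O_plus_hom:
  assumes A: "cstar_algebra A" and u: "orth A J u"
  shows "\<exists>f\<in>cstar_hom (alg (O_plus J)) A. \<forall>i j. f (fund (O_plus J) i j) = u i j"
proof -
  note uc = cstar_algebra.orthD(1)[OF A u]
  have "eval A (\<lambda>g. u (fst g) (snd g)) r = \<zero>\<^bsub>A\<^esub>" if "r \<in> orthogonal_rel J" for r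
    using cstar_algebra.eval_orthogonal_rel[OF A, of "\<lambda>g. u (fst g) (snd g)" J] uc u that by simp
  from qgroup_hom[OF bO A uc this] show ?thesis unfolding qdefs .
qed

lemma O_star_hom:
  assumes A: "cstar_algebra A" and u: "orth A J u" "half_comm A u"
  shows "\<exists>f\<in>cstar_hom (alg (O_star J)) A. \<forall>i j. f (fund (O_star J) i j) = u i j"
proof -
  note uc = cstar_algebra.orthD(1)[OF A u(1)]
  have "eval A (\<lambda>g. u (fst g) (snd g)) r = \<zero>\<^bsub>A\<^esub>" if "r \<in> orthogonal_rel J \<union> half_commutation_rel J" for r
    using cstar_algebra.eval_orthogonal_rel[OF A, of "\<lambda>g. u (fst g) (snd g)" J]
      cstar_algebra.eval_half_commutation_rel[OF A, of "\<lambda>g. u (fst g) (snd g)" J] uc u that by auto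
  from qgroup_hom[OF bS A uc this] show ?thesis unfolding qdefs .
qed

lemma O_comm_hom:
  assumes A: "cstar_algebra A" and u: "orth A J u" "comm A u"
  shows "\<exists>f\<in>cstar_hom (alg (O_comm J)) A. \<forall>i j. f (fund (O_comm J) i j) = u i j"
proof -
  note uc = cstar_algebra.orthD(1)[OF A u(1)]
  have "eval A (\<lambda>g. u (fst g) (snd g)) r = \<zero>\<^bsub>A\<^esub>" if "r \<in> orthogonal_rel J \<union> commutation_rel J" for r
    using cstar_algebra.eval_orthogonal_rel[OF A, of "\<lambda>g. u (fst g) (snd g)" J]
      cstar_algebra.eval_commutation_rel[OF A, of "\<lambda>g. u (fst g) (snd g)" J] uc u that by auto
  from qgroup_hom[OF bC A uc this] show ?thesis unfolding qdefs .
qed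

lemma B_plus_hom:
  assumes A: "cstar_algebra A" and u: "orth A I0 u" "row_sums_one A I0 u"
  shows "\<exists>f\<in>cstar_hom (alg (B_plus I0)) A. \<forall>i j. f (fund (B_plus I0) i j) = u i j"
proof -
  note uc = cstar_algebra.orthD(1)[OF A u(1)]
  have "eval A (\<lambda>g. u (fst g) (snd g)) r = \<zero>\<^bsub>A\<^esub>" if "r \<in> orthogonal_rel I0 \<union> bistochastic_rel I0" for r
    using cstar_algebra.eval_orthogonal_rel[OF A, of "\<lambda>g. u (fst g) (snd g)" I0]
      cstar_algebra.eval_bistochastic_rel[OF A, of "\<lambda>g. u (fst g) (snd g)" I0] uc u that by auto
  from qgroup_hom[OF bB A uc this] show ?thesis unfolding qdefs .
qed

lemma U_plus_hom:
  assumes A: "cstar_algebra A" and u: "orth A I0 u"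
  shows "\<exists>f\<in>cstar_hom (alg (U_plus I0)) A. \<forall>i j. f (fund (U_plus I0) i j) = u i j"
proof -
  note uc = cstar_algebra.orthD(1)[OF A u]
  have "eval A (\<lambda>g. u (fst g) (snd g)) r = \<zero>\<^bsub>A\<^esub>" if "r \<in> unitary_rel I0" for r
    using cstar_algebra.eval_unitary_rel[OF A, of "\<lambda>g. u (fst g) (snd g)" I0 r] uc u that by simp
  from qgroup_hom[OF bU A uc this] show ?thesis unfolding qdefs .
qed

text \<open>The matrix \<open>F diag(1, w) F\<^sup>t\<close>.\<close>

definition lift :: "'a cstar \<Rightarrow> 'a mat \<Rightarrow> 'a mat" where
  "lift A w = rot A N F (blk A w)"

lemma lift_orth:
  assumes A: "cstar_algebra A" and w: "orth A J w"
  shows "orth A I0 (lift A w)" "row_sums_one A I0 (lift A w)"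
proof -
  interpret rotated_algebra A N F by (rule rotated[OF A])
  show "orth A I0 (lift A w)" unfolding lift_def
    by (rule rot_orth) (use orth_blk[OF N orthD(1)[OF w]] w in simp)
  show "row_sums_one A I0 (lift A w)"
    unfolding lift_def row_sums_one_def using rot_row_sum[OF orthD(1)[OF w]] by blast
qed

lemma lift_hom:
  assumes f: "f \<in> cstar_hom A B" and A: "cstar_algebra A" and B: "cstar_algebra B" and w: "w \<in> cmat A J"
  shows "f (lift A w i j) = lift B (\<lambda>i j. f (w i j)) i j"
proof -
  interpret A: cstar_algebra A by fact
  have "(\<lambda>i j. f (blk A w i j)) = blk B (\<lambda>i j. f (w i j))"
    by (intro ext) (rule cstar_hom_blk[OF f])
  then show ?thesis unfolding lift_def
    by (simp only: cstar_hom_rot[OF f A B A.blk_cmat[OF N w]])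
qed

lemma blk_inside: "i \<in> J \<Longrightarrow> blk A w i j = w i j"
  by (simp add: blk_def)

lemma exists_induced:
  obtains \<Phi> \<Psi> where "\<Phi> \<in> cstar_hom (alg (O_plus J)) (alg (B_plus I0))" "\<Psi> \<in> cstar_hom (alg (B_plus I0)) (alg (O_plus J))"
    "\<And>i j. i \<in> J \<Longrightarrow> \<Phi> (fund (O_plus J) i j) = unrot (alg (B_plus I0)) N F (fund (B_plus I0)) i j"
    "\<And>i j. \<Psi> (fund (B_plus I0) i j) = lift (alg (O_plus J)) (fund (O_plus J)) i j"
    "\<And>x. x \<in> carrier (alg (O_plus J)) \<Longrightarrow> \<Psi> (\<Phi> x) = x" "\<And>y. y \<in> carrier (alg (B_plus I0)) \<Longrightarrow> \<Phi> (\<Psi> y) = y"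
proof -
  let ?O = "alg (O_plus J)" and ?B = "alg (B_plus I0)" and ?w = "fund (O_plus J)" and ?u = "fund (B_plus I0)"
  note O = algebras(1) and B = algebras(4)
  interpret RO: rotated_algebra ?O N F by (rule rotated[OF O])
  interpret RB: rotated_algebra ?B N F by (rule rotated[OF B])
  note wc = RO.orthD(1)[OF funds(1)] and uc = RB.orthD(1)[OF funds(6)]
  have row: "(\<Oplus>\<^bsub>?B\<^esub>j\<in>I0. ?u i j) = \<one>\<^bsub>?B\<^esub>" if "i \<in> I0" for i
    using funds(7) that unfolding row_sums_one_def by blast
  obtain v where v: "orth ?B J v" "unrot ?B N F ?u = blk ?B v" "rot ?B N F (blk ?B v) = ?u"
    by (rule RB.unrot_bistochastic[OF funds(6) row])
  obtain \<Phi> where \<Phi>: "\<Phi> \<in> cstar_hom ?O ?B" "\<And>i j. \<Phi> (?w i j) = v i j"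
    using O_plus_hom[OF B v(1)] by blast
  obtain \<Psi> where \<Psi>: "\<Psi> \<in> cstar_hom ?B ?O" "\<And>i j. \<Psi> (?u i j) = lift ?O ?w i j"
    using B_plus_hom[OF O lift_orth[OF O funds(1)]] by blast
  have vJ: "v i j = unrot ?B N F ?u i j" if "i \<in> J" for i j unfolding v(2) by (rule blk_inside[OF that, symmetric])
  have \<Psi>f: "(\<lambda>i j. \<Psi> (?u i j)) = rot ?O N F (blk ?O ?w)" by (intro ext) (simp add: \<Psi>(2) lift_def)
  have 1: "\<Psi> (\<Phi> (?w i j)) = ?w i j" if "i \<in> J" for i j
    unfolding \<Phi>(2) vJ[OF that] cstar_hom_rot[OF \<Psi>(1) B O uc] \<Psi>f
    by (simp only: RO.rot_unrot[OF RO.blk_cmat[OF N wc]] blk_inside[OF that])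
  have 2: "\<Phi> (\<Psi> (?u i j)) = ?u i j" for i j
    unfolding \<Psi>(2) lift_hom[OF \<Phi>(1) O B wc] \<Phi>(2) by (simp only: lift_def v(3))
  show ?thesis
  proof (rule that[OF \<Phi>(1) \<Psi>(1) _ \<Psi>(2)])
    show "\<Phi> (?w i j) = unrot ?B N F ?u i j" if "i \<in> J" for i j unfolding \<Phi>(2) by (rule vJ[OF that])
    show "\<Psi> (\<Phi> x) = x" if "x \<in> carrier ?O" for x
      using qgroup_hom_unique[OF bO, of ?O "\<lambda>x. \<Psi> (\<Phi> x)" "\<lambda>x. x" x] cstar_hom_comp[OF \<Phi>(1) \<Psi>(1)] cstar_hom_id
        O that 1 unfolding qdefs by blast
    show "\<Phi> (\<Psi> y) = y" if "y \<in> carrier ?B" for y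
      using qgroup_hom_unique[OF bB, of ?B "\<lambda>x. \<Phi> (\<Psi> x)" "\<lambda>x. x" y] cstar_hom_comp[OF \<Psi>(1) \<Phi>(1)] cstar_hom_id
        B that 2 unfolding qdefs by blast
  qed
qed

lemma conj_entry_eq:
  assumes A: "cstar_algebra (alg G)" and G: "ind G = I0" "fund G \<in> cmat (alg G) I0" and ij: "i \<in> I0" "j \<in> I0"
  shows "conj_entry F G i j = unrot (alg G) N F (fund G) i j"
proof -
  let ?A = "alg G"
  interpret cstar_algebra ?A by fact
  note C = cmatD[OF G(2)]
  have "unrot ?A N F (fund G) i j = (\<Oplus>\<^bsub>?A\<^esub>k\<in>I0. complex_of_real (F k i) \<odot>\<^bsub>?A\<^esub> mmul ?A I0 (fund G) (smat ?A I0 F) k j)"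
    unfolding rot_def using smat_left[OF mmul_cmat[OF G(2) smat_cmat] ij(1), of "tpose F" F j] by simp
  also have "\<dots> = conj_entry F G i j"
    unfolding conj_entry_def G(1)
  proof (rule finsum_eqI)
    fix k
    have s: "mmul ?A I0 (fund G) (smat ?A I0 F) k j = (\<Oplus>\<^bsub>?A\<^esub>l\<in>I0. complex_of_real (F l j) \<odot>\<^bsub>?A\<^esub> fund G k l)"
      by (rule smat_right[OF G(2) ij(2)])
    have "complex_of_real (F k i) \<odot>\<^bsub>?A\<^esub> (\<Oplus>\<^bsub>?A\<^esub>l\<in>I0. complex_of_real (F l j) \<odot>\<^bsub>?A\<^esub> fund G k l) =
      (\<Oplus>\<^bsub>?A\<^esub>l\<in>I0. complex_of_real (F k i) \<odot>\<^bsub>?A\<^esub> (complex_of_real (F l j) \<odot>\<^bsub>?A\<^esub> fund G k l))"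
      by (rule smult_finsum) (simp add: smult_closed C)
    also have "\<dots> = (\<Oplus>\<^bsub>?A\<^esub>l\<in>I0. complex_of_real (F k i * F l j) \<odot>\<^bsub>?A\<^esub> fund G k l)"
      by (simp add: C smult_smult)
    finally show "complex_of_real (F k i) \<odot>\<^bsub>?A\<^esub> mmul ?A I0 (fund G) (smat ?A I0 F) k j =
      (\<Oplus>\<^bsub>?A\<^esub>l\<in>I0. complex_of_real (F k i * F l j) \<odot>\<^bsub>?A\<^esub> fund G k l)" unfolding s .
    show "(\<Oplus>\<^bsub>?A\<^esub>l\<in>I0. complex_of_real (F k i * F l j) \<odot>\<^bsub>?A\<^esub> fund G k l) \<in> carrier ?A"
      by (rule finsum_mem) (simp add: smult_closed C)
  qed
  finally show ?thesis by simp
qed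

lemma induced_iso: "is_induced_iso N F (induced_iso N F)"
proof (rule exists_induced)
  fix \<Phi> \<Psi>
  assume *: "\<Phi> \<in> cstar_hom (alg (O_plus J)) (alg (B_plus I0))" "\<Psi> \<in> cstar_hom (alg (B_plus I0)) (alg (O_plus J))"
    "\<And>i j. i \<in> J \<Longrightarrow> \<Phi> (fund (O_plus J) i j) = unrot (alg (B_plus I0)) N F (fund (B_plus I0)) i j"
    "\<And>x. x \<in> carrier (alg (O_plus J)) \<Longrightarrow> \<Psi> (\<Phi> x) = x" "\<And>y. y \<in> carrier (alg (B_plus I0)) \<Longrightarrow> \<Phi> (\<Psi> y) = y"
  have "bij_betw \<Phi> (carrier (alg (O_plus J))) (carrier (alg (B_plus I0)))"
    by (rule bij_betw_byWitness[where f' = \<Psi>]) (use * cstar_homD(1)[OF *(1)] cstar_homD(1)[OF *(2)] in auto)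
  moreover have "\<Phi> (fund (O_plus J) i j) = conj_entry F (B_plus I0) i j" if "i \<in> J" "j \<in> J" for i j
    using conj_entry_eq[OF algebras(4), of i j] cstar_algebra.orthD(1)[OF algebras(4) funds(6)] that *(3)[OF that(1), of j]
    by (simp add: B_plus_def universal_qgroup_def)
  ultimately have "is_induced_iso N F \<Phi>" using *(1) by (simp add: is_induced_iso_def cstar_iso_def)
  then show ?thesis unfolding induced_iso_def by (rule someI[where P = "is_induced_iso N F"])
qed

lemma induced_iso_inverse:
  "inv_into (carrier (alg (O_plus J))) (induced_iso N F) (fund (B_plus I0) i j) = lift (alg (O_plus J)) (fund (O_plus J)) i j"
proof (rule exists_induced)
  let ?O = "alg (O_plus J)" and ?B = "alg (B_plus I0)"
  fix \<Phi> \<Psi>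
  assume *: "\<Phi> \<in> cstar_hom ?O ?B" "\<Psi> \<in> cstar_hom ?B ?O"
    "\<And>i j. i \<in> J \<Longrightarrow> \<Phi> (fund (O_plus J) i j) = unrot ?B N F (fund (B_plus I0)) i j"
    "\<And>i j. \<Psi> (fund (B_plus I0) i j) = lift ?O (fund (O_plus J)) i j"
    "\<And>x. x \<in> carrier ?O \<Longrightarrow> \<Psi> (\<Phi> x) = x" "\<And>y. y \<in> carrier ?B \<Longrightarrow> \<Phi> (\<Psi> y) = y"
  let ?P = "induced_iso N F"
  have P: "?P \<in> cstar_hom ?O ?B" "bij_betw ?P (carrier ?O) (carrier ?B)"
    "\<And>i j. i \<in> J \<Longrightarrow> j \<in> J \<Longrightarrow> ?P (fund (O_plus J) i j) = conj_entry F (B_plus I0) i j"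
    using induced_iso unfolding is_induced_iso_def cstar_iso_def by blast+
  note uc = cstar_algebra.orthD(1)[OF algebras(4) funds(6)]
  have "?P (fund (O_plus J) i j) = \<Phi> (fund (O_plus J) i j)" if "i \<in> J" "j \<in> J" for i j
    using conj_entry_eq[OF algebras(4), of i j] uc that *(3)[OF that(1), of j] P(3)[OF that]
    by (simp add: B_plus_def universal_qgroup_def)
  then have eq: "?P x = \<Phi> x" if "x \<in> carrier ?O" for x
    using qgroup_hom_unique[OF bO, of ?B ?P \<Phi> x] P(1) *(1) algebras(4) that unfolding qdefs by blast
  have c: "fund (B_plus I0) i j \<in> carrier ?B" by (rule cmatD[OF uc])
  then have c': "\<Psi> (fund (B_plus I0) i j) \<in> carrier ?O" by (rule cstar_homD(1)[OF *(2)])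
  have "inv_into (carrier ?O) ?P (?P (\<Psi> (fund (B_plus I0) i j))) = \<Psi> (fund (B_plus I0) i j)"
    by (rule inv_into_f_f[OF bij_betw_imp_inj_on[OF P(2)] c'])
  then show ?thesis using eq[OF c'] *(6)[OF c] *(4) by simp
qed

text \<open>The fundamental matrix of the image of \<open>H\<close> is \<open>F diag(1, w) F\<^sup>t\<close>.\<close>

lemma F_image_simps:
  assumes ex: "\<exists>g. restriction_map H (O_plus J) g" and H: "cstar_algebra (alg H)" "fund H \<in> cmat (alg H) J"
  shows "alg (F_image N F H) = alg H" "ind (F_image N F H) = I0"
    "fund (F_image N F H) = lift (alg H) (fund H)"
proof -
  let ?O = "alg (O_plus J)"
  show "alg (F_image N F H) = alg H" "ind (F_image N F H) = I0"
    by (simp_all add: F_image_def image_subgroup_def B_plus_def universal_qgroup_def)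
  define g where "g = (SOME g. restriction_map H (O_plus J) g)"
  have "restriction_map H (O_plus J) g" unfolding g_def using ex by (rule someI_ex)
  then have g: "g \<in> cstar_hom ?O (alg H)" "\<And>i j. i \<in> J \<Longrightarrow> j \<in> J \<Longrightarrow> g (fund (O_plus J) i j) = fund H i j"
    unfolding restriction_map_def by (auto simp: O_plus_def universal_qgroup_def)
  note wc = cstar_algebra.orthD(1)[OF algebras(1) funds(1)]
  have "(\<lambda>i j. g (fund (O_plus J) i j)) = fund H"
  proof (intro ext)
    fix i j
    show "g (fund (O_plus J) i j) = fund H i j"
    proof (cases "i \<in> J \<and> j \<in> J")
      case False
      then have "fund (O_plus J) i j = \<zero>\<^bsub>?O\<^esub>" "fund H i j = \<zero>\<^bsub>alg H\<^esub>"
        using cmat_outside[OF wc, of i j] cmat_outside[OF H(2), of i j] by blast+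
      then show ?thesis using cstar_hom_minus_zero(1)[OF g(1) algebras(1) H(1)] by simp
    qed (use g in blast)
  qed
  then have "g (lift ?O (fund (O_plus J)) i j) = lift (alg H) (fund H) i j" for i j
    using lift_hom[OF g(1) algebras(1) H(1) wc, of i j] by simp
  then show "fund (F_image N F H) = lift (alg H) (fund H)"
    unfolding F_image_def image_subgroup_def
    by (simp add: induced_iso_inverse fun_eq_iff del: One_nat_def flip: g_def)
qed

lemma restrictions:
  shows "\<exists>f. restriction_map (O_comm J) (O_star J) f" "\<exists>f. restriction_map (O_star J) (O_plus J) f"
    "\<exists>f. restriction_map (O_comm J) (O_plus J) f"
proof -
  show "\<exists>f. restriction_map (O_star J) (O_plus J) f" "\<exists>f. restriction_map (O_comm J) (O_plus J) f"
    unfolding qdefs using universal_restriction[OF bO bS Un_upper1] universal_restriction[OF bO bC Un_upper1] by blast+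
  interpret C: cstar_algebra "alg (O_comm J)" by (rule algebras(3))
  note c = C.orthD(2)[OF funds(4)] and cc = funds(5)[unfolded comm_def]
  have "half_comm (alg (O_comm J)) (fund (O_comm J))"
    unfolding half_comm_def
  proof (intro allI)
    fix i j k l m n
    let ?a = "fund (O_comm J) i j" and ?b = "fund (O_comm J) k l" and ?c = "fund (O_comm J) m n"
    let ?M = "(\<otimes>\<^bsub>alg (O_comm J)\<^esub>)"
    have "?M (?M ?a ?b) ?c = ?M (?M ?b ?a) ?c" using cc by metis
    also have "\<dots> = ?M ?b (?M ?a ?c)" by (rule C.m_assoc[OF c c c])
    also have "\<dots> = ?M ?b (?M ?c ?a)" using cc by metis
    also have "\<dots> = ?M (?M ?b ?c) ?a" by (rule C.m_assoc[OF c c c, symmetric])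
    also have "\<dots> = ?M (?M ?c ?b) ?a" using cc by metis
    finally show "?M (?M ?a ?b) ?c = ?M (?M ?c ?b) ?a" .
  qed
  then obtain f where f: "f \<in> cstar_hom (alg (O_star J)) (alg (O_comm J))" "\<And>i j. f (fund (O_star J) i j) = fund (O_comm J) i j"
    using O_star_hom[OF algebras(3) funds(4)] by blast
  have "restriction_map (O_comm J) (O_star J) f"
    unfolding qdefs by (rule restriction_mapI[OF bS bC f[unfolded qdefs]])
  then show "\<exists>f. restriction_map (O_comm J) (O_star J) f" by blast
qed

end

section \<open>Classical groups\<close>

text \<open>The function algebra \<open>C(\<Gamma>)\<close>.\<close>

abbreviation CG :: "nat set \<Rightarrow> (nat \<Rightarrow> nat \<Rightarrow> real) set \<Rightarrow> ((nat \<Rightarrow> nat \<Rightarrow> real) \<Rightarrow> complex) cstar" where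
  "CG I \<Gamma> \<equiv> alg (classical_qgroup I \<Gamma>)"

lemma classical_simps:
  "f \<in> carrier (CG I \<Gamma>) \<longleftrightarrow> continuous_on \<Gamma> f \<and> (\<forall>g. g \<notin> \<Gamma> \<longrightarrow> f g = 0)"
  "f \<otimes>\<^bsub>CG I \<Gamma>\<^esub> h = (\<lambda>g. f g * h g)" "\<one>\<^bsub>CG I \<Gamma>\<^esub> = (\<lambda>g. of_bool (g \<in> \<Gamma>))" "\<zero>\<^bsub>CG I \<Gamma>\<^esub> = (\<lambda>g. 0)"
  "f \<oplus>\<^bsub>CG I \<Gamma>\<^esub> h = (\<lambda>g. f g + h g)" "c \<odot>\<^bsub>CG I \<Gamma>\<^esub> f = (\<lambda>g. c * f g)" "adj (CG I \<Gamma>) f = (\<lambda>g. cnj (f g))"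
  "nrm (CG I \<Gamma>) f = (SUP g\<in>\<Gamma>. cmod (f g))" "ind (classical_qgroup I \<Gamma>) = I"
  "fund (classical_qgroup I \<Gamma>) i j g = (if g \<in> \<Gamma> then complex_of_real (g i j) else 0)"
  by (simp_all add: classical_qgroup_def)

lemma continuous_of_bool: "continuous_on \<Gamma> (\<lambda>g. of_bool (g \<in> \<Gamma>) :: complex)"
  using continuous_on_cong[of \<Gamma> \<Gamma> "\<lambda>g. of_bool (g \<in> \<Gamma>) :: complex" "\<lambda>_. 1"] by simp

lemma classical_ring: "ring (CG I \<Gamma>)"
proof (rule ringI)
  show "abelian_group (CG I \<Gamma>)"
  proof (rule abelian_groupI)
    fix f assume "f \<in> carrier (CG I \<Gamma>)"
    then show "\<exists>h\<in>carrier (CG I \<Gamma>). h \<oplus>\<^bsub>CG I \<Gamma>\<^esub> f = \<zero>\<^bsub>CG I \<Gamma>\<^esub>"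
      by (intro bexI[of _ "\<lambda>g. - f g"]) (auto simp: classical_simps intro: continuous_intros)
  qed (auto simp: classical_simps intro!: continuous_intros)
  show "monoid (CG I \<Gamma>)"
    by (rule monoidI) (auto simp: classical_simps fun_eq_iff intro!: continuous_intros continuous_of_bool)
qed (auto simp: classical_simps algebra_simps)

lemma classical_minus:
  assumes "f \<in> carrier (CG I \<Gamma>)" "h \<in> carrier (CG I \<Gamma>)"
  shows "f \<ominus>\<^bsub>CG I \<Gamma>\<^esub> h = (\<lambda>g. f g - h g)"
proof -
  interpret ring "CG I \<Gamma>" by (rule classical_ring)
  have "\<ominus>\<^bsub>CG I \<Gamma>\<^esub> h = (\<lambda>g. - h g)"
    by (rule minus_equality) (use assms in \<open>auto simp: classical_simps intro: continuous_intros\<close>)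
  then show ?thesis by (simp add: a_minus_def classical_simps)
qed

locale compact_group =
  fixes I :: "nat set" and \<Gamma> :: "(nat \<Rightarrow> nat \<Rightarrow> real) set"
  assumes compact: "compact \<Gamma>" and nonempty: "\<Gamma> \<noteq> {}"
begin

lemma nrm_upper:
  assumes "f \<in> carrier (CG I \<Gamma>)" "g \<in> \<Gamma>" shows "cmod (f g) \<le> nrm (CG I \<Gamma>) f"
proof -
  have "compact ((\<lambda>g. cmod (f g)) ` \<Gamma>)"
    using assms compact by (intro compact_continuous_image continuous_on_norm) (auto simp: classical_simps)
  then have "bdd_above ((\<lambda>g. cmod (f g)) ` \<Gamma>)" by (intro bounded_imp_bdd_above compact_imp_bounded)
  then show ?thesis unfolding classical_simps by (rule cSUP_upper[OF assms(2)])
qed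

lemma nrm_least: "(\<And>g. g \<in> \<Gamma> \<Longrightarrow> cmod (f g) \<le> b) \<Longrightarrow> nrm (CG I \<Gamma>) f \<le> b"
  unfolding classical_simps by (rule cSUP_least[OF nonempty])

lemma nrm_ge_0: "f \<in> carrier (CG I \<Gamma>) \<Longrightarrow> 0 \<le> nrm (CG I \<Gamma>) f"
  using nrm_upper nonempty order_trans[OF norm_ge_zero] by blast

lemma classical_complete:
  assumes X: "\<And>n. X n \<in> carrier (CG I \<Gamma>)"
    and cauchy: "\<forall>e>0. \<exists>M. \<forall>m\<ge>M. \<forall>n\<ge>M. nrm (CG I \<Gamma>) (X m \<ominus>\<^bsub>CG I \<Gamma>\<^esub> X n) < e"
  shows "\<exists>x\<in>carrier (CG I \<Gamma>). (\<lambda>n. nrm (CG I \<Gamma>) (X n \<ominus>\<^bsub>CG I \<Gamma>\<^esub> x)) \<longlonglongrightarrow> 0"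
proof -
  interpret ring "CG I \<Gamma>" by (rule classical_ring)
  have "uniformly_Cauchy_on \<Gamma> X"
    unfolding uniformly_Cauchy_on_def
  proof (intro allI impI)
    fix e :: real assume "0 < e"
    then obtain M where M: "\<And>m n. M \<le> m \<Longrightarrow> M \<le> n \<Longrightarrow> nrm (CG I \<Gamma>) (X m \<ominus>\<^bsub>CG I \<Gamma>\<^esub> X n) < e"
      using cauchy by blast
    have "dist (X m g) (X n g) < e" if "g \<in> \<Gamma>" "M \<le> m" "M \<le> n" for g m n
      using nrm_upper[OF minus_closed[OF X X] that(1), of m n] M[OF that(2,3)]
      by (simp add: classical_minus[OF X X] dist_norm)
    then show "\<exists>M. \<forall>x\<in>\<Gamma>. \<forall>m\<ge>M. \<forall>n\<ge>M. dist (X m x) (X n x) < e" by blast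
  qed
  then obtain l where l: "uniform_limit \<Gamma> X l sequentially"
    using Cauchy_uniformly_convergent unfolding uniformly_convergent_uniform_limit_iff by blast
  have "continuous_on \<Gamma> l"
    by (rule uniform_limit_theorem[OF _ l]) (use X in \<open>auto simp: classical_simps\<close>)
  then have "continuous_on \<Gamma> (\<lambda>g. if g \<in> \<Gamma> then l g else 0)"
    using continuous_on_cong[of \<Gamma> \<Gamma> "\<lambda>g. if g \<in> \<Gamma> then l g else 0" l] by simp
  then have L: "(\<lambda>g. if g \<in> \<Gamma> then l g else 0) \<in> carrier (CG I \<Gamma>)" by (simp add: classical_simps)
  have "(\<lambda>n. nrm (CG I \<Gamma>) (X n \<ominus>\<^bsub>CG I \<Gamma>\<^esub> (\<lambda>g. if g \<in> \<Gamma> then l g else 0))) \<longlonglongrightarrow> 0"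
  proof (rule LIMSEQ_I)
    fix e :: real assume e: "0 < e"
    then obtain M where M: "\<And>n g. M \<le> n \<Longrightarrow> g \<in> \<Gamma> \<Longrightarrow> dist (X n g) (l g) < e / 2"
      using uniform_limitD[OF l, of "e / 2"] unfolding eventually_sequentially by auto
    have "nrm (CG I \<Gamma>) (X n \<ominus>\<^bsub>CG I \<Gamma>\<^esub> (\<lambda>g. if g \<in> \<Gamma> then l g else 0)) \<le> e / 2" if "M \<le> n" for n
      by (rule nrm_least) (use M[OF that] in \<open>auto simp: classical_minus[OF X L] dist_norm less_imp_le\<close>)
    note near = this
    have nn: "0 \<le> nrm (CG I \<Gamma>) (X n \<ominus>\<^bsub>CG I \<Gamma>\<^esub> (\<lambda>g. if g \<in> \<Gamma> then l g else 0))" for n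
      by (rule nrm_ge_0[OF minus_closed[OF X L]])
    show "\<exists>M. \<forall>n\<ge>M. norm (nrm (CG I \<Gamma>) (X n \<ominus>\<^bsub>CG I \<Gamma>\<^esub> (\<lambda>g. if g \<in> \<Gamma> then l g else 0)) - 0) < e"
    proof (intro exI allI impI)
      fix n assume "M \<le> n"
      from near[OF this] e show "norm (nrm (CG I \<Gamma>) (X n \<ominus>\<^bsub>CG I \<Gamma>\<^esub> (\<lambda>g. if g \<in> \<Gamma> then l g else 0)) - 0) < e"
        by (simp add: nn)
    qed
  qed
  with L show ?thesis by blast
qed

lemma cstar_algebra_classical: "cstar_algebra (CG I \<Gamma>)"
proof -
  interpret ring "CG I \<Gamma>" by (rule classical_ring)
  show ?thesis
  proof unfold_locales
    fix f assume f: "f \<in> carrier (CG I \<Gamma>)"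
    show "adj (CG I \<Gamma>) f \<in> carrier (CG I \<Gamma>)" using f by (auto simp: classical_simps intro: continuous_intros)
    show "nrm (CG I \<Gamma>) f = 0 \<longleftrightarrow> f = \<zero>\<^bsub>CG I \<Gamma>\<^esub>"
    proof
      assume "nrm (CG I \<Gamma>) f = 0"
      then show "f = \<zero>\<^bsub>CG I \<Gamma>\<^esub>" using nrm_upper[OF f] f by (force simp: classical_simps(1,4))
    next
      assume "f = \<zero>\<^bsub>CG I \<Gamma>\<^esub>"
      then have "nrm (CG I \<Gamma>) f \<le> 0" by (intro nrm_least) (simp add: classical_simps(4))
      then show "nrm (CG I \<Gamma>) f = 0" using nrm_ge_0[OF f] by simp
    qed
    fix c
    show c: "c \<odot>\<^bsub>CG I \<Gamma>\<^esub> f \<in> carrier (CG I \<Gamma>)" for c using f by (auto simp: classical_simps intro: continuous_intros)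
    have le: "nrm (CG I \<Gamma>) (c \<odot>\<^bsub>CG I \<Gamma>\<^esub> h) \<le> cmod c * nrm (CG I \<Gamma>) h" if "h \<in> carrier (CG I \<Gamma>)" for c h
      using nrm_upper[OF that] by (intro nrm_least) (simp add: classical_simps(6) norm_mult mult_left_mono)
    show "nrm (CG I \<Gamma>) (c \<odot>\<^bsub>CG I \<Gamma>\<^esub> f) = cmod c * nrm (CG I \<Gamma>) f"
    proof (cases "c = 0")
      case True
      then show ?thesis using le[OF f, of c] nrm_ge_0[OF c[of c]] by simp
    next
      case False
      have "inverse c \<odot>\<^bsub>CG I \<Gamma>\<^esub> (c \<odot>\<^bsub>CG I \<Gamma>\<^esub> f) = f" using False by (simp add: classical_simps(6) flip: mult.assoc)
      then have "cmod c * nrm (CG I \<Gamma>) f \<le> nrm (CG I \<Gamma>) (c \<odot>\<^bsub>CG I \<Gamma>\<^esub> f)"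
        using le[OF c[of c], of "inverse c"] False by (simp add: norm_inverse norm_divide field_simps)
      with le[OF f, of c] show ?thesis by simp
    qed
    show "nrm (CG I \<Gamma>) (adj (CG I \<Gamma>) f \<otimes>\<^bsub>CG I \<Gamma>\<^esub> f) = (nrm (CG I \<Gamma>) f)\<^sup>2"
    proof (rule antisym)
      have sq: "cmod ((adj (CG I \<Gamma>) f \<otimes>\<^bsub>CG I \<Gamma>\<^esub> f) g) = (cmod (f g))\<^sup>2" for g
        by (simp add: classical_simps norm_mult power2_eq_square)
      show "nrm (CG I \<Gamma>) (adj (CG I \<Gamma>) f \<otimes>\<^bsub>CG I \<Gamma>\<^esub> f) \<le> (nrm (CG I \<Gamma>) f)\<^sup>2"
        by (rule nrm_least) (simp only: sq power_mono nrm_upper[OF f] norm_ge_zero)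
      have af: "adj (CG I \<Gamma>) f \<otimes>\<^bsub>CG I \<Gamma>\<^esub> f \<in> carrier (CG I \<Gamma>)"
        using f by (auto simp: classical_simps intro: continuous_intros)
      have "nrm (CG I \<Gamma>) f \<le> sqrt (nrm (CG I \<Gamma>) (adj (CG I \<Gamma>) f \<otimes>\<^bsub>CG I \<Gamma>\<^esub> f))"
      proof (rule nrm_least)
        fix g assume "g \<in> \<Gamma>"
        from nrm_upper[OF af this] show "cmod (f g) \<le> sqrt (nrm (CG I \<Gamma>) (adj (CG I \<Gamma>) f \<otimes>\<^bsub>CG I \<Gamma>\<^esub> f))"
          unfolding sq by (rule real_le_rsqrt)
      qed
      from power_mono[OF this nrm_ge_0[OF f], of 2] nrm_ge_0[OF af]
      show "(nrm (CG I \<Gamma>) f)\<^sup>2 \<le> nrm (CG I \<Gamma>) (adj (CG I \<Gamma>) f \<otimes>\<^bsub>CG I \<Gamma>\<^esub> f)" by simp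
    qed
    fix h assume h: "h \<in> carrier (CG I \<Gamma>)"
    show "nrm (CG I \<Gamma>) (f \<oplus>\<^bsub>CG I \<Gamma>\<^esub> h) \<le> nrm (CG I \<Gamma>) f + nrm (CG I \<Gamma>) h"
    proof (rule nrm_least)
      fix g assume g: "g \<in> \<Gamma>"
      show "cmod ((f \<oplus>\<^bsub>CG I \<Gamma>\<^esub> h) g) \<le> nrm (CG I \<Gamma>) f + nrm (CG I \<Gamma>) h"
        unfolding classical_simps(5) using norm_triangle_ineq[of "f g" "h g"] nrm_upper[OF f g] nrm_upper[OF h g]
        by linarith
    qed
    show "nrm (CG I \<Gamma>) (f \<otimes>\<^bsub>CG I \<Gamma>\<^esub> h) \<le> nrm (CG I \<Gamma>) f * nrm (CG I \<Gamma>) h"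
      by (rule nrm_least) (simp add: classical_simps(2) norm_mult mult_mono nrm_upper f h nrm_ge_0)
  qed (use classical_complete in \<open>auto simp: classical_simps(2-7) algebra_simps\<close>)
qed

lemma eval_point: "g \<in> \<Gamma> \<Longrightarrow> (\<lambda>f. f g) \<in> cstar_hom (CG I \<Gamma>) complex_cstar"
  by (rule cstar_homI) (simp_all add: classical_simps complex_cstar_def)

lemma classical_eqI:
  assumes "f \<in> carrier (CG I \<Gamma>)" "h \<in> carrier (CG I \<Gamma>)" "\<And>g. g \<in> \<Gamma> \<Longrightarrow> f g = h g"
  shows "f = h"
proof
  fix g
  show "f g = h g" using assms by (cases "g \<in> \<Gamma>") (auto simp: classical_simps(1))
qed

lemma coordinate_closed: "fund (classical_qgroup I \<Gamma>) i j \<in> carrier (CG I \<Gamma>)"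
proof -
  have "continuous_on \<Gamma> (\<lambda>g. complex_of_real (g i j))"
  proof (intro continuous_on_of_real)
    have "continuous_on UNIV (\<lambda>g :: nat \<Rightarrow> nat \<Rightarrow> real. g i)" by (rule continuous_on_product_coordinates)
    moreover have "continuous_on UNIV (\<lambda>g :: nat \<Rightarrow> real. g j)" by (rule continuous_on_product_coordinates)
    ultimately have "continuous_on UNIV (\<lambda>g :: nat \<Rightarrow> nat \<Rightarrow> real. g i j)"
      using continuous_on_compose2[of UNIV "\<lambda>g :: nat \<Rightarrow> real. g j" UNIV "\<lambda>g. g i"] by auto
    then show "continuous_on \<Gamma> (\<lambda>g. g i j)" using continuous_on_subset by blast
  qed
  then have "continuous_on \<Gamma> (fund (classical_qgroup I \<Gamma>) i j)"
    using continuous_on_cong[of \<Gamma> \<Gamma> "fund (classical_qgroup I \<Gamma>) i j" "\<lambda>g. complex_of_real (g i j)"]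
    by (simp add: classical_simps)
  then show ?thesis by (simp add: classical_simps)
qed

text \<open>By the Stone--Weierstrass theorem, a *-homomorphism onto the coordinates is surjective.\<close>

lemma classical_onto:
  assumes A: "cstar_algebra A" and f: "f \<in> cstar_hom A (CG I \<Gamma>)"
    and gen: "\<And>i j. fund (classical_qgroup I \<Gamma>) i j \<in> f ` carrier A"
  shows "f ` carrier A = carrier (CG I \<Gamma>)"
proof (rule cstar_hom_surjective[OF f A cstar_algebra_classical])
  interpret A: cstar_algebra A by fact
  interpret C: cstar_algebra "CG I \<Gamma>" by (rule cstar_algebra_classical)
  note h = cstar_homD[OF f]
  define R where "R = {r. \<exists>a\<in>carrier A. \<forall>g\<in>\<Gamma>. f a g = complex_of_real (r g)}"
  have RD: "\<exists>a\<in>carrier A. \<forall>g\<in>\<Gamma>. f a g = complex_of_real (r g)" if "r \<in> R" for r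
    using that by (simp only: R_def mem_Collect_eq)
  interpret function_ring_on R \<Gamma>
  proof
    show "compact \<Gamma>" by (rule compact)
    fix r assume r: "r \<in> R"
    obtain a where a: "a \<in> carrier A" "\<forall>g\<in>\<Gamma>. f a g = complex_of_real (r g)"
      using RD[OF r] by (rule bexE)
    have "continuous_on \<Gamma> (f a)" using h(1)[OF a(1)] by (simp add: classical_simps(1))
    then have "continuous_on \<Gamma> (\<lambda>g. Re (f a g))" by (rule continuous_on_Re)
    moreover have "continuous_on \<Gamma> r \<longleftrightarrow> continuous_on \<Gamma> (\<lambda>g. Re (f a g))"
      by (rule continuous_on_cong) (simp_all add: a(2))
    ultimately show "continuous_on \<Gamma> r" by simp
    fix s assume s: "s \<in> R"
    obtain b where b: "b \<in> carrier A" "\<forall>g\<in>\<Gamma>. f b g = complex_of_real (s g)"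
      using RD[OF s] by (rule bexE)
    show "(\<lambda>g. r g + s g) \<in> R" unfolding R_def mem_Collect_eq
    proof (rule bexI)
      show "\<forall>g\<in>\<Gamma>. f (a \<oplus>\<^bsub>A\<^esub> b) g = complex_of_real (r g + s g)"
        unfolding h(2)[OF a(1) b(1)] classical_simps(5) by (simp add: a(2) b(2))
    qed (use a b in simp)
    show "(\<lambda>g. r g * s g) \<in> R" unfolding R_def mem_Collect_eq
    proof (rule bexI)
      show "\<forall>g\<in>\<Gamma>. f (a \<otimes>\<^bsub>A\<^esub> b) g = complex_of_real (r g * s g)"
        unfolding h(3)[OF a(1) b(1)] classical_simps(2) by (simp add: a(2) b(2))
    qed (use a b in simp)
  next
    fix c :: real
    show "(\<lambda>_. c) \<in> R" unfolding R_def mem_Collect_eq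
    proof (rule bexI)
      show "\<forall>g\<in>\<Gamma>. f (complex_of_real c \<odot>\<^bsub>A\<^esub> \<one>\<^bsub>A\<^esub>) g = complex_of_real c"
        unfolding h(5)[OF A.one_closed] h(4) classical_simps(3,6) by simp
    qed (simp add: A.smult_closed)
  next
    fix x y :: "nat \<Rightarrow> nat \<Rightarrow> real" assume xy: "x \<in> \<Gamma>" "y \<in> \<Gamma>" "x \<noteq> y"
    then obtain i j where ij: "x i j \<noteq> y i j" unfolding fun_eq_iff by blast
    obtain a where a: "a \<in> carrier A" "fund (classical_qgroup I \<Gamma>) i j = f a"
      using gen[of i j] by (rule imageE) simp
    have "(\<lambda>g. g i j) \<in> R" unfolding R_def mem_Collect_eq
    proof (rule bexI[OF _ a(1)])
      show "\<forall>g\<in>\<Gamma>. f a g = complex_of_real (g i j)" unfolding a(2)[symmetric] classical_simps(10) by simp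
    qed
    then show "\<exists>r\<in>R. r x \<noteq> r y" by (rule bexI[rotated]) (rule ij)
  qed
  fix b and e :: real assume b: "b \<in> carrier (CG I \<Gamma>)" and e: "0 < e"
  have "continuous_on \<Gamma> (\<lambda>g. Re (b g))" "continuous_on \<Gamma> (\<lambda>g. Im (b g))"
    using b by (auto simp: classical_simps(1) intro: continuous_intros)
  note cont = this
  obtain r where r: "r \<in> R" "\<forall>g\<in>\<Gamma>. \<bar>Re (b g) - r g\<bar> < e / 4"
    using Stone_Weierstrass_basic[OF cont(1), of "e / 4"] e by auto
  obtain s where s: "s \<in> R" "\<forall>g\<in>\<Gamma>. \<bar>Im (b g) - s g\<bar> < e / 4"
    using Stone_Weierstrass_basic[OF cont(2), of "e / 4"] e by auto
  obtain x where x: "x \<in> carrier A" "\<forall>g\<in>\<Gamma>. f x g = complex_of_real (r g)"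
      using RD[OF r(1)] by (rule bexE)
  obtain y where y: "y \<in> carrier A" "\<forall>g\<in>\<Gamma>. f y g = complex_of_real (s g)"
      using RD[OF s(1)] by (rule bexE)
  let ?a = "x \<oplus>\<^bsub>A\<^esub> \<i> \<odot>\<^bsub>A\<^esub> y"
  have a: "?a \<in> carrier A" using x y by (simp add: A.smult_closed)
  have "nrm (CG I \<Gamma>) (b \<ominus>\<^bsub>CG I \<Gamma>\<^esub> f ?a) \<le> e / 2"
  proof (rule nrm_least)
    fix g assume g: "g \<in> \<Gamma>"
    have "(b \<ominus>\<^bsub>CG I \<Gamma>\<^esub> f ?a) g = b g - (of_real (r g) + \<i> * of_real (s g))"
      unfolding classical_minus[OF b h(1)[OF a]]
      unfolding h(2)[OF x(1) A.smult_closed[OF y(1)]] h(5)[OF y(1)] classical_simps(5,6)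
      using x(2) y(2) g by simp
    also have "cmod \<dots> \<le> \<bar>Re (b g) - r g\<bar> + \<bar>Im (b g) - s g\<bar>"
      using cmod_le[of "b g - (of_real (r g) + \<i> * of_real (s g))"] by simp
    finally show "cmod ((b \<ominus>\<^bsub>CG I \<Gamma>\<^esub> f ?a) g) \<le> e / 2"
      using bspec[OF r(2) g] bspec[OF s(2) g] by linarith
  qed
  then show "\<exists>a\<in>carrier A. nrm (CG I \<Gamma>) (b \<ominus>\<^bsub>CG I \<Gamma>\<^esub> f a) < e" using a e by (intro bexI[of _ ?a]) auto
qed

end

lemma complex_finsum: "(\<Oplus>\<^bsub>complex_cstar\<^esub>i\<in>I. f i) = (\<Sum>i\<in>I. f i)"
proof -
  interpret cstar_algebra complex_cstar by (rule cstar_algebra_complex)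
  show ?thesis
  proof (induction I rule: infinite_finite_induct)
    case (insert i I)
    then have "(\<Oplus>\<^bsub>complex_cstar\<^esub>i\<in>insert i I. f i) = f i \<oplus>\<^bsub>complex_cstar\<^esub> (\<Oplus>\<^bsub>complex_cstar\<^esub>i\<in>I. f i)"
      by (intro finsum_insert') (simp_all add: complex_cstar_def)
    then show ?case using insert by (simp add: complex_cstar_def)
  qed (simp_all add: finsum_infinite, simp_all add: complex_cstar_def)
qed

lemma orth_complex:
  "orth complex_cstar I (\<lambda>i j. complex_of_real (g i j)) \<longleftrightarrow> g \<in> orthogonal_matrices I"
proof -
  have 1: "mmul complex_cstar I (\<lambda>i j. complex_of_real (a i j)) (\<lambda>i j. complex_of_real (b i j)) i j
      = complex_of_real (\<Sum>k\<in>I. a i k * b k j)" for a b i j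
    by (simp add: mmul_def complex_finsum) (simp add: complex_cstar_def)
  have 2: "mone complex_cstar I i j = complex_of_real (of_bool (i \<in> I \<and> i = j))" for i j
    by (auto simp: mone_def complex_cstar_def)
  have 3: "(\<lambda>i j. complex_of_real (g i j)) \<in> cmat complex_cstar I \<longleftrightarrow> (\<forall>i j. i \<notin> I \<or> j \<notin> I \<longrightarrow> g i j = 0)"
    by (simp add: cmat_def complex_cstar_def)
  have 4: "adj complex_cstar (complex_of_real x) = complex_of_real x" for x
    by (simp add: complex_cstar_def)
  have o: "(\<forall>i j. P i j = of_bool (i \<in> I \<and> i = j)) \<longleftrightarrow> (\<forall>i\<in>I. \<forall>j\<in>I. P i j = of_bool (i = j))"
    if out: "\<And>i j. i \<notin> I \<or> j \<notin> I \<Longrightarrow> P i j = 0" for P :: "nat \<Rightarrow> nat \<Rightarrow> real"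
  proof
    assume r: "\<forall>i\<in>I. \<forall>j\<in>I. P i j = of_bool (i = j)"
    show "\<forall>i j. P i j = of_bool (i \<in> I \<and> i = j)"
    proof (intro allI)
      fix i j show "P i j = of_bool (i \<in> I \<and> i = j)"
        using out[of i j] r by (cases "i \<in> I \<and> j \<in> I") auto
    qed
  qed auto
  show ?thesis
  proof (cases "\<forall>i j. i \<notin> I \<or> j \<notin> I \<longrightarrow> g i j = 0")
    case True
    then have z: "(\<Sum>k\<in>I. g i k * g j k) = 0" "(\<Sum>k\<in>I. g k i * g k j) = 0" if "i \<notin> I \<or> j \<notin> I" for i j
      using that by (auto intro!: sum.neutral)
    have e: "(\<forall>i j. (\<Sum>k\<in>I. g i k * g j k) = of_bool (i \<in> I \<and> i = j)) \<longleftrightarrow> (\<forall>i\<in>I. \<forall>j\<in>I. (\<Sum>k\<in>I. g i k * g j k) = of_bool (i = j))"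
      "(\<forall>i j. (\<Sum>k\<in>I. g k i * g k j) = of_bool (i \<in> I \<and> i = j)) \<longleftrightarrow> (\<forall>i\<in>I. \<forall>j\<in>I. (\<Sum>k\<in>I. g k i * g k j) = of_bool (i = j))"
      using o[of "\<lambda>i j. \<Sum>k\<in>I. g i k * g j k", OF z(1)] o[of "\<lambda>i j. \<Sum>k\<in>I. g k i * g k j", OF z(2)] by simp_all
    show ?thesis
      by (simp only: orth_def 3 4 fun_eq_iff 1 2 of_real_eq_iff e orthogonal_matrices_def mem_Collect_eq simp_thms)
  next
    case False
    then show ?thesis unfolding orth_def 3 orthogonal_matrices_def mem_Collect_eq by (simp only: simp_thms)
  qed
qed

section \<open>Compactness\<close>

lemma continuous_entry: "continuous_on S (\<lambda>g :: nat \<Rightarrow> nat \<Rightarrow> real. g i j)"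
proof -
  have "continuous_on UNIV (\<lambda>g :: nat \<Rightarrow> nat \<Rightarrow> real. g i)" "continuous_on UNIV (\<lambda>g :: nat \<Rightarrow> real. g j)"
    by (rule continuous_on_product_coordinates)+
  then have "continuous_on UNIV (\<lambda>g :: nat \<Rightarrow> nat \<Rightarrow> real. g i j)"
    using continuous_on_compose2[of UNIV "\<lambda>g :: nat \<Rightarrow> real. g j" UNIV "\<lambda>g. g i"] by auto
  then show ?thesis using continuous_on_subset by blast
qed

lemma compact_matrix_box: "compact {g :: nat \<Rightarrow> nat \<Rightarrow> real. \<forall>i j. \<bar>g i j\<bar> \<le> 1}"
proof -
  have P: "compact (PiE UNIV S)" if "\<And>i. compact (S i)" for S :: "nat \<Rightarrow> 'b::topological_space set"
    using compactin_PiE[of "\<lambda>_. euclidean" UNIV S] that euclidean_product_topology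
    by (metis compactin_euclidean_iff)
  have "compact (PiE UNIV (\<lambda>i::nat. PiE UNIV (\<lambda>j::nat. {-1..1::real})))" by (intro P compact_Icc)
  also have "(PiE UNIV (\<lambda>i::nat. PiE UNIV (\<lambda>j::nat. {-1..1::real}))) = {g. \<forall>i j. \<bar>g i j\<bar> \<le> 1}"
    by (auto simp: PiE_def Pi_def abs_le_iff)
  finally show ?thesis .
qed

lemma orthogonal_entry_le:
  assumes "finite I" "g \<in> orthogonal_matrices I" shows "\<bar>g i j\<bar> \<le> 1"
proof (cases "i \<in> I \<and> j \<in> I")
  case True
  have "g i j * g i j \<le> (\<Sum>k\<in>I. g i k * g i k)" using True assms(1) by (intro member_le_sum) auto
  also have "\<dots> = 1" using assms(2) True by (simp add: orthogonal_matrices_def)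
  finally show ?thesis using abs_square_le_1[of "g i j"] by (simp add: power2_eq_square)
qed (use assms in \<open>simp add: orthogonal_matrices_def\<close>)

lemma compact_bistochastic:
  assumes I: "finite I" shows "compact (bistochastic_matrices I)"
proof -
  have c: "closed {g :: nat \<Rightarrow> nat \<Rightarrow> real. P g = c}" if "continuous_on UNIV P" for P :: "(nat \<Rightarrow> nat \<Rightarrow> real) \<Rightarrow> real" and c
    by (rule closed_Collect_eq[OF that continuous_on_const])
  have "bistochastic_matrices I =
    {g. \<forall>i j. \<bar>g i j\<bar> \<le> 1} \<inter>
    ((\<Inter>i. \<Inter>j. {g. i \<notin> I \<or> j \<notin> I \<longrightarrow> g i j = 0}) \<inter>
     (\<Inter>i\<in>I. \<Inter>j\<in>I. {g. (\<Sum>k\<in>I. g i k * g j k) = of_bool (i = j)}) \<inter>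
     (\<Inter>i\<in>I. \<Inter>j\<in>I. {g. (\<Sum>k\<in>I. g k i * g k j) = of_bool (i = j)}) \<inter>
     (\<Inter>i\<in>I. {g. (\<Sum>j\<in>I. g i j) = 1}) \<inter> (\<Inter>j\<in>I. {g. (\<Sum>i\<in>I. g i j) = 1}))"
    using orthogonal_entry_le[OF I] by (auto simp: bistochastic_matrices_def) (auto simp: orthogonal_matrices_def)
  moreover have "closed {g :: nat \<Rightarrow> nat \<Rightarrow> real. i \<notin> I \<or> j \<notin> I \<longrightarrow> g i j = 0}" for i j
    by (cases "i \<notin> I \<or> j \<notin> I") (simp_all add: c continuous_entry)
  ultimately show ?thesis
    by (simp only:) (intro compact_Int_closed compact_matrix_box closed_Int closed_INT ballI c
        continuous_on_sum continuous_on_mult continuous_entry)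
qed

section \<open>The classical subgroups\<close>

lemma cstar_iso_inverse:
  assumes f: "f \<in> cstar_hom A B" and A: "cstar_algebra A" and bij: "bij_betw f (carrier A) (carrier B)"
  shows "inv_into (carrier A) f \<in> cstar_hom B A" "bij_betw (inv_into (carrier A) f) (carrier B) (carrier A)"
proof -
  interpret A: cstar_algebra A by fact
  let ?g = "inv_into (carrier A) f"
  note h = cstar_homD[OF f]
  show bg: "bij_betw ?g (carrier B) (carrier A)" by (rule bij_betw_inv_into[OF bij])
  have gc: "?g y \<in> carrier A" if "y \<in> carrier B" for y using bij_betwE[OF bg] that by blast
  have fg: "f (?g y) = y" if "y \<in> carrier B" for y by (rule bij_betw_inv_into_right[OF bij that])
  have gf: "?g (f x) = x" if "x \<in> carrier A" for x by (rule bij_betw_inv_into_left[OF bij that])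
  show "?g \<in> cstar_hom B A"
  proof (rule cstar_homI)
    fix x assume x: "x \<in> carrier B"
    show "?g x \<in> carrier A" by (rule gc[OF x])
    show "?g (c \<odot>\<^bsub>B\<^esub> x) = c \<odot>\<^bsub>A\<^esub> ?g x" for c
      using gf[OF A.smult_closed[OF gc[OF x]], of c] by (simp only: h(5)[OF gc[OF x]] fg[OF x])
    show "?g (adj B x) = adj A (?g x)"
      using gf[OF A.adj_closed[OF gc[OF x]]] by (simp only: h(6)[OF gc[OF x]] fg[OF x])
    fix y assume y: "y \<in> carrier B"
    show "?g (x \<oplus>\<^bsub>B\<^esub> y) = ?g x \<oplus>\<^bsub>A\<^esub> ?g y"
      using gf[OF A.add.m_closed[OF gc[OF x] gc[OF y]]] by (simp only: h(2)[OF gc[OF x] gc[OF y]] fg[OF x] fg[OF y])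
    show "?g (x \<otimes>\<^bsub>B\<^esub> y) = ?g x \<otimes>\<^bsub>A\<^esub> ?g y"
      using gf[OF A.m_closed[OF gc[OF x] gc[OF y]]] by (simp only: h(3)[OF gc[OF x] gc[OF y]] fg[OF x] fg[OF y])
  next
    show "?g \<one>\<^bsub>B\<^esub> = \<one>\<^bsub>A\<^esub>" using gf[OF A.one_closed] by (simp only: h(4))
  qed
qed

context bistochastic_basis
begin

lemma one_bistochastic: "(\<lambda>i j. of_bool (i \<in> I0 \<and> i = j)) \<in> bistochastic_matrices I0"
proof -
  have "(\<Sum>k\<in>I0. of_bool (i \<in> I0 \<and> i = k) * of_bool (j \<in> I0 \<and> j = k) :: real) = of_bool (i = j)"
    "(\<Sum>k\<in>I0. of_bool (k \<in> I0 \<and> k = i) * of_bool (k \<in> I0 \<and> k = j) :: real) = of_bool (i = j)"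
    "(\<Sum>k\<in>I0. of_bool (i \<in> I0 \<and> i = k) :: real) = 1" "(\<Sum>k\<in>I0. of_bool (k \<in> I0 \<and> k = i) :: real) = 1"
    if "i \<in> I0" "j \<in> I0" for i j
    using that by (auto simp: of_bool_def if_distrib[of "\<lambda>x. x * _"] cong: if_cong)
  then show ?thesis unfolding bistochastic_matrices_def orthogonal_matrices_def by auto
qed

lemma compact_group_bistochastic: "compact_group (bistochastic_matrices I0)"
  using compact_bistochastic[of I0] one_bistochastic unfolding compact_group_def by auto

lemma point_orth:
  assumes "g \<in> bistochastic_matrices I0"
  shows "orth complex_cstar I0 (\<lambda>i j. complex_of_real (g i j))"
    "row_sums_one complex_cstar I0 (\<lambda>i j. complex_of_real (g i j))"
proof -
  show "orth complex_cstar I0 (\<lambda>i j. complex_of_real (g i j))"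
    unfolding orth_complex using assms by (simp add: bistochastic_matrices_def)
  show "row_sums_one complex_cstar I0 (\<lambda>i j. complex_of_real (g i j))"
    unfolding row_sums_one_def complex_finsum using assms
    by (simp add: bistochastic_matrices_def complex_cstar_def flip: of_real_sum)
qed

lemma bistochastic_of_orth:
  assumes o: "orth complex_cstar I0 u" and row: "row_sums_one complex_cstar I0 u"
  obtains g where "g \<in> bistochastic_matrices I0" "\<And>i j. u i j = complex_of_real (g i j)"
proof -
  interpret cstar_algebra complex_cstar by (rule cstar_algebra_complex)
  define g where "g i j = Re (u i j)" for i j
  have "cnj (u i j) = u i j" for i j using orthD(3)[OF o, of i j] by (simp add: complex_cstar_def)
  then have u: "u i j = complex_of_real (g i j)" for i j
    unfolding g_def by (metis Reals_cnj_iff of_real_Re)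
  then have ug: "u = (\<lambda>i j. complex_of_real (g i j))" by (intro ext)
  have go: "g \<in> orthogonal_matrices I0" using o unfolding ug orth_complex .
  have r: "(\<Sum>j\<in>I0. g i j) = 1" if "i \<in> I0" for i
  proof -
    have "(\<Sum>j\<in>I0. u i j) = 1" using row that unfolding row_sums_one_def complex_finsum by (simp add: complex_cstar_def)
    then have "complex_of_real (\<Sum>j\<in>I0. g i j) = 1" by (simp add: u)
    then show ?thesis by (simp only: of_real_eq_1_iff)
  qed
  have "(\<Sum>i\<in>I0. g i j) = 1" if j: "j \<in> I0" for j
  proof -
    have "(\<Sum>i\<in>I0. g i j) = (\<Sum>i\<in>I0. g i j * (\<Sum>k\<in>I0. g i k))" using r by simp
    also have "\<dots> = (\<Sum>k\<in>I0. \<Sum>i\<in>I0. g i j * g i k)" unfolding sum_distrib_left by (rule sum.swap)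
    also have "\<dots> = (\<Sum>k\<in>I0. of_bool (j = k))" using go j by (simp add: orthogonal_matrices_def)
    finally show ?thesis using j by simp
  qed
  then have "g \<in> bistochastic_matrices I0" using go r by (simp add: bistochastic_matrices_def)
  then show ?thesis using that u by blast
qed

lemma B_circ_simps:
  "alg (B_circ N F) = alg (O_star J)" "ind (B_circ N F) = I0" "fund (B_circ N F) = lift (alg (O_star J)) (fund (O_star J))"
  unfolding B_circ_def
  using F_image_simps[OF restrictions(2) algebras(2) cstar_algebra.orthD(1)[OF algebras(2) funds(2)]] by blast+

text \<open>For a compact group \<open>\<Gamma> \<subseteq> B\<^sub>N\<close>, the coordinates have the form \<open>F diag(1, v) F\<^sup>t\<close>.\<close>

context
  fixes \<Gamma> :: "(nat \<Rightarrow> nat \<Rightarrow> real) set"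
  assumes \<Gamma>: "compact_group \<Gamma>" and sub: "\<Gamma> \<subseteq> bistochastic_matrices I0"
begin

interpretation \<Gamma>: compact_group I0 \<Gamma> by (rule \<Gamma>)

lemma CGa: "cstar_algebra (CG I0 \<Gamma>)" by (rule \<Gamma>.cstar_algebra_classical)

lemma coordinates_orth: "orth (CG I0 \<Gamma>) I0 (fund (classical_qgroup I0 \<Gamma>))"
  "row_sums_one (CG I0 \<Gamma>) I0 (fund (classical_qgroup I0 \<Gamma>))"
proof -
  let ?C = "CG I0 \<Gamma>" and ?u = "fund (classical_qgroup I0 \<Gamma>)"
  interpret C: cstar_algebra ?C by (rule CGa)
  have ev: "(\<lambda>i j. ?u i j g) = (\<lambda>i j. complex_of_real (g i j))" if "g \<in> \<Gamma>" for g
    using that by (simp add: classical_simps(10))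
  have u: "?u \<in> cmat ?C I0"
  proof -
    have "?u i j = \<zero>\<^bsub>?C\<^esub>" if "i \<notin> I0 \<or> j \<notin> I0" for i j
    proof (rule \<Gamma>.classical_eqI[OF \<Gamma>.coordinate_closed C.zero_closed])
      fix g assume "g \<in> \<Gamma>"
      then show "?u i j g = \<zero>\<^bsub>?C\<^esub> g"
        using that sub by (auto simp: classical_simps(4,10) bistochastic_matrices_def orthogonal_matrices_def)
    qed
    then show ?thesis unfolding cmat_def using \<Gamma>.coordinate_closed by blast
  qed
  note ut = cmat_tpose[OF u]
  have m: "mmul ?C I0 a b = mone ?C I0"
    if ab: "a \<in> cmat ?C I0" "b \<in> cmat ?C I0"
      and g: "\<And>g. g \<in> \<Gamma> \<Longrightarrow> mmul complex_cstar I0 (\<lambda>i j. a i j g) (\<lambda>i j. b i j g) = mone complex_cstar I0" for a b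
  proof (rule ext, rule ext)
    fix i j
    show "mmul ?C I0 a b i j = mone ?C I0 i j"
    proof (rule \<Gamma>.classical_eqI)
      show "mmul ?C I0 a b i j \<in> carrier ?C" by (rule cmatD[OF C.mmul_cmat[OF ab]])
      show "mone ?C I0 i j \<in> carrier ?C" by (rule cmatD[OF C.mone_cmat])
      fix x assume x: "x \<in> \<Gamma>"
      show "mmul ?C I0 a b i j x = mone ?C I0 i j x"
        unfolding cstar_hom_mmul[OF \<Gamma>.eval_point[OF x] CGa cstar_algebra_complex ab] g[OF x]
        using x by (auto simp: mone_def classical_simps(3,4) complex_cstar_def)
    qed
  qed
  have p: "orth complex_cstar I0 (\<lambda>i j. ?u i j g)" if "g \<in> \<Gamma>" for g
    unfolding ev[OF that] using point_orth(1) sub that by blast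
  have "mmul ?C I0 ?u (tpose ?u) = mone ?C I0"
    by (rule m[OF u ut]) (use p cstar_algebra.orthD(4)[OF cstar_algebra_complex] in blast)
  moreover have "mmul ?C I0 (tpose ?u) ?u = mone ?C I0"
    by (rule m[OF ut u]) (use p cstar_algebra.orthD(5)[OF cstar_algebra_complex] in blast)
  moreover have "adj ?C (?u i j) = ?u i j" for i j
    by (simp add: classical_simps(7) fun_eq_iff classical_simps(10))
  ultimately show "orth ?C I0 ?u" using u by (simp add: orth_def)
  show "row_sums_one ?C I0 ?u"
    unfolding row_sums_one_def
  proof
    fix i assume i: "i \<in> I0"
    show "(\<Oplus>\<^bsub>?C\<^esub>j\<in>I0. ?u i j) = \<one>\<^bsub>?C\<^esub>"
    proof (rule \<Gamma>.classical_eqI)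
      show "(\<Oplus>\<^bsub>?C\<^esub>j\<in>I0. ?u i j) \<in> carrier ?C" by (rule C.finsum_mem) (rule cmatD[OF u])
      fix g assume g: "g \<in> \<Gamma>"
      have "(\<Oplus>\<^bsub>?C\<^esub>j\<in>I0. ?u i j) g = (\<Sum>j\<in>I0. ?u i j g)"
        unfolding complex_finsum[symmetric]
        by (rule cstar_hom_finsum[OF \<Gamma>.eval_point[OF g] CGa cstar_algebra_complex cmatD[OF u]])
      also have "\<dots> = complex_of_real (\<Sum>j\<in>I0. g i j)" using g by (simp add: classical_simps(10))
      also have "(\<Sum>j\<in>I0. g i j) = 1" using g sub i by (auto simp: bistochastic_matrices_def)
      finally show "(\<Oplus>\<^bsub>?C\<^esub>j\<in>I0. ?u i j) g = \<one>\<^bsub>?C\<^esub> g" using g by (simp add: classical_simps(3))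
    qed (rule C.one_closed)
  qed
qed

lemma classical_comm: "comm (CG I0 \<Gamma>) v" "half_comm (CG I0 \<Gamma>) v"
  by (simp_all add: comm_def half_comm_def classical_simps(2) mult_ac)

lemma coordinates_lift:
  obtains v where "orth (CG I0 \<Gamma>) J v" "lift (CG I0 \<Gamma>) v = fund (classical_qgroup I0 \<Gamma>)"
    "unrot (CG I0 \<Gamma>) N F (fund (classical_qgroup I0 \<Gamma>)) = blk (CG I0 \<Gamma>) v"
proof -
  interpret rotated_algebra "CG I0 \<Gamma>" N F by (rule rotated[OF CGa])
  have row: "(\<Oplus>\<^bsub>CG I0 \<Gamma>\<^esub>j\<in>I0. fund (classical_qgroup I0 \<Gamma>) i j) = \<one>\<^bsub>CG I0 \<Gamma>\<^esub>" if "i \<in> I0" for i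
    using coordinates_orth(2) that unfolding row_sums_one_def by blast
  show ?thesis
  proof (rule unrot_bistochastic[OF coordinates_orth(1) row])
    fix w assume "orth (CG I0 \<Gamma>) J w" "unrot (CG I0 \<Gamma>) N F (fund (classical_qgroup I0 \<Gamma>)) = blk (CG I0 \<Gamma>) w"
      "rot (CG I0 \<Gamma>) N F (blk (CG I0 \<Gamma>) w) = fund (classical_qgroup I0 \<Gamma>)"
    then show ?thesis using that unfolding lift_def by blast
  qed
qed

lemma classical_restriction:
  assumes A: "cstar_algebra A" and w: "w \<in> cmat A J" and v: "lift (CG I0 \<Gamma>) v = fund (classical_qgroup I0 \<Gamma>)"
    and f: "f \<in> cstar_hom A (CG I0 \<Gamma>)" "\<And>i j. f (w i j) = v i j"
  shows "f ` carrier A = carrier (CG I0 \<Gamma>)" "f (lift A w i j) = fund (classical_qgroup I0 \<Gamma>) i j"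
proof -
  interpret rotated_algebra A N F by (rule rotated[OF A])
  show eq: "f (lift A w i j) = fund (classical_qgroup I0 \<Gamma>) i j" for i j
    unfolding lift_hom[OF f(1) A CGa w] f(2) v ..
  have "lift A w i j \<in> carrier A" for i j unfolding lift_def by (rule cmatD[OF rot_cmat[OF blk_cmat[OF N w]]])
  then have "fund (classical_qgroup I0 \<Gamma>) i j \<in> f ` carrier A" for i j
    unfolding eq[symmetric] by (rule imageI)
  then show "f ` carrier A = carrier (CG I0 \<Gamma>)" by (rule \<Gamma>.classical_onto[OF A f(1)])
qed

lemma classical_subgroup_B_circ: "qsubgroup (classical_qgroup I0 \<Gamma>) (B_circ N F)"
proof (rule coordinates_lift)
  fix v assume v: "orth (CG I0 \<Gamma>) J v" "lift (CG I0 \<Gamma>) v = fund (classical_qgroup I0 \<Gamma>)"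
  obtain f where f: "f \<in> cstar_hom (alg (O_star J)) (CG I0 \<Gamma>)" "\<And>i j. f (fund (O_star J) i j) = v i j"
    using O_star_hom[OF CGa v(1) classical_comm(2)] by blast
  note r = classical_restriction[OF algebras(2) cstar_algebra.orthD(1)[OF algebras(2) funds(2)] v(2) f]
  have "restriction_map (classical_qgroup I0 \<Gamma>) (B_circ N F) f"
    unfolding restriction_map_def B_circ_simps classical_simps(9) using f(1) r by blast
  then show ?thesis unfolding qsubgroup_def by blast
qed

end

lemma B_class_subgroup: "qsubgroup (B_class I0) (B_circ N F)"
  unfolding B_class_def by (rule classical_subgroup_B_circ[OF compact_group_bistochastic order_refl])

lemma permutation_bistochastic: "permutation_matrices I0 \<subseteq> bistochastic_matrices I0"
proof
  fix g assume "g \<in> permutation_matrices I0"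
  then obtain \<sigma> where \<sigma>: "\<sigma> permutes I0" and g: "g = (\<lambda>i j. of_bool (i \<in> I0 \<and> j \<in> I0 \<and> i = \<sigma> j))"
    unfolding permutation_matrices_def by blast
  define \<tau> where "\<tau> = inv_into UNIV \<sigma>"
  have \<tau>: "\<tau> permutes I0" unfolding \<tau>_def by (rule permutes_inv[OF \<sigma>])
  have inv: "i = \<sigma> j \<longleftrightarrow> \<tau> i = j" for i j unfolding \<tau>_def using permutes_inv_eq[OF \<sigma>] by metis
  have gs: "g i j = of_bool (i \<in> I0 \<and> j \<in> I0 \<and> \<tau> i = j)" "g i j = of_bool (i \<in> I0 \<and> j \<in> I0 \<and> i = \<sigma> j)" for i j
    by (simp_all add: g inv)
  have tin: "\<tau> i \<in> I0" "\<sigma> i \<in> I0" if "i \<in> I0" for i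
    using permutes_in_image[OF \<tau>] permutes_in_image[OF \<sigma>] that by blast+
  have row: "(\<Sum>k\<in>I0. g i k * c k) = c (\<tau> i)" if "i \<in> I0" for i and c :: "nat \<Rightarrow> real"
  proof -
    have "(\<Sum>k\<in>I0. g i k * c k) = (\<Sum>k\<in>I0. if k = \<tau> i then c k else 0)"
      by (rule sum.cong) (use that in \<open>auto simp: gs(1)\<close>)
    then show ?thesis using tin that by simp
  qed
  have col: "(\<Sum>k\<in>I0. g k j * c k) = c (\<sigma> j)" if "j \<in> I0" for j and c :: "nat \<Rightarrow> real"
  proof -
    have "(\<Sum>k\<in>I0. g k j * c k) = (\<Sum>k\<in>I0. if k = \<sigma> j then c k else 0)"
      by (rule sum.cong) (use that in \<open>auto simp: gs(2)\<close>)
    then show ?thesis using tin that by simp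
  qed
  have st: "\<sigma> i = \<sigma> j \<longleftrightarrow> i = j" "\<tau> i = \<tau> j \<longleftrightarrow> i = j" for i j
    using permutes_inj[OF \<sigma>] permutes_inj[OF \<tau>] by (auto simp: inj_eq)
  show "g \<in> bistochastic_matrices I0"
    unfolding bistochastic_matrices_def orthogonal_matrices_def mem_Collect_eq
  proof (intro conjI ballI allI impI)
    fix i j
    show "g i j = 0" if "i \<notin> I0 \<or> j \<notin> I0" using that by (auto simp: g)
    assume i: "i \<in> I0"
    show "(\<Sum>k\<in>I0. g i k) = 1" using row[OF i, of "\<lambda>_. 1"] by simp
    show "(\<Sum>k\<in>I0. g k i) = 1" using col[OF i, of "\<lambda>_. 1"] by simp
    assume j: "j \<in> I0"
    show "(\<Sum>k\<in>I0. g i k * g j k) = of_bool (i = j)" unfolding row[OF i] using i j tin st(2)[of j i] by (auto simp: gs(1))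
    show "(\<Sum>k\<in>I0. g k i * g k j) = of_bool (i = j)" unfolding col[OF i] using i j tin st(1)[of i j] by (auto simp: gs(2))
  qed
qed

lemma S_class_subgroup: "qsubgroup (S_class I0) (B_circ N F)"
  unfolding S_class_def
proof (rule classical_subgroup_B_circ[OF _ permutation_bistochastic])
  have "permutation_matrices I0 = (\<lambda>\<sigma> i j. of_bool (i \<in> I0 \<and> j \<in> I0 \<and> i = \<sigma> j)) ` {\<sigma>. \<sigma> permutes I0}"
    unfolding permutation_matrices_def by blast
  then have "finite (permutation_matrices I0)" using finite_permutations[of I0] by simp
  moreover have "permutation_matrices I0 \<noteq> {}" unfolding permutation_matrices_def using permutes_id[of I0] by blast
  ultimately show "compact_group (permutation_matrices I0)"
    by (simp add: compact_group_def finite_imp_compact)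
qed

text \<open>The universal commutative algebra is the algebra of functions on the classical group: by
  Gelfand duality the norm of a polynomial is attained at a character, which is a point.\<close>

lemma O_comm_B_class: "qequal (F_image N F (O_comm J)) (B_class I0)"
proof (rule coordinates_lift[OF compact_group_bistochastic order_refl])
  let ?\<Gamma> = "bistochastic_matrices I0"
  let ?C = "CG I0 ?\<Gamma>" and ?A = "alg (O_comm J)" and ?w = "fund (O_comm J)" and ?u = "fund (classical_qgroup I0 ?\<Gamma>)"
  interpret \<Gamma>: compact_group I0 ?\<Gamma> by (rule compact_group_bistochastic)
  have C: "cstar_algebra ?C" by (rule \<Gamma>.cstar_algebra_classical)
  interpret C: cstar_algebra ?C by (rule C)
  interpret RC: rotated_algebra ?C N F by (rule rotated[OF C])
  interpret A: cstar_algebra ?A by (rule algebras(3))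
  interpret RZ: rotated_algebra complex_cstar N F by (rule rotated[OF cstar_algebra_complex])
  note wc = A.orthD(1)[OF funds(4)]
  fix v assume v: "orth ?C J v" "lift ?C v = ?u" "unrot ?C N F ?u = blk ?C v"
  obtain \<pi> where \<pi>: "\<pi> \<in> cstar_hom ?A ?C" "\<And>i j. \<pi> (?w i j) = v i j"
    using O_comm_hom[OF C v(1) classical_comm(1)[OF compact_group_bistochastic order_refl]] by blast
  note r = classical_restriction[OF compact_group_bistochastic order_refl algebras(3) wc v(2) \<pi>]
  note h = cstar_homD[OF \<pi>(1)] and hm = cstar_hom_minus_zero[OF \<pi>(1) algebras(3) C]
  define k where "k g = ?w (fst g) (snd g)" for g :: "nat \<times> nat"
  have kc: "k g \<in> carrier ?A" for g unfolding k_def by (rule cmatD[OF wc])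
  have k: "adj ?A (k g) = k g" "k g \<otimes>\<^bsub>?A\<^esub> k g' = k g' \<otimes>\<^bsub>?A\<^esub> k g" for g g'
    unfolding k_def by (rule A.orthD(3)[OF funds(4)]) (use funds(5) in \<open>auto simp: comm_def\<close>)
  have one: "\<one>\<^bsub>?A\<^esub> \<noteq> \<zero>\<^bsub>?A\<^esub>"
  proof
    assume "\<one>\<^bsub>?A\<^esub> = \<zero>\<^bsub>?A\<^esub>"
    then have "\<one>\<^bsub>?C\<^esub> = \<zero>\<^bsub>?C\<^esub>" using h(4) hm(1) by simp
    then show False using one_bistochastic unfolding classical_simps(3,4) fun_eq_iff by fastforce
  qed
  have kh: "(\<lambda>i j. k (i, j)) = ?w" by (simp add: k_def)
  have iso_poly: "nrm ?A (eval ?A k p) \<le> nrm ?C (\<pi> (eval ?A k p))" for p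
  proof -
    obtain t where t: "\<And>q. cmod (real_eval t q) \<le> nrm ?A (eval ?A k q)" "cmod (real_eval t p) = nrm ?A (eval ?A k p)"
      by (rule A.joint_spectral_value[of k, OF kc k one]) blast
    let ?t = "\<lambda>g. complex_of_real (t g)"
    have tc: "(\<lambda>i j. ?t (i, j)) \<in> cmat complex_cstar J"
    proof -
      have "?t (i, j) = 0" if "i \<notin> J \<or> j \<notin> J" for i j
      proof -
        have "k (i, j) = \<zero>\<^bsub>?A\<^esub>" unfolding k_def using cmat_outside[OF wc, of i j] that by simp
        then have "nrm ?A (eval ?A k (fgen (i, j))) = 0" by (simp only: A.eval_fgen[of k, OF kc] A.nrm_zero)
        then show ?thesis using t(1)[of "fgen (i, j)"] by (simp add: complex_eval_simps)
      qed
      then show ?thesis unfolding cmat_def by (simp add: complex_cstar_def)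
    qed
    have zero: "real_eval t q = \<zero>\<^bsub>complex_cstar\<^esub>" if "eval ?A k q = \<zero>\<^bsub>?A\<^esub>" for q
      using t(1)[of q] unfolding that A.nrm_zero by (simp add: complex_cstar_def)
    have ko: "(\<lambda>i j. k (i, j)) \<in> cmat ?A J" unfolding kh by (rule wc)
    have "\<forall>q\<in>orthogonal_rel J. eval ?A k q = \<zero>\<^bsub>?A\<^esub>"
      unfolding A.eval_orthogonal_rel[of k, OF ko] kh by (rule funds(4))
    then have "\<forall>q\<in>orthogonal_rel J. real_eval t q = \<zero>\<^bsub>complex_cstar\<^esub>" using zero by blast
    then have to: "orth complex_cstar J (\<lambda>i j. ?t (i, j))"
      unfolding RZ.eval_orthogonal_rel[of ?t, OF tc] .
    note tl = lift_orth[OF cstar_algebra_complex to]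
    obtain g where g: "g \<in> ?\<Gamma>" "\<And>i j. lift complex_cstar (\<lambda>i j. ?t (i, j)) i j = complex_of_real (g i j)"
      by (rule bistochastic_of_orth[OF tl]) blast
    note ev = \<Gamma>.eval_point[OF g(1)]
    have ug: "(\<lambda>i j. ?u i j g) = lift complex_cstar (\<lambda>i j. ?t (i, j))"
      by (intro ext) (simp add: g(2) classical_simps(10) g(1))
    have vg: "v i j g = ?t (i, j)" for i j
    proof (cases "i \<in> J")
      case True
      have "v i j g = (unrot ?C N F ?u i j) g" unfolding v(3) by (simp only: blk_inside[OF True])
      also have "\<dots> = unrot complex_cstar N F (lift complex_cstar (\<lambda>i j. ?t (i, j))) i j"
        unfolding cstar_hom_rot[OF ev C cstar_algebra_complex C.orthD(1)[OF coordinates_orth(1)[OF compact_group_bistochastic order_refl]]] ug ..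
      also have "\<dots> = blk complex_cstar (\<lambda>i j. ?t (i, j)) i j"
        unfolding lift_def by (simp only: RZ.rot_unrot[OF RZ.blk_cmat[OF N tc]])
      finally show ?thesis by (simp only: blk_inside[OF True])
    next
      case False
      have "v i j = \<zero>\<^bsub>?C\<^esub>" using cmat_outside[OF C.orthD(1)[OF v(1)], of i j] False by blast
      moreover have "?t (i, j) = \<zero>\<^bsub>complex_cstar\<^esub>" using cmat_outside[OF tc, of i j] False by blast
      ultimately show ?thesis by (simp add: classical_simps(4) complex_cstar_def)
    qed
    have "\<pi> (eval ?A k p) g = eval complex_cstar (\<lambda>s. \<pi> (k s) g) p"
      by (rule cstar_hom_eval[OF cstar_hom_comp[OF \<pi>(1) ev] algebras(3) cstar_algebra_complex kc])
    also have "(\<lambda>s. \<pi> (k s) g) = ?t" unfolding k_def \<pi>(2) vg by simp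
    finally have "cmod (\<pi> (eval ?A k p) g) = nrm ?A (eval ?A k p)" using t(2) by simp
    then show ?thesis
      using \<Gamma>.nrm_upper[OF h(1)[OF A.eval_closed[of k, OF kc]] g(1), of p] by simp
  qed
  have inj: "x = y" if xy: "x \<in> carrier ?A" "y \<in> carrier ?A" "\<pi> x = \<pi> y" for x y
  proof -
    let ?z = "x \<ominus>\<^bsub>?A\<^esub> y"
    have z: "?z \<in> carrier ?A" by (rule A.minus_closed[OF xy(1,2)])
    have pz: "\<pi> ?z = \<zero>\<^bsub>?C\<^esub>" using hm(2)[OF xy(1,2)] xy h(1) by (simp add: a_minus_def C.r_neg)
    have "nrm ?A ?z \<le> e" if e: "0 < e" for e
    proof -
      obtain p where p: "nrm ?A (?z \<ominus>\<^bsub>?A\<^esub> eval ?A k p) < e / 2"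
      proof -
        have kk: "k = ugen (J \<times> J) (orthogonal_rel J \<union> commutation_rel J)"
          by (simp add: k_def fun_eq_iff O_comm_def universal_qgroup_def)
        have AA: "?A = universal_cstar (J \<times> J) (orthogonal_rel J \<union> commutation_rel J)"
          by (simp add: O_comm_def universal_qgroup_def)
        show ?thesis
        proof (rule completion_dense[OF universal_cstar_seminorm[OF bC], of ?z "e / 2"])
          show "?z \<in> carrier (completion (universal_seminorm (relators (J \<times> J) (orthogonal_rel J \<union> commutation_rel J))))"
            using z unfolding AA universal_cstar_def .
          show "0 < e / 2" using e by simp
          fix p assume "nrm (completion (universal_seminorm (relators (J \<times> J) (orthogonal_rel J \<union> commutation_rel J))))
            (?z \<ominus>\<^bsub>completion (universal_seminorm (relators (J \<times> J) (orthogonal_rel J \<union> commutation_rel J)))\<^esub>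
             cls (universal_seminorm (relators (J \<times> J) (orthogonal_rel J \<union> commutation_rel J))) p) < e / 2"
          then show ?thesis using that[of p] unfolding AA kk
            unfolding universal_cstar_def[symmetric] cls_eq_eval[OF bC] by blast
        qed
      qed
      let ?q = "eval ?A k p"
      have q: "?q \<in> carrier ?A" by (rule A.eval_closed[of k, OF kc])
      have "nrm ?C (\<pi> (?z \<ominus>\<^bsub>?A\<^esub> ?q)) \<le> nrm ?A (?z \<ominus>\<^bsub>?A\<^esub> ?q)"
        by (rule cstar_hom_contractive[OF \<pi>(1) algebras(3) C A.minus_closed[OF z q]])
      moreover have "\<pi> (?z \<ominus>\<^bsub>?A\<^esub> ?q) = \<zero>\<^bsub>?C\<^esub> \<ominus>\<^bsub>?C\<^esub> \<pi> ?q" unfolding hm(2)[OF z q] pz ..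
      moreover have "nrm ?C (\<zero>\<^bsub>?C\<^esub> \<ominus>\<^bsub>?C\<^esub> \<pi> ?q) = nrm ?C (\<pi> ?q)"
        using C.nrm_uminus[OF h(1)[OF q]] h(1)[OF q] by (simp add: a_minus_def)
      ultimately have "nrm ?C (\<pi> ?q) < e / 2" using p by simp
      then have "nrm ?A ?q < e / 2" using iso_poly[of p] by simp
      moreover have "nrm ?A ?z \<le> nrm ?A (?z \<ominus>\<^bsub>?A\<^esub> ?q) + nrm ?A ?q"
        using A.nrm_abs_diff[OF z q] by linarith
      ultimately show ?thesis using p by linarith
    qed
    then have "nrm ?A ?z \<le> 0" by (rule field_le_epsilon[of _ 0, simplified])
    then show ?thesis using A.nrm_nonneg[OF z] A.nrm_minus_eq_zero[OF xy(1,2)] by simp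
  qed
  have bij: "bij_betw \<pi> (carrier ?A) (carrier ?C)"
    unfolding bij_betw_def r(1) using inj by (auto intro: inj_onI)
  let ?f = "inv_into (carrier ?A) \<pi>"
  note inv = cstar_iso_inverse[OF \<pi>(1) algebras(3) bij]
  note Fi = F_image_simps[OF restrictions(3) algebras(3) wc]
  interpret RA: rotated_algebra ?A N F by (rule rotated[OF algebras(3)])
  have lc: "lift ?A ?w i j \<in> carrier ?A" for i j unfolding lift_def by (rule cmatD[OF RA.rot_cmat[OF A.blk_cmat[OF N wc]]])
  have "?f (?u i j) = lift ?A ?w i j" for i j
    unfolding r(2)[symmetric] by (rule bij_betw_inv_into_left[OF bij lc])
  moreover have "?f ` carrier ?C = carrier ?A" using inv(2) by (simp add: bij_betw_def)
  ultimately have "restriction_map (F_image N F (O_comm J)) (B_class I0) ?f"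
    unfolding restriction_map_def Fi B_class_def classical_simps(9) using inv(1) by blast
  moreover have "?f \<in> cstar_iso (alg (B_class I0)) (alg (F_image N F (O_comm J)))"
    unfolding cstar_iso_def Fi B_class_def using inv by blast
  ultimately show ?thesis unfolding qequal_def by blast
qed

lemma O_plus_B_plus: "qequal (F_image N F (O_plus J)) (B_plus I0)"
proof -
  have wc: "fund (O_plus J) \<in> cmat (alg (O_plus J)) J" by (rule cstar_algebra.orthD(1)[OF algebras(1) funds(1)])
  have "restriction_map (O_plus J) (O_plus J) (\<lambda>x. x)"
    unfolding restriction_map_def using cstar_hom_id by blast
  then have "\<exists>g. restriction_map (O_plus J) (O_plus J) g" by blast
  note Fi = F_image_simps[OF this algebras(1) wc]
  show ?thesis
  proof (rule exists_induced)
    fix \<Phi> \<Psi>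
    assume *: "\<Phi> \<in> cstar_hom (alg (O_plus J)) (alg (B_plus I0))" "\<Psi> \<in> cstar_hom (alg (B_plus I0)) (alg (O_plus J))"
      "\<And>i j. \<Psi> (fund (B_plus I0) i j) = lift (alg (O_plus J)) (fund (O_plus J)) i j"
      "\<And>x. x \<in> carrier (alg (O_plus J)) \<Longrightarrow> \<Psi> (\<Phi> x) = x" "\<And>y. y \<in> carrier (alg (B_plus I0)) \<Longrightarrow> \<Phi> (\<Psi> y) = y"
    have bij: "bij_betw \<Psi> (carrier (alg (B_plus I0))) (carrier (alg (O_plus J)))"
      by (rule bij_betw_byWitness[where f' = \<Phi>]) (use * cstar_homD(1)[OF *(1)] cstar_homD(1)[OF *(2)] in auto)
    have ind: "ind (B_plus I0) = I0" by (simp add: B_plus_def universal_qgroup_def)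
    have "restriction_map (F_image N F (O_plus J)) (B_plus I0) \<Psi>"
      unfolding restriction_map_def Fi ind using *(2,3) bij by (simp add: bij_betw_def)
    moreover have "\<Psi> \<in> cstar_iso (alg (B_plus I0)) (alg (F_image N F (O_plus J)))"
      unfolding cstar_iso_def Fi using *(2) bij by blast
    ultimately show ?thesis unfolding qequal_def by blast
  qed
qed

text \<open>A homomorphism from the function algebra of a universal quantum group that sends the
  fundamental matrix to the one of \<open>B\<^sub>F\<^sup>\<circ>\<close> is surjective, since its range contains the entries of
  \<open>w\<close>, linear combinations of those of \<open>F diag(1, w) F\<^sup>t\<close>.\<close>

lemma lift_entries:
  assumes A: "cstar_algebra A" and w: "w \<in> cmat A J" and B: "cstar_algebra B" and u: "u \<in> cmat B I0"
    and f: "f \<in> cstar_hom B A" "\<And>i j. f (u i j) = lift A w i j"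
  shows "f (unrot B N F u i j) = blk A w i j"
proof -
  interpret RA: rotated_algebra A N F by (rule rotated[OF A])
  have "(\<lambda>i j. f (u i j)) = rot A N F (blk A w)" by (intro ext) (simp add: f(2) lift_def)
  then show ?thesis unfolding cstar_hom_rot[OF f(1) B A u]
    by (simp only: RA.rot_unrot[OF RA.blk_cmat[OF N w]])
qed

lemma B_circ_subgroup_of:
  assumes B: "cstar_algebra (alg G)" and u: "fund G \<in> cmat (alg G) I0" and ind: "ind G = I0"
    and f: "f \<in> cstar_hom (alg G) (alg (O_star J))" "\<And>i j. f (fund G i j) = lift (alg (O_star J)) (fund (O_star J)) i j"
  shows "qsubgroup (B_circ N F) G"
proof -
  interpret RB: rotated_algebra "alg G" N F by (rule rotated[OF B])
  note wc = cstar_algebra.orthD(1)[OF algebras(2) funds(2)]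
  have "f ` carrier (alg G) = carrier (alg (O_star J))"
    unfolding O_star_def
  proof (rule qgroup_hom_onto[OF bS B f(1)[unfolded O_star_def]])
    fix i j assume ij: "i \<in> J" "j \<in> J"
    have "fund (O_star J) i j = f (unrot (alg G) N F (fund G) i j)"
      unfolding lift_entries[OF algebras(2) wc B u f] by (rule blk_inside[OF ij(1), symmetric])
    then show "fund (universal_qgroup J (orthogonal_rel J \<union> half_commutation_rel J)) i j \<in> f ` carrier (alg G)"
      unfolding O_star_def by (rule image_eqI) (rule cmatD[OF RB.rot_cmat[OF u]])
  qed
  then have "restriction_map (B_circ N F) G f"
    unfolding restriction_map_def B_circ_simps ind using f by blast
  then show ?thesis unfolding qsubgroup_def by blast
qed

lemma B_circ_B_plus: "qsubgroup (B_circ N F) (B_plus I0)"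
proof -
  obtain f where "f \<in> cstar_hom (alg (B_plus I0)) (alg (O_star J))"
    "\<And>i j. f (fund (B_plus I0) i j) = lift (alg (O_star J)) (fund (O_star J)) i j"
    using B_plus_hom[OF algebras(2) lift_orth[OF algebras(2) funds(2)]] by blast
  then show ?thesis
    using B_circ_subgroup_of[OF algebras(4) cstar_algebra.orthD(1)[OF algebras(4) funds(6)]]
    by (simp add: B_plus_def universal_qgroup_def)
qed

lemma B_circ_U_plus: "qsubgroup (B_circ N F) (U_plus I0)"
proof -
  obtain f where "f \<in> cstar_hom (alg (U_plus I0)) (alg (O_star J))"
    "\<And>i j. f (fund (U_plus I0) i j) = lift (alg (O_star J)) (fund (O_star J)) i j"
    using U_plus_hom[OF algebras(2) lift_orth(1)[OF algebras(2) funds(2)]] by blast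
  then show ?thesis
    using B_circ_subgroup_of[OF algebras(5)] fund_cmat[OF bU]
    by (simp add: U_plus_def universal_qgroup_def)
qed

end

section \<open>The quantum group structure\<close>

text \<open>The relations \<open>copy_rel\<close> say that the generators form a homomorphic copy of \<open>A\<close>.\<close>

lemma copy_hom:
  assumes \<nu>: "cstar_seminorm \<nu>" and A: "cstar_algebra A" and null: "\<And>r. r \<in> copy_rel A \<iota> \<Longrightarrow> \<nu> r = 0"
  shows "(\<lambda>x. cls \<nu> (fgen (\<iota> x))) \<in> cstar_hom A (completion \<nu>)"
proof -
  interpret K: cstar_algebra "completion \<nu>" by (rule cstar_algebra_completion[OF \<nu>])
  note fh = free_hom_cls[OF \<nu>] note cl = K.fh_closed[OF fh]
  have eq: "cls \<nu> p = cls \<nu> q" if "p - q \<in> copy_rel A \<iota>" for p q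
  proof -
    have "nrm (completion \<nu>) (cls \<nu> (p - q)) = 0" unfolding nrm_cls[OF \<nu>] by (rule null[OF that])
    then show ?thesis unfolding K.fh_minus[OF fh] K.nrm_minus_eq_zero[OF cl cl] .
  qed
  show ?thesis
  proof (rule cstar_homI)
    fix x assume x: "x \<in> carrier A"
    show "cls \<nu> (fgen (\<iota> x)) \<in> carrier (completion \<nu>)" by (rule cl)
    show "cls \<nu> (fgen (\<iota> (c \<odot>\<^bsub>A\<^esub> x))) = c \<odot>\<^bsub>completion \<nu>\<^esub> cls \<nu> (fgen (\<iota> x))" for c
      unfolding K.fh_scale[OF fh, symmetric] by (rule eq) (use x in \<open>unfold copy_rel_def, blast\<close>)
    show "cls \<nu> (fgen (\<iota> (adj A x))) = adj (completion \<nu>) (cls \<nu> (fgen (\<iota> x)))"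
      unfolding K.fh_adj[OF fh, symmetric] by (rule eq) (use x in \<open>unfold copy_rel_def, blast\<close>)
    fix y assume y: "y \<in> carrier A"
    show "cls \<nu> (fgen (\<iota> (x \<oplus>\<^bsub>A\<^esub> y))) = cls \<nu> (fgen (\<iota> x)) \<oplus>\<^bsub>completion \<nu>\<^esub> cls \<nu> (fgen (\<iota> y))"
      unfolding K.fh_add[OF fh, symmetric] by (rule eq) (use x y in \<open>unfold copy_rel_def, blast\<close>)
    show "cls \<nu> (fgen (\<iota> (x \<otimes>\<^bsub>A\<^esub> y))) = cls \<nu> (fgen (\<iota> x)) \<otimes>\<^bsub>completion \<nu>\<^esub> cls \<nu> (fgen (\<iota> y))"
      unfolding K.fh_mult[OF fh, symmetric] by (rule eq) (use x y in \<open>unfold copy_rel_def, blast\<close>)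
  next
    show "cls \<nu> (fgen (\<iota> \<one>\<^bsub>A\<^esub>)) = \<one>\<^bsub>completion \<nu>\<^esub>"
      unfolding K.fh_one[OF fh, symmetric] by (rule eq) (unfold copy_rel_def, blast)
  qed
qed

text \<open>The tensor product exists because a *-homomorphism defined on a C*-algebra is contractive,
  which bounds the generators.\<close>

lemma bounds_tensor:
  assumes A: "cstar_algebra A" and B: "cstar_algebra B"
  shows "bounds_generators (relators (carrier A <+> carrier B) (tensor_rel A B))"
  unfolding bounds_generators_def
proof (intro allI)
  fix g :: "'a + 'b"
  let ?R = "relators (carrier A <+> carrier B) (tensor_rel A B)"
  have out: "\<nu> (fgen g) \<le> 0" if "cstar_seminorm \<nu> \<and> (\<forall>r\<in>?R. \<nu> r = 0)" "g \<notin> carrier A <+> carrier B" for \<nu>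
    using that by (simp add: relators_def)
  show "\<exists>b. \<forall>\<nu>. cstar_seminorm \<nu> \<and> (\<forall>r\<in>?R. \<nu> r = 0) \<longrightarrow> \<nu> (fgen g) \<le> b"
  proof (cases "g \<in> carrier A <+> carrier B")
    case False
    then show ?thesis using out by blast
  next
    case True
    then consider x where "g = Inl x" "x \<in> carrier A" | y where "g = Inr y" "y \<in> carrier B" by blast
    then show ?thesis
    proof cases
      case 1
      have "\<nu> (fgen g) \<le> nrm A x" if \<nu>: "cstar_seminorm \<nu> \<and> (\<forall>r\<in>?R. \<nu> r = 0)" for \<nu>
      proof -
        have "(\<lambda>x. cls \<nu> (fgen (Inl x))) \<in> cstar_hom A (completion \<nu>)"
          by (rule copy_hom) (use \<nu> A in \<open>auto simp: relators_def tensor_rel_def\<close>)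
        from cstar_hom_contractive[OF this A cstar_algebra_completion 1(2)] \<nu>
        show ?thesis by (simp add: nrm_cls 1(1))
      qed
      then show ?thesis by blast
    next
      case 2
      have "\<nu> (fgen g) \<le> nrm B y" if \<nu>: "cstar_seminorm \<nu> \<and> (\<forall>r\<in>?R. \<nu> r = 0)" for \<nu>
      proof -
        have "(\<lambda>x. cls \<nu> (fgen (Inr x))) \<in> cstar_hom B (completion \<nu>)"
          by (rule copy_hom) (use \<nu> B in \<open>auto simp: relators_def tensor_rel_def\<close>)
        from cstar_hom_contractive[OF this B cstar_algebra_completion 2(2)] \<nu>
        show ?thesis by (simp add: nrm_cls 2(1))
      qed
      then show ?thesis by blast
    qed
  qed
qed

lemma tensor_structure:
  assumes A: "cstar_algebra A" and B: "cstar_algebra B"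
  obtains l r where "cstar_algebra (tensor_cstar A B)" "l \<in> cstar_hom A (tensor_cstar A B)" "r \<in> cstar_hom B (tensor_cstar A B)"
    "\<And>x y. tens A B x y = l x \<otimes>\<^bsub>tensor_cstar A B\<^esub> r y"
    "\<And>x y. x \<in> carrier A \<Longrightarrow> y \<in> carrier B \<Longrightarrow> l x \<otimes>\<^bsub>tensor_cstar A B\<^esub> r y = r y \<otimes>\<^bsub>tensor_cstar A B\<^esub> l x"
proof -
  let ?T = "tensor_cstar A B"
  let ?\<nu> = "universal_seminorm (relators (carrier A <+> carrier B) (tensor_rel A B))"
  note b = bounds_tensor[OF A B]
  note \<nu> = universal_cstar_seminorm[OF b]
  have T: "?T = completion ?\<nu>" by (simp add: tensor_cstar_def universal_cstar_def)
  have null: "?\<nu> r = 0" if "r \<in> tensor_rel A B" for r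
    by (rule universal_vanishes[OF b]) (use that in \<open>simp add: relators_def\<close>)
  let ?l = "\<lambda>x. cls ?\<nu> (fgen (Inl x))" and ?r = "\<lambda>y. cls ?\<nu> (fgen (Inr y))"
  interpret K: cstar_algebra "completion ?\<nu>" by (rule cstar_algebra_completion[OF \<nu>])
  note fh = free_hom_cls[OF \<nu>] note cl = K.fh_closed[OF fh]
  show ?thesis
  proof (rule that[of ?l ?r])
    show "cstar_algebra ?T" unfolding T by (rule cstar_algebra_completion[OF \<nu>])
    show "?l \<in> cstar_hom A ?T" unfolding T by (rule copy_hom[OF \<nu> A null]) (simp add: tensor_rel_def)
    show "?r \<in> cstar_hom B ?T" unfolding T by (rule copy_hom[OF \<nu> B null]) (simp add: tensor_rel_def)
    show "tens A B x y = ?l x \<otimes>\<^bsub>?T\<^esub> ?r y" for x y by (simp only: tens_def ugen_eq[OF b])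
    fix x y assume xy: "x \<in> carrier A" "y \<in> carrier B"
    have "fgen (Inl x) * fgen (Inr y) - fgen (Inr y) * fgen (Inl x) \<in> tensor_rel A B"
      unfolding tensor_rel_def using xy by blast
    from null[OF this] have "nrm (completion ?\<nu>) (cls ?\<nu> (fgen (Inl x) * fgen (Inr y) - fgen (Inr y) * fgen (Inl x))) = 0"
      unfolding nrm_cls[OF \<nu>] .
    then show "?l x \<otimes>\<^bsub>?T\<^esub> ?r y = ?r y \<otimes>\<^bsub>?T\<^esub> ?l x"
      unfolding T K.fh_minus[OF fh] K.fh_mult[OF fh] using cl by (subst (asm) K.nrm_minus_eq_zero) simp_all
  qed
qed

context cstar_algebra
begin

text \<open>Half-commutation is additive in each of its three arguments.\<close>

lemma half_comm_sum1:
  assumes I: "finite I" and c: "\<And>k. k \<in> I \<Longrightarrow> f k \<in> carrier A" "y \<in> carrier A" "z \<in> carrier A"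
    and H: "\<And>k. k \<in> I \<Longrightarrow> f k \<otimes> y \<otimes> z = z \<otimes> y \<otimes> f k"
  shows "(\<Oplus>k\<in>I. f k) \<otimes> y \<otimes> z = z \<otimes> y \<otimes> (\<Oplus>k\<in>I. f k)"
proof -
  have "(\<Oplus>k\<in>I. f k) \<otimes> y = (\<Oplus>k\<in>I. f k \<otimes> y)" by (rule finsum_ldistr[OF I]) (use c in auto)
  then have "(\<Oplus>k\<in>I. f k) \<otimes> y \<otimes> z = (\<Oplus>k\<in>I. f k \<otimes> y) \<otimes> z" by simp
  also have "\<dots> = (\<Oplus>k\<in>I. f k \<otimes> y \<otimes> z)" by (rule finsum_ldistr[OF I]) (use c in auto)
  also have "\<dots> = (\<Oplus>k\<in>I. z \<otimes> y \<otimes> f k)" by (rule finsum_eqI) (simp_all add: H c)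
  also have "\<dots> = z \<otimes> y \<otimes> (\<Oplus>k\<in>I. f k)" by (rule finsum_rdistr[OF I, symmetric]) (use c in auto)
  finally show ?thesis .
qed

lemma half_comm_sum2:
  assumes I: "finite I" and c: "\<And>k. k \<in> I \<Longrightarrow> f k \<in> carrier A" "x \<in> carrier A" "z \<in> carrier A"
    and H: "\<And>k. k \<in> I \<Longrightarrow> x \<otimes> f k \<otimes> z = z \<otimes> f k \<otimes> x"
  shows "x \<otimes> (\<Oplus>k\<in>I. f k) \<otimes> z = z \<otimes> (\<Oplus>k\<in>I. f k) \<otimes> x"
proof -
  have e: "a \<otimes> (\<Oplus>k\<in>I. f k) \<otimes> b = (\<Oplus>k\<in>I. a \<otimes> f k \<otimes> b)" if "a \<in> carrier A" "b \<in> carrier A" for a b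
  proof -
    have "a \<otimes> (\<Oplus>k\<in>I. f k) = (\<Oplus>k\<in>I. a \<otimes> f k)" by (rule finsum_rdistr[OF I]) (use c that in auto)
    then have "a \<otimes> (\<Oplus>k\<in>I. f k) \<otimes> b = (\<Oplus>k\<in>I. a \<otimes> f k) \<otimes> b" by simp
    also have "\<dots> = (\<Oplus>k\<in>I. a \<otimes> f k \<otimes> b)" by (rule finsum_ldistr[OF I]) (use c that in auto)
    finally show ?thesis .
  qed
  have "(\<Oplus>k\<in>I. x \<otimes> f k \<otimes> z) = (\<Oplus>k\<in>I. z \<otimes> f k \<otimes> x)" by (rule finsum_eqI) (simp_all add: H c)
  then show ?thesis by (simp only: e c)
qed

lemma half_comm_sums:
  assumes I: "finite I" "finite J" "finite L"
    and c: "\<And>k. f k \<in> carrier A" "\<And>k. g k \<in> carrier A" "\<And>k. h k \<in> carrier A"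
    and H: "\<And>i j k. f i \<otimes> g j \<otimes> h k = h k \<otimes> g j \<otimes> f i"
  shows "(\<Oplus>i\<in>I. f i) \<otimes> (\<Oplus>j\<in>J. g j) \<otimes> (\<Oplus>k\<in>L. h k) = (\<Oplus>k\<in>L. h k) \<otimes> (\<Oplus>j\<in>J. g j) \<otimes> (\<Oplus>i\<in>I. f i)"
proof (rule half_comm_sum1[OF I(1)])
  fix i
  show "f i \<otimes> (\<Oplus>j\<in>J. g j) \<otimes> (\<Oplus>k\<in>L. h k) = (\<Oplus>k\<in>L. h k) \<otimes> (\<Oplus>j\<in>J. g j) \<otimes> f i"
  proof (rule half_comm_sum2[OF I(2)])
    fix j
    show "f i \<otimes> g j \<otimes> (\<Oplus>k\<in>L. h k) = (\<Oplus>k\<in>L. h k) \<otimes> g j \<otimes> f i"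
      by (rule half_comm_sum1[OF I(3), symmetric]) (simp_all add: c H)
  qed (simp_all add: c finsum_mem)
qed (simp_all add: c finsum_mem)

lemma orth_commuting_product:
  assumes I: "finite I" and a: "orth A I a" and b: "orth A I b"
    and ab: "\<And>i j k l. a i j \<otimes> b k l = b k l \<otimes> a i j"
  shows "orth A I (mmul A I a b)"
proof -
  note ac = orthD(1)[OF a] and bc = orthD(1)[OF b]
  note at = cmat_tpose[OF ac] and bt = cmat_tpose[OF bc]
  have t: "tpose (mmul A I a b) = mmul A I (tpose b) (tpose a)"
    by (rule ext, rule ext) (simp add: mmul_def ab)
  have "mmul A I (mmul A I a b) (mmul A I (tpose b) (tpose a)) = mmul A I a (mmul A I (mmul A I b (tpose b)) (tpose a))"
    by (simp only: mmul_assoc[OF I] ac bc at bt mmul_cmat)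
  also have "\<dots> = mone A I" by (simp only: orthD(4)[OF b] mmul_one_left[OF I at] orthD(4)[OF a])
  finally have 1: "mmul A I (mmul A I a b) (mmul A I (tpose b) (tpose a)) = mone A I" .
  have "mmul A I (mmul A I (tpose b) (tpose a)) (mmul A I a b) = mmul A I (tpose b) (mmul A I (mmul A I (tpose a) a) b)"
    by (simp only: mmul_assoc[OF I] ac bc at bt mmul_cmat)
  also have "\<dots> = mone A I" by (simp only: orthD(5)[OF a] mmul_one_left[OF I bc] orthD(5)[OF b])
  finally have 2: "mmul A I (mmul A I (tpose b) (tpose a)) (mmul A I a b) = mone A I" .
  have "adj A (mmul A I a b i j) = mmul A I a b i j" for i j
    unfolding mmul_def by (simp add: adj_finsum cmatD[OF ac] cmatD[OF bc] adj_mult orthD(3)[OF a] orthD(3)[OF b] ab)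
  then show ?thesis unfolding orth_def t using 1 2 mmul_cmat[OF ac bc] by simp
qed

lemma half_comm_commuting_product:
  assumes I: "finite I" and a: "a \<in> cmat A I" "half_comm A a" and b: "b \<in> cmat A I" "half_comm A b"
    and ab: "\<And>i j k l. a i j \<otimes> b k l = b k l \<otimes> a i j"
  shows "half_comm A (mmul A I a b)"
  unfolding half_comm_def
proof (intro allI)
  note ac = cmatD[OF a(1)] and bc = cmatD[OF b(1)]
  have r: "a i j \<otimes> b p q \<otimes> (a k l \<otimes> b r s) \<otimes> (a m n \<otimes> b t v) =
    (a i j \<otimes> a k l \<otimes> a m n) \<otimes> (b p q \<otimes> b r s \<otimes> b t v)" for i j p q k l r s m n t v
  proof -
    have "a i j \<otimes> b p q \<otimes> (a k l \<otimes> b r s) \<otimes> (a m n \<otimes> b t v) =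
      a i j \<otimes> (b p q \<otimes> a k l) \<otimes> (b r s \<otimes> a m n) \<otimes> b t v" by (simp add: ac bc m_assoc)
    also have "\<dots> = a i j \<otimes> (a k l \<otimes> b p q) \<otimes> (a m n \<otimes> b r s) \<otimes> b t v" by (simp only: ab)
    also have "\<dots> = a i j \<otimes> a k l \<otimes> (b p q \<otimes> a m n) \<otimes> b r s \<otimes> b t v" by (simp add: ac bc m_assoc)
    also have "\<dots> = a i j \<otimes> a k l \<otimes> (a m n \<otimes> b p q) \<otimes> b r s \<otimes> b t v" by (simp only: ab)
    also have "\<dots> = (a i j \<otimes> a k l \<otimes> a m n) \<otimes> (b p q \<otimes> b r s \<otimes> b t v)" by (simp add: ac bc m_assoc)
    finally show ?thesis .
  qed
  have ha: "a i j \<otimes> a k l \<otimes> a m n = a m n \<otimes> a k l \<otimes> a i j" for i j k l m n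
    using a(2) unfolding half_comm_def by blast
  have hb: "b i j \<otimes> b k l \<otimes> b m n = b m n \<otimes> b k l \<otimes> b i j" for i j k l m n
    using b(2) unfolding half_comm_def by blast
  fix i j k l m n
  show "mmul A I a b i j \<otimes> mmul A I a b k l \<otimes> mmul A I a b m n = mmul A I a b m n \<otimes> mmul A I a b k l \<otimes> mmul A I a b i j"
    unfolding mmul_def
  proof (rule half_comm_sums[OF I I I])
    show "a i p \<otimes> b p j \<otimes> (a k q \<otimes> b q l) \<otimes> (a m s \<otimes> b s n) = a m s \<otimes> b s n \<otimes> (a k q \<otimes> b q l) \<otimes> (a i p \<otimes> b p j)" for p q s
      unfolding r ha[of i p] hb[of p j] ..
  qed (simp_all add: ac bc)
qed

lemma cstar_algebra_opposite: "cstar_algebra (opposite A)"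
proof -
  have [simp]: "carrier (opposite A) = carrier A" "mult (opposite A) = (\<lambda>x y. y \<otimes> x)" "one (opposite A) = \<one>"
    "zero (opposite A) = \<zero>" "add (opposite A) = add A" "smult (opposite A) = smult A" "adj (opposite A) = adj A"
    "nrm (opposite A) = nrm A"
    by (simp_all add: opposite_def)
  have "ring (opposite A)"
  proof (rule ringI)
    show "abelian_group (opposite A)"
      by (rule abelian_groupI) (auto simp: a_ac intro: l_neg bexI[of _ "\<ominus> _"])
    show "monoid (opposite A)" by (rule monoidI) (simp_all add: m_assoc)
  qed (simp_all add: l_distr r_distr)
  then interpret O: ring "opposite A" .
  have minus: "x \<ominus>\<^bsub>opposite A\<^esub> y = x \<ominus> y" if "x \<in> carrier A" "y \<in> carrier A" for x y
  proof -
    have "\<ominus>\<^bsub>opposite A\<^esub> y = \<ominus> y" by (rule O.minus_equality) (use that in \<open>simp_all add: l_neg\<close>)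
    then show ?thesis by (simp add: a_minus_def)
  qed
  show ?thesis
  proof unfold_locales
    fix x assume x: "x \<in> carrier (opposite A)"
    show "nrm (opposite A) (adj (opposite A) x \<otimes>\<^bsub>opposite A\<^esub> x) = (nrm (opposite A) x)\<^sup>2"
      using x cstar_identity[of "adj A x"] by (simp add: adj_closed adj_adj nrm_adj)
  next
    fix X assume X: "\<And>n::nat. X n \<in> carrier (opposite A)"
      and c: "\<forall>e>0. \<exists>M. \<forall>m\<ge>M. \<forall>n\<ge>M. nrm (opposite A) (X m \<ominus>\<^bsub>opposite A\<^esub> X n) < e"
    have Xc: "X n \<in> carrier A" for n using X by simp
    have "\<exists>x\<in>carrier A. (\<lambda>n. nrm A (X n \<ominus> x)) \<longlonglongrightarrow> 0"
      by (rule complete[OF Xc]) (use c in \<open>simp add: minus Xc\<close>)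
    then show "\<exists>x\<in>carrier (opposite A). (\<lambda>n. nrm (opposite A) (X n \<ominus>\<^bsub>opposite A\<^esub> x)) \<longlonglongrightarrow> 0"
      by (simp add: minus Xc)
  qed (simp_all add: smult_closed smult_add_left smult_add_right smult_smult smult_one smult_mult_left smult_mult_right
      adj_closed adj_adj adj_add adj_smult adj_mult nrm_eq_zero nrm_triangle nrm_smult, metis nrm_mult mult.commute)
qed

lemma mmul_opposite: "mmul (opposite A) I a b i j = (\<Oplus>k\<in>I. b k j \<otimes> a i k)"
  by (simp add: mmul_def finsum_def opposite_def)

lemma opposite_matrices: "cmat (opposite A) I = cmat A I" "mone (opposite A) I = mone A I"
  "smat (opposite A) I F = smat A I F" "blk (opposite A) w = blk A w"
  by (auto simp: cmat_def mone_def smat_def blk_def fun_eq_iff opposite_def)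

lemma opposite_orth: "orth A I u \<Longrightarrow> orth (opposite A) I (tpose u)"
proof -
  assume u: "orth A I u"
  have m: "mmul (opposite A) I (tpose u) u i j = mone A I i j" "mmul (opposite A) I u (tpose u) i j = mone A I i j" for i j
  proof -
    have "mmul (opposite A) I (tpose u) u i j = mmul A I (tpose u) u j i" by (simp add: mmul_opposite) (simp add: mmul_def)
    then show "mmul (opposite A) I (tpose u) u i j = mone A I i j" by (auto simp: orthD(5)[OF u] mone_def)
    have "mmul (opposite A) I u (tpose u) i j = mmul A I u (tpose u) j i" by (simp add: mmul_opposite) (simp add: mmul_def)
    then show "mmul (opposite A) I u (tpose u) i j = mone A I i j" by (auto simp: orthD(4)[OF u] mone_def)
  qed
  have "mmul (opposite A) I (tpose u) u = mone A I" by (rule ext, rule ext, rule m(1))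
  moreover have "mmul (opposite A) I u (tpose u) = mone A I" by (rule ext, rule ext, rule m(2))
  moreover have "adj (opposite A) (u i j) = u i j" for i j using orthD(3)[OF u] by (simp add: opposite_def)
  ultimately show ?thesis using cmat_tpose[OF orthD(1)[OF u]] by (simp add: orth_def opposite_matrices)
qed

lemma opposite_smat:
  assumes a: "a \<in> cmat A I"
  shows "mmul (opposite A) I (smat A I F) a = mmul A I (smat A I F) a"
    "mmul (opposite A) I a (smat A I F) = mmul A I a (smat A I F)"
proof -
  have c: "smat A I F i j \<otimes> x = x \<otimes> smat A I F i j" if "x \<in> carrier A" for x i j
    using that by (simp add: smat_def smult_mult_left smult_mult_right)
  show "mmul (opposite A) I (smat A I F) a = mmul A I (smat A I F) a"
    by (intro ext) (simp add: mmul_opposite, simp add: mmul_def c cmatD[OF a])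
  show "mmul (opposite A) I a (smat A I F) = mmul A I a (smat A I F)"
    by (intro ext) (simp add: mmul_opposite, simp add: mmul_def c cmatD[OF a])
qed

lemma subalgebra_mmul:
  assumes B: "closed_star_subalgebra B A" and a: "\<And>i j. a i j \<in> B" and b: "\<And>i j. b i j \<in> B"
  shows "mmul A I a b i j \<in> B"
proof -
  have sr: "subring B A" using B by (simp add: closed_star_subalgebra_def)
  note srE = subringE[OF sr]
  have s: "(\<Oplus>k\<in>I. f k) \<in> B" if f: "\<And>k. f k \<in> B" for f
  proof (induction I rule: infinite_finite_induct)
    case (insert k I)
    have "(\<Oplus>k\<in>insert k I. f k) = f k \<oplus> (\<Oplus>k\<in>I. f k)"
      by (rule finsum_insert'[OF insert(1,2)]) (use f srE(1) in blast)
    then show ?case using srE(7)[OF f insert(3)] by simp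
  qed (simp_all add: finsum_infinite srE(2))
  show ?thesis unfolding mmul_def by (rule s[OF srE(6)[OF a b]])
qed

lemma carrier_closed_star_subalgebra: "closed_star_subalgebra (carrier A) A"
  unfolding closed_star_subalgebra_def by (simp add: carrier_is_subring smult_closed adj_closed)

end

context bistochastic_basis
begin

lemma lift_mmul:
  assumes A: "cstar_algebra A" and a: "a \<in> cmat A J" and b: "b \<in> cmat A J"
  shows "lift A (mmul A J a b) = mmul A I0 (lift A a) (lift A b)"
proof -
  interpret rotated_algebra A N F by (rule rotated[OF A])
  show ?thesis unfolding lift_def blk_mmul[OF N a b, symmetric]
    by (rule rot_mmul(1)[symmetric]) (intro blk_cmat N a b)+
qed

lemma lift_opposite:
  assumes A: "cstar_algebra A" and w: "w \<in> cmat A J"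
  shows "lift (opposite A) (tpose w) i j = lift A w j i"
proof -
  interpret rotated_algebra A N F by (rule rotated[OF A])
  note b = blk_cmat[OF N w] note bt = blk_cmat[OF N cmat_tpose[OF w]]
  have "lift (opposite A) (tpose w) = rot A N F (blk A (tpose w))"
    unfolding lift_def rot_def opposite_matrices opposite_smat(2)[OF bt]
    by (rule opposite_smat(1)[OF mmul_cmat[OF bt smat_cmat]])
  also have "\<dots> = tpose (rot A N F (blk A w))" unfolding rot_tpose[OF b] blk_tpose ..
  finally show ?thesis by (simp add: lift_def)
qed

lemma B_circ_compact_quantum_group: "compact_quantum_group (B_circ N F)"
proof -
  let ?A = "alg (O_star J)" and ?w = "fund (O_star J)" and ?u = "lift (alg (O_star J)) (fund (O_star J))"
  note A = algebras(2)
  interpret rotated_algebra ?A N F by (rule rotated[OF A])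
  interpret RZ: rotated_algebra complex_cstar N F by (rule rotated[OF cstar_algebra_complex])
  note wo = funds(2) note wc = orthD(1)[OF wo]
  note uo = lift_orth(1)[OF A wo] note uc = orthD(1)[OF uo]
  note wh = funds(3)
  have unit: "unitary_over ?A I0 ?u"
    unfolding unitary_over_def
  proof (intro ballI conjI)
    fix i j assume ij: "i \<in> I0" "j \<in> I0"
    show "(\<Oplus>\<^bsub>?A\<^esub>k\<in>I0. ?u i k \<otimes>\<^bsub>?A\<^esub> adj ?A (?u j k)) = (if i = j then \<one>\<^bsub>?A\<^esub> else \<zero>\<^bsub>?A\<^esub>)"
      using fun_cong[OF fun_cong[OF orthD(4)[OF uo]], of i j] ij
      unfolding mmul_def orthD(3)[OF uo] mone_def by simp
    show "(\<Oplus>\<^bsub>?A\<^esub>k\<in>I0. adj ?A (?u k i) \<otimes>\<^bsub>?A\<^esub> ?u k j) = (if i = j then \<one>\<^bsub>?A\<^esub> else \<zero>\<^bsub>?A\<^esub>)"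
      using fun_cong[OF fun_cong[OF orthD(5)[OF uo]], of i j] ij
      unfolding mmul_def orthD(3)[OF uo] mone_def by simp
  qed
  have gen: "cstar_generated ?A {?u i j | i j. i \<in> I0 \<and> j \<in> I0} = carrier ?A"
  proof -
    have "B = carrier ?A" if B: "closed_star_subalgebra B ?A" "{?u i j | i j. i \<in> I0 \<and> j \<in> I0} \<subseteq> B" for B
    proof -
      have sr: "subring B ?A" and sm: "\<And>c x. x \<in> B \<Longrightarrow> c \<odot>\<^bsub>?A\<^esub> x \<in> B"
        using B(1) by (simp_all add: closed_star_subalgebra_def)
      note srE = subringE[OF sr]
      have uB: "?u i j \<in> B" for i j
        using B(2) cmat_outside[OF uc, of i j] srE(2) by (cases "i \<in> I0 \<and> j \<in> I0") auto
      have sB: "smat ?A I0 G i j \<in> B" for G i j unfolding smat_def using sm[OF srE(3)] srE(2) by simp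
      have vB: "unrot ?A N F ?u i j \<in> B" for i j
        unfolding rot_def by (intro subalgebra_mmul[OF B(1)] uB sB)
      have "?w i j \<in> B" if "i \<in> J" for i j
        using vB[of i j] unfolding lift_def rot_unrot[OF blk_cmat[OF N wc]] blk_inside[OF that] .
      then show "B = carrier ?A"
        unfolding O_star_def using qgroup_generated[OF bS B(1)[unfolded O_star_def]] by blast
    qed
    moreover have "{?u i j | i j. i \<in> I0 \<and> j \<in> I0} \<subseteq> carrier ?A" using cmatD[OF uc] by blast
    ultimately show ?thesis unfolding cstar_generated_def using carrier_closed_star_subalgebra by blast
  qed
  have comult: "\<exists>\<Delta>\<in>cstar_hom ?A (tensor_cstar ?A ?A). \<forall>i\<in>I0. \<forall>j\<in>I0.
      \<Delta> (?u i j) = (\<Oplus>\<^bsub>tensor_cstar ?A ?A\<^esub>k\<in>I0. tens ?A ?A (?u i k) (?u k j))"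
  proof (rule tensor_structure[OF A A])
    let ?T = "tensor_cstar ?A ?A"
    fix l r
    assume T: "cstar_algebra ?T" and l: "l \<in> cstar_hom ?A ?T" and r: "r \<in> cstar_hom ?A ?T"
      and tens: "\<And>x y. tens ?A ?A x y = l x \<otimes>\<^bsub>?T\<^esub> r y"
      and lr: "\<And>x y. x \<in> carrier ?A \<Longrightarrow> y \<in> carrier ?A \<Longrightarrow> l x \<otimes>\<^bsub>?T\<^esub> r y = r y \<otimes>\<^bsub>?T\<^esub> l x"
    interpret T: cstar_algebra ?T by (rule T)
    let ?a = "\<lambda>i j. l (?w i j)" and ?b = "\<lambda>i j. r (?w i j)"
    have hc: "half_comm ?T (\<lambda>i j. h (?w i j))" if h: "h \<in> cstar_hom ?A ?T" for h
      unfolding half_comm_def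
    proof (intro allI)
      fix i j k m n p
      have "h (?w i j \<otimes>\<^bsub>?A\<^esub> ?w k m \<otimes>\<^bsub>?A\<^esub> ?w n p) = h (?w n p \<otimes>\<^bsub>?A\<^esub> ?w k m \<otimes>\<^bsub>?A\<^esub> ?w i j)"
        using wh unfolding half_comm_def by metis
      then show "h (?w i j) \<otimes>\<^bsub>?T\<^esub> h (?w k m) \<otimes>\<^bsub>?T\<^esub> h (?w n p) = h (?w n p) \<otimes>\<^bsub>?T\<^esub> h (?w k m) \<otimes>\<^bsub>?T\<^esub> h (?w i j)"
        by (simp only: cstar_homD(3)[OF h] m_closed cmatD[OF wc])
    qed
    note ao = cstar_hom_orth[OF l A T wo] and bo = cstar_hom_orth[OF r A T wo]
    note ac = T.orthD(1)[OF ao] and bc = T.orthD(1)[OF bo]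
    have ab: "?a i j \<otimes>\<^bsub>?T\<^esub> ?b k m = ?b k m \<otimes>\<^bsub>?T\<^esub> ?a i j" for i j k m
      by (rule lr[OF cmatD[OF wc] cmatD[OF wc]])
    let ?c = "mmul ?T J ?a ?b"
    have co: "orth ?T J ?c" by (rule T.orth_commuting_product[OF _ ao bo ab]) simp
    have ch: "half_comm ?T ?c" by (rule T.half_comm_commuting_product[OF _ ac hc[OF l] bc hc[OF r] ab]) simp
    obtain \<Delta> where \<Delta>: "\<Delta> \<in> cstar_hom ?A ?T" "\<And>i j. \<Delta> (?w i j) = ?c i j"
      using O_star_hom[OF T co ch] by blast
    have "\<Delta> (?u i j) = (\<Oplus>\<^bsub>?T\<^esub>k\<in>I0. tens ?A ?A (?u i k) (?u k j))" for i j
    proof -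
      have "\<Delta> (?u i j) = lift ?T ?c i j" unfolding lift_hom[OF \<Delta>(1) A T wc] \<Delta>(2) ..
      also have "\<dots> = mmul ?T I0 (lift ?T ?a) (lift ?T ?b) i j" unfolding lift_mmul[OF T ac bc] ..
      also have "\<dots> = (\<Oplus>\<^bsub>?T\<^esub>k\<in>I0. tens ?A ?A (?u i k) (?u k j))"
        unfolding mmul_def tens lift_hom[OF l A T wc] lift_hom[OF r A T wc] ..
      finally show ?thesis .
    qed
    then show ?thesis using \<Delta>(1) by blast
  qed
  have counit: "\<exists>\<epsilon>\<in>cstar_hom ?A complex_cstar. \<forall>i\<in>I0. \<forall>j\<in>I0. \<epsilon> (?u i j) = of_bool (i = j)"
  proof -
    let ?e = "mone complex_cstar J"
    have et: "tpose ?e = ?e" by (intro ext) (auto simp: mone_def)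
    have "orth complex_cstar J ?e"
      unfolding orth_def et using RZ.mmul_one_left[OF _ RZ.mone_cmat, of J] RZ.mone_cmat
      by (simp add: mone_def complex_cstar_def)
    moreover have "half_comm complex_cstar ?e" by (simp add: half_comm_def complex_cstar_def)
    ultimately obtain \<epsilon> where e: "\<epsilon> \<in> cstar_hom ?A complex_cstar" "\<And>i j. \<epsilon> (?w i j) = ?e i j"
      using O_star_hom[OF cstar_algebra_complex] by blast
    have "\<epsilon> (?u i j) = of_bool (i = j)" if "i \<in> I0" for i j
    proof -
      have "\<epsilon> (?u i j) = lift complex_cstar ?e i j" unfolding lift_hom[OF e(1) A cstar_algebra_complex wc] e(2) ..
      also have "\<dots> = mone complex_cstar I0 i j" unfolding lift_def RZ.blk_one[OF N] RZ.rot_one ..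
      finally show ?thesis using that by (simp add: mone_def complex_cstar_def)
    qed
    then show ?thesis using e(1) by blast
  qed
  have antipode: "\<exists>S\<in>cstar_hom ?A (opposite ?A). \<forall>i\<in>I0. \<forall>j\<in>I0. S (?u i j) = adj ?A (?u j i)"
  proof -
    have "half_comm (opposite ?A) (tpose ?w)"
      unfolding half_comm_def
    proof (intro allI)
      fix i j k l m n
      have "?w n m \<otimes>\<^bsub>?A\<^esub> (?w l k \<otimes>\<^bsub>?A\<^esub> ?w j i) = ?w n m \<otimes>\<^bsub>?A\<^esub> ?w l k \<otimes>\<^bsub>?A\<^esub> ?w j i"
        by (rule m_assoc[symmetric]) (rule cmatD[OF wc])+
      also have "\<dots> = ?w j i \<otimes>\<^bsub>?A\<^esub> ?w l k \<otimes>\<^bsub>?A\<^esub> ?w n m" using wh unfolding half_comm_def by blast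
      also have "\<dots> = ?w j i \<otimes>\<^bsub>?A\<^esub> (?w l k \<otimes>\<^bsub>?A\<^esub> ?w n m)" by (rule m_assoc) (rule cmatD[OF wc])+
      finally show "?w j i \<otimes>\<^bsub>opposite ?A\<^esub> ?w l k \<otimes>\<^bsub>opposite ?A\<^esub> ?w n m = ?w n m \<otimes>\<^bsub>opposite ?A\<^esub> ?w l k \<otimes>\<^bsub>opposite ?A\<^esub> ?w j i"
        by (simp add: opposite_def)
    qed
    then obtain S where S: "S \<in> cstar_hom ?A (opposite ?A)" "\<And>i j. S (?w i j) = ?w j i"
      using O_star_hom[OF cstar_algebra_opposite opposite_orth[OF wo]] by blast
    have "S (?u i j) = adj ?A (?u j i)" for i j
      unfolding lift_hom[OF S(1) A cstar_algebra_opposite wc] S(2) lift_opposite[OF A wc] orthD(3)[OF uo] ..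
    then show ?thesis using S(1) by blast
  qed
  show ?thesis
    unfolding compact_quantum_group_def B_circ_simps Let_def
    using A unit gen comult counit antipode cmatD[OF uc] by blast
qed

end

section \<open>Contractions of partition maps\<close>

lemma multi_indices_sum_PiE: "(\<Sum>i\<in>multi_indices I n. f i) = (\<Sum>\<phi>\<in>{..<n} \<rightarrow>\<^sub>E I. f (map \<phi> [0..<n]))"
proof (rule sum.reindex_bij_witness[where i = "\<lambda>\<phi>. map \<phi> [0..<n]" and j = "\<lambda>i. restrict ((!) i) {..<n}"])
  fix i assume i: "i \<in> multi_indices I n"
  show e: "map (restrict ((!) i) {..<n}) [0..<n] = i"
    by (rule nth_equalityI) (use i in \<open>auto simp: multi_indices_def\<close>)
  show "restrict ((!) i) {..<n} \<in> {..<n} \<rightarrow>\<^sub>E I"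
    using i by (auto simp: multi_indices_def subset_iff)
  show "f (map (restrict ((!) i) {..<n}) [0..<n]) = f i" unfolding e ..
next
  fix \<phi> assume p: "\<phi> \<in> {..<n} \<rightarrow>\<^sub>E I"
  show "restrict ((!) (map \<phi> [0..<n])) {..<n} = \<phi>"
  proof (rule ext)
    fix t show "restrict ((!) (map \<phi> [0..<n])) {..<n} t = \<phi> t"
      using PiE_arb[OF p, of t] by (cases "t < n") simp_all
  qed
  have "\<phi> t \<in> I" if "t < n" for t using PiE_mem[OF p] that by simp
  then show "map \<phi> [0..<n] \<in> multi_indices I n" by (auto simp: multi_indices_def)
qed

lemma prod_sum_multi_indices:
  fixes f :: "nat \<Rightarrow> nat \<Rightarrow> complex"
  assumes I: "finite I"
  shows "(\<Prod>t<n. \<Sum>y\<in>I. f t y) = (\<Sum>i\<in>multi_indices I n. \<Prod>t<n. f t (i ! t))"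
  unfolding multi_indices_sum_PiE using prod_sum_PiE[of "{..<n}" "\<lambda>_. I" f] I by simp

lemma finite_multi_indices: "finite I \<Longrightarrow> finite (multi_indices I n)"
  using finite_lists_length_eq[of I n] by (simp add: multi_indices_def conj_commute)

text \<open>The scalar obtained from a linear map between tensor powers by contracting the leg at each
  point \<open>p\<close> with the vector \<open>x p\<close>.\<close>

definition contraction :: "nat set \<Rightarrow> nat \<Rightarrow> nat \<Rightarrow> (nat + nat \<Rightarrow> nat \<Rightarrow> complex) \<Rightarrow> tensor_map \<Rightarrow> complex" where
  "contraction I m n x T = (\<Sum>i\<in>multi_indices I m. \<Sum>j\<in>multi_indices I n.
     T j i * (\<Prod>t<m. x (Inl t) (i ! t)) * (\<Prod>t<n. x (Inr t) (j ! t)))"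

lemma contraction_sum:
  "contraction I m n x (\<lambda>j i. \<Sum>T\<in>X. c T * T j i) = (\<Sum>T\<in>X. c T * contraction I m n x T)"
proof -
  have "contraction I m n x (\<lambda>j i. \<Sum>T\<in>X. c T * T j i) = (\<Sum>i\<in>multi_indices I m. \<Sum>j\<in>multi_indices I n. \<Sum>T\<in>X.
      c T * (T j i * (\<Prod>t<m. x (Inl t) (i ! t)) * (\<Prod>t<n. x (Inr t) (j ! t))))"
    unfolding contraction_def sum_distrib_right mult.assoc ..
  also have "\<dots> = (\<Sum>i\<in>multi_indices I m. \<Sum>T\<in>X. \<Sum>j\<in>multi_indices I n.
      c T * (T j i * (\<Prod>t<m. x (Inl t) (i ! t)) * (\<Prod>t<n. x (Inr t) (j ! t))))"
    by (rule sum.cong[OF refl], rule sum.swap)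
  also have "\<dots> = (\<Sum>T\<in>X. \<Sum>i\<in>multi_indices I m. \<Sum>j\<in>multi_indices I n.
      c T * (T j i * (\<Prod>t<m. x (Inl t) (i ! t)) * (\<Prod>t<n. x (Inr t) (j ! t))))"
    by (rule sum.swap)
  finally show ?thesis unfolding contraction_def sum_distrib_left .
qed

lemma contraction_partition_map:
  assumes I: "finite I" and part: "partition_on (points m n) \<pi>"
  shows "contraction I m n x (partition_map I m n \<pi>) = (\<Prod>b\<in>\<pi>. \<Sum>y\<in>I. \<Prod>p\<in>b. x p y)"
proof -
  let ?P = "points m n"
  have fP: "finite ?P" by (simp add: points_def)
  have fpi: "finite \<pi>" by (rule finite_elements[OF fP part])
  have sub: "b \<subseteq> ?P" if "b \<in> \<pi>" for b using that partition_onD1[OF part] by blast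
  have fb: "finite b" if "b \<in> \<pi>" for b by (rule finite_subset[OF sub[OF that] fP])
  have ne: "b \<noteq> {}" if "b \<in> \<pi>" for b using that partition_onD3[OF part] by blast
  have disj: "b \<inter> c = {}" if "b \<in> \<pi>" "c \<in> \<pi>" "b \<noteq> c" for b c
    using partition_onD2[OF part] that by (auto simp: disjoint_def)
  define val :: "nat list \<times> nat list \<Rightarrow> nat + nat \<Rightarrow> nat" where "val a = case_sum ((!) (fst a)) ((!) (snd a))" for a
  define B where "B p = (SOME b. b \<in> \<pi> \<and> p \<in> b)" for p
  have B: "B p \<in> \<pi> \<and> p \<in> B p" if "p \<in> ?P" for p
    unfolding B_def by (rule someI_ex) (use that partition_onD1[OF part] in blast)
  have B_eq: "B p = b" if "b \<in> \<pi>" "p \<in> b" for p b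
    using B[of p] disj[of "B p" b] that sub by blast
  have PU: "?P = \<Union>\<pi>" by (rule partition_onD1[OF part])
  define S where "S = {a \<in> multi_indices I m \<times> multi_indices I n. \<forall>b\<in>\<pi>. \<forall>p\<in>b. \<forall>q\<in>b. val a p = val a q}"
  define up where "up \<phi> = (map (\<lambda>t. \<phi> (B (Inl t))) [0..<m], map (\<lambda>t. \<phi> (B (Inr t))) [0..<n])" for \<phi> :: "(nat + nat) set \<Rightarrow> nat"
  define down where "down a = restrict (\<lambda>b. val a (SOME p. p \<in> b)) \<pi>" for a
  have SM: "S \<subseteq> multi_indices I m \<times> multi_indices I n" unfolding S_def by (rule Collect_subset)
  have fM: "finite (multi_indices I m \<times> multi_indices I n)" using I by (simp add: finite_multi_indices)
  have in_P: "Inl t \<in> ?P \<longleftrightarrow> t < m" "Inr t \<in> ?P \<longleftrightarrow> t < n" for t by (auto simp: points_def)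
  have val_up: "val (up \<phi>) p = \<phi> (B p)" if "p \<in> ?P" for \<phi> p
    using that by (cases p) (simp_all add: val_def up_def in_P)
  have some: "(SOME p. p \<in> b) \<in> b" if "b \<in> \<pi>" for b using some_in_eq ne[OF that] by blast
  have down_B: "down a (B p) = val a p" if a: "a \<in> S" and p: "p \<in> ?P" for a p
  proof -
    have "val a (SOME q. q \<in> B p) = val a p"
      using a some[of "B p"] B[OF p] unfolding S_def by blast
    then show ?thesis unfolding down_def using B[OF p] by simp
  qed
  have "contraction I m n x (partition_map I m n \<pi>)
      = (\<Sum>a\<in>multi_indices I m \<times> multi_indices I n. if a \<in> S then \<Prod>p\<in>?P. x p (val a p) else 0)"
    unfolding contraction_def sum.cartesian_product
  proof (rule sum.cong[OF refl], clarify)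
    fix i j assume ij: "i \<in> multi_indices I m" "j \<in> multi_indices I n"
    have v: "val (i, j) = case_sum ((!) i) ((!) j)" by (simp add: val_def)
    have prod: "(\<Prod>p\<in>?P. x p (val (i, j) p)) = (\<Prod>t<m. x (Inl t) (i ! t)) * (\<Prod>t<n. x (Inr t) (j ! t))"
      unfolding points_def by (subst prod.Plus) (simp_all add: v)
    let ?Q = "\<forall>b\<in>\<pi>. \<forall>p\<in>b. \<forall>q\<in>b. val (i, j) p = val (i, j) q"
    have pm: "partition_map I m n \<pi> j i = of_bool ?Q"
      unfolding partition_map_def v using ij by (simp only: simp_thms)
    have S: "(i, j) \<in> S \<longleftrightarrow> ?Q" unfolding S_def using ij by (simp only: mem_Collect_eq mem_Sigma_iff simp_thms)
    have if_of_bool: "of_bool q * a * b = (if q then c else 0)" if "c = a * b" for q and a b c :: complex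
      using that by simp
    show "partition_map I m n \<pi> j i * (\<Prod>t<m. x (Inl t) (i ! t)) * (\<Prod>t<n. x (Inr t) (j ! t))
        = (if (i, j) \<in> S then \<Prod>p\<in>?P. x p (val (i, j) p) else 0)"
      unfolding pm S by (rule if_of_bool[OF prod])
  qed
  also have "\<dots> = (\<Sum>a\<in>S. \<Prod>p\<in>?P. x p (val a p))"
    by (rule sum.mono_neutral_cong_right[OF fM SM]) simp_all
  also have "\<dots> = (\<Sum>\<phi>\<in>\<pi> \<rightarrow>\<^sub>E I. \<Prod>b\<in>\<pi>. \<Prod>p\<in>b. x p (\<phi> b))"
  proof (rule sum.reindex_bij_witness[where i = up and j = down])
    fix a assume a: "a \<in> S"
    obtain i j where ij: "a = (i, j)" by (cases a)
    have len: "length i = m" "length j = n" "set i \<subseteq> I" "set j \<subseteq> I" using a by (simp_all add: ij S_def multi_indices_def)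
    have "map (\<lambda>t. down a (B (Inl t))) [0..<m] = i"
      by (rule nth_equalityI) (simp_all add: len down_B[OF a] in_P, simp add: ij val_def)
    moreover have "map (\<lambda>t. down a (B (Inr t))) [0..<n] = j"
      by (rule nth_equalityI) (simp_all add: len down_B[OF a] in_P, simp add: ij val_def)
    ultimately show "up (down a) = a" by (simp add: up_def ij)
    have "val a p \<in> I" if "p \<in> ?P" for p
      using that len nth_mem[of _ i] nth_mem[of _ j] by (cases p) (auto simp: ij val_def in_P)
    then have "val a (SOME p. p \<in> b) \<in> I" if "b \<in> \<pi>" for b using some[OF that] sub[OF that] by blast
    then show "down a \<in> \<pi> \<rightarrow>\<^sub>E I" unfolding down_def by (rule restrict_PiE_iff[THEN iffD2, rule_format])
    have "(\<Prod>p\<in>?P. x p (val a p)) = (\<Prod>p\<in>\<Union>\<pi>. x p (down a (B p)))"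
      unfolding PU[symmetric] by (rule prod.cong) (simp_all add: down_B[OF a])
    also have "\<dots> = (\<Prod>b\<in>\<pi>. \<Prod>p\<in>b. x p (down a (B p)))"
      by (subst prod.Union_disjoint) (use fb disj in \<open>blast, blast, simp only: comp_def\<close>)
    also have "\<dots> = (\<Prod>b\<in>\<pi>. \<Prod>p\<in>b. x p (down a b))"
      by (intro prod.cong refl) (simp add: B_eq)
    finally show "(\<Prod>b\<in>\<pi>. \<Prod>p\<in>b. x p (down a b)) = (\<Prod>p\<in>?P. x p (val a p))" ..
  next
    fix \<phi> assume p: "\<phi> \<in> \<pi> \<rightarrow>\<^sub>E I"
    have "down (up \<phi>) b = \<phi> b" for b
    proof (cases "b \<in> \<pi>")
      case True
      have "(SOME p. p \<in> b) \<in> ?P" using sub[OF True] some[OF True] by blast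
      then have "val (up \<phi>) (SOME p. p \<in> b) = \<phi> (B (SOME p. p \<in> b))" by (rule val_up)
      then show ?thesis unfolding down_def B_eq[OF True some[OF True]] using True by simp
    next
      case False
      then show ?thesis using PiE_arb[OF p False] by (simp add: down_def)
    qed
    then show "down (up \<phi>) = \<phi>" by (rule ext)
    have "\<phi> (B q) \<in> I" if "q \<in> ?P" for q using p B[OF that] by auto
    then have "up \<phi> \<in> multi_indices I m \<times> multi_indices I n"
      by (auto simp: up_def multi_indices_def in_P)
    moreover have "val (up \<phi>) p = val (up \<phi>) q" if "b \<in> \<pi>" "p \<in> b" "q \<in> b" for b p q
    proof -
      have "p \<in> ?P" "q \<in> ?P" using sub[OF that(1)] that by blast+
      then show ?thesis by (simp add: val_up B_eq[OF that(1,2)] B_eq[OF that(1,3)])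
    qed
    ultimately show "up \<phi> \<in> S" unfolding S_def by blast
  qed
  also have "\<dots> = (\<Prod>b\<in>\<pi>. \<Sum>y\<in>I. \<Prod>p\<in>b. x p y)"
    by (rule prod_sum_PiE[symmetric]) (simp_all add: fpi I)
  finally show ?thesis .
qed

lemma sum_isometry:
  fixes G :: "'a \<Rightarrow> 'a \<Rightarrow> complex"
  assumes M: "finite M" and G: "\<And>q r. q \<in> M \<Longrightarrow> r \<in> M \<Longrightarrow> (\<Sum>j\<in>M. G j q * G j r) = of_bool (q = r)"
  shows "(\<Sum>j\<in>M. (\<Sum>q\<in>M. G j q * a q) * (\<Sum>r\<in>M. G j r * b r)) = (\<Sum>q\<in>M. a q * b q)"
proof -
  have "(\<Sum>j\<in>M. (\<Sum>q\<in>M. G j q * a q) * (\<Sum>r\<in>M. G j r * b r))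
      = (\<Sum>j\<in>M. \<Sum>q\<in>M. \<Sum>r\<in>M. G j q * a q * (G j r * b r))" unfolding sum_product ..
  also have "\<dots> = (\<Sum>q\<in>M. \<Sum>j\<in>M. \<Sum>r\<in>M. G j q * a q * (G j r * b r))" by (rule sum.swap)
  also have "\<dots> = (\<Sum>q\<in>M. \<Sum>r\<in>M. \<Sum>j\<in>M. G j q * a q * (G j r * b r))"
    by (rule sum.cong[OF refl], rule sum.swap)
  also have "\<dots> = (\<Sum>q\<in>M. \<Sum>r\<in>M. a q * b r * (\<Sum>j\<in>M. G j q * G j r))"
    by (simp add: sum_distrib_left mult_ac)
  also have "\<dots> = (\<Sum>q\<in>M. \<Sum>r\<in>M. if q = r then a q * b r else 0)"
    by (intro sum.cong refl) (simp add: G)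
  also have "\<dots> = (\<Sum>q\<in>M. a q * b q)" using M by simp
  finally show ?thesis .
qed

text \<open>A map intertwining the tensor powers of an orthogonal matrix has the same contractions with
  the given vectors and with their images.\<close>

lemma contraction_invariant:
  assumes I: "finite I" and g: "\<And>i j. i \<in> I \<Longrightarrow> j \<in> I \<Longrightarrow> (\<Sum>k\<in>I. g k i * g k j) = of_bool (i = j)"
    and T: "\<And>j i. j \<in> multi_indices I n \<Longrightarrow> i \<in> multi_indices I m \<Longrightarrow>
      (\<Sum>r\<in>multi_indices I m. T j r * (\<Prod>t<m. g (r ! t) (i ! t))) = (\<Sum>r\<in>multi_indices I n. T r i * (\<Prod>t<n. g (j ! t) (r ! t)))"
  shows "contraction I m n (\<lambda>p i. \<Sum>s\<in>I. g i s * x p s) T = contraction I m n x T"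
proof -
  let ?M = "multi_indices I m" and ?L = "multi_indices I n"
  define U where "U i = (\<Prod>t<m. x (Inl t) (i ! t))" for i
  define V where "V i = (\<Prod>t<n. x (Inr t) (i ! t))" for i
  define G where "G k i j = (\<Prod>t<k. g (i ! t) (j ! t))" for k and i j :: "nat list"
  have fin: "finite (multi_indices I k)" for k by (rule finite_multi_indices[OF I])
  have GU: "(\<Prod>t<m. \<Sum>s\<in>I. g (i ! t) s * x (Inl t) s) = (\<Sum>s\<in>?M. G m i s * U s)" for i
    unfolding prod_sum_multi_indices[OF I] by (simp add: G_def U_def prod.distrib)
  have GV: "(\<Prod>t<n. \<Sum>s\<in>I. g (i ! t) s * x (Inr t) s) = (\<Sum>s\<in>?L. G n i s * V s)" for i
    unfolding prod_sum_multi_indices[OF I] by (simp add: G_def V_def prod.distrib)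
  have Go: "(\<Sum>j\<in>?L. G n j q * G n j r) = of_bool (q = r)" if q: "q \<in> ?L" and r: "r \<in> ?L" for q r
  proof -
    have qr: "length q = n" "length r = n" "set q \<subseteq> I" "set r \<subseteq> I" using q r by (simp_all add: multi_indices_def)
    have "(\<Sum>j\<in>?L. G n j q * G n j r) = (\<Prod>t<n. \<Sum>y\<in>I. g y (q ! t) * g y (r ! t))"
      unfolding prod_sum_multi_indices[OF I] by (simp add: G_def prod.distrib)
    also have "\<dots> = (\<Prod>t<n. of_bool (q ! t = r ! t))"
    proof (rule prod.cong[OF refl])
      fix t assume "t \<in> {..<n}"
      then have "t < length q" "t < length r" using qr by simp_all
      then have "q ! t \<in> I" "r ! t \<in> I" using nth_mem qr(3,4) by blast+
      then show "(\<Sum>y\<in>I. g y (q ! t) * g y (r ! t)) = of_bool (q ! t = r ! t)" by (rule g)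
    qed
    also have "\<dots> = of_bool (q = r)"
    proof (cases "q = r")
      case False
      then obtain t where "t < n" "q ! t \<noteq> r ! t" using qr nth_equalityI[of q r] by auto
      then have "(\<Prod>t<n. of_bool (q ! t = r ! t) :: complex) = 0" by (intro prod_zero) auto
      then show ?thesis using False by simp
    qed simp
    finally show ?thesis .
  qed
  define Y where "Y j = (\<Sum>r\<in>?L. G n j r * V r)" for j
  have "contraction I m n (\<lambda>p i. \<Sum>s\<in>I. g i s * x p s) T = (\<Sum>i\<in>?M. \<Sum>j\<in>?L. \<Sum>s\<in>?M. T j i * G m i s * U s * Y j)"
    unfolding contraction_def GU GV Y_def[symmetric] by (simp add: sum_distrib_left sum_distrib_right mult.assoc)
  also have "\<dots> = (\<Sum>i\<in>?M. \<Sum>s\<in>?M. \<Sum>j\<in>?L. T j i * G m i s * U s * Y j)"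
    by (rule sum.cong[OF refl], rule sum.swap)
  also have "\<dots> = (\<Sum>s\<in>?M. \<Sum>i\<in>?M. \<Sum>j\<in>?L. T j i * G m i s * U s * Y j)" by (rule sum.swap)
  also have "\<dots> = (\<Sum>s\<in>?M. \<Sum>j\<in>?L. \<Sum>i\<in>?M. T j i * G m i s * U s * Y j)"
    by (rule sum.cong[OF refl], rule sum.swap)
  also have "\<dots> = (\<Sum>s\<in>?M. U s * (\<Sum>j\<in>?L. (\<Sum>i\<in>?M. T j i * G m i s) * Y j))"
    by (simp add: sum_distrib_left sum_distrib_right mult_ac)
  also have "\<dots> = (\<Sum>s\<in>?M. U s * (\<Sum>j\<in>?L. T j s * V j))"
  proof (rule sum.cong[OF refl])
    fix s assume s: "s \<in> ?M"
    have "(\<Sum>j\<in>?L. (\<Sum>i\<in>?M. T j i * G m i s) * Y j) = (\<Sum>j\<in>?L. (\<Sum>q\<in>?L. G n j q * T q s) * (\<Sum>r\<in>?L. G n j r * V r))"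
      unfolding Y_def by (rule sum.cong[OF refl]) (simp add: G_def T[OF _ s] mult.commute)
    also have "\<dots> = (\<Sum>j\<in>?L. T j s * V j)" by (rule sum_isometry[OF fin Go])
    finally show "U s * (\<Sum>j\<in>?L. (\<Sum>i\<in>?M. T j i * G m i s) * Y j) = U s * (\<Sum>j\<in>?L. T j s * V j)" by simp
  qed
  also have "\<dots> = contraction I m n x T"
    unfolding contraction_def U_def[symmetric] V_def[symmetric] by (simp add: sum_distrib_left mult_ac)
  finally show ?thesis .
qed

section \<open>The algebra of two by two matrices\<close>

text \<open>The matrix algebra is realised by operators on \<open>\<complex>\<^sup>2\<close>, which supplies the norm and completeness.\<close>

type_synonym plane_map = "(complex \<times> complex) \<Rightarrow>\<^sub>L (complex \<times> complex)"

text \<open>Multiplication of a vector of \<open>\<complex>\<^sup>2\<close> by a complex scalar.\<close>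

definition cscale :: "complex \<Rightarrow> complex \<times> complex \<Rightarrow> complex \<times> complex" where
  "cscale c v = (c * fst v, c * snd v)"

text \<open>The adjoint for the real inner product.\<close>

definition plane_adj :: "plane_map \<Rightarrow> plane_map" where
  "plane_adj T = Blinfun (adjoint (blinfun_apply T))"

text \<open>The complex linear maps among the real linear operators on the plane \<open>\<complex>\<^sup>2\<close>.  The real part of
  the complex inner product is the real one, so that adjoints agree.\<close>

definition plane_algebra :: "plane_map cstar" where
  "plane_algebra = \<lparr>carrier = {T. \<forall>c v. blinfun_apply T (cscale c v) = cscale c (blinfun_apply T v)},
     monoid.mult = (o\<^sub>L), one = id_blinfun, ring.zero = 0, add = (+),
     smult = (\<lambda>c T. Blinfun (cscale c) o\<^sub>L T), adj = plane_adj, nrm = norm\<rparr>"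

lemma bounded_linear_cscale: "bounded_linear (cscale c)"
  unfolding linear_conv_bounded_linear[symmetric]
  by (rule linearI) (auto simp: cscale_def algebra_simps)

lemma cscale_apply: "blinfun_apply (Blinfun (cscale c)) = cscale c"
  by (rule bounded_linear_Blinfun_apply[OF bounded_linear_cscale])

lemma cscale_simps: "cscale c (v + w) = cscale c v + cscale c w" "cscale c 0 = 0" "cscale 1 v = v"
  "cscale c (cscale d v) = cscale (c * d) v" "cscale (c + d) v = cscale c v + cscale d v" "cscale c (- v) = - cscale c v"
  by (simp_all add: cscale_def algebra_simps prod_eq_iff)

lemma cscale_inner: "cscale c v \<bullet> w = v \<bullet> cscale (cnj c) w"
  by (cases v; cases w) (simp add: cscale_def inner_complex_def algebra_simps)

lemma norm_cscale: "norm (cscale c v) = cmod c * norm v"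
proof -
  have "(norm (cscale c v))\<^sup>2 = (cmod c * norm v)\<^sup>2"
    by (cases v) (simp add: cscale_def norm_Pair norm_mult power_mult_distrib algebra_simps)
  then show ?thesis by (simp add: power2_eq_iff_nonneg)
qed

lemma plane_adj_inner: "blinfun_apply (plane_adj T) v \<bullet> w = v \<bullet> blinfun_apply T w"
proof -
  have l: "linear (blinfun_apply T)" by (simp add: linear_conv_bounded_linear blinfun.bounded_linear_right)
  then have "bounded_linear (adjoint (blinfun_apply T))" by (simp add: adjoint_linear flip: linear_conv_bounded_linear)
  then show ?thesis unfolding plane_adj_def using adjoint_works[OF l, of w v]
    by (simp add: bounded_linear_Blinfun_apply inner_commute)
qed

lemma inner_plane_adj: "v \<bullet> blinfun_apply (plane_adj T) w = blinfun_apply T v \<bullet> w"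
  using plane_adj_inner[of T w v] by (simp add: inner_commute)

lemma plane_map_eqI: "(\<And>v w. blinfun_apply S v \<bullet> w = blinfun_apply T v \<bullet> w) \<Longrightarrow> S = T" for S T :: plane_map
  by (rule blinfun_eqI) (metis vector_eq_rdot)

lemma plane_adj_laws: "plane_adj (plane_adj T) = T" "plane_adj (S + T) = plane_adj S + plane_adj T"
  "plane_adj (S o\<^sub>L T) = plane_adj T o\<^sub>L plane_adj S"
  by (rule plane_map_eqI, simp add: plane_adj_inner inner_plane_adj inner_add_left inner_add_right blinfun.add_left)+

lemma norm_plane_adj: "norm (plane_adj T) \<le> norm T"
proof (rule norm_blinfun_bound)
  fix v
  let ?a = "blinfun_apply (plane_adj T) v"
  have "norm ?a * norm ?a = ?a \<bullet> ?a" by (simp add: dot_square_norm power2_eq_square)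
  also have "\<dots> = v \<bullet> blinfun_apply T ?a" by (rule plane_adj_inner)
  also have "\<dots> \<le> norm v * norm (blinfun_apply T ?a)" by (rule norm_cauchy_schwarz)
  also have "\<dots> \<le> norm v * (norm T * norm ?a)" by (intro mult_left_mono norm_blinfun norm_ge_zero)
  finally have "norm ?a * norm ?a \<le> (norm T * norm v) * norm ?a" by (simp add: mult_ac)
  then show "norm ?a \<le> norm T * norm v"
    by (cases "norm ?a = 0") (auto simp del: norm_eq_zero simp: mult_le_cancel_right)
qed simp

lemma norm_plane_cstar: "norm (plane_adj T o\<^sub>L T) = (norm T)\<^sup>2"
proof (rule antisym)
  have "norm (plane_adj T o\<^sub>L T) \<le> norm (plane_adj T) * norm T" by (rule norm_blinfun_compose)
  also have "\<dots> \<le> norm T * norm T" by (intro mult_right_mono norm_plane_adj norm_ge_zero)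
  finally show "norm (plane_adj T o\<^sub>L T) \<le> (norm T)\<^sup>2" by (simp add: power2_eq_square)
  let ?s = "sqrt (norm (plane_adj T o\<^sub>L T))"
  have "norm T \<le> ?s"
  proof (rule norm_blinfun_bound)
    fix v
    have "(norm (blinfun_apply T v))\<^sup>2 = blinfun_apply (plane_adj T o\<^sub>L T) v \<bullet> v"
      by (simp add: plane_adj_inner dot_square_norm)
    also have "\<dots> \<le> norm (blinfun_apply (plane_adj T o\<^sub>L T) v) * norm v" by (rule norm_cauchy_schwarz)
    also have "\<dots> \<le> norm (plane_adj T o\<^sub>L T) * norm v * norm v" by (intro mult_right_mono norm_blinfun norm_ge_zero)
    also have "\<dots> = (?s * norm v)\<^sup>2" by (simp add: power_mult_distrib power2_eq_square)
    finally show "norm (blinfun_apply T v) \<le> ?s * norm v" by (rule power2_le_imp_le) simp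
  qed simp
  then have "(norm T)\<^sup>2 \<le> ?s\<^sup>2" by (rule power_mono) simp
  then show "(norm T)\<^sup>2 \<le> norm (plane_adj T o\<^sub>L T)" by simp
qed

lemma plane_simps: "T \<in> carrier plane_algebra \<longleftrightarrow> (\<forall>c v. blinfun_apply T (cscale c v) = cscale c (blinfun_apply T v))"
  "mult plane_algebra = (o\<^sub>L)" "\<one>\<^bsub>plane_algebra\<^esub> = id_blinfun" "\<zero>\<^bsub>plane_algebra\<^esub> = 0" "add plane_algebra = (+)"
  "smult plane_algebra = (\<lambda>c T. Blinfun (cscale c) o\<^sub>L T)" "adj plane_algebra = plane_adj" "nrm plane_algebra = norm"
  by (simp_all add: plane_algebra_def)

lemma norm_plane_smult_le: "norm (Blinfun (cscale c) o\<^sub>L T) \<le> cmod c * norm T"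
  by (rule norm_blinfun_bound) (auto simp: cscale_apply norm_cscale mult.assoc intro!: mult_left_mono norm_blinfun)

lemma cstar_algebra_plane: "cstar_algebra plane_algebra"
proof -
  note split_paired_All[simp del]
  have minus: "- T \<in> carrier plane_algebra" if "T \<in> carrier plane_algebra" for T
    using that by (simp add: plane_simps blinfun.minus_left cscale_simps)
  have "ring plane_algebra"
  proof (rule ringI)
    show "abelian_group plane_algebra"
    proof (rule abelian_groupI)
      fix T assume "T \<in> carrier plane_algebra"
      then show "\<exists>S\<in>carrier plane_algebra. S \<oplus>\<^bsub>plane_algebra\<^esub> T = \<zero>\<^bsub>plane_algebra\<^esub>"
        using minus by (intro bexI[of _ "- T"]) (simp_all add: plane_simps(4,5))
    qed (simp_all add: plane_simps blinfun.add_left blinfun.zero_left cscale_simps)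
    show "monoid plane_algebra"
      by (rule monoidI) (simp_all add: plane_simps, simp_all add: blinfun_eqI)
  qed (simp_all add: plane_simps, simp_all add: blinfun_eqI blinfun.add_left blinfun.add_right)
  then interpret ring plane_algebra .
  have minus_eq: "S \<ominus>\<^bsub>plane_algebra\<^esub> T = S - T" if "T \<in> carrier plane_algebra" for S T
  proof -
    have "\<ominus>\<^bsub>plane_algebra\<^esub> T = - T"
      by (rule minus_equality) (use that minus in \<open>simp_all add: plane_simps(4,5)\<close>)
    then show ?thesis by (simp add: a_minus_def plane_simps(5))
  qed
  show ?thesis
  proof unfold_locales
    fix T c assume T: "T \<in> carrier plane_algebra"
    show "adj plane_algebra T \<in> carrier plane_algebra"
    proof -
      have "blinfun_apply (plane_adj T) (cscale c v) = cscale c (blinfun_apply (plane_adj T) v)" for c v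
        by (rule vector_eq_rdot[THEN iffD1])
          (use T in \<open>simp add: plane_simps(1) plane_adj_inner cscale_inner\<close>)
      then show ?thesis by (simp add: plane_simps)
    qed
    show "nrm plane_algebra (c \<odot>\<^bsub>plane_algebra\<^esub> T) = cmod c * nrm plane_algebra T"
    proof (cases "c = 0")
      case True
      have "Blinfun (cscale 0) o\<^sub>L T = 0" by (rule blinfun_eqI) (simp add: cscale_apply, simp add: cscale_def zero_prod_def)
      then show ?thesis using True by (simp add: plane_simps)
    next
      case False
      have "T = Blinfun (cscale (inverse c)) o\<^sub>L (Blinfun (cscale c) o\<^sub>L T)"
        using False by (intro blinfun_eqI) (simp add: cscale_apply cscale_simps)
      then have "norm T \<le> cmod (inverse c) * norm (Blinfun (cscale c) o\<^sub>L T)" using norm_plane_smult_le by metis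
      then have "cmod c * norm T \<le> norm (Blinfun (cscale c) o\<^sub>L T)"
        using False by (simp add: norm_inverse norm_divide field_simps)
      then show ?thesis using norm_plane_smult_le[of c T] by (simp add: plane_simps)
    qed
    show "adj plane_algebra (c \<odot>\<^bsub>plane_algebra\<^esub> T) = cnj c \<odot>\<^bsub>plane_algebra\<^esub> adj plane_algebra T"
    proof -
      have "blinfun_apply T (cscale c v) = cscale c (blinfun_apply T v)" for c v using T by (simp add: plane_simps)
      then have "plane_adj (Blinfun (cscale c) o\<^sub>L T) = Blinfun (cscale (cnj c)) o\<^sub>L plane_adj T"
        by (intro plane_map_eqI) (simp add: plane_adj_inner cscale_apply cscale_inner)
      then show ?thesis by (simp add: plane_simps)
    qed
  next
    fix X assume X: "\<And>n::nat. X n \<in> carrier plane_algebra"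
      and c: "\<forall>e>0. \<exists>M. \<forall>m\<ge>M. \<forall>n\<ge>M. nrm plane_algebra (X m \<ominus>\<^bsub>plane_algebra\<^esub> X n) < e"
    have "Cauchy X" using c unfolding Cauchy_def minus_eq[OF X] by (simp add: plane_simps(8) dist_norm)
    then obtain T where T: "X \<longlonglongrightarrow> T" using convergentD[OF Cauchy_convergent] by blast
    have lim: "(\<lambda>n. blinfun_apply (X n) v) \<longlonglongrightarrow> blinfun_apply T v" for v
      by (intro blinfun.tendsto T tendsto_const)
    have Tc: "T \<in> carrier plane_algebra"
      unfolding plane_simps(1)
    proof (intro allI)
      fix c v
      have "(\<lambda>n. cscale c (blinfun_apply (X n) v)) \<longlonglongrightarrow> cscale c (blinfun_apply T v)"
        by (rule bounded_linear.tendsto[OF bounded_linear_cscale lim])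
      moreover have "blinfun_apply (X n) (cscale c v) = cscale c (blinfun_apply (X n) v)" for n
        using X[of n] by (simp add: plane_simps(1))
      ultimately have "(\<lambda>n. blinfun_apply (X n) (cscale c v)) \<longlonglongrightarrow> cscale c (blinfun_apply T v)" by simp
      then show "blinfun_apply T (cscale c v) = cscale c (blinfun_apply T v)" by (rule LIMSEQ_unique[OF lim])
    qed
    have "(\<lambda>n. norm (X n - T)) \<longlonglongrightarrow> 0" using T by (simp add: LIM_zero tendsto_norm_zero)
    then show "\<exists>T\<in>carrier plane_algebra. (\<lambda>n. nrm plane_algebra (X n \<ominus>\<^bsub>plane_algebra\<^esub> T)) \<longlonglongrightarrow> 0"
      using Tc by (intro bexI[of _ T]) (simp_all add: minus_eq plane_simps(8))
  next
    fix S T assume "S \<in> carrier plane_algebra" "T \<in> carrier plane_algebra"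
    show "adj plane_algebra (adj plane_algebra S) = S" unfolding plane_simps by (rule plane_adj_laws)
    show "adj plane_algebra (S \<oplus>\<^bsub>plane_algebra\<^esub> T) = adj plane_algebra S \<oplus>\<^bsub>plane_algebra\<^esub> adj plane_algebra T"
      unfolding plane_simps by (rule plane_adj_laws)
    show "adj plane_algebra (S \<otimes>\<^bsub>plane_algebra\<^esub> T) = adj plane_algebra T \<otimes>\<^bsub>plane_algebra\<^esub> adj plane_algebra S"
      unfolding plane_simps by (rule plane_adj_laws)
    show "nrm plane_algebra S = 0 \<longleftrightarrow> S = \<zero>\<^bsub>plane_algebra\<^esub>" unfolding plane_simps by (rule norm_eq_zero)
    show "nrm plane_algebra (S \<oplus>\<^bsub>plane_algebra\<^esub> T) \<le> nrm plane_algebra S + nrm plane_algebra T"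
      unfolding plane_simps by (rule norm_triangle_ineq)
    show "nrm plane_algebra (S \<otimes>\<^bsub>plane_algebra\<^esub> T) \<le> nrm plane_algebra S * nrm plane_algebra T"
      unfolding plane_simps by (rule norm_blinfun_compose)
    show "nrm plane_algebra (adj plane_algebra S \<otimes>\<^bsub>plane_algebra\<^esub> S) = (nrm plane_algebra S)\<^sup>2"
      unfolding plane_simps by (rule norm_plane_cstar)
  qed ((simp add: plane_simps cscale_apply cscale_simps mult.commute; fail)
      | (simp only: plane_simps, rule blinfun_eqI,
          (simp add: cscale_apply cscale_simps plane_simps blinfun.add_left blinfun.add_right; fail)))+
qed

text \<open>The self-adjoint map with matrix entries \<open>0, z, cnj z, 0\<close>.\<close>

definition antidiagonal :: "complex \<Rightarrow> plane_map" where
  "antidiagonal z = Blinfun (\<lambda>v. (z * snd v, cnj z * fst v))"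

lemma antidiagonal_apply: "blinfun_apply (antidiagonal z) v = (z * snd v, cnj z * fst v)"
proof -
  have "bounded_linear (\<lambda>v :: complex \<times> complex. (z * snd v, cnj z * fst v))"
    unfolding linear_conv_bounded_linear[symmetric] by (rule linearI) (auto simp: algebra_simps)
  then show ?thesis by (simp add: antidiagonal_def bounded_linear_Blinfun_apply)
qed

lemma antidiagonal_closed: "antidiagonal z \<in> carrier plane_algebra"
  by (simp add: plane_simps antidiagonal_apply cscale_def)

lemma antidiagonal_adj: "plane_adj (antidiagonal z) = antidiagonal z"
  by (rule plane_map_eqI, unfold plane_adj_inner antidiagonal_apply)
    (simp add: inner_prod_def inner_complex_def algebra_simps)

lemma antidiagonal_zero: "antidiagonal 0 = 0"
  by (rule blinfun_eqI) (simp add: antidiagonal_apply zero_prod_def)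

lemma antidiagonal_half_comm:
  "antidiagonal a o\<^sub>L antidiagonal b o\<^sub>L antidiagonal c = antidiagonal c o\<^sub>L antidiagonal b o\<^sub>L antidiagonal a"
  by (rule blinfun_eqI) (simp add: antidiagonal_apply)

lemma antidiagonal_square: "cmod z = 1 \<Longrightarrow> antidiagonal z o\<^sub>L antidiagonal z = id_blinfun"
  by (rule blinfun_eqI) (auto simp: antidiagonal_apply complex_norm_square[symmetric] mult.commute simp flip: mult.assoc)

lemma antidiagonal_not_comm: "antidiagonal 1 o\<^sub>L antidiagonal \<i> \<noteq> antidiagonal \<i> o\<^sub>L antidiagonal 1"
proof
  assume "antidiagonal 1 o\<^sub>L antidiagonal \<i> = antidiagonal \<i> o\<^sub>L antidiagonal 1"
  then have "blinfun_apply (antidiagonal 1 o\<^sub>L antidiagonal \<i>) (1, 0) = blinfun_apply (antidiagonal \<i> o\<^sub>L antidiagonal 1) (1, 0)" by simp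
  then show False by (simp add: antidiagonal_apply complex_eq_iff)
qed

section \<open>Non-easiness\<close>

lemma multi_indices_3: "r \<in> multi_indices I 3 \<longleftrightarrow> (\<exists>a b c. r = [a, b, c] \<and> a \<in> I \<and> b \<in> I \<and> c \<in> I)"
  by (auto simp: multi_indices_def numeral_3_eq_3 length_Suc_conv)

lemma multi_indices_Suc: "multi_indices I (Suc n) = (\<Union>a\<in>I. (#) a ` multi_indices I n)"
  by (auto simp: multi_indices_def length_Suc_conv)

lemma prod_3: "(\<Prod>t<3. f t) = f 0 * f 1 * f (2 :: nat)" for f :: "nat \<Rightarrow> complex"
  by (simp add: numeral_3_eq_3 numeral_2_eq_2)

context cstar_algebra
begin

lemma finsum_multi_indices_Suc:
  assumes I: "finite I" and f: "\<And>r. r \<in> multi_indices I (Suc n) \<Longrightarrow> f r \<in> carrier A"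
  shows "(\<Oplus>r\<in>multi_indices I (Suc n). f r) = (\<Oplus>a\<in>I. \<Oplus>r\<in>multi_indices I n. f (a # r))"
proof -
  have fc: "f (a # r) \<in> carrier A" if "a \<in> I" "r \<in> multi_indices I n" for a r
    by (rule f) (use that in \<open>simp add: multi_indices_def\<close>)
  have "(\<Oplus>r\<in>multi_indices I (Suc n). f r) = (\<Oplus>a\<in>I. \<Oplus>r\<in>(#) a ` multi_indices I n. f r)"
    unfolding multi_indices_Suc
  proof (rule add.finprod_UN_disjoint[OF I])
    show "finite ((#) a ` multi_indices I n)" for a using finite_multi_indices[OF I] by simp
    show "pairwise (\<lambda>a b. disjnt ((#) a ` multi_indices I n) ((#) b ` multi_indices I n)) I"
      by (auto simp: pairwise_def disjnt_def)
    show "f r \<in> carrier A" if "a \<in> I" "r \<in> (#) a ` multi_indices I n" for a r using that fc by blast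
  qed
  also have "\<dots> = (\<Oplus>a\<in>I. \<Oplus>r\<in>multi_indices I n. f (a # r))"
  proof (rule finsum_eqI)
    fix a assume a: "a \<in> I"
    show "(\<Oplus>r\<in>(#) a ` multi_indices I n. f r) = (\<Oplus>r\<in>multi_indices I n. f (a # r))"
      by (rule add.finprod_reindex) (use fc[OF a] in \<open>auto simp: inj_on_def\<close>)
    show "(\<Oplus>r\<in>multi_indices I n. f (a # r)) \<in> carrier A" by (rule finsum_mem) (rule fc[OF a])
  qed
  finally show ?thesis .
qed

lemma finsum_multi_indices_3:
  assumes I: "finite I" and x: "\<And>a. x a \<in> carrier A" and y: "\<And>a. y a \<in> carrier A" and z: "\<And>a. z a \<in> carrier A"
    and f: "\<And>a b c. a \<in> I \<Longrightarrow> b \<in> I \<Longrightarrow> c \<in> I \<Longrightarrow> f [a, b, c] = x a \<otimes> (y b \<otimes> z c)"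
  shows "(\<Oplus>r\<in>multi_indices I 3. f r) = (\<Oplus>a\<in>I. x a) \<otimes> ((\<Oplus>a\<in>I. y a) \<otimes> (\<Oplus>a\<in>I. z a))"
proof -
  have m0: "multi_indices I 0 = {[]}" by (auto simp: multi_indices_def)
  have e: "(\<Oplus>r\<in>multi_indices I 0. g r) = g []" if "g [] \<in> carrier A" for g
    unfolding m0 using that by (simp add: finsum_insert)
  have fc: "f [a, b, c] \<in> carrier A" if "a \<in> I" "b \<in> I" "c \<in> I" for a b c
    unfolding f[OF that] by (intro m_closed x y z)
  have "(\<Oplus>r\<in>multi_indices I 3. f r) = (\<Oplus>a\<in>I. \<Oplus>r\<in>multi_indices I (Suc (Suc 0)). f (a # r))"
    unfolding numeral_3_eq_3
    by (rule finsum_multi_indices_Suc[OF I]) (use fc in \<open>auto simp: multi_indices_3[unfolded numeral_3_eq_3]\<close>)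
  also have "\<dots> = (\<Oplus>a\<in>I. x a \<otimes> ((\<Oplus>a\<in>I. y a) \<otimes> (\<Oplus>a\<in>I. z a)))"
  proof (rule finsum_eqI)
    fix a assume a: "a \<in> I"
    have "(\<Oplus>r\<in>multi_indices I (Suc (Suc 0)). f (a # r)) = (\<Oplus>b\<in>I. \<Oplus>r\<in>multi_indices I (Suc 0). f (a # b # r))"
      by (rule finsum_multi_indices_Suc[OF I]) (use fc[OF a] in \<open>auto simp: multi_indices_def length_Suc_conv\<close>)
    also have "\<dots> = (\<Oplus>b\<in>I. x a \<otimes> (y b \<otimes> (\<Oplus>c\<in>I. z c)))"
    proof (rule finsum_eqI)
      fix b assume b: "b \<in> I"
      have "(\<Oplus>r\<in>multi_indices I (Suc 0). f (a # b # r)) = (\<Oplus>c\<in>I. \<Oplus>r\<in>multi_indices I 0. f (a # b # c # r))"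
        by (rule finsum_multi_indices_Suc[OF I]) (use fc[OF a b] in \<open>auto simp: multi_indices_def length_Suc_conv\<close>)
      also have "\<dots> = (\<Oplus>c\<in>I. x a \<otimes> (y b \<otimes> z c))"
        by (rule finsum_eqI) (simp_all add: e fc[OF a b] f[OF a b] x y z)
      also have "\<dots> = x a \<otimes> (\<Oplus>c\<in>I. y b \<otimes> z c)"
        by (rule finsum_rdistr[OF I, symmetric]) (simp_all add: x y z)
      also have "(\<Oplus>c\<in>I. y b \<otimes> z c) = y b \<otimes> (\<Oplus>c\<in>I. z c)"
        by (rule finsum_rdistr[OF I, symmetric]) (simp_all add: y z)
      finally show "(\<Oplus>r\<in>multi_indices I (Suc 0). f (a # b # r)) = x a \<otimes> (y b \<otimes> (\<Oplus>c\<in>I. z c))" .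
    qed (simp add: x y z finsum_mem)
    also have "\<dots> = x a \<otimes> (\<Oplus>b\<in>I. y b \<otimes> (\<Oplus>c\<in>I. z c))"
      by (rule finsum_rdistr[OF I, symmetric]) (simp_all add: x y z finsum_mem)
    also have "(\<Oplus>b\<in>I. y b \<otimes> (\<Oplus>c\<in>I. z c)) = (\<Oplus>b\<in>I. y b) \<otimes> (\<Oplus>c\<in>I. z c)"
      by (rule finsum_ldistr[OF I, symmetric]) (simp_all add: y z finsum_mem)
    finally show "(\<Oplus>r\<in>multi_indices I (Suc (Suc 0)). f (a # r)) = x a \<otimes> ((\<Oplus>b\<in>I. y b) \<otimes> (\<Oplus>c\<in>I. z c))" .
  qed (simp add: x y z finsum_mem)
  also have "\<dots> = (\<Oplus>a\<in>I. x a) \<otimes> ((\<Oplus>a\<in>I. y a) \<otimes> (\<Oplus>a\<in>I. z a))"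
    by (rule finsum_ldistr[OF I, symmetric]) (simp_all add: x y z finsum_mem)
  finally show ?thesis .
qed

lemma smult_products:
  assumes "x \<in> carrier A" "y \<in> carrier A" "z \<in> carrier A"
  shows "(a \<odot> x) \<otimes> (b \<odot> y) = (a * b) \<odot> (x \<otimes> y)"
    "(a \<odot> x) \<otimes> ((b \<odot> y) \<otimes> (c \<odot> z)) = (a * b * c) \<odot> (x \<otimes> (y \<otimes> z))"
    "(a \<odot> x) \<otimes> (b \<odot> y) \<otimes> (c \<odot> z) = (a * b * c) \<odot> (x \<otimes> y \<otimes> z)"
  using assms by (simp_all add: smult_mult_left smult_mult_right smult_closed mult_ac flip: smult_smult)

lemma smat_smult: "x \<in> carrier A \<Longrightarrow> smat A I G i j \<otimes> x = (if i \<in> I \<and> j \<in> I then complex_of_real (G i j) else 0) \<odot> x"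
  "x \<in> carrier A \<Longrightarrow> x \<otimes> smat A I G i j = (if i \<in> I \<and> j \<in> I then complex_of_real (G i j) else 0) \<odot> x"
  by (simp_all add: smat_def smult_mult_left smult_mult_right smult_zero_left)

lemma half_comm_smat:
  assumes I: "finite I" and a: "a \<in> cmat A I" and h: "half_comm A a"
  shows "half_comm A (mmul A I (smat A I G) a)" "half_comm A (mmul A I a (smat A I G))"
proof -
  note c = cmatD[OF a]
  have h': "(s \<odot> a i j) \<otimes> (t \<odot> a k l) \<otimes> (r \<odot> a m n) = (r \<odot> a m n) \<otimes> (t \<odot> a k l) \<otimes> (s \<odot> a i j)" for i j k l m n s t r
  proof -
    have "a i j \<otimes> a k l \<otimes> a m n = a m n \<otimes> a k l \<otimes> a i j" using h unfolding half_comm_def by blast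
    then show ?thesis unfolding smult_products(3)[OF c c c] by (simp add: mult_ac)
  qed
  show "half_comm A (mmul A I (smat A I G) a)"
    unfolding half_comm_def mmul_def smat_smult(1)[OF c]
    by (intro allI, rule half_comm_sums[OF I I I]) (rule smult_closed[OF c] h')+
  show "half_comm A (mmul A I a (smat A I G))"
    unfolding half_comm_def mmul_def smat_smult(2)[OF c]
    by (intro allI, rule half_comm_sums[OF I I I]) (rule smult_closed[OF c] h')+
qed

lemma comm_sums:
  assumes I: "finite I" and L: "finite L" and f: "\<And>i. f i \<in> carrier A" and g: "\<And>i. g i \<in> carrier A"
    and fg: "\<And>i j. f i \<otimes> g j = g j \<otimes> f i"
  shows "(\<Oplus>i\<in>I. f i) \<otimes> (\<Oplus>j\<in>L. g j) = (\<Oplus>j\<in>L. g j) \<otimes> (\<Oplus>i\<in>I. f i)"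
proof -
  have 1: "f i \<otimes> (\<Oplus>j\<in>L. g j) = (\<Oplus>j\<in>L. g j) \<otimes> f i" for i
  proof -
    have "f i \<otimes> (\<Oplus>j\<in>L. g j) = (\<Oplus>j\<in>L. f i \<otimes> g j)" by (rule finsum_rdistr[OF L]) (simp_all add: f g)
    also have "\<dots> = (\<Oplus>j\<in>L. g j \<otimes> f i)" unfolding fg ..
    also have "\<dots> = (\<Oplus>j\<in>L. g j) \<otimes> f i" by (rule finsum_ldistr[OF L, symmetric]) (simp_all add: f g)
    finally show ?thesis .
  qed
  have "(\<Oplus>i\<in>I. f i) \<otimes> (\<Oplus>j\<in>L. g j) = (\<Oplus>i\<in>I. f i \<otimes> (\<Oplus>j\<in>L. g j))"
    by (rule finsum_ldistr[OF I]) (simp_all add: f g finsum_mem)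
  also have "\<dots> = (\<Oplus>i\<in>I. (\<Oplus>j\<in>L. g j) \<otimes> f i)" unfolding 1 ..
  also have "\<dots> = (\<Oplus>j\<in>L. g j) \<otimes> (\<Oplus>i\<in>I. f i)"
    by (rule finsum_rdistr[OF I, symmetric]) (simp_all add: f g finsum_mem)
  finally show ?thesis .
qed

lemma comm_smat:
  assumes I: "finite I" and a: "a \<in> cmat A I" and h: "comm A a"
  shows "comm A (mmul A I (smat A I G) a)" "comm A (mmul A I a (smat A I G))"
proof -
  note c = cmatD[OF a]
  have h': "(s \<odot> a i j) \<otimes> (t \<odot> a k l) = (t \<odot> a k l) \<otimes> (s \<odot> a i j)" for i j k l s t
  proof -
    have "a i j \<otimes> a k l = a k l \<otimes> a i j" using h unfolding comm_def by blast
    then show ?thesis unfolding smult_products(1)[OF c c c] by (simp add: mult_ac)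
  qed
  show "comm A (mmul A I (smat A I G) a)"
    unfolding comm_def mmul_def smat_smult(1)[OF c]
    by (intro allI, rule comm_sums[OF I I]) (rule smult_closed[OF c] h')+
  show "comm A (mmul A I a (smat A I G))"
    unfolding comm_def mmul_def smat_smult(2)[OF c]
    by (intro allI, rule comm_sums[OF I I]) (rule smult_closed[OF c] h')+
qed

end

text \<open>The morphisms between third tensor powers. The tensor power ends with a factor \<open>\<one>\<close>.\<close>

lemma tensor_power_3:
  "tensor_power G [White, White, White] [a, b, c] [i, j, k] =
     fund G a i \<otimes>\<^bsub>alg G\<^esub> (fund G b j \<otimes>\<^bsub>alg G\<^esub> (fund G c k \<otimes>\<^bsub>alg G\<^esub> \<one>\<^bsub>alg G\<^esub>))"
  by (simp add: coloured_fund_def)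

lemma length_colours_3: "length [White, White, White] = 3"
  by simp

context bistochastic_basis
begin

context
  notes One_nat_def [simp del]
begin

abbreviation "CO \<equiv> alg (O_star J)"
abbreviation "wO \<equiv> fund (O_star J)"
abbreviation "uB \<equiv> lift CO wO"
abbreviation "W3 \<equiv> [White, White, White]"

abbreviation "MI3 \<equiv> multi_indices I0 3"
abbreviation "tp3 \<equiv> tensor_power (B_circ N F) W3"

lemma tensor_power_B_circ:
  "tp3 [a, b, c] [i, j, k] = uB a i \<otimes>\<^bsub>CO\<^esub> (uB b j \<otimes>\<^bsub>CO\<^esub> uB c k)"
proof -
  interpret cstar_algebra CO by (rule algebras(2))
  note u = cmatD[OF orthD(1)[OF lift_orth(1)[OF algebras(2) funds(2)]]]
  show ?thesis unfolding tensor_power_3 B_circ_simps r_one[OF u] ..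
qed

lemma Hom_3D:
  assumes "T \<in> Hom (B_circ N F) W3 W3" "j \<in> MI3" "i \<in> MI3"
  shows "(\<Oplus>\<^bsub>CO\<^esub>r\<in>MI3. T j r \<odot>\<^bsub>CO\<^esub> tp3 r i)
       = (\<Oplus>\<^bsub>CO\<^esub>r\<in>MI3. T r i \<odot>\<^bsub>CO\<^esub> tp3 j r)"
  using assms unfolding Hom_def B_circ_simps length_colours_3 by blast

text \<open>The projection onto the orthogonal complement of \<open>\<xi>\<close>, expressed through the columns of \<open>F\<close>.\<close>

definition compl_proj :: "nat \<Rightarrow> nat \<Rightarrow> real" where
  "compl_proj i j = (\<Sum>k\<in>J. F i k * F j k)"

lemma compl_proj_mult:
  "mmul CO I0 (smat CO I0 compl_proj) uB = rot CO N F wO" "mmul CO I0 uB (smat CO I0 compl_proj) = rot CO N F wO"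
proof -
  interpret rotated_algebra CO N F by (rule rotated[OF algebras(2)])
  note wc = orthD(1)[OF funds(2)]
  note b = blk_cmat[OF N wc]
  define E where "E i j = (of_bool (i \<in> J \<and> i = j) :: real)" for i j
  have E: "rot CO N F (smat CO I0 E) = smat CO I0 compl_proj"
  proof (rule ext, rule ext)
    fix i j
    have s: "(\<Sum>l\<in>I0. E k l * F j l) = (if k \<in> J then F j k else 0)" if "k \<in> I0" for k
      using that by (simp add: E_def of_bool_def if_distrib[of "\<lambda>x. x * _"] cong: if_cong)
    have "(\<Sum>k\<in>I0. F i k * (\<Sum>l\<in>I0. E k l * F j l)) = (\<Sum>k\<in>I0. if k \<in> J then F i k * F j k else 0)"
      by (rule sum.cong[OF refl]) (simp add: s del: One_nat_def)
    also have "\<dots> = compl_proj i j"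
      unfolding compl_proj_def by (rule sum.mono_neutral_cong_right) auto
    finally show "rot CO N F (smat CO I0 E) i j = smat CO I0 compl_proj i j"
      unfolding rot_def smat_smat by (simp add: smat_def)
  qed
  have left: "mmul CO I0 (smat CO I0 E) (blk CO v) = v" if v: "v \<in> cmat CO J" for v
  proof (rule ext, rule ext)
    fix i j
    note bv = blk_cmat[OF N v]
    show "mmul CO I0 (smat CO I0 E) (blk CO v) i j = v i j"
    proof (cases "i \<in> I0")
      case True
      have "mmul CO I0 (smat CO I0 E) (blk CO v) i j = (\<Oplus>\<^bsub>CO\<^esub>k\<in>I0. if i = k then v i j else \<zero>\<^bsub>CO\<^esub>)"
        unfolding smat_left[OF bv True]
      proof (rule finsum_eqI)
        fix k assume "k \<in> I0"
        have "v i j = \<zero>\<^bsub>CO\<^esub>" if "i \<notin> J" using cmat_outside[OF v] that by blast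
        then show "complex_of_real (E i k) \<odot>\<^bsub>CO\<^esub> blk CO v k j = (if i = k then v i j else \<zero>\<^bsub>CO\<^esub>)"
          using cmatD[OF v] cmatD[OF bv] blk_inside[of i CO v j] unfolding E_def
          by (cases "i \<in> J"; cases "i = k") (simp_all add: smult_one smult_zero_left)
        show "(if i = k then v i j else \<zero>\<^bsub>CO\<^esub>) \<in> carrier CO" using cmatD[OF v] by simp
      qed
      then show ?thesis using finsum_single[OF _ True cmatD[OF v]] by simp
    next
      case False
      then have "v i j = \<zero>\<^bsub>CO\<^esub>" by (intro cmat_outside[OF v]) auto
      then show ?thesis using cmat_outside[OF mmul_cmat[OF smat_cmat bv], of i j] False by simp
    qed
  qed
  have right: "mmul CO I0 (blk CO wO) (smat CO I0 E) = wO"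
  proof -
    have "tpose (smat CO I0 E) = smat CO I0 E"
      unfolding smat_tpose by (intro ext) (auto simp: smat_def E_def)
    then have "mmul CO I0 (blk CO wO) (smat CO I0 E) = tpose (mmul CO I0 (smat CO I0 E) (tpose (blk CO wO)))"
      using smat_commute_tpose(1)[OF cmat_tpose[OF b], of E] by simp
    then show ?thesis unfolding blk_tpose left[OF cmat_tpose[OF wc]] .
  qed
  show "mmul CO I0 (smat CO I0 compl_proj) uB = rot CO N F wO"
    unfolding lift_def E[symmetric] rot_mmul(1)[OF smat_cmat b] left[OF wc] ..
  show "mmul CO I0 uB (smat CO I0 compl_proj) = rot CO N F wO"
    unfolding lift_def E[symmetric] rot_mmul(1)[OF b smat_cmat] right ..
qed

text \<open>Half-commutation on the orthogonal complement of \<open>\<xi>\<close>: the flip of the outer legs of the third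
  tensor power, cut down by the projection, is a morphism.\<close>

definition flip_map :: tensor_map where
  "flip_map j i = (if j \<in> MI3 \<and> i \<in> MI3 then
     complex_of_real (compl_proj (j ! 0) (i ! 2)) * complex_of_real (compl_proj (j ! 1) (i ! 1)) *
     complex_of_real (compl_proj (j ! 2) (i ! 0)) else 0)"

lemma flip_map_Hom: "flip_map \<in> Hom (B_circ N F) W3 W3"
proof -
  interpret rotated_algebra CO N F by (rule rotated[OF algebras(2)])
  note uc = orthD(1)[OF lift_orth(1)[OF algebras(2) funds(2)]]
  note u = cmatD[OF uc]
  let ?p = "\<lambda>i j. complex_of_real (compl_proj i j)"
  let ?z = "rot CO N F wO"
  have wc: "wO \<in> cmat CO I0" using orthD(1)[OF funds(2)] by (auto simp: cmat_def)
  note zc = cmatD[OF rot_cmat[OF wc, of F]]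
  have zl: "(\<Oplus>\<^bsub>CO\<^esub>a\<in>I0. ?p i a \<odot>\<^bsub>CO\<^esub> uB a j) = ?z i j" if "i \<in> I0" for i j
    using smat_left[OF uc that, of compl_proj j] unfolding compl_proj_mult(1) by simp
  have zr: "(\<Oplus>\<^bsub>CO\<^esub>a\<in>I0. ?p a j \<odot>\<^bsub>CO\<^esub> uB i a) = ?z i j" if "j \<in> I0" for i j
    using smat_right[OF uc that, of compl_proj i] unfolding compl_proj_mult(2) by simp
  have zh: "half_comm CO ?z"
    unfolding rot_def by (intro half_comm_smat mmul_cmat wc smat_cmat funds(3)) simp_all
  have "(\<Oplus>\<^bsub>CO\<^esub>r\<in>MI3. flip_map j r \<odot>\<^bsub>CO\<^esub> tp3 r i)
      = (\<Oplus>\<^bsub>CO\<^esub>r\<in>MI3. flip_map r i \<odot>\<^bsub>CO\<^esub> tp3 j r)"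
    if j: "j \<in> MI3" and i: "i \<in> MI3" for i j
  proof -
    obtain j1 j2 j3 where j': "j = [j1, j2, j3]" "j1 \<in> I0" "j2 \<in> I0" "j3 \<in> I0" using j unfolding multi_indices_3 by blast
    obtain i1 i2 i3 where i': "i = [i1, i2, i3]" "i1 \<in> I0" "i2 \<in> I0" "i3 \<in> I0" using i unfolding multi_indices_3 by blast
    have fm: "flip_map [a, b, c] [a', b', c'] = ?p a c' * ?p b b' * ?p c a'"
      if "a \<in> I0" "b \<in> I0" "c \<in> I0" "a' \<in> I0" "b' \<in> I0" "c' \<in> I0" for a b c a' b' c'
      using that unfolding flip_map_def multi_indices_3 by simp
    have "(\<Oplus>\<^bsub>CO\<^esub>r\<in>MI3. flip_map j r \<odot>\<^bsub>CO\<^esub> tp3 r i)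
        = (\<Oplus>\<^bsub>CO\<^esub>a\<in>I0. ?p j3 a \<odot>\<^bsub>CO\<^esub> uB a i1) \<otimes>\<^bsub>CO\<^esub> ((\<Oplus>\<^bsub>CO\<^esub>a\<in>I0. ?p j2 a \<odot>\<^bsub>CO\<^esub> uB a i2) \<otimes>\<^bsub>CO\<^esub> (\<Oplus>\<^bsub>CO\<^esub>a\<in>I0. ?p j1 a \<odot>\<^bsub>CO\<^esub> uB a i3))"
      unfolding j'(1) i'(1)
    proof (rule finsum_multi_indices_3)
      fix a b c assume abc: "a \<in> I0" "b \<in> I0" "c \<in> I0"
      show "flip_map [j1, j2, j3] [a, b, c] \<odot>\<^bsub>CO\<^esub> tp3 [a, b, c] [i1, i2, i3]
          = (?p j3 a \<odot>\<^bsub>CO\<^esub> uB a i1) \<otimes>\<^bsub>CO\<^esub> ((?p j2 b \<odot>\<^bsub>CO\<^esub> uB b i2) \<otimes>\<^bsub>CO\<^esub> (?p j1 c \<odot>\<^bsub>CO\<^esub> uB c i3))"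
        unfolding tensor_power_B_circ smult_products(2)[OF u u u] fm[OF j'(2-4) abc] by (simp add: mult_ac)
    qed (rule finite_atLeastLessThan smult_closed[OF u])+
    also have "\<dots> = ?z j3 i1 \<otimes>\<^bsub>CO\<^esub> (?z j2 i2 \<otimes>\<^bsub>CO\<^esub> ?z j1 i3)" using j' by (simp only: zl)
    also have "\<dots> = ?z j3 i1 \<otimes>\<^bsub>CO\<^esub> ?z j2 i2 \<otimes>\<^bsub>CO\<^esub> ?z j1 i3" by (rule m_assoc[symmetric]) (rule zc)+
    also have "\<dots> = ?z j1 i3 \<otimes>\<^bsub>CO\<^esub> ?z j2 i2 \<otimes>\<^bsub>CO\<^esub> ?z j3 i1" using zh unfolding half_comm_def by blast
    also have "\<dots> = ?z j1 i3 \<otimes>\<^bsub>CO\<^esub> (?z j2 i2 \<otimes>\<^bsub>CO\<^esub> ?z j3 i1)" by (rule m_assoc) (rule zc)+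
    also have "\<dots> = (\<Oplus>\<^bsub>CO\<^esub>a\<in>I0. ?p a i3 \<odot>\<^bsub>CO\<^esub> uB j1 a) \<otimes>\<^bsub>CO\<^esub> ((\<Oplus>\<^bsub>CO\<^esub>a\<in>I0. ?p a i2 \<odot>\<^bsub>CO\<^esub> uB j2 a) \<otimes>\<^bsub>CO\<^esub> (\<Oplus>\<^bsub>CO\<^esub>a\<in>I0. ?p a i1 \<odot>\<^bsub>CO\<^esub> uB j3 a))"
      using i' by (simp only: zr)
    also have "\<dots> = (\<Oplus>\<^bsub>CO\<^esub>r\<in>MI3. flip_map r i \<odot>\<^bsub>CO\<^esub> tp3 j r)"
      unfolding j'(1) i'(1)
    proof (rule finsum_multi_indices_3[symmetric])
      fix a b c assume abc: "a \<in> I0" "b \<in> I0" "c \<in> I0"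
      show "flip_map [a, b, c] [i1, i2, i3] \<odot>\<^bsub>CO\<^esub> tp3 [j1, j2, j3] [a, b, c]
          = (?p a i3 \<odot>\<^bsub>CO\<^esub> uB j1 a) \<otimes>\<^bsub>CO\<^esub> ((?p b i2 \<odot>\<^bsub>CO\<^esub> uB j2 b) \<otimes>\<^bsub>CO\<^esub> (?p c i1 \<odot>\<^bsub>CO\<^esub> uB j3 c))"
        unfolding tensor_power_B_circ smult_products(2)[OF u u u] fm[OF abc i'(2-4)] ..
    qed (rule finite_atLeastLessThan smult_closed[OF u])+
    finally show ?thesis .
  qed
  moreover have "flip_map j i = 0" if "j \<notin> MI3 \<or> i \<notin> MI3" for i j
    unfolding flip_map_def using that by (simp only: if_False de_Morgan_conj[symmetric])
  ultimately show ?thesis unfolding Hom_def B_circ_simps length_colours_3 by blast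
qed

lemma point_character:
  assumes g: "g \<in> bistochastic_matrices I0"
  shows "\<exists>f\<in>cstar_hom CO complex_cstar. \<forall>i j. f (uB i j) = complex_of_real (g i j)"
proof -
  interpret rotated_algebra complex_cstar N F by (rule rotated[OF cstar_algebra_complex])
  note wc = cstar_algebra.orthD(1)[OF algebras(2) funds(2)]
  show ?thesis
  proof (rule unrot_bistochastic[OF point_orth(1)[OF g]])
    show "(\<Oplus>\<^bsub>complex_cstar\<^esub>j\<in>I0. complex_of_real (g i j)) = \<one>\<^bsub>complex_cstar\<^esub>" if "i \<in> I0" for i
      using point_orth(2)[OF g] that unfolding row_sums_one_def by blast
    fix v assume v: "orth complex_cstar J v" "rot complex_cstar N F (blk complex_cstar v) = (\<lambda>i j. complex_of_real (g i j))"
    have "half_comm complex_cstar v" by (simp add: half_comm_def complex_cstar_def)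
    then obtain f where f: "f \<in> cstar_hom CO complex_cstar" "\<And>i j. f (wO i j) = v i j"
      using O_star_hom[OF cstar_algebra_complex v(1)] by blast
    have "f (uB i j) = complex_of_real (g i j)" for i j
      unfolding lift_hom[OF f(1) algebras(2) cstar_algebra_complex wc] f(2) unfolding lift_def v(2) ..
    then show ?thesis using f(1) by blast
  qed
qed

lemma Hom_contraction_invariant:
  assumes T: "T \<in> Hom (B_circ N F) W3 W3" and g: "g \<in> bistochastic_matrices I0"
  shows "contraction I0 3 3 (\<lambda>p i. \<Sum>s\<in>I0. complex_of_real (g i s) * x p s) T = contraction I0 3 3 x T"
proof (rule contraction_invariant)
  show "finite I0" by simp
  show "(\<Sum>k\<in>I0. complex_of_real (g k i) * complex_of_real (g k j)) = of_bool (i = j)" if "i \<in> I0" "j \<in> I0" for i j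
  proof -
    have "(\<Sum>k\<in>I0. g k i * g k j) = of_bool (i = j)"
      using g that unfolding bistochastic_matrices_def orthogonal_matrices_def by blast
    then have "complex_of_real (\<Sum>k\<in>I0. g k i * g k j) = of_bool (i = j)" by simp
    then show ?thesis by simp
  qed
  fix j i assume j: "j \<in> MI3" and i: "i \<in> MI3"
  interpret cstar_algebra CO by (rule algebras(2))
  note u = cmatD[OF orthD(1)[OF lift_orth(1)[OF algebras(2) funds(2)]]]
  obtain f where f: "f \<in> cstar_hom CO complex_cstar" and fu: "\<And>i j. f (uB i j) = complex_of_real (g i j)"
    using point_character[OF g] by blast
  have tp: "tp3 r s \<in> carrier CO \<and>
      f (tp3 r s) = (\<Prod>t<3. complex_of_real (g (r ! t) (s ! t)))"
    if r: "r \<in> MI3" and s: "s \<in> MI3" for r s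
  proof -
    obtain a b c where abc: "r = [a, b, c]" "a \<in> I0" using r unfolding multi_indices_3 by blast
    obtain k l m where klm: "s = [k, l, m]" using s unfolding multi_indices_3 by blast
    show ?thesis
      unfolding prod_3 unfolding abc(1) klm tensor_power_B_circ cstar_homD(3)[OF f u m_closed[OF u u]] cstar_homD(3)[OF f u u] fu
      using m_closed[OF u m_closed[OF u u]] by (simp add: complex_cstar_def)
  qed
  have ev: "f (\<Oplus>\<^bsub>CO\<^esub>r\<in>MI3. c r \<odot>\<^bsub>CO\<^esub> h r) = (\<Sum>r\<in>MI3. c r * f (h r))"
    if h: "\<And>r. r \<in> MI3 \<Longrightarrow> h r \<in> carrier CO" for c h
  proof -
    have "f (\<Oplus>\<^bsub>CO\<^esub>r\<in>MI3. c r \<odot>\<^bsub>CO\<^esub> h r) = (\<Oplus>\<^bsub>complex_cstar\<^esub>r\<in>MI3. f (c r \<odot>\<^bsub>CO\<^esub> h r))"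
      by (rule cstar_hom_finsum[OF f algebras(2) cstar_algebra_complex]) (rule smult_closed[OF h])
    also have "\<dots> = (\<Sum>r\<in>MI3. c r * f (h r))"
      unfolding complex_finsum by (rule sum.cong[OF refl]) (simp add: cstar_homD(5)[OF f h], simp add: complex_cstar_def)
    finally show ?thesis .
  qed
  have "(\<Sum>r\<in>MI3. T j r * f (tp3 r i))
      = (\<Sum>r\<in>MI3. T r i * f (tp3 j r))"
    using arg_cong[OF Hom_3D[OF T j i], of f] ev[of "\<lambda>r. tp3 r i"] ev[of "\<lambda>r. tp3 j r"]
      tp[OF _ i] tp[OF j] by simp
  then show "(\<Sum>r\<in>MI3. T j r * (\<Prod>t<3. complex_of_real (g (r ! t) (i ! t))))
      = (\<Sum>r\<in>MI3. T r i * (\<Prod>t<3. complex_of_real (g (j ! t) (r ! t))))"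
    by (simp only: tp[OF _ i] tp[OF j] cong: sum.cong)
qed

end

end

text \<open>The reflection in the vector \<open>(1, 1, -1, -1, 0, \<dots>)\<close>.  It is bistochastic since this vector is orthogonal
  to \<open>\<xi>\<close>; the entries of its first column are \<open>\<plusminus>1/2\<close> or \<open>0\<close>, so that their power sums of order at least
  \<open>3\<close> differ from \<open>1\<close>.\<close>

definition refl_vec :: "nat \<Rightarrow> real" where
  "refl_vec i = (if i = 0 \<or> i = 1 then 1 else if i = 2 \<or> i = 3 then - 1 else 0)"

definition reflection :: "nat \<Rightarrow> nat \<Rightarrow> nat \<Rightarrow> real" where
  "reflection N i j = (if i < N \<and> j < N then of_bool (i = j) - refl_vec i * refl_vec j / 2 else 0)"

lemma sum_refl_vec:
  assumes "4 \<le> N" shows "(\<Sum>k\<in>{0..<N}. refl_vec k * f k) = f 0 + f 1 - f 2 - f 3"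
proof -
  have "(\<Sum>k\<in>{0..<N}. refl_vec k * f k) = (\<Sum>k\<in>{0, 1, 2, 3}. refl_vec k * f k)"
    by (rule sum.mono_neutral_right) (use assms in \<open>auto simp: refl_vec_def\<close>)
  also have "\<dots> = f 0 + f 1 - f 2 - f 3" by (simp add: refl_vec_def)
  finally show ?thesis .
qed

lemma reflection_bistochastic:
  assumes N: "4 \<le> N" shows "reflection N \<in> bistochastic_matrices {0..<N}"
proof -
  have sym: "reflection N i j = reflection N j i" for i j by (auto simp: reflection_def)
  have s: "(\<Sum>k\<in>{0..<N}. reflection N i k * f k) = f i - refl_vec i / 2 * (f 0 + f 1 - f 2 - f 3)" if i: "i \<in> {0..<N}" for i f
  proof -
    have "(\<Sum>k\<in>{0..<N}. reflection N i k * f k) = (\<Sum>k\<in>{0..<N}. (if i = k then f k else 0) - refl_vec i / 2 * (refl_vec k * f k))"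
      by (rule sum.cong[OF refl]) (use i in \<open>auto simp: reflection_def algebra_simps\<close>)
    also have "\<dots> = f i - refl_vec i / 2 * (f 0 + f 1 - f 2 - f 3)"
      unfolding sum_subtractf sum_distrib_left[symmetric] sum_refl_vec[OF N] using i by simp
    finally show ?thesis .
  qed
  have row: "(\<Sum>k\<in>{0..<N}. reflection N i k) = 1" if "i \<in> {0..<N}" for i
    using s[OF that, of "\<lambda>_. 1"] by simp
  have orth: "(\<Sum>k\<in>{0..<N}. reflection N i k * reflection N j k) = of_bool (i = j)" if i: "i \<in> {0..<N}" and j: "j \<in> {0..<N}" for i j
  proof -
    have "reflection N j 0 + reflection N j 1 - reflection N j 2 - reflection N j 3 = - refl_vec j"
      using j N by (auto simp: reflection_def refl_vec_def)
    then have "(\<Sum>k\<in>{0..<N}. reflection N i k * reflection N j k) = reflection N j i + refl_vec i * refl_vec j / 2"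
      unfolding s[OF i] by simp
    also have "\<dots> = of_bool (i = j)" using i j by (auto simp: reflection_def)
    finally show ?thesis .
  qed
  have "(\<Sum>k\<in>{0..<N}. reflection N k i * reflection N k j) = of_bool (i = j)" if "i \<in> {0..<N}" "j \<in> {0..<N}" for i j
    unfolding sym[of _ i] sym[of _ j] by (rule orth[OF that])
  moreover have "(\<Sum>i\<in>{0..<N}. reflection N i j) = 1" if "j \<in> {0..<N}" for j unfolding sym[of _ j] by (rule row[OF that])
  moreover have "reflection N i j = 0" if "i \<notin> {0..<N} \<or> j \<notin> {0..<N}" for i j using that by (auto simp: reflection_def)
  ultimately show ?thesis unfolding bistochastic_matrices_def orthogonal_matrices_def using row orth by blast
qed

lemma reflection_column_powers:
  assumes N: "4 \<le> N" and m: "3 \<le> m" shows "(\<Sum>y\<in>{0..<N}. complex_of_real (reflection N y 0) ^ m) \<noteq> 1"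
proof
  assume *: "(\<Sum>y\<in>{0..<N}. complex_of_real (reflection N y 0) ^ m) = 1"
  have "(\<Sum>y\<in>{0..<N}. complex_of_real (reflection N y 0) ^ m) = (\<Sum>y\<in>{0, 1, 2, 3}. complex_of_real (reflection N y 0) ^ m)"
    by (rule sum.mono_neutral_right) (use N m in \<open>auto simp: reflection_def refl_vec_def\<close>)
  then have "1 = norm (\<Sum>y\<in>{0, 1, 2, 3}. complex_of_real (reflection N y 0) ^ m)" using * by simp
  also have "\<dots> \<le> (\<Sum>y\<in>{0, 1, 2, 3}. norm (complex_of_real (reflection N y 0) ^ m))" by (rule norm_sum)
  also have "\<dots> = (\<Sum>y\<in>{0, 1, 2, 3 :: nat}. (1 / 2) ^ m)"
    by (rule sum.cong[OF refl]) (use N in \<open>auto simp: norm_power reflection_def refl_vec_def\<close>)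
  also have "\<dots> = 4 * (1 / 2 :: real) ^ m" by simp
  also have "\<dots> \<le> 4 * (1 / 2) ^ 3" using m by (intro mult_left_mono power_decreasing) auto
  finally show False by (simp add: power3_eq_cube)
qed

context bistochastic_basis
begin

context
  notes One_nat_def [simp del]
begin

lemma cols_orth: "i \<in> I0 \<Longrightarrow> j \<in> I0 \<Longrightarrow> (\<Sum>y\<in>I0. complex_of_real (F y i) * complex_of_real (F y j)) = of_bool (i = j)"
proof -
  assume "i \<in> I0" "j \<in> I0"
  then have "(\<Sum>y\<in>I0. F y i * F y j) = of_bool (i = j)" using F unfolding orthogonal_matrices_def by blast
  then have "complex_of_real (\<Sum>y\<in>I0. F y i * F y j) = of_bool (i = j)" by simp
  then show ?thesis by simp
qed

lemma cols_sum_zero: "j \<in> J \<Longrightarrow> (\<Sum>y\<in>I0. complex_of_real (F y j)) = 0"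
proof -
  assume j: "j \<in> J"
  have "(\<Sum>y\<in>I0. complex_of_real (1 / sqrt (real N)) * complex_of_real (F y j)) = (\<Sum>y\<in>I0. complex_of_real (F y 0) * complex_of_real (F y j))"
    by (rule sum.cong[OF refl]) (simp add: F0)
  also have "\<dots> = 0" using cols_orth[of 0 j] j by auto
  finally show ?thesis unfolding sum_distrib_left[symmetric] using N by simp
qed

text \<open>Contract a block \<open>b\<close> with \<open>e\<^sub>0\<close> and all other points with \<open>\<xi>\<close>: invariance of the contraction forces the
  power sum of order \<open>card b\<close> of the first column of any matrix in \<open>B\<^sub>N\<close> to be \<open>1\<close>.\<close>

lemma partition_morphism_block_size:
  assumes N4: "4 \<le> N" and part: "partition_on (points 3 3) \<pi>"
    and T: "partition_map I0 3 3 \<pi> \<in> Hom (B_circ N F) W3 W3" and b: "b \<in> \<pi>"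
  shows "card b < 3"
proof (rule ccontr)
  assume "\<not> card b < 3"
  then have card: "3 \<le> card b" by simp
  let ?g = "\<lambda>i j. complex_of_real (reflection N i j)"
  note gb = reflection_bistochastic[OF N4]
  define x where "x p i = (if p \<in> b then of_bool (i = 0) else 1 :: complex)" for p :: "nat + nat" and i :: nat
  have fpi: "finite \<pi>" by (rule finite_elements[OF _ part]) (simp add: points_def)
  have "b \<subseteq> points 3 3" using b partition_onD1[OF part] by blast
  then have fb: "finite b" by (rule finite_subset) (simp add: points_def)
  have bne: "b \<noteq> {}" using card by auto
  have gx: "(\<Sum>s\<in>I0. ?g i s * x p s) = (if p \<in> b then ?g i 0 else 1)" if i: "i \<in> I0" for p i
  proof (cases "p \<in> b")
    case True
    have "(\<Sum>s\<in>I0. ?g i s * x p s) = (\<Sum>s\<in>I0. if s = 0 then ?g i 0 else 0)"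
      by (rule sum.cong[OF refl]) (simp add: x_def True)
    then show ?thesis using True N by simp
  next
    case False
    have "(\<Sum>s\<in>I0. reflection N i s) = 1" using gb i unfolding bistochastic_matrices_def by blast
    then have "complex_of_real (\<Sum>s\<in>I0. reflection N i s) = 1" by simp
    then show ?thesis using False by (simp add: x_def)
  qed
  have others: "c \<inter> b = {}" if "c \<in> \<pi> - {b}" for c
    using partition_onD2[OF part] that b by (auto simp: disjoint_def)
  let ?k = "\<Prod>c\<in>\<pi> - {b}. (of_nat N :: complex)"
  have "contraction I0 3 3 x (partition_map I0 3 3 \<pi>) = (\<Sum>y\<in>I0. \<Prod>p\<in>b. x p y) * (\<Prod>c\<in>\<pi> - {b}. \<Sum>y\<in>I0. \<Prod>p\<in>c. x p y)"
    unfolding contraction_partition_map[OF finite_atLeastLessThan part] by (rule prod.remove[OF fpi b])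
  also have "(\<Sum>y\<in>I0. \<Prod>p\<in>b. x p y) = (\<Sum>y\<in>I0. if y = 0 then 1 else 0)"
    by (rule sum.cong[OF refl]) (use fb bne in \<open>auto simp: x_def\<close>)
  also have "\<dots> = 1" using N by simp
  also have "(\<Prod>c\<in>\<pi> - {b}. \<Sum>y\<in>I0. \<Prod>p\<in>c. x p y) = ?k"
  proof (rule prod.cong[OF refl])
    fix c assume "c \<in> \<pi> - {b}"
    then have "x p y = 1" if "p \<in> c" for p y using others that by (auto simp: x_def)
    then show "(\<Sum>y\<in>I0. \<Prod>p\<in>c. x p y) = of_nat N" by simp
  qed
  finally have 1: "contraction I0 3 3 x (partition_map I0 3 3 \<pi>) = ?k" by simp
  have "contraction I0 3 3 (\<lambda>p i. \<Sum>s\<in>I0. ?g i s * x p s) (partition_map I0 3 3 \<pi>)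
      = (\<Sum>y\<in>I0. \<Prod>p\<in>b. \<Sum>s\<in>I0. ?g y s * x p s) * (\<Prod>c\<in>\<pi> - {b}. \<Sum>y\<in>I0. \<Prod>p\<in>c. \<Sum>s\<in>I0. ?g y s * x p s)"
    unfolding contraction_partition_map[OF finite_atLeastLessThan part] by (rule prod.remove[OF fpi b])
  also have "(\<Sum>y\<in>I0. \<Prod>p\<in>b. \<Sum>s\<in>I0. ?g y s * x p s) = (\<Sum>y\<in>I0. ?g y 0 ^ card b)"
    by (rule sum.cong[OF refl]) (simp add: gx)
  also have "(\<Prod>c\<in>\<pi> - {b}. \<Sum>y\<in>I0. \<Prod>p\<in>c. \<Sum>s\<in>I0. ?g y s * x p s) = ?k"
  proof (rule prod.cong[OF refl])
    fix c assume c: "c \<in> \<pi> - {b}"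
    have "(\<Sum>s\<in>I0. ?g y s * x p s) = 1" if "p \<in> c" "y \<in> I0" for p y using gx[OF that(2), of p] others[OF c] that by auto
    then show "(\<Sum>y\<in>I0. \<Prod>p\<in>c. \<Sum>s\<in>I0. ?g y s * x p s) = of_nat N" by simp
  qed
  finally have "(\<Sum>y\<in>I0. ?g y 0 ^ card b) * ?k = ?k"
    using 1 Hom_contraction_invariant[OF T gb] by simp
  moreover have "?k \<noteq> 0" using N by simp
  ultimately have "(\<Sum>y\<in>I0. ?g y 0 ^ card b) = 1" using mult_cancel_right2 by blast
  then show False using reflection_column_powers[OF N4 card] by blast
qed

text \<open>The upper legs are contracted with the columns \<open>1, 2, 3\<close> of \<open>F\<close>, the lower ones with the
  columns \<open>3, 2, 1\<close>.\<close>

definition leg_column :: "nat + nat \<Rightarrow> nat" where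
  "leg_column = case_sum (\<lambda>t. t + 1) (\<lambda>t. 3 - t)"

lemma leg_column_J: "4 \<le> N \<Longrightarrow> p \<in> points 3 3 \<Longrightarrow> leg_column p \<in> J"
  by (cases p) (auto simp: leg_column_def points_def)

lemma flip_map_contraction:
  assumes N4: "4 \<le> N"
  shows "contraction I0 3 3 (\<lambda>p y. complex_of_real (F y (leg_column p))) flip_map = 1"
proof -
  let ?F = "\<lambda>i j. complex_of_real (F i j)" and ?p = "\<lambda>i j. complex_of_real (compl_proj i j)"
  have pF: "(\<Sum>y\<in>I0. ?p y a * ?F y m) = ?F a m" if m: "m \<in> J" for a m
  proof -
    have "(\<Sum>y\<in>I0. ?p y a * ?F y m) = (\<Sum>y\<in>I0. \<Sum>k\<in>J. ?F a k * (?F y k * ?F y m))"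
      unfolding compl_proj_def by (simp add: sum_distrib_left sum_distrib_right mult_ac)
    also have "\<dots> = (\<Sum>k\<in>J. ?F a k * (\<Sum>y\<in>I0. ?F y k * ?F y m))"
      unfolding sum_distrib_left by (rule sum.swap)
    also have "\<dots> = (\<Sum>k\<in>J. if k = m then ?F a k else 0)"
      by (rule sum.cong[OF refl]) (use m in \<open>simp add: cols_orth\<close>)
    also have "\<dots> = ?F a m" using m by simp
    finally show ?thesis .
  qed
  have m: "1 \<in> J" "2 \<in> J" "3 \<in> J" using N4 by auto
  have col: "leg_column (Inl 0) = 1" "leg_column (Inl 1) = 2" "leg_column (Inl 2) = 3"
    "leg_column (Inr 0) = 3" "leg_column (Inr 1) = 2" "leg_column (Inr 2) = 1" by (simp_all add: leg_column_def)
  have inner: "(\<Sum>j\<in>MI3. flip_map j i * (?F (i ! 0) 1 * ?F (i ! 1) 2 * ?F (i ! 2) 3) * (?F (j ! 0) 3 * ?F (j ! 1) 2 * ?F (j ! 2) 1))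
      = (?F (i ! 0) 1 * ?F (i ! 0) 1) * (?F (i ! 1) 2 * ?F (i ! 1) 2) * (?F (i ! 2) 3 * ?F (i ! 2) 3)"
    if i: "i \<in> MI3" for i
  proof -
    define h where "h t y = ?p y (i ! (2 - t)) * ?F y (3 - t)" for t y
    have hs: "(\<Sum>y\<in>I0. h t y) = ?F (i ! (2 - t)) (3 - t)" if "3 - t \<in> J" for t
      unfolding h_def by (rule pF[OF that])
    have "(\<Sum>j\<in>MI3. flip_map j i * (?F (i ! 0) 1 * ?F (i ! 1) 2 * ?F (i ! 2) 3) * (?F (j ! 0) 3 * ?F (j ! 1) 2 * ?F (j ! 2) 1))
        = (\<Sum>j\<in>MI3. (?F (i ! 0) 1 * ?F (i ! 1) 2 * ?F (i ! 2) 3) * (\<Prod>t<3. h t (j ! t)))"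
      by (rule sum.cong[OF refl]) (use i in \<open>simp add: flip_map_def prod_3 h_def mult_ac One_nat_def\<close>)
    also have "\<dots> = (?F (i ! 0) 1 * ?F (i ! 1) 2 * ?F (i ! 2) 3) * (\<Prod>t<3. \<Sum>y\<in>I0. h t y)"
      unfolding sum_distrib_left[symmetric] prod_sum_multi_indices[OF finite_atLeastLessThan] ..
    also have "(\<Prod>t<3. \<Sum>y\<in>I0. h t y) = ?F (i ! 2) 3 * ?F (i ! 1) 2 * ?F (i ! 0) 1"
      unfolding prod_3 using m hs[of 0] hs[of 1] hs[of 2] by (simp add: One_nat_def)
    finally show ?thesis by (simp add: mult_ac)
  qed
  define h where "h t y = ?F y (t + 1) * ?F y (t + 1)" for t y
  have "contraction I0 3 3 (\<lambda>p y. ?F y (leg_column p)) flip_map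
      = (\<Sum>i\<in>MI3. (?F (i ! 0) 1 * ?F (i ! 0) 1) * (?F (i ! 1) 2 * ?F (i ! 1) 2) * (?F (i ! 2) 3 * ?F (i ! 2) 3))"
    unfolding contraction_def prod_3 col by (rule sum.cong[OF refl], rule inner)
  also have "\<dots> = (\<Sum>i\<in>MI3. \<Prod>t<3. h t (i ! t))" by (simp add: prod_3 h_def)
  also have "\<dots> = (\<Prod>t<3. \<Sum>y\<in>I0. h t y)" unfolding prod_sum_multi_indices[OF finite_atLeastLessThan] ..
  also have "\<dots> = 1" unfolding prod_3 h_def using N4 by (simp add: cols_orth)
  finally show ?thesis .
qed

text \<open>By orthogonality of the columns of \<open>F\<close>, to each other and to \<open>\<xi>\<close>, only pairs of points with equal
  columns contribute; so \<open>\<pi>\<close> joins each upper point to its mirror image in the lower row.\<close>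

lemma partition_blocks:
  assumes N4: "4 \<le> N" and part: "partition_on (points 3 3) \<pi>"
    and T: "partition_map I0 3 3 \<pi> \<in> Hom (B_circ N F) W3 W3"
    and nz: "contraction I0 3 3 (\<lambda>p y. complex_of_real (F y (leg_column p))) (partition_map I0 3 3 \<pi>) \<noteq> 0"
  shows "b \<in> \<pi> \<Longrightarrow> \<exists>t<3. b = {Inl t, Inr (2 - t)}" and "t < 3 \<Longrightarrow> {Inl t, Inr (2 - t)} \<in> \<pi>"
proof -
  have fpi: "finite \<pi>" by (rule finite_elements[OF _ part]) (simp add: points_def)
  show 1: "\<exists>t<3. b = {Inl t, Inr (2 - t)}" if b: "b \<in> \<pi>" for b
  proof -
    have sub: "b \<subseteq> points 3 3" using b partition_onD1[OF part] by blast
    then have fb: "finite b" by (rule finite_subset) (simp add: points_def)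
    have "b \<noteq> {}" using b partition_onD3[OF part] by blast
    then have c0: "card b \<noteq> 0" using fb by simp
    have s: "(\<Sum>y\<in>I0. \<Prod>p\<in>b. complex_of_real (F y (leg_column p))) \<noteq> 0"
      using nz b fpi unfolding contraction_partition_map[OF finite_atLeastLessThan part] prod_zero_iff[OF fpi] by blast
    have "card b \<noteq> 1"
    proof
      assume "card b = 1"
      then obtain p where p: "b = {p}" by (rule card_1_singletonE)
      then show False using s cols_sum_zero[OF leg_column_J[OF N4, of p]] sub by simp
    qed
    then have "card b = 2" using c0 partition_morphism_block_size[OF N4 part T b] by linarith
    then obtain p q where pq: "b = {p, q}" "p \<noteq> q" unfolding card_2_iff by blast
    have P: "p \<in> points 3 3" "q \<in> points 3 3" using sub pq by auto
    have J: "leg_column p \<in> I0" "leg_column q \<in> I0" using leg_column_J[OF N4 P(1)] leg_column_J[OF N4 P(2)] by auto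
    have "(\<Sum>y\<in>I0. complex_of_real (F y (leg_column p)) * complex_of_real (F y (leg_column q))) \<noteq> 0"
      using s pq by simp
    then have eq: "leg_column p = leg_column q" unfolding cols_orth[OF J] by (simp split: if_splits)
    show ?thesis
    proof (cases p)
      case (Inl t)
      have t: "t < 3" using P(1) Inl by (auto simp: points_def)
      show ?thesis
      proof (cases q)
        case (Inl t') then show ?thesis using eq \<open>p = Inl t\<close> pq(2) by (simp add: leg_column_def)
      next
        case (Inr t')
        then have "t' = 2 - t" using eq \<open>p = Inl t\<close> P(2) t by (auto simp: leg_column_def points_def)
        then show ?thesis using pq(1) Inl Inr t by blast
      qed
    next
      case (Inr t)
      have t: "t < 3" using P(1) Inr by (auto simp: points_def)
      show ?thesis
      proof (cases q)
        case (Inl t')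
        then have "t' < 3" "t = 2 - t'" using eq \<open>p = Inr t\<close> P(2) t by (auto simp: leg_column_def points_def)
        then show ?thesis using pq(1) Inl Inr by blast
      next
        case (Inr t') then show ?thesis using eq \<open>p = Inr t\<close> pq(2) P(2) t by (auto simp: leg_column_def points_def)
      qed
    qed
  qed
  show "{Inl t, Inr (2 - t)} \<in> \<pi>" if t: "t < 3"
  proof -
    have "Inl t \<in> points 3 3" using t by (auto simp: points_def)
    then obtain b where b: "b \<in> \<pi>" "Inl t \<in> b" using partition_onD1[OF part] by blast
    then obtain t' where "b = {Inl t', Inr (2 - t')}" using 1 by blast
    then show ?thesis using b by simp
  qed
qed

text \<open>The diagonal matrix with antidiagonal entries for \<open>1, \<i>, \<i>, \<dots>\<close> is orthogonal and half-commuting,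
  but the first two entries do not commute.\<close>

lemma O_star_not_comm:
  assumes "4 \<le> N"
  shows "\<not> comm CO wO"
proof
  assume c: "comm CO wO"
  define z where "z i j = (if i \<in> J \<and> i = j then if i = 1 then 1 else \<i> else 0)" for i j
  define v where "v i j = antidiagonal (z i j)" for i j
  interpret P: cstar_algebra plane_algebra by (rule cstar_algebra_plane)
  have vt: "tpose v = v" by (rule ext, rule ext) (auto simp: v_def z_def)
  have vc: "v \<in> cmat plane_algebra J"
    unfolding cmat_def by (auto simp: v_def z_def antidiagonal_closed antidiagonal_zero plane_simps(4))
  have "mmul plane_algebra J v v i j = mone plane_algebra J i j" for i j
  proof (cases "i \<in> J")
    case True
    have "mmul plane_algebra J v v i j = (\<Oplus>\<^bsub>plane_algebra\<^esub>k\<in>J. if i = k then mone plane_algebra J i j else \<zero>\<^bsub>plane_algebra\<^esub>)"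
      unfolding mmul_def
    proof (rule P.finsum_eqI)
      fix k assume "k \<in> J"
      show "(if i = k then mone plane_algebra J i j else \<zero>\<^bsub>plane_algebra\<^esub>) \<in> carrier plane_algebra"
        using cmatD[OF P.mone_cmat] by simp
      have "v i i o\<^sub>L v i i = id_blinfun" using True by (simp add: v_def z_def antidiagonal_square)
      then show "v i k \<otimes>\<^bsub>plane_algebra\<^esub> v k j = (if i = k then mone plane_algebra J i j else \<zero>\<^bsub>plane_algebra\<^esub>)"
        using True by (cases "i = k"; cases "i = j")
          (simp_all add: mone_def plane_simps(2-4), simp_all add: v_def z_def antidiagonal_zero)
    qed
    also have "\<dots> = mone plane_algebra J i j" by (rule P.finsum_single[OF finite_atLeastLessThan True cmatD[OF P.mone_cmat]])
    finally show ?thesis .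
  next
    case False
    then show ?thesis using cmat_outside[OF P.mmul_cmat[OF vc vc], of i j] cmat_outside[OF P.mone_cmat, of i J j] by simp
  qed
  then have "mmul plane_algebra J v v = mone plane_algebra J" by (rule ext[OF ext])
  then have vo: "orth plane_algebra J v"
    unfolding orth_def vt using vc by (simp add: plane_simps(7) v_def antidiagonal_adj)
  have vh: "half_comm plane_algebra v"
    unfolding half_comm_def plane_simps(2) v_def by (intro allI antidiagonal_half_comm)
  obtain f where f: "f \<in> cstar_hom CO plane_algebra" "\<And>i j. f (wO i j) = v i j"
    using O_star_hom[OF cstar_algebra_plane vo vh] by blast
  note wc = cstar_algebra.orthD(2)[OF algebras(2) funds(2)]
  have "f (wO 1 1 \<otimes>\<^bsub>CO\<^esub> wO 2 2) = f (wO 2 2 \<otimes>\<^bsub>CO\<^esub> wO 1 1)"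
    using c unfolding comm_def by simp
  then have "v 1 1 o\<^sub>L v 2 2 = v 2 2 o\<^sub>L v 1 1"
    unfolding cstar_homD(3)[OF f(1) wc wc] f(2) plane_simps(2) .
  then show False using antidiagonal_not_comm assms by (simp add: v_def z_def)
qed

theorem B_circ_not_easy:
  assumes N4: "4 \<le> N"
  shows "\<not> easy (B_circ N F)"
proof
  interpret rotated_algebra CO N F by (rule rotated[OF algebras(2)])
  note uo = lift_orth(1)[OF algebras(2) funds(2)] and ur = lift_orth(2)[OF algebras(2) funds(2)]
  note uc = orthD(1)[OF uo] note u = cmatD[OF uc]
  note wc = orthD(1)[OF funds(2)]
  assume "easy (B_circ N F)"
  then obtain D where D: "category_of_partitions D"
    "\<And>k l. Hom (B_circ N F) k l = tensor_span (partition_map I0 (length k) (length l) ` D k l)"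
    unfolding easy_def B_circ_simps by blast
  note H = D(2)[of W3 W3, unfolded length_colours_3]
  let ?L = "contraction I0 3 3 (\<lambda>p y. complex_of_real (F y (leg_column p)))"
  obtain X c where X: "X \<subseteq> partition_map I0 3 3 ` D W3 W3" "flip_map = (\<lambda>j i. \<Sum>T\<in>X. c T * T j i)"
    using flip_map_Hom unfolding H tensor_span_def by blast
  have "(\<Sum>T\<in>X. c T * ?L T) = 1"
    unfolding contraction_sum[symmetric] X(2)[symmetric] by (rule flip_map_contraction[OF N4])
  then have "\<exists>T\<in>X. ?L T \<noteq> 0" using sum.neutral[of X "\<lambda>T. c T * ?L T"] by force
  then obtain \<pi> where pi: "\<pi> \<in> D W3 W3" and nz: "?L (partition_map I0 3 3 \<pi>) \<noteq> 0" using X(1) by blast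
  have part: "partition_on (points 3 3) \<pi>"
    using D(1) pi unfolding category_of_partitions_def by (metis length_colours_3)
  have T: "partition_map I0 3 3 \<pi> \<in> Hom (B_circ N F) W3 W3"
  proof -
    let ?T = "partition_map I0 3 3 \<pi>"
    have "?T = (\<lambda>j i. \<Sum>T\<in>{?T}. 1 * T j i)" by simp
    moreover have "{?T} \<subseteq> partition_map I0 3 3 ` D W3 W3" using pi by blast
    ultimately show ?thesis
      unfolding H tensor_span_def mem_Collect_eq by (intro exI[of _ "{?T}"] exI[of _ "\<lambda>_. 1"] conjI) simp_all
  qed
  note blocks = partition_blocks[OF N4 part T nz]
  have pm: "partition_map I0 3 3 \<pi> j i = of_bool (j = rev i)" if j: "j \<in> MI3" and i: "i \<in> MI3" for i j
  proof -
    obtain j1 j2 j3 where j': "j = [j1, j2, j3]" using j unfolding multi_indices_3 by blast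
    obtain i1 i2 i3 where i': "i = [i1, i2, i3]" using i unfolding multi_indices_3 by blast
    let ?v = "case_sum (\<lambda>r. i ! r) (\<lambda>r. j ! r)"
    have "(\<forall>b\<in>\<pi>. \<forall>p\<in>b. \<forall>q\<in>b. ?v p = ?v q) \<longleftrightarrow> (\<forall>t<3. i ! t = j ! (2 - t))"
    proof
      assume *: "\<forall>b\<in>\<pi>. \<forall>p\<in>b. \<forall>q\<in>b. ?v p = ?v q"
      show "\<forall>t<3. i ! t = j ! (2 - t)"
      proof (intro allI impI)
        fix t :: nat assume "t < 3"
        then have "?v (Inl t) = ?v (Inr (2 - t))" using bspec[OF * blocks(2)] by blast
        then show "i ! t = j ! (2 - t)" by simp
      qed
    next
      assume *: "\<forall>t<3. i ! t = j ! (2 - t)"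
      show "\<forall>b\<in>\<pi>. \<forall>p\<in>b. \<forall>q\<in>b. ?v p = ?v q"
      proof
        fix b assume "b \<in> \<pi>"
        then obtain t where "t < 3" "b = {Inl t, Inr (2 - t)}" using blocks(1) by blast
        then show "\<forall>p\<in>b. \<forall>q\<in>b. ?v p = ?v q" using * by simp
      qed
    qed
    also have "\<dots> \<longleftrightarrow> j = rev i"
      unfolding i' j' by (auto simp: numeral_3_eq_3 numeral_2_eq_2 All_less_Suc One_nat_def)
    finally show ?thesis unfolding partition_map_def using i j by simp
  qed
  have uh: "uB j3 i1 \<otimes>\<^bsub>CO\<^esub> (uB j2 i2 \<otimes>\<^bsub>CO\<^esub> uB j1 i3) = uB j1 i3 \<otimes>\<^bsub>CO\<^esub> (uB j2 i2 \<otimes>\<^bsub>CO\<^esub> uB j3 i1)"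
    if "j1 \<in> I0" "j2 \<in> I0" "j3 \<in> I0" "i1 \<in> I0" "i2 \<in> I0" "i3 \<in> I0" for i1 i2 i3 j1 j2 j3
  proof -
    let ?j = "[j1, j2, j3]" and ?i = "[i1, i2, i3]"
    have ji: "?j \<in> MI3" "?i \<in> MI3" "rev ?j \<in> MI3" "rev ?i \<in> MI3"
      using that unfolding multi_indices_3 by simp_all
    have fin: "finite MI3" by (rule finite_multi_indices) simp
    have single: "(\<Oplus>\<^bsub>CO\<^esub>r\<in>MI3. C r \<odot>\<^bsub>CO\<^esub> h r) = h s"
      if s: "s \<in> MI3" and C: "\<And>r. r \<in> MI3 \<Longrightarrow> C r = of_bool (s = r)"
        and h: "\<And>r. r \<in> MI3 \<Longrightarrow> h r \<in> carrier CO" for C s h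
    proof -
      have "(\<Oplus>\<^bsub>CO\<^esub>r\<in>MI3. C r \<odot>\<^bsub>CO\<^esub> h r) = (\<Oplus>\<^bsub>CO\<^esub>r\<in>MI3. if s = r then h s else \<zero>\<^bsub>CO\<^esub>)"
      proof (rule finsum_eqI)
        fix r assume r: "r \<in> MI3"
        show "C r \<odot>\<^bsub>CO\<^esub> h r = (if s = r then h s else \<zero>\<^bsub>CO\<^esub>)"
          unfolding C[OF r] using smult_one[OF h[OF r]] smult_zero_left[OF h[OF r]] by (cases "s = r") simp_all
        show "(if s = r then h s else \<zero>\<^bsub>CO\<^esub>) \<in> carrier CO"
          unfolding if_split[of "\<lambda>x. x \<in> carrier CO"] using h[OF s] zero_closed by blast
      qed
      also have "\<dots> = h s" using add.finprod_singleton[OF s fin, of "\<lambda>_. h s"] h[OF s] by simp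
      finally show ?thesis .
    qed
    have tc: "tp3 r s \<in> carrier CO" if rs: "r \<in> MI3" "s \<in> MI3" for r s
    proof -
      obtain a b c where r: "r = [a, b, c]" using rs(1) unfolding multi_indices_3 by blast
      obtain k l m where s: "s = [k, l, m]" using rs(2) unfolding multi_indices_3 by blast
      show ?thesis unfolding r s tensor_power_B_circ by (intro m_closed u)
    qed
    have "(\<Oplus>\<^bsub>CO\<^esub>r\<in>MI3. partition_map I0 3 3 \<pi> ?j r \<odot>\<^bsub>CO\<^esub> tp3 r ?i)
        = tp3 (rev ?j) ?i"
    proof (rule single[OF ji(3)])
      fix r assume r: "r \<in> MI3"
      have "?j = rev r \<longleftrightarrow> rev ?j = r" by (metis rev_rev_ident)
      then show "partition_map I0 3 3 \<pi> ?j r = of_bool (rev ?j = r)" unfolding pm[OF ji(1) r] by (simp only:)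
      show "tp3 r ?i \<in> carrier CO" by (rule tc[OF r ji(2)])
    qed
    moreover have "(\<Oplus>\<^bsub>CO\<^esub>r\<in>MI3. partition_map I0 3 3 \<pi> r ?i \<odot>\<^bsub>CO\<^esub> tp3 ?j r)
        = tp3 ?j (rev ?i)"
    proof (rule single[OF ji(4)])
      fix r assume r: "r \<in> MI3"
      show "partition_map I0 3 3 \<pi> r ?i = of_bool (rev ?i = r)" unfolding pm[OF r ji(2)] by (simp only: eq_commute)
      show "tp3 ?j r \<in> carrier CO" by (rule tc[OF ji(1) r])
    qed
    ultimately have "tp3 (rev ?j) ?i = tp3 ?j (rev ?i)"
      using Hom_3D[OF T ji(1,2)] by simp
    then show ?thesis by (simp only: rev.simps append.simps tensor_power_B_circ)
  qed
  \<comment> \<open>Summing the middle entry over a row turns half-commutation into commutation.\<close>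
  have 0: "0 \<in> I0" using N by simp
  have mid: "(\<Oplus>\<^bsub>CO\<^esub>k\<in>I0. x \<otimes>\<^bsub>CO\<^esub> (uB 0 k \<otimes>\<^bsub>CO\<^esub> y)) = x \<otimes>\<^bsub>CO\<^esub> y" if x: "x \<in> carrier CO" and y: "y \<in> carrier CO" for x y
  proof -
    have "(\<Oplus>\<^bsub>CO\<^esub>k\<in>I0. x \<otimes>\<^bsub>CO\<^esub> (uB 0 k \<otimes>\<^bsub>CO\<^esub> y)) = x \<otimes>\<^bsub>CO\<^esub> (\<Oplus>\<^bsub>CO\<^esub>k\<in>I0. uB 0 k \<otimes>\<^bsub>CO\<^esub> y)"
      by (rule finsum_rdistr[symmetric]) (simp_all add: x y u)
    also have "(\<Oplus>\<^bsub>CO\<^esub>k\<in>I0. uB 0 k \<otimes>\<^bsub>CO\<^esub> y) = (\<Oplus>\<^bsub>CO\<^esub>k\<in>I0. uB 0 k) \<otimes>\<^bsub>CO\<^esub> y"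
      by (rule finsum_ldistr[symmetric]) (simp_all add: y u)
    also have "(\<Oplus>\<^bsub>CO\<^esub>k\<in>I0. uB 0 k) = \<one>\<^bsub>CO\<^esub>" using ur 0 unfolding row_sums_one_def by blast
    finally show ?thesis using y by simp
  qed
  have ucomm: "uB a b \<otimes>\<^bsub>CO\<^esub> uB c d = uB c d \<otimes>\<^bsub>CO\<^esub> uB a b" for a b c d
  proof (cases "a \<in> I0 \<and> b \<in> I0 \<and> c \<in> I0 \<and> d \<in> I0")
    case True
    have "(\<Oplus>\<^bsub>CO\<^esub>k\<in>I0. uB a b \<otimes>\<^bsub>CO\<^esub> (uB 0 k \<otimes>\<^bsub>CO\<^esub> uB c d)) = (\<Oplus>\<^bsub>CO\<^esub>k\<in>I0. uB c d \<otimes>\<^bsub>CO\<^esub> (uB 0 k \<otimes>\<^bsub>CO\<^esub> uB a b))"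
      by (rule finsum_eqI) (use True 0 in \<open>simp_all only: uh m_closed u\<close>)
    then show ?thesis unfolding mid[OF u u] .
  next
    case False
    then have "uB a b = \<zero>\<^bsub>CO\<^esub> \<or> uB c d = \<zero>\<^bsub>CO\<^esub>" using cmat_outside[OF uc] by blast
    then show ?thesis using u[of a b] u[of c d] by auto
  qed
  then have "comm CO uB" unfolding comm_def by blast
  then have "comm CO (unrot CO N F uB)"
    unfolding rot_def by (intro comm_smat mmul_cmat uc smat_cmat) simp_all
  then have bc: "comm CO (blk CO wO)" unfolding lift_def rot_unrot(2)[OF blk_cmat[OF N wc]] .
  have "wO i j \<otimes>\<^bsub>CO\<^esub> wO k l = wO k l \<otimes>\<^bsub>CO\<^esub> wO i j" for i j k l
  proof (cases "i \<in> J \<and> k \<in> J")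
    case True
    then show ?thesis using bc unfolding comm_def using blk_inside[of i CO wO j] blk_inside[of k CO wO l] by metis
  next
    case False
    then have "wO i j = \<zero>\<^bsub>CO\<^esub> \<or> wO k l = \<zero>\<^bsub>CO\<^esub>" using cmat_outside[OF wc] by blast
    then show ?thesis using cmatD[OF wc, of i j] cmatD[OF wc, of k l] by auto
  qed
  then show False using O_star_not_comm[OF N4] unfolding comm_def by blast
qed

end

end

theorem proposition5p2:
  fixes N :: nat and F :: "nat \<Rightarrow> nat \<Rightarrow> real"
  assumes "N \<ge> 1"
    and "F \<in> orthogonal_matrices {0..<N}"
    and "\<forall>i<N. mat_vec {0..<N} F (\<lambda>k. of_bool (k = 0)) i = 1 / sqrt (real N) * (\<lambda>_. 1) i"
  shows "is_induced_iso N F (induced_iso N F)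
    \<and> qsubgroup (O_comm {1..<N}) (O_star {1..<N})
    \<and> qsubgroup (O_star {1..<N}) (O_plus {1..<N})
    \<and> qequal (F_image N F (O_comm {1..<N})) (B_class {0..<N})
    \<and> qequal (F_image N F (O_plus {1..<N})) (B_plus {0..<N})
    \<and> compact_quantum_group (B_circ N F)
    \<and> qsubgroup (B_class {0..<N}) (B_circ N F)
    \<and> qsubgroup (B_circ N F) (B_plus {0..<N})
    \<and> qsubgroup (S_class {0..<N}) (B_circ N F)
    \<and> qsubgroup (B_circ N F) (U_plus {0..<N})
    \<and> (N \<ge> 4 \<longrightarrow> \<not> easy (B_circ N F))"
proof -
  interpret bistochastic_basis N F
  proof
    fix i assume i: "i < N"
    have "mat_vec {0..<N} F (\<lambda>k. of_bool (k = 0)) i = F i 0"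
      unfolding mat_vec_def using assms(1) by (simp add: of_bool_def if_distrib[of "\<lambda>x. _ * x"] cong: if_cong)
    then show "F i 0 = 1 / sqrt (real N)" using assms(3) i by simp
  qed (use assms in simp_all)
  show ?thesis
    using induced_iso restrictions(1,2) O_comm_B_class O_plus_B_plus B_circ_compact_quantum_group
      B_class_subgroup B_circ_B_plus S_class_subgroup B_circ_U_plus B_circ_not_easy
    unfolding qsubgroup_def[of "O_comm J"] qsubgroup_def[of "O_star J"] by (intro conjI impI)
qed

end
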